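(* Fix integers $1\le d<D$, reals $0<f_{min}\le f_{max}<\infty$, $\rho>0$, $0<\beta\le1$, and $0<\delta<\frac1{d(d+1)}$. For a suitable choice of the tuning constants $k_1,k_2,c,t,c'$ in the definition of $\hat M_{\mathtt{TDC}\delta}$ (see context), $\hat M_{\mathtt{TDC}\delta}=\hat M_{\mathtt{TDC}\delta}(\mathbb{X}_n)$ is a simplicial complex with vertices included in $\mathbb{X}_n$ such that, for constants $C,C'>0$ depending only on $d,f_{min},f_{max},\rho$, when $\mathbb{X}_n$ is an i.i.d. $n$-sample from a distribution in $\mathcal{O}_{D,d,f_{min},f_{max},\rho,\beta}$ with associated submanifold $M$, $$\lim_{n\to\infty}\mathbb{P}\left(d_H(M,\hat M_{\mathtt{TDC}\delta})\le C\left(\frac{\log n}{\beta n}\right)^{2/d-2\delta}\ \text{ and }\ M\cong\hat M_{\mathtt{TDC}\delta}\right)=1.$$ Moreover, for $n$ large enough, $$\sup_{P\in\mathcal{O}_{D,d,f_{min},f_{max},\rho,\beta}}\mathbb{E}_P\, d_H(M,\hat M_{\mathtt{TDC}\delta})\le C'\left(\frac{\log n}{\beta n}\right)^{2/d-2\delta}.$$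
   Context: Notation: $\|\cdot\|$ is the Euclidean norm, $\mathcal{B}(x,r)$ the closed Euclidean ball, $d_H$ the Hausdorff distance, $d(x,A)$ the distance to a set, $\cong$ the ambient isotopy relation in $\mathbb{R}^D$ (a simplicial complex is identified with its underlying subset of $\mathbb{R}^D$). Models. $\mathrm{med}(M)=\{x:\exists a\ne b\in M,\ \|x-a\|=\|x-b\|=d(x,M)\}$ and $\mathrm{reach}(M)=\inf_{p\in M}d(p,\mathrm{med}(M))$. $\mathcal{M}_{D,d,\rho}$ is the set of compact connected $d$-dimensional submanifolds $M\subset\mathbb{R}^D$ without boundary with $\mathrm{reach}(M)\ge\rho$; $v_M$ is the $d$-dimensional Hausdorff measure restricted to $M$. $\mathcal{U}_M(f_{min},f_{max})$ is the set of probability distributions with a density $f$ with respect to $v_M$ such that $f_{min}\le f\le f_{max}$ on $M$; $\mathcal{G}_{D,d,f_{min},f_{max},\rho}=\bigcup_{M\in\mathcal{M}_{D,d,\rho}}\mathcal{U}_M(f_{min},f_{max})$. There is $C_d>0$ such that the support $M$ of every $Q\in\mathcal{G}_{D,d,f_{min},f_{max},\rho}$ has $\mathrm{diam}(M)\le K_{d,f_{min},\rho}:=C_d/(\rho^{d-1}f_{min})$; set $K_0=K_{d,f_{min},\rho}+\rho$ and $\mathcal{B}_0=\mathcal{B}(0,K_0)$. $\mathcal{O}_{D,d,f_{min},f_{max},\rho,\beta}$ is the set of mixtures $P=\beta Q+(1-\beta)U_{\mathcal{B}_0}$, with $Q\in\mathcal{G}_{D,d,f_{min},f_{max},\rho}$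 whose support $M$ (the associated submanifold) contains $0$, and $U_{\mathcal{B}_0}$ the uniform distribution on $\mathcal{B}_0$. $\mathbb{E}_P$ is expectation with respect to an i.i.d. $n$-sample $\mathbb{X}_n=\{X_1,\dots,X_n\}$ from $P$. Tangential Delaunay Complex. For a finite $\mathcal{P}\subset\mathbb{R}^D$ and a weight assignment $\omega:\mathcal{P}\to[0,\infty)$, let $d(x,p^\omega)^2=\|x-p\|^2-\omega(p)^2$, $\mathrm{Vor}^\omega(p)=\{x: d(x,p^\omega)^2\le d(x,q^\omega)^2\ \forall q\in\mathcal{P}\}$, $\mathrm{Vor}^\omega(\tau)=\bigcap_{p\in\tau}\mathrm{Vor}^\omega(p)$. $\mathrm{Del}^\omega(\mathcal{P})$ consists of the simplices $\tau\subset\mathcal P$ with $\mathrm{Vor}^\omega(\tau)\ne\emptyset$. Given a family $T=\{T_p\}_{p\in\mathcal{P}}$ of $d$-dimensional linear subspaces, identified with the affine spaces $p+T_p$, $\mathrm{Del}^\omega(\mathcal{P},T)$ is the subcomplex of simplices $\tau$ with $\mathrm{Vor}^\omega(\tau)\cap\bigcup_{p\in\tau}(p+T_p)\ne\emptyset$. $\omega_*=\omega_{*\mathcal{P},T}$ is the weight assignment of Boissonnat and Ghosh, a function of $(\mathcal{P},T)$ only, which satisfies: there are $\varepsilon_d,C_d>0$ such that for all $\rho>0$, $\varepsilon\le\varepsilon_d\rho$, $M\in\mathcal{M}_{D,d,\rho}$ and every $\mathcal{P}\subset M$ that is an $(\varepsilon,2\varepsilon)$-net of $M$ (i.e. $d(p,\mathcal{P}\setminus\{p\})\ge\varepsilon$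 for all $p\in\mathcal{P}$ and $\sup_{x\in M}d(x,\mathcal{P})\le2\varepsilon$), with $T=\{T_pM\}_{p\in\mathcal{P}}$, one has $d_H(M,\mathrm{Del}^{\omega_*}(\mathcal{P},T))\le C_d\varepsilon^2/\rho$ and $M\cong\mathrm{Del}^{\omega_*}(\mathcal{P},T)$. Tangent space estimation. For a finite point set $\mathcal{P}=\{p_1,\dots,p_r\}$ and $h>0$, $\mathtt{TSE}(\mathcal{P},h)_j$ is the span of $d$ eigenvectors associated with the $d$ largest eigenvalues of $\sum_{i\ne j}(p_i-\bar p_j)(p_i-\bar p_j)^t\mathbf{1}_{\mathcal{B}(p_j,h)}(p_i)$, where $\bar p_j$ is the barycenter of the points $p_i$, $i\ne j$, lying in $\mathcal{B}(p_j,h)$. Decluttering. For $k_1,k_2,h>0$, the slab at $x$ in direction $T$ ($d$-dimensional linear subspace) is $S(x,T,h)=\{x\}\oplus\mathcal{B}_T(0,k_1h)\oplus\mathcal{B}_{T^\perp}(0,k_2h^2)$ ($\oplus$ Minkowski sum; $\mathcal{B}_T,\mathcal{B}_{T^\perp}$ Euclidean balls in $T,T^\perp$). For a threshold $t>0$ and points $\mathcal{P}=(p_1,\dots,p_r)$ with subspaces $T_{\mathcal{P}}=(T_1,\dots,T_r)$, $\mathtt{SD}_t(\mathcal{P},T_{\mathcal{P}},h)$ is the set of those $p_j$ with $|S(p_j,T_j,h)\cap\mathcal{P}|\ge t(n-1)h^d$. Let $\gamma_0=\frac1{d+1}$, $\gamma_{k+1}=\frac{2\gamma_k+1}{d+2}$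 (so $\gamma_k=\frac1d-\frac1{d(d+1)}(\frac2{d+2})^k$), and $h_k=\left(c\frac{\log n}{\beta(n-1)}\right)^{\gamma_k}$ with $c=c_{d,f_{min},f_{max},\rho}$. Set $\mathbb{X}^{(-1)}=\mathbb{X}_n$ and $\mathbb{X}^{(k+1)}=\mathtt{SD}_t(\mathbb{X}^{(k)},\mathtt{TSE}(\mathbb{X}^{(k)},h_{k+1}),h_{k+1})$ for $k\ge-1$. Farthest point sampling of a finite set $\mathcal{P}$ with parameter $\varepsilon$: start with $\mathcal{Q}=\{p_1\}$ for one point $p_1\in\mathcal{P}$, and while $\max_{p\in\mathcal{P}}d(p,\mathcal{Q})>\varepsilon$, add to $\mathcal{Q}$ a point of $\mathcal{P}$ maximizing $d(\cdot,\mathcal{Q})$; output $\mathcal{Q}$. Estimator. Let $k_\delta$ be the smallest integer $k\ge 0$ with $\gamma_k\ge\frac1d-\delta$, $\mathbb{Y}_n^\delta$ the output of farthest point sampling on $\mathbb{X}^{(k_\delta)}$ with parameter $\varepsilon=c'h_{k_\delta}$ ($c'=c'_{d,f_{min},f_{max}}$ large enough), and $\hat T^\delta$ the restriction of $\mathtt{TSE}(\mathbb{X}^{(k_\delta)},h_{k_\delta})$ to $\mathbb{Y}_n^\delta$. Then $\hat M_{\mathtt{TDC}\delta}=\mathrm{Del}^{\omega_*}(\mathbb{Y}_n^\delta,\hat T^\delta)$. The constants are chosen as: $k_1,k_2$ small enough, $c$ large enough, $t$ a suitable threshold. *)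

theory Defs
  imports "HOL-Probability.Probability"
begin

section \<open>Euclidean spaces of all dimensions inside one type\<close>

text \<open>
  The constants of the theorem are uniform in the ambient dimension \<open>D\<close>, so \<open>D\<close> has to be an
  ordinary variable and cannot be the dimension of a type.  All the spaces \<open>\<real>\<^sup>D\<close> are realised as the
  subspaces \<open>euclid D\<close> of the inner product space of finitely supported real sequences, with
  \<open>x \<bullet> y = (\<Sum>i. x\<^sub>i y\<^sub>i)\<close>.  Everything that refers to the ambient space (medial axis,
  Voronoi cells, orthogonal complements, isotopies, ...) is relative to \<open>euclid D\<close>.
\<close>

typedef finseq = "{x :: nat \<Rightarrow> real. finite {i. x i \<noteq> 0}}"
  morphisms finseq_nth Abs_finseq
  by (rule exI[of _ "\<lambda>_. 0"]) simp

setup_lifting type_definition_finseq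

lemma finite_finseq_support [simp]: "finite {i. finseq_nth x i \<noteq> 0}"
  using finseq_nth[of x] by simp

lemma finseq_eqI: "(\<And>i. finseq_nth x i = finseq_nth y i) \<Longrightarrow> x = y"
  by transfer auto

instantiation finseq :: real_vector
begin

lift_definition zero_finseq :: finseq is "\<lambda>_. 0" by simp

lift_definition plus_finseq :: "finseq \<Rightarrow> finseq \<Rightarrow> finseq" is "\<lambda>x y i. x i + y i"
proof -
  fix x y :: "nat \<Rightarrow> real"
  assume "finite {i. x i \<noteq> 0}" "finite {i. y i \<noteq> 0}"
  then show "finite {i. x i + y i \<noteq> 0}"
    by (rule finite_subset[rotated, OF finite_UnI]) auto
qed

lift_definition uminus_finseq :: "finseq \<Rightarrow> finseq" is "\<lambda>x i. - x i"
  by simp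

definition minus_finseq :: "finseq \<Rightarrow> finseq \<Rightarrow> finseq"
  where "minus_finseq x y = x + (- y)"

lift_definition scaleR_finseq :: "real \<Rightarrow> finseq \<Rightarrow> finseq" is "\<lambda>r x i. r * x i"
  by (erule finite_subset[rotated]) auto

instance
proof
  fix a b c :: finseq and r s :: real
  show "a + b + c = a + (b + c)" by transfer (simp add: add.assoc)
  show "a + b = b + a" by transfer (simp add: add.commute)
  show "0 + a = a" by transfer simp
  show "- a + a = 0" by transfer simp
  show "a - b = a + - b" by (simp add: minus_finseq_def)
  show "r *\<^sub>R (a + b) = r *\<^sub>R a + r *\<^sub>R b" by transfer (simp add: algebra_simps)
  show "(r + s) *\<^sub>R a = r *\<^sub>R a + s *\<^sub>R a" by transfer (simp add: algebra_simps)
  show "r *\<^sub>R s *\<^sub>R a = (r * s) *\<^sub>R a" by transfer (simp add: algebra_simps)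
  show "1 *\<^sub>R a = a" by transfer simp
qed

end

lemmas finseq_nth_simps [simp] =
  zero_finseq.rep_eq plus_finseq.rep_eq uminus_finseq.rep_eq scaleR_finseq.rep_eq

instantiation finseq :: real_inner
begin

definition inner_finseq :: "finseq \<Rightarrow> finseq \<Rightarrow> real"
  where "inner_finseq x y = (\<Sum>i | finseq_nth x i \<noteq> 0. finseq_nth x i * finseq_nth y i)"

definition norm_finseq :: "finseq \<Rightarrow> real"
  where "norm_finseq x = sqrt (x \<bullet> x)"

definition dist_finseq :: "finseq \<Rightarrow> finseq \<Rightarrow> real"
  where "dist_finseq x y = norm (x - y)"

definition sgn_finseq :: "finseq \<Rightarrow> finseq"
  where "sgn_finseq x = x /\<^sub>R norm x"

definition uniformity_finseq :: "(finseq \<times> finseq) filter"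
  where "uniformity_finseq = (INF e\<in>{0<..}. principal {(x, y). dist x y < e})"

definition open_finseq :: "finseq set \<Rightarrow> bool"
  where "open_finseq U \<longleftrightarrow> (\<forall>x\<in>U. \<forall>\<^sub>F (x', y) in uniformity. x' = x \<longrightarrow> y \<in> U)"

lemma inner_finseq_superset:
  assumes "finite I" "{i. finseq_nth x i \<noteq> 0} \<subseteq> I"
  shows "x \<bullet> y = (\<Sum>i\<in>I. finseq_nth x i * finseq_nth y i)"
  unfolding inner_finseq_def using assms by (intro sum.mono_neutral_left) auto

instance
proof
  fix x y z :: finseq and r :: real and U :: "finseq set"
  let ?I = "{i. finseq_nth x i \<noteq> 0} \<union> {i. finseq_nth y i \<noteq> 0}"
  have I: "finite ?I" by simp
  show "dist x y = norm (x - y)" by (rule dist_finseq_def)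
  show "sgn x = x /\<^sub>R norm x" by (rule sgn_finseq_def)
  show "uniformity = (INF e\<in>{0<..}. principal {(x, y). dist x (y::finseq) < e})"
    by (rule uniformity_finseq_def)
  show "open U = (\<forall>x\<in>U. \<forall>\<^sub>F (x', y) in uniformity. x' = x \<longrightarrow> y \<in> U)"
    by (rule open_finseq_def)
  show "x \<bullet> y = y \<bullet> x"
    using inner_finseq_superset[OF I, of x y] inner_finseq_superset[OF I, of y x]
    by (auto simp: mult.commute)
  have "(x + y) \<bullet> z = (\<Sum>i\<in>?I. finseq_nth (x + y) i * finseq_nth z i)"
    by (rule inner_finseq_superset[OF I]) auto
  moreover have "x \<bullet> z = (\<Sum>i\<in>?I. finseq_nth x i * finseq_nth z i)"
    by (rule inner_finseq_superset[OF I]) auto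
  moreover have "y \<bullet> z = (\<Sum>i\<in>?I. finseq_nth y i * finseq_nth z i)"
    by (rule inner_finseq_superset[OF I]) auto
  ultimately show "(x + y) \<bullet> z = x \<bullet> z + y \<bullet> z"
    by (simp add: algebra_simps sum.distrib)
  have "(r *\<^sub>R x) \<bullet> y = (\<Sum>i\<in>?I. finseq_nth (r *\<^sub>R x) i * finseq_nth y i)"
    by (rule inner_finseq_superset[OF I]) auto
  moreover have "x \<bullet> y = (\<Sum>i\<in>?I. finseq_nth x i * finseq_nth y i)"
    by (rule inner_finseq_superset[OF I]) auto
  ultimately show "(r *\<^sub>R x) \<bullet> y = r * (x \<bullet> y)"
    by (simp add: sum_distrib_left mult.assoc)
  show "0 \<le> x \<bullet> x"
    unfolding inner_finseq_def by (intro sum_nonneg) auto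
  show "(x \<bullet> x = 0) = (x = 0)"
  proof
    assume "x \<bullet> x = 0"
    then have "\<forall>i\<in>{i. finseq_nth x i \<noteq> 0}. finseq_nth x i * finseq_nth x i = 0"
      unfolding inner_finseq_def by (subst (asm) sum_nonneg_eq_0_iff) auto
    then show "x = 0" by (intro finseq_eqI) auto
  qed (simp add: inner_finseq_def)
  show "norm x = sqrt (x \<bullet> x)" by (rule norm_finseq_def)
qed

end

definition euclid :: "nat \<Rightarrow> finseq set"
  where "euclid D = {x. \<forall>i\<ge>D. finseq_nth x i = 0}"

definition euclid_of :: "nat \<Rightarrow> (nat \<Rightarrow> real) \<Rightarrow> finseq"
  where "euclid_of D x = Abs_finseq (\<lambda>i. if i < D then x i else 0)"

definition euclid_lebesgue :: "nat \<Rightarrow> finseq measure"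
  where "euclid_lebesgue D = distr (\<Pi>\<^sub>M i\<in>{..<D}. lborel) borel (euclid_of D)"

lemma finseq_nth_euclid_of [simp]: "finseq_nth (euclid_of D x) i = (if i < D then x i else 0)"
proof -
  have "finite {i. (if i < D then x i else 0) \<noteq> 0}"
    by (rule finite_subset[of _ "{..<D}"]) auto
  then show ?thesis
    by (simp add: euclid_of_def Abs_finseq_inverse)
qed

lemma finseq_nth_sum: "finseq_nth (sum f I) i = (\<Sum>j\<in>I. finseq_nth (f j) i)"
  by (induction I rule: infinite_finite_induct) auto

lemma euclid_of_eq_sum: "euclid_of D x = (\<Sum>j<D. x j *\<^sub>R euclid_of D (\<lambda>i. if i = j then 1 else 0))"
  by (rule finseq_eqI) (auto simp: finseq_nth_sum if_distrib[of "times _"] cong: if_cong)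

lemma borel_measurable_euclid_of [measurable]:
  "euclid_of D \<in> measurable (\<Pi>\<^sub>M i\<in>{..<D}. lborel) borel"
proof -
  have "continuous_on UNIV (euclid_of D)"
    by (subst euclid_of_eq_sum[abs_def])
      (intro continuous_on_sum continuous_on_scaleR continuous_on_product_coordinates continuous_on_const)
  then have "euclid_of D \<in> borel_measurable borel"
    by (rule borel_measurable_continuous_onI)
  moreover have "(\<lambda>x i. if i < D then x i else 0) \<in>
      measurable (\<Pi>\<^sub>M i\<in>{..<D}. lborel) (borel :: (nat \<Rightarrow> real) measure)"
  proof (rule measurable_coordinatewise_then_product)
    fix i
    show "(\<lambda>x. if i < D then x i else (0 :: real)) \<in> borel_measurable (\<Pi>\<^sub>M i\<in>{..<D}. lborel)"
    proof (cases "i < D")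
      case True
      then have "(\<lambda>x. x i) \<in> measurable (\<Pi>\<^sub>M i\<in>{..<D}. lborel) (lborel :: real measure)"
        by (intro measurable_component_singleton) auto
      with True show ?thesis by simp
    qed simp
  qed
  ultimately have "(\<lambda>x. euclid_of D (\<lambda>i. if i < D then x i else 0)) \<in>
      measurable (\<Pi>\<^sub>M i\<in>{..<D}. lborel) borel"
    by (rule measurable_compose[rotated])
  moreover have "euclid_of D (\<lambda>i. if i < D then x i else 0) = euclid_of D x" for x
    by (rule finseq_eqI) auto
  ultimately show ?thesis by simp
qed

definition orth_compl :: "nat \<Rightarrow> finseq set \<Rightarrow> finseq set"
  where "orth_compl D T = {w \<in> euclid D. \<forall>u\<in>T. w \<bullet> u = 0}"


section \<open>Metric and topological notions\<close>

text \<open>Extended valued: the distance between a nonempty and an empty set is \<open>\<infinity>\<close>.\<close>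

definition hausdorff_dist :: "'a::metric_space set \<Rightarrow> 'a set \<Rightarrow> ennreal"
  where "hausdorff_dist A B =
    max (SUP x\<in>A. INF y\<in>B. ennreal (dist x y)) (SUP y\<in>B. INF x\<in>A. ennreal (dist x y))"

definition ambient_isotopic :: "nat \<Rightarrow> finseq set \<Rightarrow> finseq set \<Rightarrow> bool"
  where "ambient_isotopic D A B \<longleftrightarrow>
    (\<exists>F :: real \<Rightarrow> finseq \<Rightarrow> finseq.
        continuous_on ({0..1} \<times> euclid D) (\<lambda>(s, x). F s x) \<and>
        (\<forall>s\<in>{0..1}. \<exists>G. homeomorphism (euclid D) (euclid D) (F s) G) \<and>
        (\<forall>x\<in>euclid D. F 0 x = x) \<and>
        F 1 ` A = B)"

definition medial_axis :: "nat \<Rightarrow> finseq set \<Rightarrow> finseq set"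
  where "medial_axis D M =
    {x \<in> euclid D. \<exists>a\<in>M. \<exists>b\<in>M. a \<noteq> b \<and> dist x a = infdist x M \<and> dist x b = infdist x M}"

definition reach :: "nat \<Rightarrow> finseq set \<Rightarrow> ennreal"
  where "reach D M = (INF p\<in>M. INF z\<in>medial_axis D M. ennreal (dist p z))"

text \<open>Normalised so that it extends \<open>k\<close>-dimensional volume.\<close>

definition hausdorff_outer :: "nat \<Rightarrow> 'a::metric_space set \<Rightarrow> ennreal"
  where "hausdorff_outer k A =
    (SUP \<eta>\<in>{0<..}.
       INF U\<in>{U :: nat \<Rightarrow> 'a set. A \<subseteq> (\<Union>i. U i) \<and> (\<forall>i. bounded (U i) \<and> diameter (U i) \<le> \<eta>)}.
         (\<Sum>i. if U i = {} then 0
              else ennreal (unit_ball_vol (real k) * (diameter (U i) / 2) ^ k)))"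

definition hausdorff_measure :: "nat \<Rightarrow> 'a::metric_space measure"
  where "hausdorff_measure k = measure_of UNIV (sets borel) (hausdorff_outer k)"


section \<open>Submanifolds and the statistical models\<close>

definition C1_map_on :: "nat \<Rightarrow> finseq set \<Rightarrow> (finseq \<Rightarrow> finseq) \<Rightarrow> bool"
  where "C1_map_on D U \<phi> \<longleftrightarrow>
    (\<exists>\<phi>' :: finseq \<Rightarrow> finseq \<Rightarrow>\<^sub>L finseq.
        (\<forall>x\<in>U. (\<phi> has_derivative blinfun_apply (\<phi>' x)) (at x within euclid D)) \<and>
        continuous_on U \<phi>')"

text \<open>
  Embedded \<open>d\<close>-dimensional \<open>C\<^sup>1\<close> submanifolds without boundary, by straightening charts of the
  ambient space.  The models only involve those of positive reach, which are automatically
  of class \<open>C\<^sup>1\<^sup>,\<^sup>1\<close>.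
\<close>

definition C1_submanifold :: "nat \<Rightarrow> nat \<Rightarrow> finseq set \<Rightarrow> bool"
  where "C1_submanifold D d M \<longleftrightarrow> d \<le> D \<and> M \<subseteq> euclid D \<and>
    (\<forall>p\<in>M. \<exists>U W \<phi> \<psi>. p \<in> U \<and>
        openin (top_of_set (euclid D)) U \<and> openin (top_of_set (euclid D)) W \<and>
        homeomorphism U W \<phi> \<psi> \<and> C1_map_on D U \<phi> \<and> C1_map_on D W \<psi> \<and>
        \<phi> ` (U \<inter> M) = W \<inter> euclid d)"

definition tangent_space :: "finseq set \<Rightarrow> finseq \<Rightarrow> finseq set"
  where "tangent_space M p =
    {v. \<exists>\<gamma> :: real \<Rightarrow> finseq. \<gamma> 0 = p \<and> (\<exists>e>0. \<forall>s. \<bar>s\<bar> < e \<longrightarrow> \<gamma> s \<in> M) \<and>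
        (\<gamma> has_vector_derivative v) (at 0)}"

definition manifold_class :: "nat \<Rightarrow> nat \<Rightarrow> real \<Rightarrow> finseq set set"
  where "manifold_class D d \<rho> =
    {M. M \<noteq> {} \<and> compact M \<and> connected M \<and> C1_submanifold D d M \<and> ennreal \<rho> \<le> reach D M}"

definition manifold_volume :: "nat \<Rightarrow> finseq set \<Rightarrow> finseq measure"
  where "manifold_volume d M = density (hausdorff_measure d) (indicator M)"

definition manifold_dists :: "nat \<Rightarrow> real \<Rightarrow> real \<Rightarrow> finseq set \<Rightarrow> finseq measure set"
  where "manifold_dists d f_min f_max M =
    {Q. prob_space Q \<and>
        (\<exists>f :: finseq \<Rightarrow> real. f \<in> borel_measurable borel \<and> (\<forall>x\<in>M. f_min \<le> f x \<and> f x \<le> f_max) \<and>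
             Q = density (manifold_volume d M) (\<lambda>x. ennreal (f x)))}"

text \<open>
  \<open>diam_constant d A\<close>: the number \<open>A\<close> is admissible as the constant \<open>C\<^sub>d\<close> in
  \<open>diam M \<le> C\<^sub>d / (\<rho>\<^sup>d\<^sup>-\<^sup>1 f\<^sub>m\<^sub>i\<^sub>n)\<close>; this is the constant that fixes the radius \<open>K\<^sub>0\<close>.
\<close>

definition diam_constant :: "nat \<Rightarrow> real \<Rightarrow> bool"
  where "diam_constant d A \<longleftrightarrow> 0 < A \<and>
    (\<forall>D \<rho> f_min f_max M Q.
        0 < \<rho> \<longrightarrow> 0 < f_min \<longrightarrow> f_min \<le> f_max \<longrightarrow>
        M \<in> manifold_class D d \<rho> \<longrightarrow> Q \<in> manifold_dists d f_min f_max M \<longrightarrow>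
        diameter M \<le> A / (\<rho> ^ (d - 1) * f_min))"

definition ball_radius :: "real \<Rightarrow> nat \<Rightarrow> real \<Rightarrow> real \<Rightarrow> real"
  where "ball_radius A d f_min \<rho> = A / (\<rho> ^ (d - 1) * f_min) + \<rho>"

text \<open>
  The outlier model as the set of pairs (distribution, associated submanifold); since
  \<open>f_min > 0\<close>, the submanifold is the support of the component \<open>Q\<close>.
\<close>

definition outlier_model ::
  "real \<Rightarrow> nat \<Rightarrow> nat \<Rightarrow> real \<Rightarrow> real \<Rightarrow> real \<Rightarrow> real \<Rightarrow> (finseq measure \<times> finseq set) set"
  where "outlier_model A D d f_min f_max \<rho> \<beta> =
    {(P, M). M \<in> manifold_class D d \<rho> \<and> 0 \<in> M \<and> sets P = sets borel \<and>
       (\<exists>Q\<in>manifold_dists d f_min f_max M. \<forall>B\<in>sets borel.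
          emeasure P B = ennreal \<beta> * emeasure Q B +
            ennreal (1 - \<beta>) *
              emeasure (uniform_measure (euclid_lebesgue D)
                         (euclid D \<inter> cball 0 (ball_radius A d f_min \<rho>))) B)}"

definition sample :: "finseq measure \<Rightarrow> nat \<Rightarrow> (nat \<Rightarrow> finseq) measure"
  where "sample P n = (\<Pi>\<^sub>M i\<in>{..<n}. P)"

text \<open>
  Inner probability and outer expectation, so that no measurability of the estimator (which involves
  arbitrary tie breaking and an abstract weight assignment) has to be assumed.  They agree with
  probability and expectation on measurable events and functions.
\<close>

definition inner_prob :: "'a measure \<Rightarrow> 'a set \<Rightarrow> real"
  where "inner_prob N E = (SUP B\<in>{B \<in> sets N. B \<subseteq> E}. measure N B)"

definition outer_expectation :: "'a measure \<Rightarrow> ('a \<Rightarrow> ennreal) \<Rightarrow> ennreal"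
  where "outer_expectation N f =
    (INF g\<in>{g \<in> borel_measurable N. \<forall>x\<in>space N. f x \<le> g x}. \<integral>\<^sup>+ x. g x \<partial>N)"


section \<open>Simplicial complexes and the tangential Delaunay complex\<close>

definition abstract_simplicial_complex :: "'a set set \<Rightarrow> bool"
  where "abstract_simplicial_complex K \<longleftrightarrow>
    (\<forall>\<sigma>\<in>K. finite \<sigma> \<and> \<sigma> \<noteq> {}) \<and> (\<forall>\<sigma>\<in>K. \<forall>\<tau>. \<tau> \<subseteq> \<sigma> \<and> \<tau> \<noteq> {} \<longrightarrow> \<tau> \<in> K)"

definition underlying :: "'a::real_vector set set \<Rightarrow> 'a set"
  where "underlying K = (\<Union>\<sigma>\<in>K. convex hull \<sigma>)"

definition weighted_voronoi :: "nat \<Rightarrow> (finseq \<Rightarrow> real) \<Rightarrow> finseq set \<Rightarrow> finseq set \<Rightarrow> finseq set"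
  where "weighted_voronoi D \<omega> \<P> \<tau> =
    {x \<in> euclid D. \<forall>p\<in>\<tau>. \<forall>q\<in>\<P>. (norm (x - p))\<^sup>2 - (\<omega> p)\<^sup>2 \<le> (norm (x - q))\<^sup>2 - (\<omega> q)\<^sup>2}"

definition weighted_delaunay :: "nat \<Rightarrow> (finseq \<Rightarrow> real) \<Rightarrow> finseq set \<Rightarrow> finseq set set"
  where "weighted_delaunay D \<omega> \<P> =
    {\<tau>. \<tau> \<subseteq> \<P> \<and> \<tau> \<noteq> {} \<and> weighted_voronoi D \<omega> \<P> \<tau> \<noteq> {}}"

text \<open>
  The condition on \<open>\<tau>\<close> need not pass to the faces of \<open>\<tau>\<close>, so the subcomplex is
  the one generated by these \<open>\<tau>\<close>; adding faces does not change the underlying set.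
\<close>

definition tangential_delaunay ::
  "nat \<Rightarrow> (finseq \<Rightarrow> real) \<Rightarrow> finseq set \<Rightarrow> (finseq \<Rightarrow> finseq set) \<Rightarrow> finseq set set"
  where "tangential_delaunay D \<omega> \<P> T =
    {\<sigma>. \<sigma> \<noteq> {} \<and>
        (\<exists>\<tau>\<in>weighted_delaunay D \<omega> \<P>.
            \<sigma> \<subseteq> \<tau> \<and> weighted_voronoi D \<omega> \<P> \<tau> \<inter> (\<Union>p\<in>\<tau>. (+) p ` T p) \<noteq> {})}"

definition is_net :: "real \<Rightarrow> finseq set \<Rightarrow> finseq set \<Rightarrow> bool"
  where "is_net \<epsilon> M \<P> \<longleftrightarrow> finite \<P> \<and> \<P> \<noteq> {} \<and> \<P> \<subseteq> M \<and>
    (\<forall>p\<in>\<P>. \<forall>q\<in>\<P> - {p}. \<epsilon> \<le> dist p q) \<and> (\<forall>x\<in>M. infdist x \<P> \<le> 2 * \<epsilon>)"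

text \<open>
  A weight assignment \<open>\<omega>\<^sub>s D \<P> T\<close> is given for every ambient dimension, point set
  \<open>\<P>\<close> and family \<open>T\<close> of subspaces, the latter passed as an extensional function on \<open>\<P>\<close>.
\<close>

definition weights_of_Boissonnat_Ghosh ::
  "nat \<Rightarrow> (nat \<Rightarrow> finseq set \<Rightarrow> (finseq \<Rightarrow> finseq set) \<Rightarrow> finseq \<Rightarrow> real) \<Rightarrow> bool"
  where "weights_of_Boissonnat_Ghosh d \<omega>\<^sub>s \<longleftrightarrow>
    (\<forall>D \<P> T. finite \<P> \<longrightarrow> (\<forall>p\<in>\<P>. 0 \<le> \<omega>\<^sub>s D \<P> T p)) \<and>
    (\<exists>\<epsilon>\<^sub>d>0. \<exists>A>0. \<forall>D \<rho> \<epsilon> M \<P>.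
        0 < \<rho> \<longrightarrow> 0 < \<epsilon> \<longrightarrow> \<epsilon> \<le> \<epsilon>\<^sub>d * \<rho> \<longrightarrow> M \<in> manifold_class D d \<rho> \<longrightarrow> is_net \<epsilon> M \<P> \<longrightarrow>
        (let T = restrict (tangent_space M) \<P>;
             N = underlying (tangential_delaunay D (\<omega>\<^sub>s D \<P> T) \<P> T)
         in hausdorff_dist M N \<le> ennreal (A * \<epsilon>\<^sup>2 / \<rho>) \<and> ambient_isotopic D M N))"


section \<open>The estimator\<close>

text \<open>Ties (between eigenvalues, or in farthest point sampling) may be broken arbitrarily, so the
  steps of the construction are rendered as relations between input and admissible output.\<close>

definition barycenter :: "'a::real_vector set \<Rightarrow> 'a"
  where "barycenter N = (\<Sum>q\<in>N. q) /\<^sub>R real (card N)"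

definition local_scatter :: "finseq set \<Rightarrow> real \<Rightarrow> finseq \<Rightarrow> finseq \<Rightarrow> finseq"
  where "local_scatter \<P> h p v =
    (let N = {q \<in> \<P> - {p}. q \<in> cball p h}; m = barycenter N
     in (\<Sum>q\<in>N. ((q - m) \<bullet> v) *\<^sub>R (q - m)))"

definition top_eigenspace :: "nat \<Rightarrow> nat \<Rightarrow> (finseq \<Rightarrow> finseq) \<Rightarrow> finseq set \<Rightarrow> bool"
  where "top_eigenspace D d S V \<longleftrightarrow>
    (\<exists>B E l. B \<subseteq> euclid D \<and> card B = D \<and> pairwise orthogonal B \<and> (\<forall>b\<in>B. norm b = 1) \<and>
        (\<forall>b\<in>B. S b = l b *\<^sub>R b) \<and>
        E \<subseteq> B \<and> card E = d \<and> (\<forall>e\<in>E. \<forall>b\<in>B - E. l b \<le> (l e :: real)) \<and> V = span E)"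

definition is_TSE :: "nat \<Rightarrow> nat \<Rightarrow> finseq set \<Rightarrow> real \<Rightarrow> (finseq \<Rightarrow> finseq set) \<Rightarrow> bool"
  where "is_TSE D d \<P> h T \<longleftrightarrow> (\<forall>p\<in>\<P>. top_eigenspace D d (local_scatter \<P> h p) (T p))"

definition slab :: "nat \<Rightarrow> real \<Rightarrow> real \<Rightarrow> finseq \<Rightarrow> finseq set \<Rightarrow> real \<Rightarrow> finseq set"
  where "slab D k\<^sub>1 k\<^sub>2 x T h =
    {x + u + w | u w. u \<in> T \<and> norm u \<le> k\<^sub>1 * h \<and> w \<in> orth_compl D T \<and> norm w \<le> k\<^sub>2 * h\<^sup>2}"

definition slab_declutter ::
  "nat \<Rightarrow> nat \<Rightarrow> real \<Rightarrow> real \<Rightarrow> real \<Rightarrow> nat \<Rightarrow> finseq set \<Rightarrow> (finseq \<Rightarrow> finseq set) \<Rightarrow> real \<Rightarrow> finseq set"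
  where "slab_declutter D d k\<^sub>1 k\<^sub>2 t n \<P> T h =
    {p \<in> \<P>. t * (real n - 1) * h ^ d \<le> real (card (slab D k\<^sub>1 k\<^sub>2 p (T p) h \<inter> \<P>))}"

primrec gam :: "nat \<Rightarrow> nat \<Rightarrow> real"
  where
    "gam d 0 = 1 / (real d + 1)"
  | "gam d (Suc k) = (2 * gam d k + 1) / (real d + 2)"

definition scale :: "nat \<Rightarrow> real \<Rightarrow> real \<Rightarrow> nat \<Rightarrow> nat \<Rightarrow> real"
  where "scale d c \<beta> n k = (c * (ln (real n) / (\<beta> * (real n - 1)))) powr gam d k"

definition k_delta :: "nat \<Rightarrow> real \<Rightarrow> nat"
  where "k_delta d \<delta> = (LEAST k. 1 / real d - \<delta> \<le> gam d k)"

text \<open>The first index is shifted by one: index \<open>j\<close> stands for the point set \<open>\<X>\<^sup>(\<^sup>j\<^sup>-\<^sup>1\<^sup>)\<close>.\<close>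

inductive decluttered ::
  "nat \<Rightarrow> nat \<Rightarrow> real \<Rightarrow> real \<Rightarrow> real \<Rightarrow> real \<Rightarrow> real \<Rightarrow> nat \<Rightarrow> finseq set \<Rightarrow> nat \<Rightarrow> finseq set \<Rightarrow> bool"
  for D d k\<^sub>1 k\<^sub>2 c t \<beta> n X
  where
    start: "decluttered D d k\<^sub>1 k\<^sub>2 c t \<beta> n X 0 X"
  | step: "\<lbrakk>decluttered D d k\<^sub>1 k\<^sub>2 c t \<beta> n X j Y; is_TSE D d Y (scale d c \<beta> n j) T\<rbrakk> \<Longrightarrow>
      decluttered D d k\<^sub>1 k\<^sub>2 c t \<beta> n X (Suc j) (slab_declutter D d k\<^sub>1 k\<^sub>2 t n Y T (scale d c \<beta> n j))"

inductive fps_state :: "finseq set \<Rightarrow> real \<Rightarrow> finseq set \<Rightarrow> bool"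
  for \<P> \<epsilon>
  where
    start: "p \<in> \<P> \<Longrightarrow> fps_state \<P> \<epsilon> {p}"
  | step: "\<lbrakk>fps_state \<P> \<epsilon> S; \<exists>p\<in>\<P>. \<epsilon> < infdist p S;
      q \<in> \<P>; \<forall>p\<in>\<P>. infdist p S \<le> infdist q S\<rbrakk> \<Longrightarrow> fps_state \<P> \<epsilon> (insert q S)"

definition is_fps :: "finseq set \<Rightarrow> real \<Rightarrow> finseq set \<Rightarrow> bool"
  where "is_fps \<P> \<epsilon> S \<longleftrightarrow> fps_state \<P> \<epsilon> S \<and> (\<forall>p\<in>\<P>. infdist p S \<le> \<epsilon>)"

text \<open>
  When decluttering removes every point, farthest point sampling has no starting point and the
  construction is undefined; the output is then a complex reduced to an arbitrary sample point.
\<close>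

definition is_TDC_delta ::
  "(nat \<Rightarrow> finseq set \<Rightarrow> (finseq \<Rightarrow> finseq set) \<Rightarrow> finseq \<Rightarrow> real) \<Rightarrow> nat \<Rightarrow> nat \<Rightarrow>
   real \<Rightarrow> real \<Rightarrow> real \<Rightarrow> real \<Rightarrow> real \<Rightarrow> real \<Rightarrow> real \<Rightarrow> nat \<Rightarrow> finseq set \<Rightarrow> finseq set set \<Rightarrow> bool"
  where "is_TDC_delta \<omega>\<^sub>s D d k\<^sub>1 k\<^sub>2 c t c' \<beta> \<delta> n X K \<longleftrightarrow>
    (\<exists>Y. decluttered D d k\<^sub>1 k\<^sub>2 c t \<beta> n X (Suc (k_delta d \<delta>)) Y \<and>
      (if Y = {} then \<exists>p\<in>X. K = {{p}}
       else \<exists>T S. is_TSE D d Y (scale d c \<beta> n (k_delta d \<delta>)) T \<and>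
              is_fps Y (c' * scale d c \<beta> n (k_delta d \<delta>)) S \<and>
              K = tangential_delaunay D (\<omega>\<^sub>s D S (restrict T S)) S (restrict T S)))"

definition tdc_estimator ::
  "(nat \<Rightarrow> finseq set \<Rightarrow> (finseq \<Rightarrow> finseq set) \<Rightarrow> finseq \<Rightarrow> real) \<Rightarrow> nat \<Rightarrow> nat \<Rightarrow>
   real \<Rightarrow> real \<Rightarrow> real \<Rightarrow> real \<Rightarrow> real \<Rightarrow> real \<Rightarrow> real \<Rightarrow> (nat \<Rightarrow> finseq set \<Rightarrow> finseq set set) \<Rightarrow> bool"
  where "tdc_estimator \<omega>\<^sub>s D d k\<^sub>1 k\<^sub>2 c t c' \<beta> \<delta> est \<longleftrightarrow>
    (\<forall>n X. finite X \<longrightarrow> X \<noteq> {} \<longrightarrow> X \<subseteq> euclid D \<longrightarrow>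
       is_TDC_delta \<omega>\<^sub>s D d k\<^sub>1 k\<^sub>2 c t c' \<beta> \<delta> n X (est n X))"

end

theory Submission
  imports Defs "HOL-Real_Asymp.Real_Asymp"
begin

text \<open>
  Except with probability \<open>n\<^sup>-\<^sup>3\<close>, by Chernoff bounds over finite nets, every ball of radius of
  order \<open>h\<^sub>k\<close> centred on \<open>M\<close> contains of the order of \<open>n \<beta> h\<^sub>k\<^sup>d\<close> sample points of \<open>M\<close>, few outliers
  lie in a ball of that radius, and only boundedly many of them lie within \<open>O(h\<^sub>k\<^sub>-\<^sub>1\<^sup>2)\<close> of
  \<open>M\<close> in such a ball.  On this event, if the outliers left after a step are within \<open>h\<^sub>k\<^sub>-\<^sub>1\<^sup>2 / \<rho>\<close> of
  \<open>M\<close>, then the scatter matrices at scale \<open>h\<^sub>k\<close> give the tangent spaces up to an angle \<open>O(h\<^sub>k)\<close>;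
  hence a slab at a point of \<open>M\<close> contains a ball of \<open>M\<close> and is never too empty, while a slab
  at distance more than \<open>h\<^sub>k\<^sup>2 / \<rho>\<close> from \<open>M\<close> misses \<open>M\<close>, so its centre is discarded.  By induction
  the surviving points \<open>p\<close> are within \<open>O(h\<^sup>2)\<close> of \<open>M\<close>, for the final scale \<open>h\<close>, with tangent
  spaces known up to \<open>O(h)\<close>.

  For \<open>\<epsilon> = h\<close> the farthest point sample is then interpolated: adding to the identity
  bumps of radius \<open>h / 4\<close>, which move the nearest point of \<open>M\<close> to \<open>p\<close> and rotate its tangent
  space onto the estimated one, is a diffeomorphism with second derivatives of order \<open>1\<close>.
  It carries \<open>M\<close> to an isotopic submanifold \<open>M'\<close> at distance \<open>O(h\<^sup>2)\<close> whose reach is bounded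
  below, whose points include the sample and whose tangent spaces there are the estimated
  ones.  So the exact guarantee for the weights of Boissonnat and Ghosh applies to \<open>M'\<close>.
\<close>

section \<open>Subspaces of the Euclidean spaces\<close>

text \<open>The weights enter only through their guarantee for exact nets with exact tangent spaces,
  and nothing is known of how they react to perturbed input; so the data are kept and the manifold
  is moved. The errors allow it: a bump of radius of order h that moves a point by O(h^2) and turns
  a plane by O(h) has first derivative O(h) and second derivative O(1), and the reach depends on the
  latter.

  The scales come from balancing the scatter matrix. Points of \<open>M\<close> give tangential
  eigenvalues of order at least n \<beta> h^(d+2), while a remaining outlier contributes at most h
  times its normal offset, of order h_old^2. Boundedly many outliers thus cost an angle O(h) once
  h_old^2 ln n <= n \<beta> h^(d+2), which is the recursion of \<open>gam\<close>; the logarithm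
  absorbs the bound on their number. It also removes \<open>D\<close> and \<open>\<beta>\<close>
  from the angle constant at every scale but the first. The bound on \<open>\<delta>\<close> forces
  at least one further scale, so the final constants involve neither.\<close>

lemma subspace_euclid: "subspace (euclid D)"
  by (auto simp: subspace_def euclid_def)

definition unit_vec :: "nat \<Rightarrow> finseq"
  where "unit_vec j = euclid_of (Suc j) (\<lambda>i. if i = j then 1 else 0)"

lemma nth_unit_vec [simp]: "finseq_nth (unit_vec j) i = (if i = j then 1 else 0)"
  by (auto simp: unit_vec_def)

lemma inner_unit_vec: "unit_vec j \<bullet> x = finseq_nth x j"
  by (subst inner_finseq_superset[of "{j}"]) auto

lemma finseq_nth_minus [simp]: "finseq_nth (x - y) i = finseq_nth x i - finseq_nth y i"
  by (simp only: minus_finseq_def finseq_nth_simps)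

lemma norm_unit_vec [simp]: "norm (unit_vec j) = 1"
  by (simp add: norm_eq_sqrt_inner inner_unit_vec)

lemma unit_vec_inj: "unit_vec i = unit_vec j \<Longrightarrow> i = j"
  by (metis inner_unit_vec nth_unit_vec zero_neq_one)

lemma unit_vec_in_euclid: "j < D \<Longrightarrow> unit_vec j \<in> euclid D"
  by (auto simp: euclid_def)

lemma euclid_sum: "x \<in> euclid D \<Longrightarrow> x = (\<Sum>j<D. finseq_nth x j *\<^sub>R unit_vec j)"
  by (rule finseq_eqI) (auto simp: finseq_nth_sum euclid_def if_distrib[of "times _"] cong: if_cong)

lemma euclid_mono: "d \<le> D \<Longrightarrow> euclid d \<subseteq> euclid D"
  by (auto simp: euclid_def)

lemma euclid_eq_span: "euclid D = span (unit_vec ` {..<D})"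
proof
  show "euclid D \<subseteq> span (unit_vec ` {..<D})"
  proof
    fix x assume "x \<in> euclid D"
    then have "x = (\<Sum>j<D. finseq_nth x j *\<^sub>R unit_vec j)" by (rule euclid_sum)
    also have "\<dots> \<in> span (unit_vec ` {..<D})"
      by (intro span_sum span_scale span_base) auto
    finally show "x \<in> span (unit_vec ` {..<D})" .
  qed
  show "span (unit_vec ` {..<D}) \<subseteq> euclid D"
    by (rule span_minimal) (auto simp: subspace_euclid intro: unit_vec_in_euclid)
qed

lemma closed_euclid: "closed (euclid D)"
proof -
  have eq: "euclid D = (\<Inter>i\<in>{D..}. {x. unit_vec i \<bullet> x = 0})"
    by (auto simp: euclid_def inner_unit_vec)
  show ?thesis
    unfolding eq by (intro closed_INT ballI closed_Collect_eq continuous_intros)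
qed

lemma abs_nth_le_norm: "\<bar>finseq_nth x i\<bar> \<le> norm x"
  using Cauchy_Schwarz_ineq2[of "unit_vec i" x] by (simp add: inner_unit_vec)

text \<open>Closed bounded sets of \<open>finseq\<close> need not be compact. Induction on the
  dimension works inside \<open>euclid D\<close>: the next ball is a closed subset of the image of
  the previous one times an interval.\<close>

lemma compact_euclid_cball0: "compact (euclid D \<inter> cball 0 R)"
proof (induction D)
  case 0
  have "euclid 0 = {0}" by (auto simp: euclid_def intro: finseq_eqI)
  then have "finite (euclid 0 \<inter> cball 0 R)" by (metis finite.emptyI finite_Int finite_insert)
  then show ?case by (rule finite_imp_compact)
next
  case (Suc D)
  let ?f = "\<lambda>(x::finseq, s::real). x + s *\<^sub>R unit_vec D"
  let ?K = "?f ` ((euclid D \<inter> cball 0 R) \<times> {-R..R})"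
  have K: "compact ?K"
    by (rule compact_continuous_image[OF _ compact_Times[OF Suc compact_Icc]])
      (auto simp: case_prod_unfold intro!: continuous_intros)
  have sub: "euclid (Suc D) \<inter> cball 0 R \<subseteq> ?K"
  proof
    fix x assume x: "x \<in> euclid (Suc D) \<inter> cball 0 R"
    let ?y = "x - finseq_nth x D *\<^sub>R unit_vec D"
    have 1: "?y \<in> euclid D"
      using x by (auto simp: euclid_def)
    have "norm ?y ^2 = norm x ^2 - (finseq_nth x D)^2"
      unfolding power2_norm_eq_inner
      by (simp add: inner_diff_left inner_diff_right inner_unit_vec inner_commute[of x "unit_vec D"] power2_eq_square)
    then have "norm ?y ^2 \<le> norm x ^2" by auto
    then have "norm ?y \<le> norm x" by (rule power2_le_imp_le) simp
    moreover have "norm x \<le> R" using x by auto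
    moreover have "\<bar>finseq_nth x D\<bar> \<le> norm x" by (rule abs_nth_le_norm)
    ultimately have "(?y, finseq_nth x D) \<in> (euclid D \<inter> cball 0 R) \<times> {-R..R}"
      using 1 by auto
    moreover have "x = ?f (?y, finseq_nth x D)" by simp
    ultimately show "x \<in> ?K" by (rule rev_image_eqI)
  qed
  have "euclid (Suc D) \<inter> cball 0 R = ?K \<inter> (euclid (Suc D) \<inter> cball 0 R)"
    using sub by auto
  moreover have "closed (euclid (Suc D) \<inter> cball 0 R)"
    by (intro closed_Int closed_euclid closed_cball)
  ultimately show ?case using K by (metis compact_Int_closed)
qed

lemma compact_euclid_cball: "compact (euclid D \<inter> cball p R)"
proof -
  have "cball p R \<subseteq> cball 0 (norm p + R)"
  proof
    fix x assume "x \<in> cball p R"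
    then have "norm (x - p) \<le> R" by (simp add: dist_norm norm_minus_commute)
    then have "norm x \<le> norm p + R" using norm_triangle_ineq2[of x p] by linarith
    then show "x \<in> cball 0 (norm p + R)" by simp
  qed
  then have "euclid D \<inter> cball p R = (euclid D \<inter> cball 0 (norm p + R)) \<inter> cball p R" by auto
  then show ?thesis by (metis compact_Int_closed compact_euclid_cball0 closed_cball)
qed

text \<open>An orthonormal basis kept as a set; its cardinality makes the dimension part of
  \<open>dsub\<close>.\<close>

definition frame :: "nat \<Rightarrow> finseq set \<Rightarrow> finseq set \<Rightarrow> bool"
  where "frame d E T \<longleftrightarrow> finite E \<and> card E = d \<and> pairwise orthogonal E \<and> (\<forall>e\<in>E. norm e = 1) \<and> span E = T"

definition dsub :: "nat \<Rightarrow> finseq set \<Rightarrow> bool"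
  where "dsub d T \<longleftrightarrow> (\<exists>E. frame d E T)"

lemma frame_independent: "frame d E T \<Longrightarrow> independent E"
  unfolding frame_def by (intro pairwise_orthogonal_independent) auto

lemma frame_subset: "frame d E T \<Longrightarrow> E \<subseteq> T"
  unfolding frame_def using span_superset by blast

lemma frame_inner: "frame d E T \<Longrightarrow> e \<in> E \<Longrightarrow> e' \<in> E \<Longrightarrow> e \<bullet> e' = (if e = e' then 1 else 0)"
  unfolding frame_def pairwise_def orthogonal_def by (auto simp: norm_eq_1)

text \<open>Gram-Schmidt may return the zero vector, which is dropped before normalising.\<close>

lemma span_finite_frame:
  assumes "finite B" shows "\<exists>k\<le>card B. \<exists>E. frame k E (span B)"
proof -
  obtain C where C: "finite C" "card C \<le> card B" "span C = span B" "pairwise orthogonal C"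
    using basis_orthogonal[OF assms] by blast
  let ?C = "C - {0}" and ?f = "\<lambda>c::finseq. (1 / norm c) *\<^sub>R c"
  have sp: "span (?f ` ?C) = span ?C"
    using C(1) by (intro span_image_scale) auto
  have po: "pairwise orthogonal ?C" using C(4) by (auto simp: pairwise_def)
  have inner0: "c \<bullet> c' = 0" if "c \<in> ?C" "c' \<in> ?C" "c \<noteq> c'" for c c'
    using po that by (auto simp: pairwise_def orthogonal_def)
  have "pairwise orthogonal (?f ` ?C)"
    unfolding pairwise_def orthogonal_def
  proof (intro ballI impI)
    fix x y assume "x \<in> ?f ` ?C" "y \<in> ?f ` ?C" "x \<noteq> y"
    then obtain c c' where "c \<in> ?C" "c' \<in> ?C" "x = ?f c" "y = ?f c'" "c \<noteq> c'" by blast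
    then show "x \<bullet> y = 0" using inner0[of c c'] by simp
  qed
  moreover have "\<forall>e\<in>?f ` ?C. norm e = 1" by auto
  moreover have "card (?f ` ?C) \<le> card B"
    using C card_image_le[of ?C ?f] card_mono[of C ?C] by (meson Diff_subset finite_Diff le_trans)
  moreover have "span ?C = span B" using C(3) by simp
  ultimately have "frame (card (?f ` ?C)) (?f ` ?C) (span B)" "card (?f ` ?C) \<le> card B"
    using sp C(1) unfolding frame_def by (simp_all only: finite_imageI finite_Diff simp_thms)
  then show ?thesis by blast
qed

lemma dsub_span:
  assumes "finite B" "independent B" shows "dsub (card B) (span B)"
proof -
  obtain k E where k: "k \<le> card B" and E: "frame k E (span B)"
    using span_finite_frame[OF assms(1)] by blast
  have "card B \<le> card E"
    using independent_span_bound[of E B] E assms(2) span_superset[of B]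
    unfolding frame_def by auto
  then have "k = card B" using k E unfolding frame_def by simp
  then show ?thesis using E unfolding dsub_def by blast
qed

lemma dsub_euclid: "dsub D (euclid D)"
proof -
  have inj: "inj_on unit_vec {..<D}" using unit_vec_inj by (auto intro: inj_onI)
  have "0 \<noteq> unit_vec j" for j by (metis norm_unit_vec norm_zero zero_neq_one)
  then have "independent (unit_vec ` {..<D})"
    by (intro pairwise_orthogonal_independent)
      (auto simp: pairwise_def orthogonal_def inner_unit_vec simp del: zero_finseq.rep_eq)
  then have "dsub (card (unit_vec ` {..<D})) (euclid D)"
    unfolding euclid_eq_span by (intro dsub_span) auto
  then show ?thesis using inj by (simp add: card_image)
qed

lemma dsub_subspace: "dsub d T \<Longrightarrow> subspace T"
  unfolding dsub_def frame_def by auto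

section \<open>Orthogonal projection onto finite-dimensional subspaces\<close>

definition proj :: "finseq set \<Rightarrow> finseq \<Rightarrow> finseq"
  where "proj T x = (SOME y. y \<in> T \<and> (\<forall>u\<in>T. (x - y) \<bullet> u = 0))"

lemma proj_unique:
  assumes "subspace T" "y \<in> T" "\<And>u. u \<in> T \<Longrightarrow> (x - y) \<bullet> u = 0"
  shows "proj T x = y"
  unfolding proj_def
proof (rule some_equality)
  show "y \<in> T \<and> (\<forall>u\<in>T. (x - y) \<bullet> u = 0)" using assms by auto
next
  fix z assume z: "z \<in> T \<and> (\<forall>u\<in>T. (x - z) \<bullet> u = 0)"
  have "z - y \<in> T" using assms z by (auto intro: subspace_diff)
  then have "(x - y) \<bullet> (z - y) - (x - z) \<bullet> (z - y) = 0" using assms z by auto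
  then have "(z - y) \<bullet> (z - y) = 0" by (simp add: inner_diff_left)
  then show "z = y" by simp
qed

lemma proj_frame:
  assumes "frame d E T" shows "proj T x = (\<Sum>e\<in>E. (x \<bullet> e) *\<^sub>R e)"
proof (rule proj_unique)
  have fin: "finite E" and T: "T = span E" using assms by (auto simp: frame_def)
  show "subspace T" by (simp add: T)
  show "(\<Sum>e\<in>E. (x \<bullet> e) *\<^sub>R e) \<in> T" unfolding T by (intro span_sum span_scale span_base)
  have base: "(x - (\<Sum>e\<in>E. (x \<bullet> e) *\<^sub>R e)) \<bullet> u = 0" if "u \<in> E" for u
  proof -
    have "(\<Sum>e\<in>E. (x \<bullet> e) *\<^sub>R e) \<bullet> u = (\<Sum>e\<in>E. if e = u then x \<bullet> e else 0)"
      unfolding inner_sum_left by (intro sum.cong) (auto simp: frame_inner[OF assms _ that])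
    then show ?thesis using that fin by (simp add: inner_diff_left)
  qed
  fix u assume "u \<in> T"
  then have "u \<in> span E" by (simp add: T)
  then show "(x - (\<Sum>e\<in>E. (x \<bullet> e) *\<^sub>R e)) \<bullet> u = 0"
  proof (induction rule: span_induct)
    show "subspace {u. (x - (\<Sum>e\<in>E. (x \<bullet> e) *\<^sub>R e)) \<bullet> u = 0}"
      by (auto simp: subspace_def inner_add_right)
  qed (use base in auto)
qed

context
  fixes d T assumes T: "dsub d T"
begin

lemma proj_props: "proj T x \<in> T \<and> (\<forall>u\<in>T. (x - proj T x) \<bullet> u = 0)"
proof -
  obtain E where E: "frame d E T" using T by (auto simp: dsub_def)
  then have fin: "finite E" and TE: "T = span E" by (auto simp: frame_def)
  have base: "(x - proj T x) \<bullet> u = 0" if "u \<in> E" for u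
  proof -
    have "(\<Sum>e\<in>E. (x \<bullet> e) *\<^sub>R e) \<bullet> u = (\<Sum>e\<in>E. if e = u then x \<bullet> e else 0)"
      unfolding inner_sum_left by (intro sum.cong) (auto simp: frame_inner[OF E _ that])
    then show ?thesis using that fin by (simp add: inner_diff_left proj_frame[OF E])
  qed
  have "(x - proj T x) \<bullet> u = 0" if "u \<in> T" for u
  proof -
    have "u \<in> span E" using that by (simp add: TE)
    then show ?thesis
    proof (induction rule: span_induct)
      show "subspace {u. (x - proj T x) \<bullet> u = 0}"
        by (auto simp: subspace_def inner_add_right)
    qed (use base in auto)
  qed
  moreover have "proj T x \<in> T"
    unfolding proj_frame[OF E] unfolding TE by (intro span_sum span_scale span_base)
  ultimately show ?thesis by blast
qed

lemma proj_in: "proj T x \<in> T" using proj_props by blast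

lemma proj_orth: "u \<in> T \<Longrightarrow> (x - proj T x) \<bullet> u = 0" using proj_props by blast

lemma proj_inner: "u \<in> T \<Longrightarrow> proj T x \<bullet> u = x \<bullet> u"
  using proj_orth[of u x] by (simp add: inner_diff_left)

lemma proj_id: "u \<in> T \<Longrightarrow> proj T u = u"
  by (rule proj_unique[OF dsub_subspace[OF T]]) auto

lemma linear_proj: "linear (proj T)"
proof (rule linearI)
  note S = dsub_subspace[OF T]
  fix x y and r :: real
  show "proj T (x + y) = proj T x + proj T y"
    by (rule proj_unique[OF S])
      (auto intro!: subspace_add[OF S] proj_in simp: inner_add_left inner_diff_left proj_inner)
  show "proj T (r *\<^sub>R x) = r *\<^sub>R proj T x"
    by (rule proj_unique[OF S])
      (auto intro!: subspace_scale[OF S] proj_in simp: inner_diff_left proj_inner)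
qed

lemma proj_pythagoras: "(norm x)\<^sup>2 = (norm (proj T x))\<^sup>2 + (norm (x - proj T x))\<^sup>2"
proof -
  have "x = proj T x + (x - proj T x)" by simp
  then have "(norm x)\<^sup>2 = (norm (proj T x + (x - proj T x)))\<^sup>2" by simp
  also have "\<dots> = (norm (proj T x))\<^sup>2 + (norm (x - proj T x))\<^sup>2"
    using proj_orth[OF proj_in, of x x] by (intro norm_add_Pythagorean) (simp add: orthogonal_def inner_commute)
  finally show ?thesis .
qed

lemma norm_proj_le: "norm (proj T x) \<le> norm x"
  using proj_pythagoras[of x] by (auto intro: power2_le_imp_le[of "_" "norm x"])

lemma norm_proj_compl_le: "norm (x - proj T x) \<le> norm x"
  using proj_pythagoras[of x] by (auto intro: power2_le_imp_le[of "_" "norm x"])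

lemma proj_best:
  assumes "y \<in> T" shows "norm (x - proj T x) \<le> norm (x - y)"
proof -
  have "proj T (x - y) = proj T x - y"
    using assms by (simp add: linear_diff[OF linear_proj] proj_id)
  then show ?thesis using norm_proj_compl_le[of "x - y"] by (simp add: algebra_simps)
qed

lemma bounded_linear_proj: "bounded_linear (proj T)"
  using linear_proj norm_proj_le
  by (auto simp: bounded_linear_def bounded_linear_axioms_def intro!: exI[of _ 1])

text \<open>The residual \<open>x - proj T x\<close> is itself normal to \<open>T\<close>, and its
  inner product with \<open>x\<close> is its squared norm; testing \<open>x\<close> against normal
  vectors therefore controls the residual.\<close>

lemma norm_compl_bound:
  assumes "\<And>w. (\<forall>u\<in>T. w \<bullet> u = 0) \<Longrightarrow> w \<in> euclid D \<Longrightarrow> w \<bullet> x \<le> c * norm w"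
    and "x \<in> euclid D" "T \<subseteq> euclid D" "0 \<le> c"
  shows "norm (x - proj T x) \<le> c"
proof (cases "x = proj T x")
  case True
  then show ?thesis using assms(4) by simp
next
  case False
  let ?w = "x - proj T x"
  have "?w \<in> euclid D" using assms proj_in by (meson subspace_diff subspace_euclid subsetD)
  then have "?w \<bullet> x \<le> c * norm ?w" using assms(1)[of ?w] proj_orth by blast
  moreover have "?w \<bullet> x = (norm ?w)\<^sup>2"
    using proj_orth[OF proj_in, of x x]
    by (simp add: power2_norm_eq_inner inner_diff_right)
  ultimately have "norm ?w * norm ?w \<le> c * norm ?w" by (simp add: power2_eq_square)
  then show ?thesis using False by simp
qed

lemma dsub_span_contained:
  assumes "independent B" "finite B" "card B = d" "B \<subseteq> T" shows "span B = T"
proof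
  show "span B \<subseteq> T" using assms dsub_subspace[OF T] by (simp add: span_minimal)
  obtain E where E: "frame d E T" using T by (auto simp: dsub_def)
  show "T \<subseteq> span B"
  proof (rule ccontr)
    assume "\<not> ?thesis"
    then obtain t where t: "t \<in> T" "t \<notin> span B" by blast
    then have ind: "independent (insert t B)" using assms by (intro independent_insertI) auto
    have "insert t B \<subseteq> span E" using t assms E by (auto simp: frame_def)
    then have "card (insert t B) \<le> d"
      using independent_span_bound[OF _ ind, of E] E by (auto simp: frame_def)
    moreover have "t \<notin> B" using t span_base by blast
    ultimately show False using assms by simp
  qed
qed

end

text \<open>The projections of \<open>A\<close> to \<open>T\<close> span fewer than \<open>d\<close>
  dimensions, so some basis vector of \<open>T\<close> has a nonzero residual there. For vectors of
  \<open>T\<close>, orthogonality to \<open>a\<close> and to \<open>proj T a\<close> is the same.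
  This is the dimension count behind the min-max argument in
  \<open>top_eigenspace_frame\<close>.\<close>

lemma dsub_orth_ex:
  assumes T: "dsub d T" and "finite A" "card A < d"
  shows "\<exists>u\<in>T. norm u = 1 \<and> (\<forall>a\<in>A. u \<bullet> a = 0)"
proof -
  obtain E where E: "frame d E T" using T by (auto simp: dsub_def)
  let ?F = "proj T ` A"
  have F: "finite ?F" "card ?F < d" using assms(2,3) card_image_le[of A "proj T"] by auto
  obtain k G where G: "frame k G (span ?F)" using span_finite_frame[OF F(1)] by blast
  then have GF: "dsub k (span ?F)" by (auto simp: dsub_def)
  have "\<not> E \<subseteq> span ?F"
    using independent_span_bound[OF F(1) frame_independent[OF E]] F(2) E by (auto simp: frame_def)
  then obtain e where e: "e \<in> E" "e \<notin> span ?F" by blast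
  let ?u = "e - proj (span ?F) e"
  have FT: "span ?F \<subseteq> T"
    by (rule span_minimal) (auto simp: proj_in[OF T] dsub_subspace[OF T])
  have p: "proj (span ?F) e \<in> span ?F" by (rule proj_in[OF GF])
  have o: "?u \<bullet> u = 0" if "u \<in> span ?F" for u by (rule proj_orth[OF GF that])
  have uT: "?u \<in> T" using subspace_diff[OF dsub_subspace[OF T] subsetD[OF frame_subset[OF E] e(1)] subsetD[OF FT p]] .
  have u0: "?u \<noteq> 0" using e p by auto
  have ua: "?u \<bullet> a = 0" if "a \<in> A" for a
  proof -
    have "?u \<bullet> a = a \<bullet> ?u" by (rule inner_commute)
    also have "\<dots> = proj T a \<bullet> ?u" using proj_inner[OF T uT, of a] by simp
    also have "\<dots> = 0" using o[of "proj T a"] that by (simp add: span_base inner_commute)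
    finally show ?thesis .
  qed
  show ?thesis
    using uT u0 ua subspace_scale[OF dsub_subspace[OF T] uT]
    by (intro bexI[of _ "(1 / norm ?u) *\<^sub>R ?u"]) auto
qed

lemma dsub_linear_image:
  assumes "dsub d T" "linear f" "\<And>u. u \<in> T \<Longrightarrow> f u = 0 \<Longrightarrow> u = 0"
  shows "dsub d (f ` T)"
proof -
  obtain E where E: "frame d E T" using assms by (auto simp: dsub_def)
  have inj: "inj_on f T"
    using linear_inj_on_iff_eq_0[OF assms(2) dsub_subspace[OF assms(1)]] assms(3) by blast
  have TE: "span E = T" using E by (auto simp: frame_def)
  have "independent (f ` E)"
    using linear_independent_injective_image[OF assms(2) frame_independent[OF E]] inj TE by simp
  moreover have "card (f ` E) = d"
    using card_image[OF inj_on_subset[OF inj frame_subset[OF E]]] E by (auto simp: frame_def)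
  moreover have "span (f ` E) = f ` T"
    using linear_span_image[OF assms(2), of E] TE by simp
  ultimately show ?thesis using dsub_span[of "f ` E"] E by (auto simp: frame_def)
qed

lemma dsub_eq:
  assumes "dsub d T" "dsub d T'" "T \<subseteq> T'" shows "T = T'"
proof -
  obtain E where E: "frame d E T" using assms by (auto simp: dsub_def)
  have "span E = T'"
    by (rule dsub_span_contained[OF assms(2) frame_independent[OF E]])
      (use E frame_subset[OF E] assms in \<open>auto simp: frame_def\<close>)
  then show ?thesis using E by (auto simp: frame_def)
qed

text \<open>The sine of the largest angle between a vector of \<open>T\<close> and the space
  \<open>T'\<close> is at most \<open>c\<close>. The relation is one-sided; for equal dimensions
  \<open>dev_sym\<close> reverses it.\<close>

definition dev :: "finseq set \<Rightarrow> finseq set \<Rightarrow> real \<Rightarrow> bool"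
  where "dev T T' c \<longleftrightarrow> (\<forall>u\<in>T. norm (u - proj T' u) \<le> c * norm u)"

lemma devD: "dev T T' c \<Longrightarrow> u \<in> T \<Longrightarrow> norm (u - proj T' u) \<le> c * norm u"
  by (auto simp: dev_def)

lemma dev_mono: "dev T T' c \<Longrightarrow> c \<le> c' \<Longrightarrow> dev T T' c'"
  unfolding dev_def by (meson mult_right_mono norm_ge_zero order_trans)

lemma dev_trans:
  assumes "dsub d T'" "dsub d T''" "dev T T' a" "dev T' T'' b" "0 \<le> b"
  shows "dev T T'' (a + b)"
  unfolding dev_def
proof
  fix u assume u: "u \<in> T"
  let ?v = "proj T' u"
  have "norm (u - proj T'' u) \<le> norm (u - proj T'' ?v)"
    by (rule proj_best[OF assms(2) proj_in[OF assms(2)]])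
  also have "\<dots> \<le> norm (u - ?v) + norm (?v - proj T'' ?v)"
    using norm_triangle_ineq[of "u - ?v" "?v - proj T'' ?v"] by simp
  also have "\<dots> \<le> a * norm u + b * norm ?v"
    using assms(3,4) u proj_in[OF assms(1)] by (intro add_mono) (auto simp: dev_def)
  also have "\<dots> \<le> a * norm u + b * norm u"
    using norm_proj_le[OF assms(1), of u] assms(5) by (intro add_left_mono mult_left_mono) auto
  finally show "norm (u - proj T'' u) \<le> (a + b) * norm u" by (simp add: algebra_simps)
qed

lemma dev_inner:
  assumes "dsub d T'" "dev T T' c" "u \<in> T" "\<And>v. v \<in> T' \<Longrightarrow> w \<bullet> v = 0"
  shows "\<bar>w \<bullet> u\<bar> \<le> c * norm w * norm u"
proof -
  have "w \<bullet> u = w \<bullet> (u - proj T' u)"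
    using assms(4)[OF proj_in[OF assms(1)], of u] by (simp add: inner_diff_right)
  then have "\<bar>w \<bullet> u\<bar> \<le> norm w * norm (u - proj T' u)" using Cauchy_Schwarz_ineq2 by simp
  also have "\<dots> \<le> norm w * (c * norm u)" using assms by (intro mult_left_mono) (auto simp: dev_def)
  finally show ?thesis by (simp add: algebra_simps)
qed

lemma devI:
  assumes "dsub d T'" "T \<subseteq> euclid D" "T' \<subseteq> euclid D" "0 \<le> c"
    and "\<And>u w. u \<in> T \<Longrightarrow> w \<in> euclid D \<Longrightarrow> (\<forall>v\<in>T'. w \<bullet> v = 0) \<Longrightarrow> w \<bullet> u \<le> c * norm w * norm u"
  shows "dev T T' c"
  unfolding dev_def
proof
  fix u assume "u \<in> T"
  show "norm (u - proj T' u) \<le> c * norm u"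
  proof (cases "u = proj T' u")
    case False
    then show ?thesis
      using assms(2-5) \<open>u \<in> T\<close>
      by (intro norm_compl_bound[OF assms(1)]) (auto simp: mult.assoc mult.commute[of "norm u"])
  qed (use assms(4) in simp)
qed

lemma dev_injective:
  assumes "dev T T' c" "c < 1" "u \<in> T" "proj T' u = 0" shows "u = 0"
proof (rule ccontr)
  assume "u \<noteq> 0"
  have "norm u \<le> c * norm u" using devD[OF assms(1,3)] assms(4) by simp
  with \<open>u \<noteq> 0\<close> assms(2) show False by simp
qed

lemma proj_onto:
  assumes "dsub d T" "dsub d T'" "dev T T' c" "c < 1"
  shows "proj T' ` T = T'"
proof (rule dsub_eq)
  show "dsub d (proj T' ` T)"
    using assms by (intro dsub_linear_image linear_proj) (auto intro: dev_injective)
qed (use assms proj_in in auto)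

text \<open>Equal dimensions make the projection of \<open>T\<close> to \<open>T'\<close> onto. A
  vector \<open>u\<close> of \<open>T'\<close> is thus the image of some \<open>v\<close> with norm
  at most twice that of \<open>u\<close>, as \<open>c\<close> is at most 1/2; this is the factor
  2.\<close>

lemma dev_sym:
  assumes "dsub d T" "dsub d T'" "T \<subseteq> euclid D" "T' \<subseteq> euclid D" "dev T T' c" "c \<le> 1/2" "0 \<le> c"
  shows "dev T' T (2 * c)"
proof (rule devI[OF assms(1,4,3)])
  fix u w assume u: "u \<in> T'" and w: "\<forall>v\<in>T. w \<bullet> v = 0"
  obtain v where v: "v \<in> T" "u = proj T' v"
    using proj_onto[OF assms(1,2,5)] assms(6) u by auto
  have "norm v \<le> norm u + norm (v - u)" using norm_triangle_ineq2[of v u] by simp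
  also have "norm (v - u) \<le> c * norm v" using devD[OF assms(5) v(1)] v(2) by simp
  finally have "norm v - c * norm v \<le> norm u" by simp
  moreover have "c * norm v \<le> 1/2 * norm v" using assms by (intro mult_right_mono) auto
  ultimately have nv: "norm v \<le> 2 * norm u" by simp
  have "w \<bullet> u = w \<bullet> (u - v)" using w v by (simp add: inner_diff_right)
  also have "\<dots> \<le> norm w * norm (u - v)" by (rule norm_cauchy_schwarz)
  also have "\<dots> \<le> norm w * (c * (2 * norm u))"
  proof (rule mult_left_mono)
    have "norm (u - v) \<le> c * norm v" using devD[OF assms(5) v(1)] v(2) by (simp add: norm_minus_commute)
    also have "\<dots> \<le> c * (2 * norm u)" using nv assms by (intro mult_left_mono) auto
    finally show "norm (u - v) \<le> c * (2 * norm u)" .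
  qed simp
  finally show "w \<bullet> u \<le> 2 * c * norm w * norm u" by (simp add: algebra_simps)
qed (use assms in auto)

section \<open>Tangent spaces of submanifolds\<close>

text \<open>Charts are differentiable only within \<open>euclid D\<close>, whereas curves are
  differentiated at 0 without restriction; a curve that stays in \<open>S\<close> near 0 reconciles
  the two.\<close>

lemma curve_chain:
  fixes \<gamma> :: "real \<Rightarrow> 'a::real_normed_vector" and f :: "'a \<Rightarrow> 'b::real_normed_vector"
  assumes "(f has_derivative f') (at (\<gamma> 0) within S)" "(\<gamma> has_vector_derivative v) (at 0)"
    and "0 < e" "\<And>s. \<bar>s\<bar> < e \<Longrightarrow> \<gamma> s \<in> S"
  shows "((\<lambda>s. f (\<gamma> s)) has_vector_derivative f' v) (at 0)"
proof -
  have "(\<gamma> has_vector_derivative v) (at 0 within {-e<..<e})"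
    using assms(2) by (rule has_vector_derivative_at_within)
  moreover have "(f has_derivative f') (at (\<gamma> 0) within \<gamma> ` {-e<..<e})"
    using assms(4) by (intro has_derivative_subset[OF assms(1)]) auto
  ultimately have "((f \<circ> \<gamma>) has_vector_derivative f' v) (at 0 within {-e<..<e})"
    by (rule vector_derivative_diff_chain_within)
  then show ?thesis
    using assms(3) by (subst (asm) has_vector_derivative_within_open) (auto simp: o_def)
qed

lemma vector_derivative_in_subspace:
  assumes "(\<gamma> has_vector_derivative v) (at 0)" "0 < e" "\<And>s. \<bar>s\<bar> < e \<Longrightarrow> \<gamma> s \<in> S"
    and "subspace S" "closed S"
  shows "v \<in> S"
proof -
  have "((\<lambda>s. (\<gamma> s - \<gamma> 0 - s *\<^sub>R v) /\<^sub>R norm s) \<longlongrightarrow> 0) (at 0)"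
    using assms(1) by (simp add: has_vector_derivative_def has_derivative_at_within)
  moreover have "(\<lambda>n. e / 2 * inverse (real (Suc n))) \<longlonglongrightarrow> e / 2 * 0"
    by (intro tendsto_intros LIMSEQ_inverse_real_of_nat)
  then have lim0: "filterlim (\<lambda>n. e / 2 * inverse (real (Suc n))) (at 0) sequentially"
    using assms(2) by (auto simp: filterlim_at)
  ultimately have "(\<lambda>n. (\<gamma> (e / 2 * inverse (real (Suc n))) - \<gamma> 0 - (e / 2 * inverse (real (Suc n))) *\<^sub>R v)
      /\<^sub>R norm (e / 2 * inverse (real (Suc n)))) \<longlonglongrightarrow> 0" (is "?f \<longlonglongrightarrow> 0")
    by (rule filterlim_compose)
  moreover have "?f n = (\<gamma> (e / 2 * inverse (real (Suc n))) - \<gamma> 0) /\<^sub>R (e / 2 * inverse (real (Suc n))) - v" for n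
    using assms(2) by (simp add: scaleR_diff_right del: of_nat_Suc)
  ultimately have lim: "(\<lambda>n. (\<gamma> (e / 2 * inverse (real (Suc n))) - \<gamma> 0) /\<^sub>R (e / 2 * inverse (real (Suc n)))) \<longlonglongrightarrow> v"
    by (simp add: LIM_zero_iff)
  have "e / 2 * inverse (real (Suc n)) < e" for n
  proof -
    have "inverse (real (Suc n)) \<le> 1" by (simp add: inverse_le_1_iff)
    then have "e / 2 * inverse (real (Suc n)) \<le> e / 2 * 1" using assms(2) by (intro mult_left_mono) auto
    then show ?thesis using assms(2) by linarith
  qed
  then have "\<gamma> (e / 2 * inverse (real (Suc n))) \<in> S" for n
    using assms(2) by (intro assms(3)) (simp add: abs_mult del: of_nat_Suc)
  then have "(\<gamma> (e / 2 * inverse (real (Suc n))) - \<gamma> 0) /\<^sub>R (e / 2 * inverse (real (Suc n))) \<in> S" for n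
    using assms(2) assms(3)[of 0] by (intro subspace_scale[OF assms(4)] subspace_diff[OF assms(4)]) auto
  then show ?thesis using closed_sequentially[OF assms(5) _ lim] by blast
qed

lemma small_ball_openin:
  assumes "openin (top_of_set S) U" "p \<in> U"
  obtains e where "0 < e" "\<And>x. x \<in> S \<Longrightarrow> dist x p < e \<Longrightarrow> x \<in> U"
proof -
  obtain e where "e > 0" "ball p e \<inter> S \<subseteq> U"
    using assms by (auto simp: openin_contains_ball)
  then show ?thesis by (intro that[of e]) (auto simp: dist_commute)
qed

locale chart =
  fixes D d :: nat and M U W :: "finseq set" and \<phi> \<psi> :: "finseq \<Rightarrow> finseq"
    and \<phi>' \<psi>' :: "finseq \<Rightarrow> finseq \<Rightarrow>\<^sub>L finseq" and p :: finseq
  assumes dD: "d \<le> D" and ME: "M \<subseteq> euclid D" and pM: "p \<in> M" and pU: "p \<in> U"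
    and openU: "openin (top_of_set (euclid D)) U" and openW: "openin (top_of_set (euclid D)) W"
    and hom: "homeomorphism U W \<phi> \<psi>"
    and der\<phi>: "\<And>x. x \<in> U \<Longrightarrow> (\<phi> has_derivative blinfun_apply (\<phi>' x)) (at x within euclid D)"
    and der\<psi>: "\<And>x. x \<in> W \<Longrightarrow> (\<psi> has_derivative blinfun_apply (\<psi>' x)) (at x within euclid D)"
    and cont\<phi>': "continuous_on U \<phi>'" and cont\<psi>': "continuous_on W \<psi>'"
    and img: "\<phi> ` (U \<inter> M) = W \<inter> euclid d"

lemma C1_submanifold_chart:
  assumes "C1_submanifold D d M" "p \<in> M"
  obtains U W \<phi> \<psi> \<phi>' \<psi>' where "chart D d M U W \<phi> \<psi> \<phi>' \<psi>' p"
proof -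
  have 1: "d \<le> D" "M \<subseteq> euclid D" using assms(1) by (auto simp: C1_submanifold_def)
  obtain U W \<phi> \<psi> where *: "p \<in> U" "openin (top_of_set (euclid D)) U" "openin (top_of_set (euclid D)) W"
    "homeomorphism U W \<phi> \<psi>" "C1_map_on D U \<phi>" "C1_map_on D W \<psi>" "\<phi> ` (U \<inter> M) = W \<inter> euclid d"
    using assms unfolding C1_submanifold_def by fast
  obtain \<phi>' where "\<forall>x\<in>U. (\<phi> has_derivative blinfun_apply (\<phi>' x)) (at x within euclid D)" "continuous_on U \<phi>'"
    using *(5) unfolding C1_map_on_def by fast
  moreover obtain \<psi>' where "\<forall>x\<in>W. (\<psi> has_derivative blinfun_apply (\<psi>' x)) (at x within euclid D)" "continuous_on W \<psi>'"
    using *(6) unfolding C1_map_on_def by fast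
  ultimately have "chart D d M U W \<phi> \<psi> \<phi>' \<psi>' p"
    using 1 * assms(2) by unfold_locales simp_all
  then show thesis by (rule that)
qed

context chart
begin

lemma \<phi>_W: "x \<in> U \<Longrightarrow> \<phi> x \<in> W" and \<psi>_U: "y \<in> W \<Longrightarrow> \<psi> y \<in> U"
  and \<psi>\<phi>: "x \<in> U \<Longrightarrow> \<psi> (\<phi> x) = x" and \<phi>\<psi>: "y \<in> W \<Longrightarrow> \<phi> (\<psi> y) = y"
  using hom unfolding homeomorphism_def by auto

lemma UE: "U \<subseteq> euclid D" and WE: "W \<subseteq> euclid D"
  using openU openW by (auto dest: openin_imp_subset)

lemma line_in_euclid:
  assumes "openin (top_of_set (euclid D)) V" "x \<in> V" "v \<in> euclid D"
  obtains e where "0 < e" "\<And>s. \<bar>s\<bar> < e \<Longrightarrow> x + s *\<^sub>R v \<in> V"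
proof -
  obtain r where r: "0 < r" "\<And>y. y \<in> euclid D \<Longrightarrow> dist y x < r \<Longrightarrow> y \<in> V"
    using small_ball_openin[OF assms(1,2)] by blast
  have xE: "x \<in> euclid D" using assms openin_imp_subset by blast
  show ?thesis
  proof (rule that)
    show "0 < r / (norm v + 1)" using r(1) by (simp add: add_nonneg_pos)
    fix s assume s: "\<bar>s\<bar> < r / (norm v + 1)"
    have "\<bar>s\<bar> * norm v \<le> \<bar>s\<bar> * (norm v + 1)" by (intro mult_left_mono) auto
    also have "\<dots> < r" using s by (simp add: pos_less_divide_eq add_nonneg_pos)
    finally have "dist (x + s *\<^sub>R v) x < r" by (simp add: dist_norm)
    then show "x + s *\<^sub>R v \<in> V"
      using r(2) xE assms(3) by (auto intro: subspace_add subspace_scale subspace_euclid)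
  qed
qed

lemma line_derivative: "((\<lambda>s. x + s *\<^sub>R v) has_vector_derivative v) (at (0::real))"
  by (auto intro!: derivative_eq_intros)

text \<open>A derivative within \<open>euclid D\<close> is determined only on vectors of
  \<open>euclid D\<close>. The inverse relation is obtained by differentiating along a segment and
  using uniqueness of the derivative of that curve.\<close>

lemma deriv_inverse1:
  assumes "x \<in> U" "v \<in> euclid D"
  shows "\<phi>' x v \<in> euclid D" "\<psi>' (\<phi> x) (\<phi>' x v) = v"
proof -
  obtain e where e: "0 < e" "\<And>s. \<bar>s\<bar> < e \<Longrightarrow> x + s *\<^sub>R v \<in> U"
    using line_in_euclid[OF openU assms] by blast
  have d1: "((\<lambda>s. \<phi> (x + s *\<^sub>R v)) has_vector_derivative \<phi>' x v) (at 0)"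
    using curve_chain[of \<phi> "\<phi>' x" "\<lambda>s. x + s *\<^sub>R v", OF _ line_derivative e(1)]
      der\<phi>[OF assms(1)] e(2) UE by auto
  have inW: "\<phi> (x + s *\<^sub>R v) \<in> W" if "\<bar>s\<bar> < e" for s using e(2)[OF that] \<phi>_W by auto
  show "\<phi>' x v \<in> euclid D"
    by (rule vector_derivative_in_subspace[OF d1 e(1) _ subspace_euclid closed_euclid])
      (use inW WE in auto)
  have d2: "((\<lambda>s. \<psi> (\<phi> (x + s *\<^sub>R v))) has_vector_derivative \<psi>' (\<phi> x) (\<phi>' x v)) (at 0)"
    using curve_chain[of \<psi> "\<psi>' (\<phi> x)" "\<lambda>s. \<phi> (x + s *\<^sub>R v)", OF _ d1 e(1)]
      der\<psi>[OF \<phi>_W[OF assms(1)]] inW WE by auto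
  have "((\<lambda>s. \<psi> (\<phi> (x + s *\<^sub>R v))) has_vector_derivative v) (at 0)"
  proof (rule has_vector_derivative_transform_within_open[OF line_derivative])
    show "open {-e<..<e}" by auto
  qed (use e \<psi>\<phi> in auto)
  then show "\<psi>' (\<phi> x) (\<phi>' x v) = v" using d2 vector_derivative_unique_at by blast
qed

text \<open>Read backwards, with all of \<open>euclid D\<close> as the manifold, a chart is again a
  chart; facts about \<open>\<phi>\<close> so transfer to \<open>\<psi>\<close>.\<close>

lemma chart_swap: "chart D D (euclid D) W U \<psi> \<phi> \<psi>' \<phi>' (\<phi> p)"
proof unfold_locales
  show "homeomorphism W U \<psi> \<phi>" using hom by (rule homeomorphism_symD)
  show "\<phi> p \<in> euclid D" using \<phi>_W[OF pU] WE by auto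
  show "\<psi> ` (W \<inter> euclid D) = U \<inter> euclid D"
    using hom WE UE unfolding homeomorphism_def by (simp add: Int_absorb2)
qed (use openU openW der\<phi> der\<psi> cont\<phi>' cont\<psi>' \<phi>_W[OF pU] in simp_all)

lemma deriv_inverse2:
  assumes "y \<in> W" "v \<in> euclid D"
  shows "\<psi>' y v \<in> euclid D" "\<phi>' (\<psi> y) (\<psi>' y v) = v"
  using chart.deriv_inverse1[OF chart_swap assms] by auto

lemma tangent_eq:
  assumes q: "q \<in> U" "q \<in> M" shows "tangent_space M q = \<psi>' (\<phi> q) ` euclid d"
proof (intro equalityI subsetI)
  fix v assume "v \<in> \<psi>' (\<phi> q) ` euclid d"
  then obtain c where c: "c \<in> euclid d" "v = \<psi>' (\<phi> q) c" by auto
  have cD: "c \<in> euclid D" using c euclid_mono[OF dD] by auto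
  obtain e where e: "0 < e" "\<And>s. \<bar>s\<bar> < e \<Longrightarrow> \<phi> q + s *\<^sub>R c \<in> W"
    using line_in_euclid[OF openW \<phi>_W[OF q(1)] cD] by blast
  have "\<phi> q \<in> euclid d" using img q by blast
  then have "\<phi> q + s *\<^sub>R c \<in> euclid d" for s
    using c by (auto intro: subspace_add subspace_scale subspace_euclid)
  then have "\<phi> q + s *\<^sub>R c \<in> \<phi> ` (U \<inter> M)" if "\<bar>s\<bar> < e" for s
    unfolding img using e(2)[OF that] by simp
  then have inM: "\<psi> (\<phi> q + s *\<^sub>R c) \<in> M" if "\<bar>s\<bar> < e" for s
    using that \<psi>\<phi> by fastforce
  have "((\<lambda>s. \<psi> (\<phi> q + s *\<^sub>R c)) has_vector_derivative \<psi>' (\<phi> q) c) (at 0)"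
    using curve_chain[of \<psi> "\<psi>' (\<phi> q)" "\<lambda>s. \<phi> q + s *\<^sub>R c", OF _ line_derivative e(1)]
      der\<psi>[OF \<phi>_W[OF q(1)]] e(2) WE by auto
  then show "v \<in> tangent_space M q"
    unfolding tangent_space_def using e(1) inM c(2) \<psi>\<phi>[OF q(1)]
    by (intro CollectI exI[of _ "\<lambda>s. \<psi> (\<phi> q + s *\<^sub>R c)"]) auto
next
  fix v assume "v \<in> tangent_space M q"
  then obtain \<gamma> e where \<gamma>: "\<gamma> 0 = q" "e > 0" "\<And>s. \<bar>s\<bar> < e \<Longrightarrow> \<gamma> s \<in> M"
    "(\<gamma> has_vector_derivative v) (at 0)" unfolding tangent_space_def by blast
  obtain r where r: "0 < r" "\<And>x. x \<in> euclid D \<Longrightarrow> dist x q < r \<Longrightarrow> x \<in> U"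
    using small_ball_openin[OF openU q(1)] by blast
  have "isCont \<gamma> 0" using \<gamma>(4) by (rule has_vector_derivative_continuous)
  then obtain e1 where e1: "0 < e1" "\<And>s. dist s 0 < e1 \<Longrightarrow> dist (\<gamma> s) (\<gamma> 0) < r"
    using r(1) unfolding continuous_at_eps_delta by blast
  define e2 where "e2 = min e e1"
  have e2: "0 < e2" "\<And>s. \<bar>s\<bar> < e2 \<Longrightarrow> \<gamma> s \<in> U \<inter> M"
    using e1 \<gamma>(1-3) r(2) ME by (auto simp: e2_def dist_real_def subset_iff)
  have v: "v \<in> euclid D"
    by (rule vector_derivative_in_subspace[OF \<gamma>(4) e2(1) _ subspace_euclid closed_euclid])
      (use e2 ME in auto)
  have d1: "((\<lambda>s. \<phi> (\<gamma> s)) has_vector_derivative \<phi>' q v) (at 0)"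
    using curve_chain[of \<phi> "\<phi>' q" \<gamma>, OF _ \<gamma>(4) e2(1)] der\<phi>[OF q(1)] e2(2) UE \<gamma>(1) by auto
  have "\<phi>' q v \<in> euclid d"
    by (rule vector_derivative_in_subspace[OF d1 e2(1) _ subspace_euclid closed_euclid])
      (use e2 img in auto)
  then show "v \<in> \<psi>' (\<phi> q) ` euclid d"
    using deriv_inverse1(2)[OF q(1) v] by (metis imageI)
qed

lemma dsub_tangent: "dsub d (tangent_space M p)"
proof -
  have "dsub d (blinfun_apply (\<psi>' (\<phi> p)) ` euclid d)"
  proof (rule dsub_linear_image[OF dsub_euclid])
    show "linear (blinfun_apply (\<psi>' (\<phi> p)))" by (rule bounded_linear.linear[OF blinfun.bounded_linear_right])
    fix u assume "u \<in> euclid d" "\<psi>' (\<phi> p) u = 0"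
    then show "u = 0" using deriv_inverse2(2)[OF \<phi>_W[OF pU], of u] euclid_mono[OF dD]
      by (auto simp: blinfun.zero_right)
  qed
  then show ?thesis by (simp add: tangent_eq[OF pU pM])
qed

lemma tangent_euclid: "tangent_space M p \<subseteq> euclid D"
  unfolding tangent_eq[OF pU pM] using deriv_inverse2(1)[OF \<phi>_W[OF pU]] euclid_mono[OF dD] by auto

text \<open>Tangent vectors are defined by curves, but the feet in \<open>normal_ineq\<close> form
  only a sequence. Straightened secants lie in the closed space \<open>euclid d\<close>, hence so
  does their limit.\<close>

lemma secant_limit_tangent:
  assumes x: "\<And>n::nat. x n \<in> M" "\<And>n. 0 < s n" "s \<longlonglongrightarrow> 0" "(\<lambda>n. (x n - p) /\<^sub>R s n) \<longlonglongrightarrow> \<xi>"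
  shows "\<xi> \<in> tangent_space M p"
proof -
  have "(\<lambda>n. s n *\<^sub>R ((x n - p) /\<^sub>R s n)) \<longlonglongrightarrow> 0 *\<^sub>R \<xi>"
    by (intro tendsto_intros x)
  moreover have "s n *\<^sub>R ((x n - p) /\<^sub>R s n) = x n - p" for n using x(2)[of n] by simp
  ultimately have xp: "x \<longlonglongrightarrow> p" by (simp add: LIM_zero_iff)
  have xE: "x n \<in> euclid D" "p \<in> euclid D" for n using x(1) ME pM by auto
  have "(x n - p) /\<^sub>R s n \<in> euclid D" for n
    using xE by (intro subspace_scale subspace_diff subspace_euclid)
  then have \<xi>: "\<xi> \<in> euclid D" using closed_sequentially[OF closed_euclid _ x(4)] by blast
  let ?A = "blinfun_apply (\<phi>' p)"
  let ?q = "\<lambda>n. (\<phi> (x n) - \<phi> p) /\<^sub>R s n"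
  have lim: "?q \<longlonglongrightarrow> ?A \<xi>"
  proof -
    have "(\<lambda>n. ?A ((x n - p) /\<^sub>R s n)) \<longlonglongrightarrow> ?A \<xi>"
      by (intro tendsto_intros x)
    moreover have "(\<lambda>n. ?q n - ?A ((x n - p) /\<^sub>R s n)) \<longlonglongrightarrow> 0"
    proof (rule LIMSEQ_I)
      fix r :: real assume r: "0 < r"
      \<comment> \<open>The difference quotients are eventually bounded by
        \<open>norm \<xi> + 1\<close>, so this slope leaves an error of
        \<open>r / 2\<close>.\<close>
      define c where "c = r / (2 * (norm \<xi> + 1))"
      have c: "0 < c" using r by (simp add: c_def add_nonneg_pos)
      obtain \<delta> where \<delta>: "0 < \<delta>" "\<And>y. y \<in> euclid D \<Longrightarrow> norm (y - p) < \<delta> \<Longrightarrow>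
          norm (\<phi> y - \<phi> p - ?A (y - p)) \<le> c * norm (y - p)"
        using der\<phi>[OF pU] c unfolding has_derivative_within_alt by blast
      obtain N1 where N1: "\<And>n. n \<ge> N1 \<Longrightarrow> norm (x n - p) < \<delta>"
        using LIMSEQ_D[OF xp \<delta>(1)] by blast
      obtain N2 where N2: "\<And>n. n \<ge> N2 \<Longrightarrow> norm ((x n - p) /\<^sub>R s n - \<xi>) < 1"
        using LIMSEQ_D[OF x(4), of 1] by auto
      show "\<exists>no. \<forall>n\<ge>no. norm (?q n - ?A ((x n - p) /\<^sub>R s n) - 0) < r"
      proof (intro exI allI impI)
        fix n assume n: "max N1 N2 \<le> n"
        have "?q n - ?A ((x n - p) /\<^sub>R s n) = (\<phi> (x n) - \<phi> p - ?A (x n - p)) /\<^sub>R s n"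
          by (subst blinfun.scaleR_right) (simp add: scaleR_diff_right)
        then have "norm (?q n - ?A ((x n - p) /\<^sub>R s n)) = norm (\<phi> (x n) - \<phi> p - ?A (x n - p)) / s n"
          using x(2)[of n] by (simp add: divide_inverse mult.commute)
        also have "\<dots> \<le> (c * norm (x n - p)) / s n"
          using \<delta>(2)[OF xE(1) N1] n x(2)[of n] by (intro divide_right_mono) auto
        also have "\<dots> = c * norm ((x n - p) /\<^sub>R s n)"
          using x(2)[of n] by (simp add: divide_inverse mult.commute)
        also have "\<dots> \<le> c * (norm \<xi> + 1)"
        proof (rule mult_left_mono)
          show "norm ((x n - p) /\<^sub>R s n) \<le> norm \<xi> + 1"
            using N2[of n] n norm_triangle_ineq2[of "(x n - p) /\<^sub>R s n" \<xi>] by simp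
        qed (use c in simp)
        also have "\<dots> = r / 2" by (simp add: c_def field_simps add_nonneg_eq_0_iff)
        also have "\<dots> < r" using r by simp
        finally show "norm (?q n - ?A ((x n - p) /\<^sub>R s n) - 0) < r" by simp
      qed
    qed
    ultimately have "(\<lambda>n. (?q n - ?A ((x n - p) /\<^sub>R s n)) + ?A ((x n - p) /\<^sub>R s n)) \<longlonglongrightarrow> 0 + ?A \<xi>"
      by (intro tendsto_add)
    then show ?thesis by simp
  qed
  obtain r where r: "0 < r" "\<And>x. x \<in> euclid D \<Longrightarrow> dist x p < r \<Longrightarrow> x \<in> U"
    using small_ball_openin[OF openU pU] by blast
  obtain N where N: "\<And>n. n \<ge> N \<Longrightarrow> dist (x n) p < r"
    using xp r(1) unfolding lim_sequentially by blast
  have "?q (n + N) \<in> euclid d" for n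
  proof -
    have "x (n + N) \<in> U \<inter> M" using N r(2) xE x(1) by simp
    then have "\<phi> (x (n + N)) \<in> euclid d" "\<phi> p \<in> euclid d" using img pU pM by blast+
    then show ?thesis by (intro subspace_scale subspace_diff subspace_euclid)
  qed
  moreover have "(\<lambda>n. ?q (n + N)) \<longlonglongrightarrow> ?A \<xi>" using lim by (rule LIMSEQ_ignore_initial_segment)
  ultimately have "?A \<xi> \<in> euclid d" using closed_sequentially[OF closed_euclid, of "\<lambda>n. ?q (n + N)"] by blast
  then have "\<psi>' (\<phi> p) (?A \<xi>) \<in> \<psi>' (\<phi> p) ` euclid d" by (rule imageI)
  then show ?thesis
    using deriv_inverse1(2)[OF pU \<xi>] by (simp add: tangent_eq[OF pU pM])
qed

text \<open>Qualitative, with a radius that depends on the chart. It starts a bootstrap: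
  surjectivity of the tangential projection, then angle bounds, then surjectivity again at a radius
  proportional to \<open>\<rho>\<close>.\<close>

lemma tangent_nearby:
  obtains R where "0 < R"
    "\<And>q w. q \<in> M \<Longrightarrow> dist q p < R \<Longrightarrow> w \<in> tangent_space M p \<Longrightarrow> (\<forall>u\<in>tangent_space M q. w \<bullet> u = 0) \<Longrightarrow> w = 0"
proof -
  obtain r where r: "0 < r" "\<And>x. x \<in> euclid D \<Longrightarrow> dist x p < r \<Longrightarrow> x \<in> U"
    using small_ball_openin[OF openU pU] by blast
  define K where "K = norm (\<phi>' p) + 1"
  have K: "0 < K" by (simp add: K_def add_nonneg_pos)
  have "continuous_on U (\<lambda>x. \<psi>' (\<phi> x))"
    using hom by (intro continuous_on_compose2[OF cont\<psi>']) (auto simp: homeomorphism_def)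
  then obtain r1 where r1: "0 < r1" "\<And>q. q \<in> U \<Longrightarrow> dist q p < r1 \<Longrightarrow> dist (\<psi>' (\<phi> q)) (\<psi>' (\<phi> p)) < 1 / K"
    using pU K unfolding continuous_on_iff by (metis zero_less_divide_1_iff)
  show ?thesis
  proof (rule that)
    show "0 < min r r1" using r r1 by simp
    fix q w assume q: "q \<in> M" "dist q p < min r r1" and w: "w \<in> tangent_space M p"
      "\<forall>u\<in>tangent_space M q. w \<bullet> u = 0"
    have qU: "q \<in> U" using q r ME by auto
    obtain c where c: "c \<in> euclid d" "w = \<psi>' (\<phi> p) c" using w(1) tangent_eq[OF pU pM] by auto
    have cD: "c \<in> euclid D" using c euclid_mono[OF dD] by auto
    have cw: "c = \<phi>' p w" using deriv_inverse2(2)[OF \<phi>_W[OF pU] cD] c(2) \<psi>\<phi>[OF pU] by simp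
    have nc: "norm c \<le> norm (\<phi>' p) * norm w" unfolding cw by (rule norm_blinfun)
    have "\<psi>' (\<phi> q) c \<in> tangent_space M q" using tangent_eq[OF qU q(1)] c(1) by auto
    then have "w \<bullet> \<psi>' (\<phi> q) c = 0" using w(2) by blast
    then have "w \<bullet> w = w \<bullet> ((\<psi>' (\<phi> p) - \<psi>' (\<phi> q)) c)"
      using c(2) by (simp add: blinfun.diff_left inner_diff_right)
    also have "\<dots> \<le> norm w * norm ((\<psi>' (\<phi> p) - \<psi>' (\<phi> q)) c)" by (rule norm_cauchy_schwarz)
    also have "\<dots> \<le> norm w * (norm (\<psi>' (\<phi> p) - \<psi>' (\<phi> q)) * norm c)"
      by (intro mult_left_mono norm_blinfun) auto
    also have "\<dots> \<le> norm w * (1 / K * (norm (\<phi>' p) * norm w))"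
      using r1(2)[OF qU] q(2) nc K
      by (intro mult_left_mono mult_mono) (auto simp: dist_norm norm_minus_commute)
    finally have *: "norm w * norm w \<le> norm (\<phi>' p) / K * (norm w * norm w)"
      by (simp add: dot_square_norm power2_eq_square algebra_simps)
    show "w = 0"
    proof (rule ccontr)
      assume "w \<noteq> 0"
      then have "1 * (norm w * norm w) \<le> norm (\<phi>' p) / K * (norm w * norm w)" "0 < norm w * norm w"
        using * by simp_all
      then have "1 \<le> norm (\<phi>' p) / K" using mult_right_le_imp_le by blast
      then show False using K by (simp add: K_def pos_le_divide_eq add_nonneg_pos)
    qed
  qed
qed

end

lemma dsub_tangent_space: "C1_submanifold D d M \<Longrightarrow> p \<in> M \<Longrightarrow> dsub d (tangent_space M p)"
  by (meson C1_submanifold_chart chart.dsub_tangent)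

lemma tangent_space_euclid: "C1_submanifold D d M \<Longrightarrow> p \<in> M \<Longrightarrow> tangent_space M p \<subseteq> euclid D"
  by (meson C1_submanifold_chart chart.tangent_euclid)

section \<open>Submanifolds of positive reach\<close>

text \<open>The first-order condition at a local minimiser on \<open>M\<close>. It serves for feet,
  with \<open>L\<close> the identity, and for lifting tangent vectors to \<open>M\<close>, with
  \<open>L\<close> a projection.\<close>

lemma curve_critical:
  assumes "bounded_linear L" "u \<in> tangent_space M a" "0 < r"
    and min: "\<And>q. q \<in> M \<Longrightarrow> dist q a < r \<Longrightarrow> norm (L a - c) \<le> norm (L q - (c :: finseq))"
  shows "(L a - c) \<bullet> L u = 0"
proof -
  obtain \<gamma> e where \<gamma>: "\<gamma> 0 = a" "e > 0" "\<And>s. \<bar>s\<bar> < e \<Longrightarrow> \<gamma> s \<in> M"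
    "(\<gamma> has_vector_derivative u) (at 0)"
    using assms(2) unfolding tangent_space_def by blast
  have "isCont \<gamma> 0" using \<gamma>(4) by (rule has_vector_derivative_continuous)
  then obtain e1 where e1: "0 < e1" "\<And>s. dist s 0 < e1 \<Longrightarrow> dist (\<gamma> s) (\<gamma> 0) < r"
    using assms(3) unfolding continuous_at_eps_delta by blast
  let ?f = "\<lambda>s. (L (\<gamma> s) - c) \<bullet> (L (\<gamma> s) - c)"
  have "((\<lambda>s. L (\<gamma> s)) has_vector_derivative L u) (at 0)"
    by (rule bounded_linear.has_vector_derivative[OF assms(1) \<gamma>(4)])
  then have d: "((\<lambda>s. L (\<gamma> s) - c) has_derivative (\<lambda>s. s *\<^sub>R L u)) (at 0)"
    unfolding has_vector_derivative_def by (auto intro!: derivative_eq_intros)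
  have "(?f has_derivative (\<lambda>s. (L (\<gamma> 0) - c) \<bullet> (s *\<^sub>R L u) + (s *\<^sub>R L u) \<bullet> (L (\<gamma> 0) - c))) (at 0)"
    by (rule has_derivative_inner[OF d d])
  moreover have "(\<lambda>s. (L (\<gamma> 0) - c) \<bullet> (s *\<^sub>R L u) + (s *\<^sub>R L u) \<bullet> (L (\<gamma> 0) - c)) = (*) (2 * ((L a - c) \<bullet> L u))"
    by (rule ext) (simp add: \<gamma>(1) inner_commute)
  ultimately have "DERIV ?f 0 :> 2 * ((L a - c) \<bullet> L u)"
    by (simp add: has_field_derivative_def)
  moreover have "\<forall>y. \<bar>0 - y\<bar> < min e e1 \<longrightarrow> ?f 0 \<le> ?f y"
  proof (intro allI impI)
    fix y :: real assume y: "\<bar>0 - y\<bar> < min e e1"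
    have "norm (L a - c) \<le> norm (L (\<gamma> y) - c)"
      using y \<gamma>(1) e1(2)[of y] by (intro min \<gamma>(3)) (auto simp: dist_real_def)
    then show "?f 0 \<le> ?f y" by (simp add: \<gamma>(1) norm_le)
  qed
  ultimately have "2 * ((L a - c) \<bullet> L u) = 0"
    using \<gamma>(2) e1(1) by (intro DERIV_local_min[of ?f _ 0 "min e e1"]) auto
  then show ?thesis by simp
qed

definition foot :: "finseq set \<Rightarrow> finseq \<Rightarrow> finseq \<Rightarrow> bool"
  where "foot M x a \<longleftrightarrow> a \<in> M \<and> dist x a = infdist x M"

lemma foot_ex: "compact M \<Longrightarrow> M \<noteq> {} \<Longrightarrow> \<exists>a. foot M x a"
proof -
  assume M: "compact M" "M \<noteq> {}"
  obtain a where a: "a \<in> M" "\<And>y. y \<in> M \<Longrightarrow> dist x a \<le> dist x y"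
    using continuous_attains_inf[OF M continuous_on_dist[OF continuous_on_const continuous_on_id, of M x]] by auto
  have "infdist x M = dist x a"
    by (rule antisym[OF infdist_le[OF a(1)]])
      (use M(2) a(2) in \<open>auto simp: infdist_notempty intro: cINF_greatest\<close>)
  then show ?thesis using a(1) by (auto simp: foot_def)
qed

lemma foot_le: "foot M x a \<Longrightarrow> y \<in> M \<Longrightarrow> dist x a \<le> dist x y"
  unfolding foot_def using infdist_le by metis

lemma foot_normal:
  assumes "foot M x a" "u \<in> tangent_space M a" shows "(x - a) \<bullet> u = 0"
proof -
  have "(a - x) \<bullet> u = 0"
    using curve_critical[OF bounded_linear_ident assms(2), of 1 x] foot_le[OF assms(1)]
    by (simp add: dist_norm norm_minus_commute)
  then show ?thesis by (simp add: inner_diff_left)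
qed

text \<open>The converse half of Federer's description of the reach. Two feet \<open>a\<close>,
  \<open>b\<close> of \<open>z\<close> satisfy 2 (z - a) . (b - a) = |b - a|^2; since z - a is
  normal, \<open>ineq\<close> bounds the left side by |z - a| |b - a|^2 / \<rho>.\<close>

lemma reach_ge:
  assumes d: "\<And>x. x \<in> M \<Longrightarrow> dsub d (tangent_space M x)" and "0 < \<rho>"
    and ineq: "\<And>x y. x \<in> M \<Longrightarrow> y \<in> M \<Longrightarrow>
      norm (y - x - proj (tangent_space M x) (y - x)) \<le> (norm (y - x))\<^sup>2 / (2 * \<rho>)"
  shows "ennreal \<rho> \<le> reach D M"
  unfolding reach_def
proof (intro INF_greatest ennreal_leI)
  fix p z assume p: "p \<in> M" and "z \<in> medial_axis D M"
  then obtain a b where ab: "foot M z a" "foot M z b" "a \<noteq> b"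
    unfolding medial_axis_def foot_def by auto
  then have M: "a \<in> M" "b \<in> M" by (auto simp: foot_def)
  let ?T = "tangent_space M a" and ?w = "b - a"
  have "norm (z - b) = norm (z - a)" using ab by (simp add: foot_def dist_norm)
  then have "(z - b) \<bullet> (z - b) = (z - a) \<bullet> (z - a)" by (simp add: norm_eq)
  then have 1: "2 * ((z - a) \<bullet> ?w) = (norm ?w)\<^sup>2"
    by (simp add: power2_norm_eq_inner inner_diff_left inner_diff_right inner_commute)
  have "(z - a) \<bullet> ?w = (z - a) \<bullet> (?w - proj ?T ?w)"
    using foot_normal[OF ab(1) proj_in[OF d[OF M(1)]], of ?w] by (simp add: inner_diff_right)
  also have "\<dots> \<le> norm (z - a) * norm (?w - proj ?T ?w)" by (rule norm_cauchy_schwarz)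
  also have "\<dots> \<le> norm (z - a) * ((norm ?w)\<^sup>2 / (2 * \<rho>))"
    by (intro mult_left_mono ineq M) auto
  finally have "(norm ?w)\<^sup>2 / 2 \<le> norm (z - a) * ((norm ?w)\<^sup>2 / (2 * \<rho>))" using 1 by linarith
  then have "1 * ((norm ?w)\<^sup>2 / 2) \<le> norm (z - a) / \<rho> * ((norm ?w)\<^sup>2 / 2)" by simp
  moreover have "0 < (norm ?w)\<^sup>2 / 2" using ab(3) by simp
  ultimately have "1 \<le> norm (z - a) / \<rho>" using mult_right_le_imp_le by blast
  then have "\<rho> \<le> norm (z - a)" using assms(2) by (simp add: pos_le_divide_eq)
  also have "\<dots> \<le> dist p z" using foot_le[OF ab(1) p] by (simp add: dist_norm norm_minus_commute)
  finally show "\<rho> \<le> dist p z" .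
qed

locale reach_manifold =
  fixes D d :: nat and M :: "finseq set" and \<rho> :: real
  assumes mc: "M \<in> manifold_class D d \<rho>" and \<rho>: "0 < \<rho>"
begin

abbreviation Tan :: "finseq \<Rightarrow> finseq set" where "Tan \<equiv> tangent_space M"

lemma M_ne: "M \<noteq> {}" and M_compact: "compact M" and M_sub: "C1_submanifold D d M"
  and M_reach: "ennreal \<rho> \<le> reach D M" and ME: "M \<subseteq> euclid D"
  using mc by (auto simp: manifold_class_def C1_submanifold_def)

lemma dsub_Tan: "a \<in> M \<Longrightarrow> dsub d (Tan a)" by (rule dsub_tangent_space[OF M_sub])

lemma Tan_euclid: "a \<in> M \<Longrightarrow> Tan a \<subseteq> euclid D" by (rule tangent_space_euclid[OF M_sub])

lemma foot_exists: "\<exists>a. foot M x a" by (rule foot_ex[OF M_compact M_ne])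

lemma foot_unique:
  assumes "x \<in> euclid D" "infdist x M < \<rho>" "foot M x a" "foot M x b" shows "a = b"
proof (rule ccontr)
  assume "a \<noteq> b"
  then have "x \<in> medial_axis D M" using assms unfolding medial_axis_def foot_def by auto
  then have "reach D M \<le> ennreal (dist a x)"
    using assms(3) unfolding reach_def foot_def by (auto intro!: INF_lower2)
  then have "ennreal \<rho> \<le> ennreal (dist a x)" using M_reach by (rule order_trans[rotated])
  then have "\<rho> \<le> dist a x" by (simp add: ennreal_le_iff)
  then show False using assms(2,3) by (simp add: foot_def dist_commute)
qed

text \<open>By compactness, the part of \<open>M\<close> away from the unique foot stays at a
  strictly larger distance.\<close>

lemma foot_continuous:
  assumes x: "x \<in> euclid D" "infdist x M < \<rho>" "foot M x a" and "0 < \<epsilon>"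
  obtains \<eta> where "0 < \<eta>" "\<And>y b. dist y x < \<eta> \<Longrightarrow> foot M y b \<Longrightarrow> dist b a < \<epsilon>"
proof (cases "M - ball a \<epsilon> = {}")
  case True
  then show ?thesis by (intro that[of 1]) (auto simp: foot_def dist_commute)
next
  case False
  have "compact (M - ball a \<epsilon>)" by (intro compact_diff M_compact open_ball)
  then obtain m where m: "m \<in> M - ball a \<epsilon>" "\<And>y. y \<in> M - ball a \<epsilon> \<Longrightarrow> dist x m \<le> dist x y"
    using continuous_attains_inf[OF _ False continuous_on_dist[OF continuous_on_const continuous_on_id, of _ x]]
    by blast
  have lt: "dist x a < dist x m"
  proof (rule ccontr)
    assume "\<not> ?thesis"
    then have "foot M x m" using m(1) foot_le[OF x(3), of m] x(3) by (simp add: foot_def)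
    then have "m = a" using foot_unique[OF x(1,2) _ x(3)] by blast
    then show False using m(1) \<open>0 < \<epsilon>\<close> by simp
  qed
  show ?thesis
  proof (rule that)
    \<comment> \<open>Half the gap, because moving from \<open>x\<close> to \<open>y\<close> is paid
      for twice, at \<open>a\<close> and at \<open>b\<close>.\<close>
    show "0 < (dist x m - dist x a) / 2" using lt by simp
    fix y b assume y: "dist y x < (dist x m - dist x a) / 2" and b: "foot M y b"
    show "dist b a < \<epsilon>"
    proof (rule ccontr)
      assume "\<not> ?thesis"
      then have "dist x m \<le> dist x b" using b by (intro m(2)) (auto simp: foot_def dist_commute)
      moreover have "dist x b \<le> dist y x + dist y b" by (metis dist_triangle dist_commute)
      moreover have "dist y b \<le> dist y a" using foot_le[OF b] x(3) by (simp add: foot_def)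
      moreover have "dist y a \<le> dist y x + dist x a" by (rule dist_triangle)
      ultimately show False using y by argo
    qed
  qed
qed

text \<open>The new foot is so close to \<open>a\<close> that \<open>w\<close> still points away
  from it. Hence even the distance to the new foot, which at \<open>x\<close> already bounds the
  distance to \<open>M\<close>, grows.\<close>

lemma infdist_increases:
  assumes x: "x \<in> euclid D" "infdist x M < \<rho>" "foot M x a" and w: "w \<in> euclid D" "0 < w \<bullet> (x - a)"
  obtains \<eta> where "0 < \<eta>" "\<And>s. 0 < s \<Longrightarrow> s < \<eta> \<Longrightarrow> infdist x M < infdist (x + s *\<^sub>R w) M"
proof -
  define \<epsilon> where "\<epsilon> = w \<bullet> (x - a) / (norm w + 1)"
  have pos: "0 < norm w + 1" by (simp add: add_nonneg_pos)
  have \<epsilon>: "0 < \<epsilon>" using w pos by (simp add: \<epsilon>_def)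
  obtain \<eta> where \<eta>: "0 < \<eta>" "\<And>y b. dist y x < \<eta> \<Longrightarrow> foot M y b \<Longrightarrow> dist b a < \<epsilon>"
    using foot_continuous[OF x \<epsilon>] by blast
  show ?thesis
  proof (rule that)
    show "0 < \<eta> / (norm w + 1)" using \<eta> pos by simp
    fix s :: real assume s: "0 < s" "s < \<eta> / (norm w + 1)"
    obtain b where b: "foot M (x + s *\<^sub>R w) b" using foot_exists by blast
    have "s * norm w \<le> s * (norm w + 1)" using s by simp
    also have "\<dots> < \<eta>" using s pos by (simp add: pos_less_divide_eq)
    finally have "dist (x + s *\<^sub>R w) x < \<eta>" using s by (simp add: dist_norm)
    then have ba: "norm (b - a) < \<epsilon>" using \<eta>(2)[OF _ b] by (simp add: dist_norm)
    have "w \<bullet> (b - a) \<le> norm w * norm (b - a)" by (rule norm_cauchy_schwarz)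
    also have "\<dots> \<le> norm w * \<epsilon>" using ba by (intro mult_left_mono) auto
    also have "\<dots> < (norm w + 1) * \<epsilon>" using \<epsilon> by (simp add: algebra_simps)
    also have "\<dots> = w \<bullet> (x - a)" using pos by (simp add: \<epsilon>_def)
    finally have "0 < w \<bullet> (x - b)" by (simp add: inner_diff_right)
    then have "0 < 2 * s * (w \<bullet> (x - b)) + s\<^sup>2 * (norm w)\<^sup>2" using s by (intro add_pos_nonneg) auto
    moreover have "(norm (x + s *\<^sub>R w - b))\<^sup>2 = (norm (x - b))\<^sup>2 + 2 * s * (w \<bullet> (x - b)) + s\<^sup>2 * (norm w)\<^sup>2"
      unfolding power2_norm_eq_inner
      by (simp add: algebra_simps inner_add_left inner_add_right inner_diff_left inner_diff_right
          inner_commute power2_eq_square)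
    ultimately have "(norm (x - b))\<^sup>2 < (norm (x + s *\<^sub>R w - b))\<^sup>2"
      by linarith
    then have "norm (x - b) < norm (x + s *\<^sub>R w - b)" by (rule power2_less_imp_less) simp
    moreover have "infdist x M \<le> norm (x - b)" using b by (metis foot_def infdist_le dist_norm)
    ultimately show "infdist x M < infdist (x + s *\<^sub>R w) M" using b by (simp add: foot_def dist_norm)
  qed
qed

text \<open>
  A point of \<open>cball z0 L\<close> at maximal distance from \<open>M\<close> lies on the sphere, in the direction of its
  own normal, because moving it along that normal would increase the distance.
\<close>

lemma normal_ray_step:
  assumes a: "a \<in> M" and v: "v \<in> euclid D" "norm v = 1" and t: "0 < t" "infdist (a + t *\<^sub>R v) M = t"
    and L: "0 < L" "L \<le> t" "t + L < \<rho>"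
  shows "infdist (a + (t + L) *\<^sub>R v) M = t + L"
proof -
  define z0 where "z0 = a + t *\<^sub>R v"
  have z0E: "z0 \<in> euclid D" using a ME v by (auto simp: z0_def intro: subspace_add subspace_scale subspace_euclid)
  let ?K = "euclid D \<inter> cball z0 L"
  have "compact ?K" by (rule compact_euclid_cball)
  moreover have "z0 \<in> ?K" using z0E L by simp
  then have "?K \<noteq> {}" by blast
  ultimately obtain z where z: "z \<in> ?K" "\<And>y. y \<in> ?K \<Longrightarrow> infdist y M \<le> infdist z M"
    using continuous_attains_sup[OF _ _ continuous_on_infdist[OF continuous_on_id], of ?K M] by blast
  define \<delta> where "\<delta> = infdist z M"
  have zE: "z \<in> euclid D" and zL: "norm (z - z0) \<le> L" using z(1) by (auto simp: dist_norm norm_minus_commute)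
  have \<delta>t: "t \<le> \<delta>" using z(2)[OF \<open>z0 \<in> ?K\<close>] t(2) by (simp add: \<delta>_def z0_def)
  have "\<delta> \<le> infdist z0 M + dist z z0" unfolding \<delta>_def by (rule infdist_triangle)
  then have \<delta>L: "\<delta> \<le> t + L" using zL t(2) by (simp add: z0_def dist_norm)
  then have \<delta>\<rho>: "infdist z M < \<rho>" using L by (simp add: \<delta>_def)
  obtain b where b: "foot M z b" using foot_exists by blast
  have zb: "norm (z - b) = \<delta>" using b by (simp add: foot_def \<delta>_def dist_norm)
  have bE: "b \<in> euclid D" using b ME by (auto simp: foot_def)
  have \<delta>0: "0 < \<delta>" using \<delta>t t by simp
  have contra: False if w: "w \<in> euclid D" "0 < w \<bullet> (z - b)" and e: "0 < e"
    and in_K: "\<And>s. 0 < s \<Longrightarrow> s < e \<Longrightarrow> norm (z + s *\<^sub>R w - z0) \<le> L" for w e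
  proof -
    obtain \<eta> where \<eta>: "0 < \<eta>" "\<And>s. 0 < s \<Longrightarrow> s < \<eta> \<Longrightarrow> infdist z M < infdist (z + s *\<^sub>R w) M"
      using infdist_increases[OF zE \<delta>\<rho> b w] by blast
    define s where "s = min e \<eta> / 2"
    have s: "0 < s" "s < e" "s < \<eta>" using e \<eta>(1) by (auto simp: s_def min_def)
    have "z + s *\<^sub>R w \<in> ?K"
      using in_K[OF s(1,2)] zE w(1)
      by (auto simp: dist_norm norm_minus_commute intro: subspace_add subspace_scale subspace_euclid)
    then show False using z(2) \<eta>(2)[OF s(1,3)] by fastforce
  qed
  have zbE: "z - b \<in> euclid D" using zE bE by (rule subspace_diff[OF subspace_euclid])
  have zz0: "norm (z - z0) = L"
  proof (rule ccontr)
    assume "norm (z - z0) \<noteq> L"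
    then have lt: "norm (z - z0) < L" using zL by simp
    show False
    proof (rule contra[OF zbE])
      have "z - b \<noteq> 0" using zb \<delta>0 by auto
      then show "0 < (z - b) \<bullet> (z - b)" by simp
      show "0 < (L - norm (z - z0)) / \<delta>" using lt \<delta>0 by simp
      fix s :: real assume s: "0 < s" "s < (L - norm (z - z0)) / \<delta>"
      have "norm (z + s *\<^sub>R (z - b) - z0) \<le> norm (z - z0) + norm (s *\<^sub>R (z - b))"
        using norm_triangle_ineq[of "z - z0" "s *\<^sub>R (z - b)"] by (simp add: algebra_simps)
      also have "norm (s *\<^sub>R (z - b)) = s * \<delta>" using s zb by simp
      also have "s * \<delta> \<le> L - norm (z - z0)" using s \<delta>0 by (simp add: pos_less_divide_eq)
      finally show "norm (z + s *\<^sub>R (z - b) - z0) \<le> L" by simp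
    qed
  qed
  define n where "n = (1 / \<delta>) *\<^sub>R (z - b)"
  define u where "u = (1 / L) *\<^sub>R (z - z0)"
  have n1: "norm n = 1" using zb \<delta>0 by (simp add: n_def)
  have u1: "norm u = 1" using zz0 L by (simp add: u_def)
  have nE: "n \<in> euclid D" using zbE by (simp add: n_def subspace_scale[OF subspace_euclid])
  have uE: "u \<in> euclid D" using zE z0E by (simp add: u_def subspace_scale[OF subspace_euclid] subspace_diff[OF subspace_euclid])
  have zn: "z - b = \<delta> *\<^sub>R n" using \<delta>0 by (simp add: n_def)
  have zu: "z - z0 = L *\<^sub>R u" using L by (simp add: u_def)
  \<comment> \<open>At a maximiser on the sphere the normal direction must be radial: otherwise
    \<open>n - u\<close> leads into the ball and still has a positive product with the
    normal.\<close>
  have "n = u"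
  proof (rule ccontr)
    assume ne: "n \<noteq> u"
    let ?w = "n - u"
    have nn: "n \<bullet> n = 1" "u \<bullet> u = 1" using n1 u1 by (auto simp: norm_eq_1)
    have w2: "(norm ?w)\<^sup>2 = 2 - 2 * (n \<bullet> u)"
      using nn by (simp add: power2_norm_eq_inner inner_diff_left inner_diff_right inner_commute)
    have "0 < (norm ?w)\<^sup>2" using ne by simp
    then have wn: "0 < 1 - n \<bullet> u" using w2 by simp
    show False
    proof (rule contra)
      show "?w \<in> euclid D" using nE uE by (rule subspace_diff[OF subspace_euclid])
      have "?w \<bullet> (z - b) = \<delta> * (1 - n \<bullet> u)"
        using nn by (simp add: zn inner_diff_left inner_diff_right inner_commute)
      then show "0 < ?w \<bullet> (z - b)" using wn \<delta>0 by simp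
      show "0 < L" by (rule L)
      fix s assume s: "0 < s" "s < L"
      have "z + s *\<^sub>R ?w - z0 = L *\<^sub>R u + s *\<^sub>R ?w" using zu by (simp add: algebra_simps)
      then have "(norm (z + s *\<^sub>R ?w - z0))\<^sup>2 = L\<^sup>2 + 2 * L * s * (n \<bullet> u - 1) + s\<^sup>2 * (norm ?w)\<^sup>2"
        unfolding power2_norm_eq_inner
        using nn by (simp add: inner_add_left inner_add_right inner_diff_left inner_diff_right
            inner_commute power2_eq_square algebra_simps)
      also have "\<dots> = L\<^sup>2 - 2 * s * (L - s) * (1 - n \<bullet> u)"
        unfolding w2 by (simp add: power2_eq_square algebra_simps)
      also have "\<dots> \<le> L\<^sup>2" using s wn by simp
      finally show "norm (z + s *\<^sub>R ?w - z0) \<le> L" by (rule power2_le_imp_le) (use L in simp)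
    qed
  qed
  \<comment> \<open>Going back from \<open>z\<close> by \<open>L\<close> along its normal returns to
    the centre \<open>z0\<close>, whose distance \<open>t\<close> to \<open>M\<close> then forces
    the largest possible gain, \<open>\<delta> = t + L\<close>.\<close>
  then have z0b: "z0 - b = (\<delta> - L) *\<^sub>R n" using zn zu by (simp add: algebra_simps)
  have "t \<le> norm (z0 - b)"
    using t(2) infdist_le[of b M z0] b by (simp add: z0_def foot_def dist_norm)
  also have "\<dots> = \<delta> - L" using z0b n1 \<delta>t L by simp
  finally have "\<delta> = t + L" using \<delta>L by simp
  then have "dist z0 b = t" using z0b n1 t by (simp add: dist_norm)
  then have "foot M z0 b" using b t(2) by (simp add: foot_def z0_def)
  moreover have "foot M z0 a" using a v t by (simp add: foot_def z0_def dist_norm)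
  ultimately have "a = b" using foot_unique[OF z0E, of a b] t L by (simp add: z0_def)
  then have "t *\<^sub>R v = t *\<^sub>R n" using z0b \<open>\<delta> = t + L\<close> by (simp add: z0_def)
  then have "v = n" using t by simp
  then have "z = a + (t + L) *\<^sub>R v" using zn \<open>a = b\<close> \<open>\<delta> = t + L\<close> by (simp add: algebra_simps)
  then show ?thesis using \<open>\<delta> = t + L\<close> by (simp add: \<delta>_def)
qed

text \<open>A step may be as long as the distance already reached, so finitely many doublings attain
  any \<open>t'\<close> below \<open>\<rho>\<close>.\<close>

lemma normal_ray:
  assumes a: "a \<in> M" and v: "v \<in> euclid D" "norm v = 1" and t: "0 < t" "infdist (a + t *\<^sub>R v) M = t"
    and t': "t \<le> t'" "t' < \<rho>"
  shows "infdist (a + t' *\<^sub>R v) M = t'"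
proof -
  have "t' \<le> 2 ^ k * t \<Longrightarrow> t \<le> t' \<Longrightarrow> 0 < t \<Longrightarrow> infdist (a + t *\<^sub>R v) M = t \<Longrightarrow> ?thesis" for k t
  proof (induction k arbitrary: t)
    case (Suc k)
    show ?case
    proof (cases "t' \<le> 2 * t")
      case True
      show ?thesis
      proof (cases "t' = t")
        case False
        then show ?thesis
          using normal_ray_step[OF a v Suc.prems(3,4), of "t' - t"] True Suc.prems t' by simp
      qed (use Suc.prems in simp)
    next
      case False
      then have "infdist (a + (2 * t) *\<^sub>R v) M = 2 * t"
        using normal_ray_step[OF a v Suc.prems(3,4), of t] Suc.prems t' by simp
      then show ?thesis using Suc.IH[of "2 * t"] Suc.prems False by simp
    qed
  qed simp
  moreover obtain k :: nat where "t' / t \<le> 2 ^ k"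
    using real_arch_pow[of 2 "t' / t"] by (auto intro: less_imp_le)
  then have "t' \<le> 2 ^ k * t" using t by (simp add: pos_divide_le_eq)
  ultimately show ?thesis using t t' by blast
qed

text \<open>Along the normal ray, the balls of every radius below \<open>\<rho>\<close> touching
  \<open>M\<close> at \<open>a\<close> have no point of \<open>M\<close> inside. Expanding the
  square and letting the radius tend to \<open>\<rho>\<close> gives the inequality.\<close>

lemma foot_ineq:
  assumes x: "x \<in> euclid D" "infdist x M < \<rho>" "foot M x a" and y: "y \<in> M"
  shows "(x - a) \<bullet> (y - a) \<le> norm (x - a) * ((norm (y - a))\<^sup>2 / (2 * \<rho>))"
proof (cases "x = a")
  case False
  define t where "t = norm (x - a)"
  define v where "v = (1 / t) *\<^sub>R (x - a)"
  have t: "0 < t" using False by (simp add: t_def)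
  have aM: "a \<in> M" using x by (simp add: foot_def)
  have xv: "x - a = t *\<^sub>R v" using t by (simp add: v_def)
  have v: "v \<in> euclid D" "norm v = 1"
    using x(1) aM ME t by (auto simp: v_def t_def intro!: subspace_scale[OF subspace_euclid] subspace_diff[OF subspace_euclid])
  have "infdist x M = t" using x(3) by (simp add: foot_def t_def dist_norm)
  moreover have "x = a + t *\<^sub>R v" using xv by (simp add: algebra_simps)
  ultimately have inf: "infdist (a + t *\<^sub>R v) M = t" by simp
  have t\<rho>: "t < \<rho>" using x(2) \<open>infdist x M = t\<close> by simp
  have main: "2 * r * (v \<bullet> (y - a)) \<le> (norm (y - a))\<^sup>2" if "t \<le> r" "r < \<rho>" for r
  proof -
    have "r \<le> norm (a + r *\<^sub>R v - y)"
      using normal_ray[OF aM v t inf that] infdist_le[OF y, of "a + r *\<^sub>R v"] by (simp add: dist_norm)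
    then have "r\<^sup>2 \<le> (norm (a + r *\<^sub>R v - y))\<^sup>2" using that t by (intro power_mono) auto
    moreover have "v \<bullet> v = 1" using v by (simp add: norm_eq_1)
    then have "(norm (a + r *\<^sub>R v - y))\<^sup>2 = r\<^sup>2 - 2 * r * (v \<bullet> (y - a)) + (norm (y - a))\<^sup>2"
      unfolding power2_norm_eq_inner
      by (simp add: inner_add_left inner_add_right inner_diff_left inner_diff_right inner_commute
          power2_eq_square algebra_simps)
    ultimately show ?thesis by simp
  qed
  have "2 * \<rho> * (v \<bullet> (y - a)) \<le> (norm (y - a))\<^sup>2"
  proof (rule tendsto_upperbound)
    show "((\<lambda>r. 2 * r * (v \<bullet> (y - a))) \<longlongrightarrow> 2 * \<rho> * (v \<bullet> (y - a))) (at_left \<rho>)"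
      by (intro tendsto_intros)
    show "\<forall>\<^sub>F r in at_left \<rho>. 2 * r * (v \<bullet> (y - a)) \<le> (norm (y - a))\<^sup>2"
      using eventually_at_left_real[OF t\<rho>] by eventually_elim (use main in auto)
  qed simp
  then have "v \<bullet> (y - a) \<le> (norm (y - a))\<^sup>2 / (2 * \<rho>)" using \<rho> by (simp add: pos_le_divide_eq mult_ac)
  then have "t * (v \<bullet> (y - a)) \<le> t * ((norm (y - a))\<^sup>2 / (2 * \<rho>))" using t by (intro mult_left_mono) auto
  then show ?thesis using t v(2) unfolding xv by simp
qed simp

text \<open>It is not known beforehand that \<open>a\<close> is the foot of points along an
  arbitrary normal \<open>v\<close>. The feet \<open>b n\<close> of the points
  \<open>a + s n v\<close> give directions \<open>e n\<close> that obey \<open>foot_ineq\<close> and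
  subconverge to some \<open>l\<close>. Then \<open>v - l\<close> is a limit of secants, hence
  tangent, while \<open>l\<close> obeys the inequality at \<open>a\<close> and is therefore normal;
  so \<open>v - l\<close> is orthogonal to itself.\<close>

lemma normal_ineq:
  assumes a: "a \<in> M" and v: "v \<in> euclid D" "\<And>u. u \<in> Tan a \<Longrightarrow> v \<bullet> u = 0" and y: "y \<in> M"
  shows "v \<bullet> (y - a) \<le> norm v * ((norm (y - a))\<^sup>2 / (2 * \<rho>))"
proof -
  have unit: "v \<bullet> (y - a) \<le> (norm (y - a))\<^sup>2 / (2 * \<rho>)"
    if v: "v \<in> euclid D" "\<And>u. u \<in> Tan a \<Longrightarrow> v \<bullet> u = 0" "norm v = 1" for v
  proof -
    obtain U W \<phi> \<psi> \<phi>' \<psi>' where ch: "chart D d M U W \<phi> \<psi> \<phi>' \<psi>' a"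
      using C1_submanifold_chart[OF M_sub a] by blast
    define s where "s n = \<rho> / 2 * inverse (real (Suc n))" for n
    have s0: "0 < s n" and s\<rho>: "s n < \<rho>" for n
    proof -
      show "0 < s n" using \<rho> by (simp add: s_def)
      have "inverse (real (Suc n)) \<le> 1" by (simp add: inverse_le_1_iff)
      then have "s n \<le> \<rho> / 2 * 1" unfolding s_def using \<rho> by (intro mult_left_mono) auto
      then show "s n < \<rho>" using \<rho> by linarith
    qed
    have "s \<longlonglongrightarrow> \<rho> / 2 * 0" unfolding s_def by (intro tendsto_intros LIMSEQ_inverse_real_of_nat)
    then have slim: "s \<longlonglongrightarrow> 0" by simp
    define z where "z n = a + s n *\<^sub>R v" for n
    have zE: "z n \<in> euclid D" for n
      using a ME v by (auto simp: z_def intro: subspace_add subspace_scale subspace_euclid)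
    define b where "b n = (SOME b. foot M (z n) b)" for n
    have b: "foot M (z n) (b n)" for n unfolding b_def by (rule someI_ex[OF foot_exists])
    have bM: "b n \<in> M" for n using b by (simp add: foot_def)
    define e where "e n = (z n - b n) /\<^sub>R s n" for n
    have zb: "norm (z n - b n) \<le> s n" for n
      using foot_le[OF b a, of n] s0[of n] v(3) by (simp add: dist_norm z_def)
    have e1: "norm (e n) \<le> 1" for n
      using zb[of n] s0[of n] by (simp add: e_def divide_inverse[symmetric] mult.commute[of "inverse _"])
    have "e n \<in> euclid D" for n
      unfolding e_def using zE bM ME by (intro subspace_scale[OF subspace_euclid] subspace_diff[OF subspace_euclid]) auto
    then have "\<forall>n. e n \<in> euclid D \<inter> cball 0 1" using e1 by simp
    then obtain l r where l: "l \<in> euclid D \<inter> cball 0 1" "strict_mono r" "(e \<circ> r) \<longlonglongrightarrow> l"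
      using compact_euclid_cball0[of D 1] unfolding compact_def by (metis (no_types, lifting))
    have ze: "z n - b n = s n *\<^sub>R e n" for n using s0[of n] by (simp add: e_def)
    have ineq: "e n \<bullet> (q - b n) \<le> (norm (q - b n))\<^sup>2 / (2 * \<rho>)" if q: "q \<in> M" for q n
    proof -
      have "infdist (z n) M < \<rho>" using b[of n] zb[of n] s\<rho>[of n] by (simp add: foot_def dist_norm)
      then have "(z n - b n) \<bullet> (q - b n) \<le> norm (z n - b n) * ((norm (q - b n))\<^sup>2 / (2 * \<rho>))"
        by (rule foot_ineq[OF zE _ b q])
      also have "\<dots> \<le> s n * ((norm (q - b n))\<^sup>2 / (2 * \<rho>))"
        using zb[of n] \<rho> by (intro mult_right_mono) auto
      finally have "s n * (e n \<bullet> (q - b n)) \<le> s n * ((norm (q - b n))\<^sup>2 / (2 * \<rho>))" by (simp add: ze)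
      then show ?thesis using s0[of n] mult_left_le_imp_le by blast
    qed
    have ba: "b n - a = s n *\<^sub>R (v - e n)" for n
      using ze[of n] by (simp add: z_def algebra_simps)
    have slr: "(\<lambda>n. s (r n)) \<longlonglongrightarrow> 0" using LIMSEQ_subseq_LIMSEQ[OF slim l(2)] by (simp add: o_def)
    have elr: "(\<lambda>n. e (r n)) \<longlonglongrightarrow> l" using l(3) by (simp add: o_def)
    have "(\<lambda>n. (b (r n) - a) /\<^sub>R s (r n)) = (\<lambda>n. v - e (r n))"
      using s0 by (simp add: ba less_imp_neq[symmetric])
    moreover have "(\<lambda>n. v - e (r n)) \<longlonglongrightarrow> v - l" by (intro tendsto_intros elr)
    ultimately have tan: "v - l \<in> Tan a"
      using chart.secant_limit_tangent[OF ch, of "\<lambda>n. b (r n)" "\<lambda>n. s (r n)"] bM s0 slr by simp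
    have "(\<lambda>n. a + s (r n) *\<^sub>R (v - e (r n))) \<longlonglongrightarrow> a + 0 *\<^sub>R (v - l)" by (intro tendsto_intros slr elr)
    moreover have "a + s (r n) *\<^sub>R (v - e (r n)) = b (r n)" for n using ba[of "r n"] by (simp add: algebra_simps)
    ultimately have blim: "(\<lambda>n. b (r n)) \<longlonglongrightarrow> a" by simp
    have lineq: "l \<bullet> (q - a) \<le> (norm (q - a))\<^sup>2 / (2 * \<rho>)" if q: "q \<in> M" for q
    proof (rule LIMSEQ_le)
      show "(\<lambda>n. e (r n) \<bullet> (q - b (r n))) \<longlonglongrightarrow> l \<bullet> (q - a)" by (intro tendsto_intros elr blim)
      show "(\<lambda>n. (norm (q - b (r n)))\<^sup>2 / (2 * \<rho>)) \<longlonglongrightarrow> (norm (q - a))\<^sup>2 / (2 * \<rho>)"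
        using \<rho> by (intro tendsto_intros blim) auto
    qed (use ineq q in auto)
    have lnormal: "l \<bullet> u = 0" if u: "u \<in> Tan a" for u
    proof -
      \<comment> \<open>The inequality for \<open>l\<close> says that \<open>a\<close> is a nearest
        point of \<open>M\<close> to \<open>a + \<rho> l\<close>, so the first-order condition
        applies.\<close>
      have "(a - (a + \<rho> *\<^sub>R l)) \<bullet> u = 0"
      proof (rule curve_critical[OF bounded_linear_ident u, of 1])
        fix q assume "q \<in> M"
        have "(norm (q - a - \<rho> *\<^sub>R l))\<^sup>2 = (norm (q - a))\<^sup>2 - 2 * \<rho> * (l \<bullet> (q - a)) + (norm (\<rho> *\<^sub>R l))\<^sup>2"
          unfolding power2_norm_eq_inner
          by (simp add: inner_diff_left inner_diff_right inner_commute power2_eq_square algebra_simps)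
        moreover have "2 * \<rho> * (l \<bullet> (q - a)) \<le> (norm (q - a))\<^sup>2"
          using lineq[OF \<open>q \<in> M\<close>] \<rho> by (simp add: pos_le_divide_eq mult_ac)
        ultimately have "(norm (\<rho> *\<^sub>R l))\<^sup>2 \<le> (norm (q - a - \<rho> *\<^sub>R l))\<^sup>2" by simp
        then have "norm (\<rho> *\<^sub>R l) \<le> norm (q - a - \<rho> *\<^sub>R l)" by (rule power2_le_imp_le) simp
        then show "norm (a - (a + \<rho> *\<^sub>R l)) \<le> norm (q - (a + \<rho> *\<^sub>R l))" by (simp add: algebra_simps)
      qed simp
      then show ?thesis using \<rho> by simp
    qed
    have "(v - l) \<bullet> (v - l) = 0" using v(2)[OF tan] lnormal[OF tan] by (simp add: inner_diff_left)
    then have "v = l" by simp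
    then show ?thesis using lineq[OF y] by simp
  qed
  show ?thesis
  proof (cases "v = 0")
    case False
    have "((1 / norm v) *\<^sub>R v) \<bullet> (y - a) \<le> (norm (y - a))\<^sup>2 / (2 * \<rho>)"
      using v False by (intro unit) (auto intro: subspace_scale[OF subspace_euclid])
    then show ?thesis using False by (simp add: field_simps)
  qed simp
qed

lemma normal_part:
  assumes "x \<in> M" "y \<in> M"
  shows "norm (y - x - proj (Tan x) (y - x)) \<le> (norm (y - x))\<^sup>2 / (2 * \<rho>)"
proof (rule norm_compl_bound[OF dsub_Tan[OF assms(1)]])
  fix w assume "\<forall>u\<in>Tan x. w \<bullet> u = 0" "w \<in> euclid D"
  then show "w \<bullet> (y - x) \<le> (norm (y - x))\<^sup>2 / (2 * \<rho>) * norm w"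
    using normal_ineq[OF assms(1), of w y] assms(2) by (simp add: mult.commute)
qed (use assms ME Tan_euclid \<rho> in \<open>auto intro: subspace_diff[OF subspace_euclid]\<close>)

text \<open>The two foot inequalities are added. At distance at most \<open>\<rho> / 2\<close> each
  right side takes only a quarter of |b - a|^2, so half of it remains.\<close>

lemma foot_lipschitz:
  assumes x: "x \<in> euclid D" "infdist x M \<le> \<rho> / 2" "foot M x a"
    and y: "y \<in> euclid D" "infdist y M \<le> \<rho> / 2" "foot M y b"
  shows "norm (a - b) \<le> 2 * norm (x - y)"
proof -
  have M: "a \<in> M" "b \<in> M" using x y by (auto simp: foot_def)
  have half: "norm (x - a) * ((norm (b - a))\<^sup>2 / (2 * \<rho>)) \<le> (norm (b - a))\<^sup>2 / 4"
    "norm (y - b) * ((norm (b - a))\<^sup>2 / (2 * \<rho>)) \<le> (norm (b - a))\<^sup>2 / 4"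
  proof -
    have "norm (x - a) \<le> \<rho> / 2" "norm (y - b) \<le> \<rho> / 2"
      using x y by (auto simp: foot_def dist_norm)
    then have "norm (x - a) * ((norm (b - a))\<^sup>2 / (2 * \<rho>)) \<le> \<rho> / 2 * ((norm (b - a))\<^sup>2 / (2 * \<rho>))"
      "norm (y - b) * ((norm (b - a))\<^sup>2 / (2 * \<rho>)) \<le> \<rho> / 2 * ((norm (b - a))\<^sup>2 / (2 * \<rho>))"
      using \<rho> by (intro mult_right_mono; simp)+
    moreover have "\<rho> / 2 * ((norm (b - a))\<^sup>2 / (2 * \<rho>)) = (norm (b - a))\<^sup>2 / 4" using \<rho> by simp
    ultimately show "norm (x - a) * ((norm (b - a))\<^sup>2 / (2 * \<rho>)) \<le> (norm (b - a))\<^sup>2 / 4"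
      "norm (y - b) * ((norm (b - a))\<^sup>2 / (2 * \<rho>)) \<le> (norm (b - a))\<^sup>2 / 4" by linarith+
  qed
  have "(x - a) \<bullet> (b - a) \<le> (norm (b - a))\<^sup>2 / 4"
  proof -
    have "infdist x M < \<rho>" using x(2) \<rho> by simp
    from foot_ineq[OF x(1) this x(3) M(2)] half(1) show ?thesis by linarith
  qed
  moreover have "(y - b) \<bullet> (a - b) \<le> (norm (b - a))\<^sup>2 / 4"
  proof -
    have "infdist y M < \<rho>" using y(2) \<rho> by simp
    from foot_ineq[OF y(1) this y(3) M(1)] half(2) show ?thesis by (simp add: norm_minus_commute)
  qed
  ultimately have "(norm (b - a))\<^sup>2 / 2 \<le> (y - x) \<bullet> (b - a)"
    by (simp add: power2_norm_eq_inner inner_diff_left inner_diff_right inner_commute)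
  also have "\<dots> \<le> norm (y - x) * norm (b - a)" by (rule norm_cauchy_schwarz)
  finally have "norm (b - a) * norm (b - a) \<le> (2 * norm (y - x)) * norm (b - a)"
    by (simp add: power2_eq_square)
  then have "norm (b - a) \<le> 2 * norm (y - x)"
    using mult_right_le_imp_le[of "norm (b - a)" "norm (b - a)" "2 * norm (y - x)"] by (cases "b = a") simp_all
  then show ?thesis by (simp add: norm_minus_commute)
qed

section \<open>Tangential projection and angles between nearby tangent spaces\<close>

lemma proj_lower:
  assumes "x \<in> M" "q \<in> M" "norm (q - x) \<le> \<rho>"
  shows "norm (q - x) \<le> 2 * norm (proj (Tan x) (q - x))"
proof -
  have "norm (q - x) \<le> norm (proj (Tan x) (q - x)) + norm (q - x - proj (Tan x) (q - x))"
    using norm_triangle_ineq[of "proj (Tan x) (q - x)" "q - x - proj (Tan x) (q - x)"] by simp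
  also have "norm (q - x - proj (Tan x) (q - x)) \<le> (norm (q - x))\<^sup>2 / (2 * \<rho>)"
    by (rule normal_part[OF assms(1,2)])
  also have "(norm (q - x))\<^sup>2 / (2 * \<rho>) \<le> norm (q - x) / 2"
    using assms(3) \<rho> mult_left_mono[OF assms(3), of "norm (q - x)"]
    by (simp add: power2_eq_square field_simps)
  finally show ?thesis by simp
qed

text \<open>The distance of the projection to \<open>u\<close> is minimised over a compact ball of
  \<open>M\<close>. The minimiser is interior, so the residual is tangent at \<open>x\<close> and
  normal at \<open>q\<close>, and \<open>nd\<close> makes it vanish. \<open>nd\<close> is a
  hypothesis so that the lemma can be used first with a chart-dependent radius and later with
  \<open>\<rho> / 28\<close>.\<close>

lemma proj_surj_aux:
  assumes x: "x \<in> M" and R: "0 < R" "R \<le> \<rho>"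
    and nd: "\<And>q w. q \<in> M \<Longrightarrow> dist q x < R \<Longrightarrow> w \<in> Tan x \<Longrightarrow> (\<forall>u\<in>Tan q. w \<bullet> u = 0) \<Longrightarrow> w = 0"
    and u: "u \<in> Tan x" "4 * norm u < R"
  obtains q where "q \<in> M" "proj (Tan x) (q - x) = u" "norm (q - x) \<le> 2 * norm u"
proof -
  let ?P = "proj (Tan x)"
  have T: "dsub d (Tan x)" by (rule dsub_Tan[OF x])
  \<comment> \<open>Above \<open>4 * norm u\<close>, to keep the minimiser off the boundary, and
    below \<open>R\<close>, to keep it where \<open>nd\<close> applies.\<close>
  define R' where "R' = (4 * norm u + R) / 2"
  have R': "4 * norm u < R'" "R' < R" using u R by (auto simp: R'_def)
  have "0 \<le> norm u" by simp
  then have "0 < R'" using R'(1) by linarith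
  let ?K = "M \<inter> cball x R'"
  have K: "compact ?K" "x \<in> ?K" using M_compact x \<open>0 < R'\<close> by auto
  have "continuous_on ?K (\<lambda>q. norm (?P q - (?P x + u)))"
    by (intro continuous_intros bounded_linear.continuous_on[OF bounded_linear_proj[OF T]])
  moreover have "?K \<noteq> {}" using K(2) by blast
  ultimately obtain q where q: "q \<in> ?K"
    "\<And>y. y \<in> ?K \<Longrightarrow> norm (?P q - (?P x + u)) \<le> norm (?P y - (?P x + u))"
    using continuous_attains_inf[OF K(1)] by blast
  have Pq: "?P (q - x) = ?P q - ?P x" by (rule linear_diff[OF linear_proj[OF T]])
  have "norm (?P (q - x) - u) \<le> norm u"
    using q(2)[OF K(2)] by (simp add: Pq algebra_simps)
  then have "norm (?P (q - x)) \<le> 2 * norm u" using norm_triangle_ineq2[of "?P (q - x)" u] by simp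
  moreover have "norm (q - x) \<le> 2 * norm (?P (q - x))"
    using q(1) R' R by (intro proj_lower x) (auto simp: dist_norm norm_minus_commute)
  ultimately have qx: "norm (q - x) < R'" using R' by simp
  have "?P (q - x) - u = 0"
  proof (rule nd[of q])
    show "q \<in> M" "dist q x < R" using q(1) qx R' by (auto simp: dist_norm)
    show wT: "?P (q - x) - u \<in> Tan x" by (intro subspace_diff dsub_subspace[OF T] proj_in[OF T] u)
    show "\<forall>u'\<in>Tan q. (?P (q - x) - u) \<bullet> u' = 0"
    proof
      fix u' assume u': "u' \<in> Tan q"
      have "(?P q - (?P x + u)) \<bullet> ?P u' = 0"
      proof (rule curve_critical[OF bounded_linear_proj[OF T] u', of "R' - norm (q - x)"])
        fix y assume "y \<in> M" "dist y q < R' - norm (q - x)"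
        moreover have "dist x y \<le> norm (q - x) + dist y q"
          using dist_triangle[of x y q] by (simp add: dist_norm norm_minus_commute)
        ultimately show "norm (?P q - (?P x + u)) \<le> norm (?P y - (?P x + u))" by (intro q(2)) auto
      qed (use qx in simp)
      then have "?P u' \<bullet> (?P (q - x) - u) = 0" by (simp add: Pq inner_commute algebra_simps)
      then show "(?P (q - x) - u) \<bullet> u' = 0" using proj_inner[OF T wT, of u'] by (simp add: inner_commute)
    qed
  qed
  then have "?P (q - x) = u" by simp
  moreover have "norm (q - x) \<le> 2 * norm (?P (q - x))"
    using q(1) R' R by (intro proj_lower x) (auto simp: dist_norm norm_minus_commute)
  ultimately show ?thesis using q(1) by (intro that[of q]) auto
qed

text \<open>A tangent vector at \<open>x\<close> of length \<open>s = norm (x - y)\<close> is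
  realised by a point \<open>q\<close> of \<open>M\<close> and tested against a normal at
  \<open>y\<close>. The three errors are (3 s)^2, s^2 and (2 s)^2 over 2 \<rho>, in total 7 s^2 /
  \<rho>; symmetrising doubles 7 to 14.\<close>

lemma dev_local:
  assumes x: "x \<in> M"
  obtains r where "0 < r" "\<And>y. y \<in> M \<Longrightarrow> dist y x < r \<Longrightarrow>
    dev (Tan x) (Tan y) (14 * norm (x - y) / \<rho>) \<and> dev (Tan y) (Tan x) (14 * norm (x - y) / \<rho>)"
proof -
  obtain U W \<phi> \<psi> \<phi>' \<psi>' where ch: "chart D d M U W \<phi> \<psi> \<phi>' \<psi>' x"
    using C1_submanifold_chart[OF M_sub x] by blast
  obtain R where R: "0 < R" "\<And>q w. q \<in> M \<Longrightarrow> dist q x < R \<Longrightarrow> w \<in> Tan x \<Longrightarrow>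
      (\<forall>u\<in>Tan q. w \<bullet> u = 0) \<Longrightarrow> w = 0" using chart.tangent_nearby[OF ch] by blast
  define R' where "R' = min R \<rho>"
  have R': "0 < R'" "R' \<le> \<rho>" "R' \<le> R" using R \<rho> by (auto simp: R'_def)
  show ?thesis
  proof (rule that)
    \<comment> \<open>Small enough for \<open>4 * s < R'\<close> and for the bound
      \<open>7 * s / \<rho> \<le> 1 / 2\<close> that \<open>dev_sym\<close> asks for.\<close>
    show "0 < R' / 14" using R' by simp
    fix y assume y: "y \<in> M" "dist y x < R' / 14"
    define s where "s = norm (x - y)"
    have s: "s < R' / 14" using y by (simp add: s_def dist_norm norm_minus_commute)
    have 7: "dev (Tan x) (Tan y) (7 * s / \<rho>)"
    proof (rule devI[OF dsub_Tan[OF y(1)] Tan_euclid[OF x] Tan_euclid[OF y(1)]])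
      show "0 \<le> 7 * s / \<rho>" using \<rho> by (simp add: s_def)
      fix u w assume u: "u \<in> Tan x" and w: "w \<in> euclid D" "\<forall>v\<in>Tan y. w \<bullet> v = 0"
      show "w \<bullet> u \<le> 7 * s / \<rho> * norm w * norm u"
      proof (cases "u = 0 \<or> s = 0")
        case True
        then show ?thesis using w u by (auto simp: s_def)
      next
        case False
        then have s0: "0 < s" and u0: "0 < norm u" by (auto simp: s_def)
        define u1 where "u1 = (s / norm u) *\<^sub>R u"
        have nu1: "norm u1 = s" using s0 u0 by (simp add: u1_def)
        have u1T: "u1 \<in> Tan x" unfolding u1_def by (intro subspace_scale dsub_subspace[OF dsub_Tan[OF x]] u)
        have 4: "4 * norm u1 < R'" using s s0 by (simp add: nu1)
        obtain q where q: "q \<in> M" "proj (Tan x) (q - x) = u1" "norm (q - x) \<le> 2 * norm u1"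
          by (rule proj_surj_aux[OF x R'(1,2) _ u1T 4]) (use R(2) R'(3) in auto)
        have qx: "norm (q - x) \<le> 2 * s" using q nu1 by simp
        have qy: "norm (q - y) \<le> 3 * s"
          using norm_triangle_ineq[of "q - x" "x - y"] qx by (simp add: s_def)
        have "w \<bullet> (q - y) \<le> norm w * ((norm (q - y))\<^sup>2 / (2 * \<rho>))"
          using normal_ineq[OF y(1) w(1) _ q(1)] w(2) by blast
        also have "\<dots> \<le> norm w * ((3 * s)\<^sup>2 / (2 * \<rho>))"
          using qy \<rho> by (intro mult_left_mono divide_right_mono power_mono) auto
        finally have 1: "w \<bullet> (q - y) \<le> norm w * ((3 * s)\<^sup>2 / (2 * \<rho>))" .
        have "- w \<in> euclid D" using w(1) by (rule subspace_neg[OF subspace_euclid])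
        then have 2: "(- w) \<bullet> (x - y) \<le> norm w * (s\<^sup>2 / (2 * \<rho>))"
          using normal_ineq[OF y(1) _ _ x, of "- w"] w(2) by (simp add: s_def)
        have "norm (q - x - u1) \<le> (norm (q - x))\<^sup>2 / (2 * \<rho>)" using normal_part[OF x q(1)] q(2) by simp
        also have "\<dots> \<le> (2 * s)\<^sup>2 / (2 * \<rho>)" using qx \<rho> by (intro divide_right_mono power_mono) auto
        finally have "norm w * norm (q - x - u1) \<le> norm w * ((2 * s)\<^sup>2 / (2 * \<rho>))" by (rule mult_left_mono) simp
        moreover have "- (w \<bullet> (q - x - u1)) \<le> norm w * norm (q - x - u1)"
          using norm_cauchy_schwarz[of "- w" "q - x - u1"] by simp
        ultimately have 3: "- (w \<bullet> (q - x - u1)) \<le> norm w * ((2 * s)\<^sup>2 / (2 * \<rho>))" by linarith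
        have "w \<bullet> u1 = w \<bullet> (q - y) + (- w) \<bullet> (x - y) - w \<bullet> (q - x - u1)"
          by (simp add: inner_diff_right)
        also have "\<dots> \<le> norm w * ((3 * s)\<^sup>2 / (2 * \<rho>)) + norm w * (s\<^sup>2 / (2 * \<rho>)) + norm w * ((2 * s)\<^sup>2 / (2 * \<rho>))"
          using 1 2 3 by linarith
        also have "\<dots> = s * (7 * s / \<rho> * norm w)" using \<rho> by (simp add: power2_eq_square field_simps)
        finally have "s / norm u * (w \<bullet> u) \<le> s * (7 * s / \<rho> * norm w)" by (simp add: u1_def)
        then have "s * (w \<bullet> u) \<le> s * (7 * s / \<rho> * norm w * norm u)"
          using u0 by (simp add: field_simps)
        then show ?thesis using s0 mult_left_le_imp_le by blast
      qed
    qed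
    have "7 * s / \<rho> \<le> 1 / 2" using s R' \<rho> by (simp add: field_simps)
    moreover have "0 \<le> 7 * s / \<rho>" using \<rho> by (simp add: s_def)
    ultimately have "dev (Tan y) (Tan x) (2 * (7 * s / \<rho>))"
      by (intro dev_sym[OF dsub_Tan[OF x] dsub_Tan[OF y(1)] Tan_euclid[OF x] Tan_euclid[OF y(1)] 7])
    then show "dev (Tan x) (Tan y) (14 * norm (x - y) / \<rho>) \<and> dev (Tan y) (Tan x) (14 * norm (x - y) / \<rho>)"
      using dev_mono[OF 7, of "14 * s / \<rho>"] \<open>0 \<le> 7 * s / \<rho>\<close> by (simp add: s_def)
  qed
qed

text \<open>The radius in \<open>dev_local\<close> is not uniform, so the local bounds are chained
  along the feet of the segment from \<open>x\<close> to \<open>y\<close>. That segment stays within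
  \<open>\<rho> / 2\<close> of \<open>M\<close>, where feet are 2-Lipschitz, which turns 14 into 28.
  \<open>Bolzano\<close> supplies the compactness of the parameter interval.\<close>

lemma dev_Tan:
  assumes x: "x \<in> M" and y: "y \<in> M" and xy: "norm (x - y) \<le> \<rho>"
  shows "dev (Tan x) (Tan y) (28 * norm (x - y) / \<rho>)"
proof -
  define z where "z s = x + s *\<^sub>R (y - x)" for s
  define f where "f s = (SOME b. foot M (z s) b)" for s
  have f: "foot M (z s) (f s)" for s unfolding f_def by (rule someI_ex[OF foot_exists])
  have fM: "f s \<in> M" for s using f by (simp add: foot_def)
  have zE: "z s \<in> euclid D" for s
    using x y ME by (auto simp: z_def intro!: subspace_add subspace_diff subspace_scale subspace_euclid)
  have zd: "infdist (z s) M \<le> \<rho> / 2" if "0 \<le> s" "s \<le> 1" for s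
  proof (cases "s \<le> 1/2")
    case True
    have "infdist (z s) M \<le> dist (z s) x" by (rule infdist_le[OF x])
    also have "\<dots> = s * norm (x - y)" using that by (simp add: z_def dist_norm norm_minus_commute)
    also have "\<dots> \<le> 1/2 * \<rho>" using True that xy by (intro mult_mono) auto
    finally show ?thesis by simp
  next
    case False
    have "infdist (z s) M \<le> dist (z s) y" by (rule infdist_le[OF y])
    also have "z s - y = (1 - s) *\<^sub>R (x - y)" by (simp add: z_def algebra_simps)
    then have "dist (z s) y = (1 - s) * norm (x - y)" using that by (simp add: dist_norm)
    also have "\<dots> \<le> 1/2 * \<rho>" using False that xy by (intro mult_mono) auto
    finally show ?thesis by simp
  qed
  have lip: "norm (f s - f s') \<le> 2 * norm (x - y) * \<bar>s - s'\<bar>" if "0 \<le> s" "s \<le> 1" "0 \<le> s'" "s' \<le> 1" for s s'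
  proof -
    have "norm (f s - f s') \<le> 2 * norm (z s - z s')"
      using that by (intro foot_lipschitz zE zd f)
    also have "norm (z s - z s') = \<bar>s - s'\<bar> * norm (x - y)"
    proof -
      have "z s - z s' = (s - s') *\<^sub>R (y - x)" by (simp add: z_def algebra_simps)
      then show ?thesis by (simp add: norm_minus_commute)
    qed
    finally show ?thesis by (simp add: mult_ac)
  qed
  have f0: "f 0 = x" using foot_unique[OF zE[of 0] _ f, of x] zd[of 0] \<rho> x by (simp add: foot_def z_def)
  have f1: "f 1 = y" using foot_unique[OF zE[of 1] _ f, of y] zd[of 1] \<rho> y by (simp add: foot_def z_def)
  let ?C = "28 * norm (x - y) / \<rho>"
  define P where "P a b \<longleftrightarrow> (0 \<le> a \<longrightarrow> b \<le> 1 \<longrightarrow> dev (Tan (f a)) (Tan (f b)) (?C * (b - a)))" for a b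
  have "P 0 1"
  proof (rule Bolzano)
    fix a b c assume "P a b" "P b c" "a \<le> b" "b \<le> c"
    show "P a c" unfolding P_def
    proof (intro impI)
      assume "0 \<le> a" "c \<le> 1"
      then have 1: "dev (Tan (f a)) (Tan (f b)) (?C * (b - a))" "dev (Tan (f b)) (Tan (f c)) (?C * (c - b))"
        using \<open>P a b\<close> \<open>P b c\<close> \<open>a \<le> b\<close> \<open>b \<le> c\<close> by (auto simp: P_def)
      have "dev (Tan (f a)) (Tan (f c)) (?C * (b - a) + ?C * (c - b))"
        using \<open>b \<le> c\<close> \<rho> by (intro dev_trans[OF dsub_Tan[OF fM] dsub_Tan[OF fM] 1]) auto
      moreover have "?C * (b - a) + ?C * (c - b) = ?C * (c - a)" by (simp add: right_diff_distrib)
      ultimately show "dev (Tan (f a)) (Tan (f c)) (?C * (c - a))" by simp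
    qed
  next
    fix s :: real assume s: "0 \<le> s" "s \<le> 1"
    obtain r where r: "0 < r" "\<And>y. y \<in> M \<Longrightarrow> dist y (f s) < r \<Longrightarrow>
        dev (Tan (f s)) (Tan y) (14 * norm (f s - y) / \<rho>) \<and> dev (Tan y) (Tan (f s)) (14 * norm (f s - y) / \<rho>)"
      using dev_local[OF fM] by blast
    define e where "e = r / (2 * norm (x - y) + 1)"
    have pos: "0 < 2 * norm (x - y) + 1" by (simp add: add_nonneg_pos)
    have near: "dist (f s') (f s) < r" "14 * norm (f s - f s') / \<rho> \<le> ?C * \<bar>s - s'\<bar>"
      if "0 \<le> s'" "s' \<le> 1" "\<bar>s - s'\<bar> < e" for s'
    proof -
      have "norm (f s - f s') \<le> 2 * norm (x - y) * \<bar>s - s'\<bar>" using lip s that by blast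
      then have "14 * norm (f s - f s') \<le> 28 * norm (x - y) * \<bar>s - s'\<bar>" unfolding mult.assoc by linarith
      then show "14 * norm (f s - f s') / \<rho> \<le> ?C * \<bar>s - s'\<bar>"
        using \<rho> by (simp add: divide_right_mono)
      have "2 * norm (x - y) * \<bar>s - s'\<bar> \<le> (2 * norm (x - y) + 1) * \<bar>s - s'\<bar>" by (intro mult_right_mono) auto
      also have "\<dots> < r" using that(3) pos by (simp add: e_def pos_less_divide_eq mult.commute)
      finally show "dist (f s') (f s) < r"
        using \<open>norm (f s - f s') \<le> 2 * norm (x - y) * \<bar>s - s'\<bar>\<close>
        unfolding dist_norm norm_minus_commute[of "f s'"] by linarith
    qed
    show "\<exists>e>0. \<forall>a b. a \<le> s \<and> s \<le> b \<and> b - a < e \<longrightarrow> P a b"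
    proof (intro exI conjI allI impI)
      show "0 < e" using r pos by (simp add: e_def)
      fix a b assume ab: "a \<le> s \<and> s \<le> b \<and> b - a < e"
      show "P a b" unfolding P_def
      proof (intro impI)
        assume "0 \<le> a" "b \<le> 1"
        then have a: "0 \<le> a" "a \<le> 1" "\<bar>s - a\<bar> < e" and b: "0 \<le> b" "b \<le> 1" "\<bar>s - b\<bar> < e"
          using ab s by auto
        have "dev (Tan (f a)) (Tan (f s)) (?C * \<bar>s - a\<bar>)"
          using r(2)[OF fM near(1)[OF a]] near(2)[OF a] dev_mono by blast
        moreover have "dev (Tan (f s)) (Tan (f b)) (?C * \<bar>s - b\<bar>)"
          using r(2)[OF fM near(1)[OF b]] near(2)[OF b] dev_mono by blast
        ultimately have "dev (Tan (f a)) (Tan (f b)) (?C * \<bar>s - a\<bar> + ?C * \<bar>s - b\<bar>)"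
          using \<rho> by (intro dev_trans[OF dsub_Tan[OF fM] dsub_Tan[OF fM]]) auto
        moreover have "?C * \<bar>s - a\<bar> + ?C * \<bar>s - b\<bar> = ?C * (b - a)" using ab by (simp add: right_diff_distrib)
        ultimately show "dev (Tan (f a)) (Tan (f b)) (?C * (b - a))" by simp
      qed
    qed
  qed simp
  then show ?thesis by (simp add: P_def f0 f1)
qed

text \<open>By the uniform angle bound, \<open>nd\<close> holds up to distance
  \<open>\<rho> / 28\<close>, where the sine is still below 1. A quarter of this is
  \<open>\<rho> / 112\<close>, the locality constant of the later estimates.\<close>

lemma proj_surj:
  assumes x: "x \<in> M" and u: "u \<in> Tan x" "norm u < \<rho> / 112"
  obtains q where "q \<in> M" "proj (Tan x) (q - x) = u" "norm (q - x) \<le> 2 * norm u"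
proof -
  have nd: "w = 0" if q: "q \<in> M" "dist q x < \<rho> / 28" and w: "w \<in> Tan x" "\<forall>u\<in>Tan q. w \<bullet> u = 0" for q w
  proof (rule dev_injective[OF dev_Tan[OF x q(1)]])
    have n: "norm (x - q) < \<rho> / 28" using q by (simp add: dist_norm norm_minus_commute)
    then show "norm (x - q) \<le> \<rho>" using \<rho> by simp
    show "28 * norm (x - q) / \<rho> < 1" using n \<rho> by (simp add: field_simps)
    show "proj (Tan q) w = 0"
      using w(2) by (intro proj_unique subspace_0 dsub_subspace[OF dsub_Tan[OF q(1)]]) auto
  qed (rule w)
  show ?thesis
    by (rule proj_surj_aux[OF x _ _ nd u(1), of "\<rho> / 28"]) (use \<rho> u that in auto)
qed

end

section \<open>Coverings and Hausdorff measure\<close>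

lemma finite_key_representatives:
  assumes "finite K" "key ` A \<subseteq> K"
  obtains F where "F \<subseteq> A" "finite F" "card F \<le> card K" "\<And>x. x \<in> A \<Longrightarrow> \<exists>z\<in>F. key x = key z"
proof -
  let ?r = "\<lambda>k. SOME x. x \<in> A \<and> key x = k"
  have r: "?r (key x) \<in> A \<and> key (?r (key x)) = key x" if "x \<in> A" for x
    using that by (intro someI_ex[of "\<lambda>y. y \<in> A \<and> key y = key x"]) auto
  have fin: "finite (key ` A)" using assms finite_subset by blast
  have "card (?r ` key ` A) \<le> card (key ` A)" using fin by (rule card_image_le)
  also have "\<dots> \<le> card K" using assms by (intro card_mono) auto
  finally show ?thesis
    using r fin by (intro that[of "?r ` key ` A"]) auto
qed

lemma card_floor_interval:
  fixes x :: real assumes "0 \<le> x"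
  shows "real (card {\<lfloor>- x\<rfloor>..\<lfloor>x\<rfloor>}) \<le> 2 * x + 2"
proof -
  have "0 \<le> \<lfloor>x\<rfloor> - \<lfloor>- x\<rfloor> + 1" using assms by linarith
  then have "real (card {\<lfloor>- x\<rfloor>..\<lfloor>x\<rfloor>}) = real_of_int (\<lfloor>x\<rfloor> - \<lfloor>- x\<rfloor> + 1)" by simp
  also have "\<dots> \<le> 2 * x + 2" by linarith
  finally show ?thesis .
qed

lemma norm_frame_le:
  assumes "frame d E T" shows "norm (proj T x) \<le> (\<Sum>e\<in>E. \<bar>x \<bullet> e\<bar>)"
proof -
  have "norm (proj T x) \<le> (\<Sum>e\<in>E. norm ((x \<bullet> e) *\<^sub>R e))"
    unfolding proj_frame[OF assms] by (rule norm_sum)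
  also have "\<dots> = (\<Sum>e\<in>E. \<bar>x \<bullet> e\<bar>)" using assms by (intro sum.cong) (auto simp: frame_def)
  finally show ?thesis .
qed

text \<open>Coordinates are rounded to a grid and one point of \<open>A\<close> is kept per occupied
  cell, so the net lies in \<open>A\<close> itself.\<close>

lemma frame_cover:
  assumes E: "frame d E T" and d: "1 \<le> d" and r: "0 < s" "s \<le> r"
    and A: "\<And>x e. x \<in> A \<Longrightarrow> e \<in> E \<Longrightarrow> \<bar>(x - p) \<bullet> e\<bar> \<le> r"
  obtains F where "F \<subseteq> A" "finite F" "real (card F) \<le> ((2 * real d + 2) * (r / s)) ^ d"
    "\<And>x. x \<in> A \<Longrightarrow> \<exists>z\<in>F. norm (proj T (x - z)) \<le> s"
proof -
  \<comment> \<open>The error in norm is at most the sum of \<open>d\<close> coordinate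
    errors.\<close>
  define \<sigma> where "\<sigma> = s / real d"
  have \<sigma>: "0 < \<sigma>" using r d by (simp add: \<sigma>_def)
  have finE: "finite E" and cE: "card E = d" using E by (auto simp: frame_def)
  define key where "key x = (\<lambda>e\<in>E. \<lfloor>((x - p) \<bullet> e) / \<sigma>\<rfloor>)" for x
  let ?K = "PiE E (\<lambda>_. {\<lfloor>- (r / \<sigma>)\<rfloor>..\<lfloor>r / \<sigma>\<rfloor>})"
  have keyK: "key ` A \<subseteq> ?K"
  proof
    fix k assume "k \<in> key ` A"
    then obtain x where x: "x \<in> A" "k = key x" by auto
    have "- (r / \<sigma>) \<le> ((x - p) \<bullet> e) / \<sigma> \<and> ((x - p) \<bullet> e) / \<sigma> \<le> r / \<sigma>" if "e \<in> E" for e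
    proof -
      have "- r \<le> (x - p) \<bullet> e" "(x - p) \<bullet> e \<le> r" using A[OF x(1) that] by linarith+
      then have "- r / \<sigma> \<le> ((x - p) \<bullet> e) / \<sigma>" "((x - p) \<bullet> e) / \<sigma> \<le> r / \<sigma>"
        using \<sigma> by (intro divide_right_mono; simp)+
      then show ?thesis by simp
    qed
    then show "k \<in> ?K" unfolding x(2) key_def by (auto intro!: floor_mono)
  qed
  have "finite ?K" using finE by (intro finite_PiE) auto
  then obtain F where F: "F \<subseteq> A" "finite F" "card F \<le> card ?K" "\<And>x. x \<in> A \<Longrightarrow> \<exists>z\<in>F. key x = key z"
    using finite_key_representatives[OF _ keyK] by metis
  have rs: "1 \<le> r / s" using r by simp
  have "real (card ?K) = real (card {\<lfloor>- (r / \<sigma>)\<rfloor>..\<lfloor>r / \<sigma>\<rfloor>}) ^ d"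
    using finE cE by (simp add: card_PiE)
  also have "\<dots> \<le> (2 * (r / \<sigma>) + 2) ^ d"
    using card_floor_interval[of "r / \<sigma>"] \<sigma> r by (intro power_mono) auto
  also have "2 * (r / \<sigma>) + 2 = 2 * real d * (r / s) + 2 * 1" using r d by (simp add: \<sigma>_def field_simps)
  also have "(2 * real d * (r / s) + 2 * 1) ^ d \<le> (2 * real d * (r / s) + 2 * (r / s)) ^ d"
    using rs r by (intro power_mono add_left_mono mult_left_mono) auto
  also have "2 * real d * (r / s) + 2 * (r / s) = (2 * real d + 2) * (r / s)" by (simp only: distrib_right)
  finally have "real (card F) \<le> ((2 * real d + 2) * (r / s)) ^ d" using F(3) by linarith
  moreover have "\<exists>z\<in>F. norm (proj T (x - z)) \<le> s" if x: "x \<in> A" for x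
  proof -
    obtain z where z: "z \<in> F" "key x = key z" using F(4)[OF x] by blast
    have "\<bar>(x - z) \<bullet> e\<bar> \<le> \<sigma>" if "e \<in> E" for e
    proof -
      have "\<lfloor>((x - p) \<bullet> e) / \<sigma>\<rfloor> = \<lfloor>((z - p) \<bullet> e) / \<sigma>\<rfloor>"
        using z(2) that by (metis key_def restrict_apply')
      then have "\<bar>((x - p) \<bullet> e) / \<sigma> - ((z - p) \<bullet> e) / \<sigma>\<bar> \<le> 1" by linarith
      then have "\<bar>((x - z) \<bullet> e) / \<sigma>\<bar> \<le> 1" by (simp add: inner_diff_left diff_divide_distrib)
      then show ?thesis using \<sigma> by simp
    qed
    then have "(\<Sum>e\<in>E. \<bar>(x - z) \<bullet> e\<bar>) \<le> real (card E) * \<sigma>" by (intro sum_bounded_above) auto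
    also have "\<dots> = s" using d by (simp add: cE \<sigma>_def)
    finally show ?thesis using norm_frame_le[OF E, of "x - z"] z(1) by (intro bexI[of _ z]) auto
  qed
  ultimately show ?thesis using F by (intro that) auto
qed

lemma euclid_cover:
  assumes "1 \<le> D" "0 < s" "s \<le> r" "A \<subseteq> euclid D \<inter> cball p r" "p \<in> euclid D"
  obtains F where "F \<subseteq> A" "finite F" "real (card F) \<le> ((2 * real D + 2) * (r / s)) ^ D"
    "\<And>x. x \<in> A \<Longrightarrow> \<exists>z\<in>F. dist x z \<le> s"
proof -
  obtain E where E: "frame D E (euclid D)" using dsub_euclid[of D] by (auto simp: dsub_def)
  have "\<bar>(x - p) \<bullet> e\<bar> \<le> r" if "x \<in> A" "e \<in> E" for x e
  proof -
    have "\<bar>(x - p) \<bullet> e\<bar> \<le> norm (x - p) * norm e" by (rule Cauchy_Schwarz_ineq2)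
    also have "\<dots> = dist p x" using E that by (simp add: frame_def dist_norm norm_minus_commute)
    finally show ?thesis using that assms(4) by auto
  qed
  then obtain F where F: "F \<subseteq> A" "finite F" "real (card F) \<le> ((2 * real D + 2) * (r / s)) ^ D"
    "\<And>x. x \<in> A \<Longrightarrow> \<exists>z\<in>F. norm (proj (euclid D) (x - z)) \<le> s"
    by (rule frame_cover[OF E assms(1-3), of A p]) blast+
  have "\<exists>z\<in>F. dist x z \<le> s" if x: "x \<in> A" for x
  proof -
    obtain z where z: "z \<in> F" "norm (proj (euclid D) (x - z)) \<le> s" using F(4)[OF x] by blast
    have "x - z \<in> euclid D" using x z(1) F(1) assms(4) by (auto intro!: subspace_diff[OF subspace_euclid])
    then have "proj (euclid D) (x - z) = x - z" by (rule proj_id[OF dsub_euclid])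
    then show ?thesis using z by (auto simp: dist_norm)
  qed
  then show ?thesis using F by (intro that) auto
qed

section \<open>Covering numbers and Hausdorff measure of balls in the manifold\<close>

context reach_manifold
begin

text \<open>By the reach, the chord is within a quarter of its length of \<open>Tan x\<close>; and
  \<open>Tan x\<close> makes with \<open>Tan p\<close> an angle of sine at most 28 / 112 = 1/4. At
  least half of the chord thus survives the projection.\<close>

lemma proj_bilipschitz:
  assumes p: "p \<in> M" "r \<le> \<rho> / 112" and xy: "x \<in> M" "dist p x \<le> r" "y \<in> M" "dist p y \<le> r"
  shows "norm (y - x) \<le> 2 * norm (proj (Tan p) (y - x))"
proof -
  let ?w = "y - x"
  have r0: "0 \<le> r" using xy(2) order_trans[OF zero_le_dist] by blast
  have w: "norm ?w \<le> 2 * r" using norm_triangle_ineq[of "y - p" "p - x"] xy by (simp add: dist_norm norm_minus_commute)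
  have px: "norm (x - p) \<le> r" using xy by (simp add: dist_norm norm_minus_commute)
  let ?u = "proj (Tan x) ?w"
  have "norm (?w - ?u) \<le> (norm ?w)\<^sup>2 / (2 * \<rho>)" by (rule normal_part[OF xy(1,3)])
  also have "\<dots> = norm ?w * (norm ?w / (2 * \<rho>))" by (simp add: power2_eq_square)
  also have "\<dots> \<le> norm ?w * (1 / 4)"
    using w p(2) \<rho> by (intro mult_left_mono) (auto simp: pos_divide_le_eq)
  finally have 1: "norm (?w - ?u) \<le> norm ?w / 4" by simp
  have "dev (Tan x) (Tan p) (28 * norm (x - p) / \<rho>)" using px p(2) \<rho> by (intro dev_Tan xy p) auto
  then have "norm (?u - proj (Tan p) ?u) \<le> 28 * norm (x - p) / \<rho> * norm ?u"
    by (rule devD[OF _ proj_in[OF dsub_Tan[OF xy(1)]]])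
  also have "\<dots> \<le> 1 / 4 * norm ?w"
    using px p(2) \<rho> norm_proj_le[OF dsub_Tan[OF xy(1)], of ?w]
    by (intro mult_mono) (auto simp: pos_divide_le_eq)
  finally have 2: "norm (?u - proj (Tan p) ?u) \<le> norm ?w / 4" by simp
  have "norm (?w - proj (Tan p) ?w) \<le> norm (?w - proj (Tan p) ?u)"
    by (rule proj_best[OF dsub_Tan[OF p(1)] proj_in[OF dsub_Tan[OF p(1)]]])
  also have "\<dots> \<le> norm (?w - ?u) + norm (?u - proj (Tan p) ?u)"
    using norm_triangle_ineq[of "?w - ?u" "?u - proj (Tan p) ?u"] by simp
  finally have "norm (?w - proj (Tan p) ?w) \<le> norm ?w / 2" using 1 2 by simp
  moreover have "norm ?w \<le> norm (proj (Tan p) ?w) + norm (?w - proj (Tan p) ?w)"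
    using norm_triangle_ineq[of "proj (Tan p) ?w" "?w - proj (Tan p) ?w"] by simp
  ultimately show ?thesis by simp
qed

text \<open>Covering the projection to \<open>Tan p\<close> makes the exponent \<open>d\<close>
  rather than the ambient dimension; the bilipschitz bound costs a factor 2 in the mesh.\<close>

lemma manifold_cover:
  assumes d: "1 \<le> d" and p: "p \<in> M" "r \<le> \<rho> / 112" and s: "0 < s" "s \<le> 2 * r"
  obtains F where "F \<subseteq> M \<inter> cball p r" "finite F" "real (card F) \<le> ((4 * real d + 4) * (r / s)) ^ d"
    "\<And>x. x \<in> M \<inter> cball p r \<Longrightarrow> \<exists>z\<in>F. dist x z \<le> s"
proof -
  obtain E where E: "frame d E (Tan p)" using dsub_Tan[OF p(1)] by (auto simp: dsub_def)
  have "\<bar>(x - p) \<bullet> e\<bar> \<le> r" if "x \<in> M \<inter> cball p r" "e \<in> E" for x e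
  proof -
    have "\<bar>(x - p) \<bullet> e\<bar> \<le> norm (x - p) * norm e" by (rule Cauchy_Schwarz_ineq2)
    also have "\<dots> = dist p x" using E that by (simp add: frame_def dist_norm norm_minus_commute)
    finally show ?thesis using that by auto
  qed
  moreover have "0 < s / 2" "s / 2 \<le> r" using s by auto
  ultimately obtain F where F: "F \<subseteq> M \<inter> cball p r" "finite F"
    "real (card F) \<le> ((2 * real d + 2) * (r / (s / 2))) ^ d"
    "\<And>x. x \<in> M \<inter> cball p r \<Longrightarrow> \<exists>z\<in>F. norm (proj (Tan p) (x - z)) \<le> s / 2"
    using frame_cover[OF E d, of "s / 2" r "M \<inter> cball p r" p] by metis
  have "\<exists>z\<in>F. dist x z \<le> s" if x: "x \<in> M \<inter> cball p r" for x
  proof -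
    obtain z where z: "z \<in> F" "norm (proj (Tan p) (x - z)) \<le> s / 2" using F(4)[OF x] by blast
    have "norm (x - z) \<le> 2 * norm (proj (Tan p) (x - z))"
      using z(1) F(1) x by (intro proj_bilipschitz[OF p]) auto
    then show ?thesis using z by (auto simp: dist_norm intro!: bexI[of _ z])
  qed
  moreover have "(2 * real d + 2) * (r / (s / 2)) = (4 * real d + 4) * (r / s)" by (simp add: field_simps)
  then have "real (card F) \<le> ((4 * real d + 4) * (r / s)) ^ d" using F(3) by (simp only:)
  ultimately show ?thesis using F(1,2) by (intro that) auto
qed

text \<open>The bound on the number of balls of radius \<open>s\<close>, times s^d, does not depend
  on \<open>s\<close>, so arbitrarily fine covers share one bound.\<close>

lemma hausdorff_outer_upper:
  assumes d: "1 \<le> d" and p: "p \<in> M" and r: "0 < r" "r \<le> \<rho> / 112"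
  shows "hausdorff_outer d (M \<inter> cball p r) \<le> ennreal (unit_ball_vol (real d) * (4 * real d + 4) ^ d * r ^ d)"
  unfolding hausdorff_outer_def
proof (rule SUP_least)
  fix \<eta> :: real assume "\<eta> \<in> {0<..}"
  then have \<eta>: "0 < \<eta>" by simp
  define s where "s = min r (\<eta> / 2)"
  have s: "0 < s" "s \<le> r" "2 * s \<le> \<eta>" using r \<eta> by (auto simp: s_def)
  obtain F where F: "finite F" "real (card F) \<le> ((4 * real d + 4) * (r / s)) ^ d"
    "\<And>x. x \<in> M \<inter> cball p r \<Longrightarrow> \<exists>z\<in>F. dist x z \<le> s"
    by (rule manifold_cover[OF d p r(2) s(1)]) (use s(2) r in \<open>auto\<close>)
  obtain f :: "nat \<Rightarrow> finseq" where f: "bij_betw f {..<card F} F"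
    using ex_bij_betw_nat_finite[OF F(1)] by (auto simp: atLeast0LessThan)
  define U where "U i = (if i < card F then cball (f i) s else {})" for i
  have diam: "diameter (U i) \<le> 2 * s" for i
  proof (rule diameter_le)
    fix x y assume "x \<in> U i" "y \<in> U i"
    then have "dist (f i) x \<le> s" "dist (f i) y \<le> s" by (auto simp: U_def split: if_splits)
    then have "dist x y \<le> 2 * s" using dist_triangle[of x y "f i"] by (simp add: dist_commute)
    then show "norm (x - y) \<le> 2 * s" by (simp add: dist_norm)
  qed (use s in auto)
  have bdd: "bounded (U i)" for i by (simp add: U_def)
  have cover: "M \<inter> cball p r \<subseteq> (\<Union>i. U i)"
  proof
    fix x assume "x \<in> M \<inter> cball p r"
    then obtain z where z: "z \<in> F" "dist x z \<le> s" using F(3) by blast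
    then obtain i where i: "i < card F" "f i = z" using f unfolding bij_betw_def by (metis imageE lessThan_iff)
    then have "x \<in> U i" using z by (simp add: U_def dist_commute)
    then show "x \<in> (\<Union>i. U i)" by blast
  qed
  let ?\<omega> = "unit_ball_vol (real d)"
  let ?t = "\<lambda>i. if U i = {} then 0 else ennreal (?\<omega> * (diameter (U i) / 2) ^ d)"
  have "(INF U\<in>{U. M \<inter> cball p r \<subseteq> (\<Union>i. U i) \<and> (\<forall>i. bounded (U i) \<and> diameter (U i) \<le> \<eta>)}.
      (\<Sum>i. if U i = {} then 0 else ennreal (?\<omega> * (diameter (U i) / 2) ^ d))) \<le> (\<Sum>i. ?t i)"
    using cover bdd order_trans[OF diam s(3)] by (intro INF_lower) auto
  also have "(\<Sum>i. ?t i) = (\<Sum>i<card F. ?t i)"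
    by (rule suminf_finite) (auto simp: U_def)
  also have "\<dots> \<le> (\<Sum>i<card F. ennreal (?\<omega> * s ^ d))"
  proof (rule sum_mono)
    fix i assume "i \<in> {..<card F}"
    have "(diameter (U i) / 2) ^ d \<le> s ^ d"
      using diam[of i] diameter_ge_0[OF bdd, of i] by (intro power_mono) auto
    then show "?t i \<le> ennreal (?\<omega> * s ^ d)" by (auto intro!: ennreal_leI mult_left_mono)
  qed
  also have "\<dots> = ennreal (real (card F) * (?\<omega> * s ^ d))"
    using s by (simp add: ennreal_mult'[symmetric] ennreal_of_nat_eq_real_of_nat)
  also have "\<dots> \<le> ennreal (((4 * real d + 4) * (r / s)) ^ d * (?\<omega> * s ^ d))"
    using F(2) s by (intro ennreal_leI mult_right_mono) auto
  also have "((4 * real d + 4) * (r / s)) ^ d * (?\<omega> * s ^ d) = ?\<omega> * (4 * real d + 4) ^ d * r ^ d"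
    using s by (simp add: power_mult_distrib power_divide)
  finally show "(INF U\<in>{U. M \<inter> cball p r \<subseteq> (\<Union>i. U i) \<and> (\<forall>i. bounded (U i) \<and> diameter (U i) \<le> \<eta>)}.
      (\<Sum>i. if U i = {} then 0 else ennreal (?\<omega> * (diameter (U i) / 2) ^ d)))
      \<le> ennreal (?\<omega> * (4 * real d + 4) ^ d * r ^ d)" .
qed

text \<open>Coordinates in an orthonormal basis of \<open>Tan p\<close> are 1-Lipschitz, and their
  image of this piece of \<open>M\<close> contains a box. A cover of the piece becomes a cover of
  the box by cubes, so Lebesgue measure bounds the Hausdorff sum from below.\<close>

lemma hausdorff_outer_lower:
  assumes d: "1 \<le> d" and p: "p \<in> M" and r: "0 < r" "r \<le> \<rho> / 112"
  shows "ennreal (unit_ball_vol (real d) / (8 * real d) ^ d * r ^ d) \<le> hausdorff_outer d (M \<inter> cball p r)"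
proof -
  interpret lb: product_sigma_finite "\<lambda>_::nat. lborel :: real measure" by standard
  let ?L = "\<Pi>\<^sub>M i\<in>{..<d}. (lborel :: real measure)"
  let ?\<omega> = "unit_ball_vol (real d)"
  obtain E where E: "frame d E (Tan p)" using dsub_Tan[OF p] by (auto simp: dsub_def)
  have finE: "finite E" and cE: "card E = d" using E by (auto simp: frame_def)
  obtain e :: "nat \<Rightarrow> finseq" where e: "bij_betw e {..<d} E"
    using ex_bij_betw_nat_finite[OF finE] cE by (auto simp: atLeast0LessThan)
  have eE: "e i \<in> E" if "i < d" for i using e that by (auto simp: bij_betw_def)
  have ne: "norm (e i) = 1" if "i < d" for i using eE[OF that] E by (simp add: frame_def)
  define g where "g x = (\<lambda>i\<in>{..<d}. (x - p) \<bullet> e i)" for x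
  \<comment> \<open>A tangent vector over this box has norm at most \<open>r / 4\<close>, which is
    below \<open>\<rho> / 112\<close>; \<open>proj_surj\<close> lifts it to a point within
    \<open>r / 2\<close> of \<open>p\<close>.\<close>
  define Box where "Box = PiE {..<d} (\<lambda>_. {- (r / (4 * real d))..r / (4 * real d)})"
  have BoxL: "emeasure ?L Box = ennreal ((r / (2 * real d)) ^ d)"
  proof -
    have "emeasure ?L Box = (\<Prod>i<d. emeasure lborel {- (r / (4 * real d))..r / (4 * real d)})"
      unfolding Box_def by (intro lb.emeasure_PiM) auto
    also have "\<dots> = (\<Prod>i<d. ennreal (r / (2 * real d)))" using r d by (intro prod.cong) auto
    also have "\<dots> = ennreal ((r / (2 * real d)) ^ d)" using r by (simp add: ennreal_power)
    finally show ?thesis .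
  qed
  have surj: "\<exists>q\<in>M \<inter> cball p r. g q = y" if y: "y \<in> Box" for y
  proof -
    define u where "u = (\<Sum>i<d. y i *\<^sub>R e i)"
    have uT: "u \<in> Tan p" unfolding u_def
      using eE frame_subset[OF E] by (intro subspace_sum[OF dsub_subspace[OF dsub_Tan[OF p]]]
        subspace_scale[OF dsub_subspace[OF dsub_Tan[OF p]]]) auto
    have "norm u \<le> (\<Sum>i<d. norm (y i *\<^sub>R e i))" unfolding u_def by (rule norm_sum)
    also have "\<dots> \<le> real (card {..<d}) * (r / (4 * real d))"
      using y ne by (intro sum_bounded_above) (auto simp: Box_def PiE_def Pi_def abs_le_iff)
    also have "\<dots> = r / 4" using d by simp
    finally have nu: "norm u \<le> r / 4" .
    then have "norm u < \<rho> / 112" using r by linarith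
    then obtain q where q: "q \<in> M" "proj (Tan p) (q - p) = u" "norm (q - p) \<le> 2 * norm u"
      using proj_surj[OF p uT] by blast
    have "(q - p) \<bullet> e i = y i" if i: "i < d" for i
    proof -
      have "(q - p) \<bullet> e i = u \<bullet> e i"
        using proj_inner[OF dsub_Tan[OF p], of "e i" "q - p"] q(2) eE[OF i] frame_subset[OF E] by auto
      also have "\<dots> = (\<Sum>j<d. y j * (e j \<bullet> e i))" by (simp add: u_def inner_sum_left)
      also have "\<dots> = (\<Sum>j<d. if j = i then y j else 0)"
      proof (rule sum.cong)
        fix j assume "j \<in> {..<d}"
        then have "e j = e i \<longleftrightarrow> j = i" using e i by (auto simp: bij_betw_def inj_on_def)
        then show "y j * (e j \<bullet> e i) = (if j = i then y j else 0)"
          using frame_inner[OF E eE eE, of j i] \<open>j \<in> {..<d}\<close> i by auto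
      qed simp
      also have "\<dots> = y i" using i by simp
      finally show ?thesis .
    qed
    then have "g q = y" using y by (auto simp: g_def Box_def PiE_def extensional_def restrict_def)
    moreover have "q \<in> M \<inter> cball p r" using q nu r by (auto simp: dist_norm norm_minus_commute)
    ultimately show ?thesis by blast
  qed
  have "ennreal (?\<omega> / (8 * real d) ^ d * r ^ d) \<le>
      (\<Sum>i. if U i = {} then 0 else ennreal (?\<omega> * (diameter (U i) / 2) ^ d))"
    if U: "M \<inter> cball p r \<subseteq> (\<Union>i. U i)" "\<And>i. bounded (U i)" for U :: "nat \<Rightarrow> finseq set"
  proof -
    \<comment> \<open>The cube is centred at an arbitrary point of \<open>U i\<close> and so takes
      the full diameter as half side; comparing with half the diameter produces
      \<open>4 ^ d\<close>.\<close>
    define B where "B i = (if U i = {} then {} else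
      PiE {..<d} (\<lambda>j. {g (SOME x. x \<in> U i) j - diameter (U i)..g (SOME x. x \<in> U i) j + diameter (U i)}))" for i
    have Bs: "range B \<subseteq> sets ?L" by (auto simp: B_def intro!: sets_PiM_I_finite)
    have dU: "0 \<le> diameter (U i)" for i by (rule diameter_ge_0[OF U(2)])
    have eB: "ennreal (?\<omega> / 4 ^ d) * emeasure ?L (B i) = (if U i = {} then 0 else ennreal (?\<omega> * (diameter (U i) / 2) ^ d))" for i
    proof (cases "U i = {}")
      case False
      have "emeasure ?L (B i) = (\<Prod>j<d. emeasure lborel {g (SOME x. x \<in> U i) j - diameter (U i)..g (SOME x. x \<in> U i) j + diameter (U i)})"
        using False by (simp add: B_def) (intro lb.emeasure_PiM, auto)
      also have "\<dots> = (\<Prod>j<d. ennreal (2 * diameter (U i)))" using dU[of i] by (intro prod.cong) auto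
      also have "\<dots> = ennreal ((2 * diameter (U i)) ^ d)" using dU[of i] by (simp add: ennreal_power)
      finally have eq: "emeasure ?L (B i) = ennreal ((2 * diameter (U i)) ^ d)" .
      have "ennreal (?\<omega> / 4 ^ d) * emeasure ?L (B i) = ennreal (?\<omega> / 4 ^ d * (2 * diameter (U i)) ^ d)"
        unfolding eq using dU[of i] by (intro ennreal_mult''[symmetric]) simp
      also have "?\<omega> / 4 ^ d * (2 * diameter (U i)) ^ d = ?\<omega> * (2 * diameter (U i) / 4) ^ d"
        by (simp only: power_divide times_divide_eq_left times_divide_eq_right)
      also have "2 * diameter (U i) / 4 = diameter (U i) / 2" by simp
      finally show ?thesis using False by simp
    qed (simp add: B_def)
    have "Box \<subseteq> (\<Union>i. B i)"
    proof
      fix y assume "y \<in> Box"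
      then obtain q where q: "q \<in> M \<inter> cball p r" "g q = y" using surj by blast
      then obtain i where i: "q \<in> U i" using U(1) by blast
      let ?x = "SOME x. x \<in> U i"
      have x: "?x \<in> U i" using i by (rule someI)
      have "\<bar>g q j - g ?x j\<bar> \<le> diameter (U i)" if j: "j < d" for j
      proof -
        have "g q j - g ?x j = (q - ?x) \<bullet> e j" using j by (simp add: g_def inner_diff_left)
        also have "\<bar>\<dots>\<bar> \<le> norm (q - ?x) * norm (e j)" by (rule Cauchy_Schwarz_ineq2)
        also have "\<dots> = dist q ?x" using ne[OF j] by (simp add: dist_norm)
        also have "\<dots> \<le> diameter (U i)" by (rule diameter_bounded_bound[OF U(2) i x])
        finally show ?thesis .
      qed
      then have "g q \<in> B i" using i by (auto simp: B_def g_def PiE_def abs_le_iff)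
        (smt (verit, best))+
      then show "y \<in> (\<Union>i. B i)" using q by blast
    qed
    then have "emeasure ?L Box \<le> emeasure ?L (\<Union>i. B i)" using Bs by (intro emeasure_mono) auto
    also have "\<dots> \<le> (\<Sum>i. emeasure ?L (B i))" by (rule emeasure_subadditive_countably[OF Bs])
    finally have "ennreal (?\<omega> / 4 ^ d) * ennreal ((r / (2 * real d)) ^ d) \<le> ennreal (?\<omega> / 4 ^ d) * (\<Sum>i. emeasure ?L (B i))"
      unfolding BoxL by (intro mult_left_mono) auto
    also have "\<dots> = (\<Sum>i. ennreal (?\<omega> / 4 ^ d) * emeasure ?L (B i))" by simp
    finally have main: "ennreal (?\<omega> / 4 ^ d * (r / (2 * real d)) ^ d) \<le>
      (\<Sum>i. if U i = {} then 0 else ennreal (?\<omega> * (diameter (U i) / 2) ^ d))"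
    proof (subst ennreal_mult'')
      show "0 \<le> (r / (2 * real d)) ^ d" using r by simp
    qed (simp only: eB)
    have "8 * real d = 4 * (2 * real d)" by simp
    then have "(8 * real d) ^ d = 4 ^ d * (2 * real d) ^ d" by (simp only: power_mult_distrib)
    then have "?\<omega> / (8 * real d) ^ d * r ^ d = ?\<omega> / 4 ^ d * (r / (2 * real d)) ^ d"
      by (simp add: power_divide)
    then show ?thesis using main by simp
  qed
  then show ?thesis unfolding hausdorff_outer_def
    by (intro SUP_upper2[of 1] INF_greatest) auto
qed

end

section \<open>Distributions with outliers\<close>

lemma sets_euclid_lebesgue [simp]: "sets (euclid_lebesgue D) = sets borel"
  by (simp add: euclid_lebesgue_def)

lemma euclid_of_in_euclid: "euclid_of D x \<in> euclid D"
  by (simp add: euclid_def)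

lemma euclid_lebesgue_cball_le:
  assumes "0 \<le> r" shows "emeasure (euclid_lebesgue D) (cball p r) \<le> ennreal ((2 * r) ^ D)"
proof -
  interpret lb: product_sigma_finite "\<lambda>_::nat. lborel :: real measure" by standard
  let ?L = "\<Pi>\<^sub>M i\<in>{..<D}. (lborel :: real measure)"
  let ?B = "PiE {..<D} (\<lambda>i. {finseq_nth p i - r..finseq_nth p i + r})"
  have "emeasure (euclid_lebesgue D) (cball p r) = emeasure ?L (euclid_of D -` cball p r \<inter> space ?L)"
    unfolding euclid_lebesgue_def by (rule emeasure_distr) auto
  also have "\<dots> \<le> emeasure ?L ?B"
  proof (rule emeasure_mono)
    show "euclid_of D -` cball p r \<inter> space ?L \<subseteq> ?B"
    proof
      fix x assume x: "x \<in> euclid_of D -` cball p r \<inter> space ?L"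
      have "\<bar>x i - finseq_nth p i\<bar> \<le> r" if "i < D" for i
      proof -
        have "\<bar>finseq_nth (euclid_of D x - p) i\<bar> \<le> norm (euclid_of D x - p)" by (rule abs_nth_le_norm)
        also have "\<dots> \<le> r" using x by (simp add: dist_norm norm_minus_commute)
        finally show ?thesis using that by simp
      qed
      then show "x \<in> ?B" using x by (auto simp: space_PiM PiE_def abs_le_iff) (smt (verit))+
    qed
  qed (auto intro!: sets_PiM_I_finite)
  also have "\<dots> = (\<Prod>i<D. emeasure lborel {finseq_nth p i - r..finseq_nth p i + r})"
    by (intro lb.emeasure_PiM) auto
  also have "\<dots> = (\<Prod>i<D. ennreal (2 * r))" using assms by (intro prod.cong) auto
  also have "\<dots> = ennreal ((2 * r) ^ D)" using assms by (simp add: ennreal_power)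
  finally show ?thesis .
qed

lemma euclid_lebesgue_cball_ge:
  assumes "0 \<le> K" "1 \<le> D"
  shows "ennreal ((2 * K / real D) ^ D) \<le> emeasure (euclid_lebesgue D) (euclid D \<inter> cball 0 K)"
proof -
  interpret lb: product_sigma_finite "\<lambda>_::nat. lborel :: real measure" by standard
  let ?L = "\<Pi>\<^sub>M i\<in>{..<D}. (lborel :: real measure)"
  let ?B = "PiE {..<D} (\<lambda>i. {- (K / real D)..K / real D})"
  have meas: "euclid D \<inter> cball 0 K \<in> sets borel" by (intro borel_closed closed_Int closed_euclid closed_cball)
  have "ennreal ((2 * K / real D) ^ D) = (\<Prod>i<D. ennreal (2 * K / real D))"
    using assms by (simp add: ennreal_power)
  also have "\<dots> = (\<Prod>i<D. emeasure lborel {- (K / real D)..K / real D})"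
    using assms by (intro prod.cong) auto
  also have "\<dots> = emeasure ?L ?B" by (intro lb.emeasure_PiM[symmetric]) auto
  also have "\<dots> \<le> emeasure ?L (euclid_of D -` (euclid D \<inter> cball 0 K) \<inter> space ?L)"
  proof (rule emeasure_mono)
    show "?B \<subseteq> euclid_of D -` (euclid D \<inter> cball 0 K) \<inter> space ?L"
    proof
      fix x assume x: "x \<in> ?B"
      have "euclid_of D x = (\<Sum>j<D. finseq_nth (euclid_of D x) j *\<^sub>R unit_vec j)"
        by (rule euclid_sum[OF euclid_of_in_euclid])
      then have "norm (euclid_of D x) \<le> (\<Sum>j<D. norm (finseq_nth (euclid_of D x) j *\<^sub>R unit_vec j))"
        using norm_sum by metis
      also have "\<dots> \<le> real (card {..<D}) * (K / real D)"
        using x by (intro sum_bounded_above) (auto simp: PiE_def Pi_def abs_le_iff)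
      also have "\<dots> = K" using assms by simp
      finally show "x \<in> euclid_of D -` (euclid D \<inter> cball 0 K) \<inter> space ?L"
        using x euclid_of_in_euclid[of D x] by (auto simp: space_PiM PiE_def)
    qed
    show "euclid_of D -` (euclid D \<inter> cball 0 K) \<inter> space ?L \<in> sets ?L"
      using meas by (intro measurable_sets[OF borel_measurable_euclid_of])
  qed
  also have "\<dots> = emeasure (euclid_lebesgue D) (euclid D \<inter> cball 0 K)"
    unfolding euclid_lebesgue_def using meas by (intro emeasure_distr[symmetric]) auto
  finally show ?thesis .
qed

definition ball_uniform :: "nat \<Rightarrow> real \<Rightarrow> finseq measure"
  where "ball_uniform D K = uniform_measure (euclid_lebesgue D) (euclid D \<inter> cball 0 K)"

text \<open>The ball of radius \<open>K\<close> contains a cube of side \<open>2 * K / D\<close>,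
  and a ball of radius \<open>r\<close> lies in a cube of side \<open>2 * r\<close>; the quotient of
  the two volumes is the bound.\<close>

lemma ball_uniform:
  assumes "0 < K" "1 \<le> D" "B \<in> sets borel"
  shows "emeasure (ball_uniform D K) UNIV = 1" "emeasure (ball_uniform D K) (- (euclid D \<inter> cball 0 K)) = 0"
    and "0 \<le> r \<Longrightarrow> B \<subseteq> cball p r \<Longrightarrow> emeasure (ball_uniform D K) B \<le> ennreal ((real D / K) ^ D * r ^ D)"
proof -
  let ?A = "euclid D \<inter> cball 0 K" and ?L = "euclid_lebesgue D"
  have A: "?A \<in> sets borel" by (intro borel_closed closed_Int closed_euclid closed_cball)
  have em: "emeasure (ball_uniform D K) S = emeasure ?L (?A \<inter> S) / emeasure ?L ?A" if "S \<in> sets borel" for S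
    unfolding ball_uniform_def using A that by (intro emeasure_uniform_measure) auto
  have "emeasure ?L ?A \<le> emeasure ?L (cball 0 K)" by (intro emeasure_mono) auto
  also have "\<dots> \<le> ennreal ((2 * K) ^ D)" using assms by (intro euclid_lebesgue_cball_le) simp
  finally have fin: "emeasure ?L ?A < \<infinity>" using le_less_trans ennreal_less_top by fastforce
  define L where "L = measure ?L ?A"
  have L: "emeasure ?L ?A = ennreal L" unfolding L_def using fin by (intro emeasure_eq_ennreal_measure) auto
  have "(2 * K / real D) ^ D \<le> L"
    using euclid_lebesgue_cball_ge[of K D] assms L by (simp add: L_def)
  moreover have pos: "0 < (2 * K / real D) ^ D" using assms by simp
  ultimately have L0: "(2 * K / real D) ^ D \<le> L" "0 < L" by auto
  show "emeasure (ball_uniform D K) UNIV = 1"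
    using em[of UNIV] L L0 by (simp add: divide_ennreal)
  show "emeasure (ball_uniform D K) (- ?A) = 0" 
    unfolding em[OF borel_comp[OF A]] by (simp only: Compl_disjoint emeasure_empty) simp
  assume r: "0 \<le> r" "B \<subseteq> cball p r"
  have "emeasure ?L (?A \<inter> B) \<le> emeasure ?L (cball p r)" using r by (intro emeasure_mono) auto
  also have "\<dots> \<le> ennreal ((2 * r) ^ D)" using r by (intro euclid_lebesgue_cball_le)
  finally have "emeasure (ball_uniform D K) B \<le> ennreal ((2 * r) ^ D) / ennreal L"
    unfolding em[OF assms(3)] L by (rule divide_right_mono_ennreal)
  also have "\<dots> = ennreal ((2 * r) ^ D / L)" using r L0 by (intro divide_ennreal) auto
  also have "\<dots> \<le> ennreal ((2 * r) ^ D / (2 * K / real D) ^ D)"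
    using r L0 pos by (intro ennreal_leI divide_left_mono) auto
  also have "(2 * r) ^ D / (2 * K / real D) ^ D = (2 * r / (2 * K / real D)) ^ D" by (simp only: power_divide)
  also have "2 * r / (2 * K / real D) = real D / K * r" using assms by simp
  finally show "emeasure (ball_uniform D K) B \<le> ennreal ((real D / K) ^ D * r ^ D)"
    by (simp only: power_mult_distrib)
qed

lemma manifold_dists_emeasure:
  assumes Q: "Q \<in> manifold_dists d f_min f_max M" and M: "M \<in> sets borel" and B: "B \<in> sets borel"
    and "0 \<le> f_min"
  shows "prob_space Q" "sets Q = sets borel"
    "ennreal f_min * hausdorff_outer d (M \<inter> B) \<le> emeasure Q B"
    "emeasure Q B \<le> ennreal f_max * hausdorff_outer d (M \<inter> B)"
proof -
  let ?H = "hausdorff_measure d :: finseq measure"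
  obtain f where f: "f \<in> borel_measurable borel" "\<And>x. x \<in> M \<Longrightarrow> f_min \<le> f x \<and> f x \<le> f_max"
    "Q = density (manifold_volume d M) (\<lambda>x. ennreal (f x))" and pQ: "prob_space Q"
    using Q unfolding manifold_dists_def by auto
  show "prob_space Q" by (rule pQ)
  have sH: "sets ?H = sets borel"
    unfolding hausdorff_measure_def using sets.sigma_sets_eq[of "borel :: finseq measure"]
    by (subst sets_measure_of) auto
  have sV: "sets (manifold_volume d M) = sets borel" by (simp add: manifold_volume_def sH)
  show sQ: "sets Q = sets borel" by (simp add: f(3) sV)
  have [measurable]: "f \<in> borel_measurable ?H" using f(1) sH measurable_cong_sets by blast
  have [measurable]: "M \<in> sets ?H" "B \<in> sets ?H" using M B sH by auto
  have QB: "emeasure Q S = (\<integral>\<^sup>+x. ennreal (f x) * indicator (M \<inter> S) x \<partial>?H)" if "S \<in> sets borel" for S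
  proof -
    have [measurable]: "S \<in> sets ?H" using that sH by simp
    have "emeasure Q S = (\<integral>\<^sup>+x. ennreal (f x) * indicator S x \<partial>manifold_volume d M)"
      unfolding f(3) using that f(1) sV
      by (intro emeasure_density) (auto simp: measurable_cong_sets[OF sV refl])
    also have "\<dots> = (\<integral>\<^sup>+x. indicator M x * (ennreal (f x) * indicator S x) \<partial>?H)"
      unfolding manifold_volume_def by (subst nn_integral_density) auto
    also have "\<dots> = (\<integral>\<^sup>+x. ennreal (f x) * indicator (M \<inter> S) x \<partial>?H)"
      by (intro nn_integral_cong) (auto simp: indicator_def)
    finally show ?thesis .
  qed
  \<comment> \<open>If the outer measure were not countably additive, \<open>measure_of\<close> would be the zero measure,
    which leaves no room for the probability measure \<open>Q\<close>.\<close>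
  have ms: "measure_space UNIV (sigma_sets UNIV (sets borel)) (hausdorff_outer d :: finseq set \<Rightarrow> ennreal)"
  proof (rule ccontr)
    assume "\<not> ?thesis"
    then have "emeasure ?H S = 0" for S
      unfolding hausdorff_measure_def by (simp add: emeasure_measure_of_conv)
    then have "AE x in ?H. ennreal (f x) * indicator (M \<inter> UNIV) x = 0"
      by (intro AE_I[of _ _ UNIV]) (auto simp: sH)
    moreover have "UNIV \<in> sets (borel :: finseq measure)" by simp
    ultimately have "emeasure Q UNIV = 0" by (subst QB) (auto simp: nn_integral_0_iff_AE)
    moreover have "emeasure Q (space Q) = 1" using pQ by (rule prob_space.emeasure_space_1)
    moreover have "space Q = UNIV" using sets_eq_imp_space_eq[OF sQ] by simp
    ultimately show False by simp
  qed
  have eH: "emeasure ?H S = hausdorff_outer d S" if "S \<in> sets borel" for S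
    unfolding hausdorff_measure_def using ms that by (auto simp: emeasure_measure_of_conv)
  have MB: "M \<inter> B \<in> sets borel" using M B by auto
  have "ennreal f_min * hausdorff_outer d (M \<inter> B) = (\<integral>\<^sup>+x. ennreal f_min * indicator (M \<inter> B) x \<partial>?H)"
    unfolding eH[OF MB, symmetric] by (intro nn_integral_cmult_indicator[symmetric]) measurable
  also have "\<dots> \<le> emeasure Q B" unfolding QB[OF B]
    using f(2) by (intro nn_integral_mono) (auto simp: indicator_def intro: ennreal_leI)
  finally show "ennreal f_min * hausdorff_outer d (M \<inter> B) \<le> emeasure Q B" .
  have "emeasure Q B \<le> (\<integral>\<^sup>+x. ennreal f_max * indicator (M \<inter> B) x \<partial>?H)" unfolding QB[OF B]
    using f(2) by (intro nn_integral_mono) (auto simp: indicator_def intro: ennreal_leI)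
  also have "\<dots> = ennreal f_max * hausdorff_outer d (M \<inter> B)"
    unfolding eH[OF MB, symmetric] by (intro nn_integral_cmult_indicator) measurable
  finally show "emeasure Q B \<le> ennreal f_max * hausdorff_outer d (M \<inter> B)" .
qed

lemma hausdorff_outer_empty [simp]: "hausdorff_outer d {} = 0"
proof -
  have "(INF U\<in>{U :: nat \<Rightarrow> 'a::metric_space set. {} \<subseteq> (\<Union>i. U i) \<and> (\<forall>i. bounded (U i) \<and> diameter (U i) \<le> \<eta>)}.
       (\<Sum>i. if U i = {} then 0 else ennreal (unit_ball_vol (real d) * (diameter (U i) / 2) ^ d))) \<le> 0"
    if "0 < \<eta>" for \<eta>
    using that by (intro INF_lower2[of "\<lambda>_. {}"]) auto
  then show ?thesis unfolding hausdorff_outer_def by (intro antisym SUP_least) auto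
qed

text \<open>Constants for the mass at scale \<open>r\<close>. \<open>vol_low\<close> and
  \<open>vol_up\<close> compare the measure of \<open>M\<close> in a ball with r^d, the latter
  through a doubled radius because its balls are centred anywhere. \<open>vol_amb\<close> bounds
  outlier mass by r^D, and \<open>vol_tube\<close> outlier mass near \<open>M\<close>.\<close>

definition vol_low :: "nat \<Rightarrow> real" where "vol_low d = unit_ball_vol (real d) / (8 * real d) ^ d"
definition vol_up :: "nat \<Rightarrow> real" where "vol_up d = unit_ball_vol (real d) * (8 * real d + 8) ^ d"
definition vol_amb :: "nat \<Rightarrow> real \<Rightarrow> real" where "vol_amb D K = (real D / K) ^ D"
definition vol_tube :: "nat \<Rightarrow> nat \<Rightarrow> real \<Rightarrow> real"
  where "vol_tube d D K = (16 * real d + 16) ^ d * (vol_amb D K * 2 ^ D)"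

lemma vol_pos: "1 \<le> d \<Longrightarrow> 0 < vol_low d" "0 < vol_up d" "0 < K \<Longrightarrow> 1 \<le> D \<Longrightarrow> 0 < vol_amb D K"
  "0 < K \<Longrightarrow> 1 \<le> D \<Longrightarrow> 0 < vol_tube d D K"
  by (auto simp: vol_low_def vol_up_def vol_amb_def vol_tube_def add_nonneg_pos)

locale outlier_dist = reach_manifold D d M \<rho> for D d M \<rho> +
  fixes A f_min f_max \<beta> :: real and P :: "finseq measure"
  assumes dD: "1 \<le> d" "d < D" and f: "0 < f_min" "f_min \<le> f_max" and \<beta>: "0 < \<beta>" "\<beta> \<le> 1"
    and A: "diam_constant d A" and PM: "(P, M) \<in> outlier_model A D d f_min f_max \<rho> \<beta>"
begin

abbreviation "K0 \<equiv> ball_radius A d f_min \<rho>"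

lemma K0_pos: "0 < K0"
  using A f \<rho> by (auto simp: ball_radius_def diam_constant_def intro!: add_nonneg_pos)

lemma M_closed: "closed M" using M_compact by (rule compact_imp_closed)

lemma M_borel [measurable]: "M \<in> sets borel" by (intro borel_closed M_closed)

lemma sets_P: "sets P = sets borel" and space_P: "space P = UNIV"
proof -
  show "sets P = sets borel" using PM by (simp add: outlier_model_def)
  then show "space P = UNIV" using sets_eq_imp_space_eq by fastforce
qed

lemma mixture:
  obtains Q where "Q \<in> manifold_dists d f_min f_max M"
    "\<And>B. B \<in> sets borel \<Longrightarrow> emeasure P B = ennreal \<beta> * emeasure Q B + ennreal (1 - \<beta>) * emeasure (ball_uniform D K0) B"
  using PM unfolding outlier_model_def ball_uniform_def by blast

lemma M_cball: "M \<subseteq> cball 0 K0"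
proof
  obtain Q where "Q \<in> manifold_dists d f_min f_max M" using mixture by blast
  then have "diameter M \<le> A / (\<rho> ^ (d - 1) * f_min)"
    using A \<rho> f mc unfolding diam_constant_def by blast
  fix x assume "x \<in> M"
  moreover have "0 \<in> M" using PM by (simp add: outlier_model_def)
  ultimately have "dist 0 x \<le> diameter M"
    using diameter_bounded_bound[OF compact_imp_bounded[OF M_compact]] by blast
  then show "x \<in> cball 0 K0" using \<open>diameter M \<le> _\<close> \<rho> by (simp add: ball_radius_def)
qed

lemma prob_P: "prob_space P"
proof
  obtain Q where Q: "Q \<in> manifold_dists d f_min f_max M"
    "\<And>B. B \<in> sets borel \<Longrightarrow> emeasure P B = ennreal \<beta> * emeasure Q B + ennreal (1 - \<beta>) * emeasure (ball_uniform D K0) B"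
    using mixture by metis
  have "prob_space Q" "sets Q = sets borel" using manifold_dists_emeasure[OF Q(1) M_borel, of UNIV] f by auto
  then have "emeasure Q UNIV = 1"
    using prob_space.emeasure_space_1[of Q] sets_eq_imp_space_eq[of Q borel] by simp
  moreover have "emeasure (ball_uniform D K0) UNIV = 1" using K0_pos dD by (intro ball_uniform[of _ _ UNIV]) auto
  ultimately show "emeasure P (space P) = 1"
    using Q(2)[of UNIV] \<beta> by (simp add: space_P ennreal_plus[symmetric] del: ennreal_plus)
qed

text \<open>The weight \<open>\<beta>\<close> is kept on the manifold part, where it has to cancel
  against the lower bounds; the outlier weight is simply bounded by 1.\<close>

lemma emeasure_P_le:
  assumes "B \<in> sets borel"
    and "hausdorff_outer d (M \<inter> B) \<le> ennreal a" "emeasure (ball_uniform D K0) B \<le> ennreal b" "0 \<le> a" "0 \<le> b"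
  shows "measure P B \<le> \<beta> * (f_max * a) + b"
proof -
  obtain Q where Q: "Q \<in> manifold_dists d f_min f_max M"
    "\<And>B. B \<in> sets borel \<Longrightarrow> emeasure P B = ennreal \<beta> * emeasure Q B + ennreal (1 - \<beta>) * emeasure (ball_uniform D K0) B"
    using mixture by metis
  have "emeasure Q B \<le> ennreal f_max * hausdorff_outer d (M \<inter> B)"
    using manifold_dists_emeasure(4)[OF Q(1) M_borel assms(1)] f by simp
  also have "\<dots> \<le> ennreal f_max * ennreal a" by (intro mult_left_mono assms) auto
  finally have "emeasure P B \<le> ennreal \<beta> * (ennreal f_max * ennreal a) + ennreal (1 - \<beta>) * ennreal b"
    unfolding Q(2)[OF assms(1)] by (intro add_mono mult_left_mono assms) auto
  also have "\<dots> \<le> ennreal \<beta> * (ennreal f_max * ennreal a) + 1 * ennreal b"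
    using \<beta> by (intro add_left_mono mult_right_mono) (auto simp: ennreal_le_1)
  also have "\<dots> = ennreal (\<beta> * (f_max * a) + b)" using \<beta> f assms by (simp add: ennreal_mult')
  finally have "ennreal (measure P B) \<le> ennreal (\<beta> * (f_max * a) + b)"
    using prob_P by (simp add: finite_measure.emeasure_eq_measure prob_space.finite_measure)
  then show ?thesis using \<beta> f assms by (subst (asm) ennreal_le_iff) auto
qed

lemma manifold_ball_ge:
  assumes "x \<in> M" "0 < r" "r \<le> \<rho> / 112"
  shows "\<beta> * f_min * vol_low d * r ^ d \<le> measure P (M \<inter> cball x r)"
proof -
  obtain Q where Q: "Q \<in> manifold_dists d f_min f_max M"
    "\<And>B. B \<in> sets borel \<Longrightarrow> emeasure P B = ennreal \<beta> * emeasure Q B + ennreal (1 - \<beta>) * emeasure (ball_uniform D K0) B"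
    using mixture by metis
  have B: "M \<inter> cball x r \<in> sets borel" by (intro borel_closed closed_Int M_closed closed_cball)
  have "ennreal (\<beta> * f_min * vol_low d * r ^ d) = ennreal \<beta> * (ennreal f_min * ennreal (vol_low d * r ^ d))"
    using \<beta> f assms vol_pos(1)[OF dD(1)] by (simp add: ennreal_mult'[symmetric] mult.assoc)
  also have "\<dots> \<le> ennreal \<beta> * (ennreal f_min * hausdorff_outer d (M \<inter> (M \<inter> cball x r)))"
    using hausdorff_outer_lower[OF dD(1) assms] by (intro mult_left_mono) (auto simp: vol_low_def Int_absorb)
  also have "\<dots> \<le> ennreal \<beta> * emeasure Q (M \<inter> cball x r)"
    using manifold_dists_emeasure(3)[OF Q(1) M_borel B] f by (intro mult_left_mono) auto
  also have "\<dots> \<le> emeasure P (M \<inter> cball x r)" unfolding Q(2)[OF B] by simp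
  finally show ?thesis
    using prob_P by (simp add: finite_measure.emeasure_eq_measure prob_space.finite_measure)
qed

text \<open>The part of \<open>M\<close> in an arbitrary ball lies in a ball of twice the radius
  centred on \<open>M\<close>, whence 224 = 2 * 112.\<close>

lemma ball_le:
  assumes "0 < r" "r \<le> \<rho> / 224"
  shows "measure P (cball p r) \<le> \<beta> * (f_max * (vol_up d * r ^ d)) + vol_amb D K0 * r ^ D"
proof (rule emeasure_P_le)
  show "hausdorff_outer d (M \<inter> cball p r) \<le> ennreal (vol_up d * r ^ d)"
  proof (cases "M \<inter> cball p r = {}")
    case False
    then obtain a where a: "a \<in> M" "dist p a \<le> r" by auto
    have sub: "M \<inter> cball p r \<subseteq> M \<inter> cball a (2 * r)"
      using a dist_triangle[of a _ p] by (auto simp: dist_commute) (smt (verit))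
    have "hausdorff_outer d (M \<inter> cball p r) \<le> hausdorff_outer d (M \<inter> cball a (2 * r))"
      unfolding hausdorff_outer_def using sub by (intro SUP_mono' INF_superset_mono) auto
    also have "\<dots> \<le> ennreal (unit_ball_vol (real d) * (4 * real d + 4) ^ d * (2 * r) ^ d)"
      using a assms by (intro hausdorff_outer_upper dD) auto
    also have "unit_ball_vol (real d) * (4 * real d + 4) ^ d * (2 * r) ^ d = unit_ball_vol (real d) * ((4 * real d + 4) * (2 * r)) ^ d"
      by (simp only: power_mult_distrib mult.assoc)
    also have "(4 * real d + 4) * (2 * r) = (8 * real d + 8) * r" by (simp add: algebra_simps)
    finally show ?thesis by (simp add: vol_up_def power_mult_distrib mult.assoc)
  qed simp
  show "emeasure (ball_uniform D K0) (cball p r) \<le> ennreal (vol_amb D K0 * r ^ D)"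
    unfolding vol_amb_def using K0_pos dD assms by (intro ball_uniform(3)) auto
qed (use assms vol_pos(2)[of d] vol_pos(3)[OF K0_pos, of D] dD in auto)

lemma outlier_ball_le:
  assumes "0 < r" shows "measure P (cball p r - M) \<le> vol_amb D K0 * r ^ D"
proof -
  have "measure P (cball p r - M) \<le> \<beta> * (f_max * 0) + vol_amb D K0 * r ^ D"
  proof (rule emeasure_P_le)
    have "M \<inter> (cball p r - M) = {}" by auto
    then show "hausdorff_outer d (M \<inter> (cball p r - M)) \<le> ennreal 0" by simp
    show "emeasure (ball_uniform D K0) (cball p r - M) \<le> ennreal (vol_amb D K0 * r ^ D)"
      unfolding vol_amb_def using K0_pos dD assms by (intro ball_uniform(3)) auto
  qed (use assms vol_pos(3)[OF K0_pos, of D] dD in auto)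
  then show ?thesis by simp
qed

lemma tube_borel: "{x. infdist x M \<le> s} \<in> sets borel"
  by (intro borel_closed closed_Collect_le continuous_intros)

text \<open>Of the order of (r / s)^d balls of radius \<open>s\<close> cover the nearby part of
  \<open>M\<close>, their doubles cover the tube, and each has outlier mass of order s^D. All feet
  concerned lie within \<open>4 * r\<close> of one of them, whence 448 = 4 * 112.\<close>

lemma outlier_tube_le:
  assumes s: "0 < s" "s \<le> r" and r: "r \<le> \<rho> / 448"
  shows "measure P (cball p r \<inter> {x. infdist x M \<le> s} - M) \<le> vol_tube d D K0 * (r ^ d * s ^ (D - d))"
proof -
  let ?B = "cball p r \<inter> {x. infdist x M \<le> s} - M"
  have B: "?B \<in> sets borel" using tube_borel[of s] by auto
  have nn: "0 \<le> vol_tube d D K0 * (r ^ d * s ^ (D - d))"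
    using s vol_pos(4)[OF K0_pos, of D d] dD by simp
  have "measure P ?B \<le> \<beta> * (f_max * 0) + vol_tube d D K0 * (r ^ d * s ^ (D - d))"
  proof (rule emeasure_P_le[OF B])
    have "M \<inter> ?B = {}" by auto
    then show "hausdorff_outer d (M \<inter> ?B) \<le> ennreal 0" by simp
    show "emeasure (ball_uniform D K0) ?B \<le> ennreal (vol_tube d D K0 * (r ^ d * s ^ (D - d)))"
    proof (cases "?B = {}")
      case False
      then obtain x0 where x0: "x0 \<in> ?B" by blast
      obtain a0 where a0: "foot M x0 a0" using foot_exists by blast
      have a0M: "a0 \<in> M" using a0 by (simp add: foot_def)
      have "4 * r \<le> \<rho> / 112" "s \<le> 2 * (4 * r)" using r s by auto
      then obtain F where F: "finite F" "real (card F) \<le> ((4 * real d + 4) * (4 * r / s)) ^ d"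
        "\<And>x. x \<in> M \<inter> cball a0 (4 * r) \<Longrightarrow> \<exists>z\<in>F. dist x z \<le> s"
        by (rule manifold_cover[OF dD(1) a0M _ s(1)]) auto
      have cover: "?B \<subseteq> (\<Union>z\<in>F. cball z (2 * s))"
      proof
        fix x assume x: "x \<in> ?B"
        obtain a where a: "foot M x a" using foot_exists by blast
        have "dist a0 a \<le> dist x0 a0 + dist p x0 + dist p x + dist x a"
          using dist_triangle[of a0 a x] dist_triangle[of a0 x p] dist_triangle[of a0 p x0] by (simp add: dist_commute)
        also have "\<dots> \<le> 4 * r" using x x0 a a0 s by (simp add: foot_def)
        finally obtain z where z: "z \<in> F" "dist a z \<le> s" using F(3)[of a] a by (auto simp: foot_def)
        have "dist z x \<le> dist a z + dist x a" using dist_triangle[of z x a] by (simp add: dist_commute)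
        also have "\<dots> \<le> 2 * s" using z x a by (simp add: foot_def)
        finally show "x \<in> (\<Union>z\<in>F. cball z (2 * s))" using z(1) by auto
      qed
      let ?U = "ball_uniform D K0"
      have sU: "sets ?U = sets borel" by (simp add: ball_uniform_def)
      have "emeasure ?U ?B \<le> emeasure ?U (\<Union>z\<in>F. cball z (2 * s))"
        using cover F(1) sU by (intro emeasure_mono) auto
      also have "\<dots> \<le> (\<Sum>z\<in>F. emeasure ?U (cball z (2 * s)))"
      proof (rule emeasure_subadditive_finite[OF F(1)])
        show "(\<lambda>z. cball z (2 * s)) ` F \<subseteq> sets ?U" unfolding sU by (intro image_subsetI borel_closed closed_cball)
      qed
      also have "\<dots> \<le> (\<Sum>z\<in>F. ennreal (vol_amb D K0 * (2 * s) ^ D))"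
        unfolding vol_amb_def using K0_pos dD s by (intro sum_mono ball_uniform(3)) auto
      also have "\<dots> = ennreal (real (card F) * (vol_amb D K0 * (2 * s) ^ D))"
        using s vol_pos(3)[OF K0_pos, of D] dD by (simp add: ennreal_mult' ennreal_of_nat_eq_real_of_nat)
      also have "\<dots> \<le> ennreal (((4 * real d + 4) * (4 * r / s)) ^ d * (vol_amb D K0 * (2 * s) ^ D))"
        using F(2) s vol_pos(3)[OF K0_pos, of D] dD by (intro ennreal_leI mult_right_mono) auto
      also have "((4 * real d + 4) * (4 * r / s)) ^ d * (vol_amb D K0 * (2 * s) ^ D) = vol_tube d D K0 * (r ^ d * s ^ (D - d))"
      proof -
        have 1: "(4 * real d + 4) * (4 * r / s) = (16 * real d + 16) * (r / s)" using s by (simp add: field_simps)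
        have 2: "s ^ D = s ^ d * s ^ (D - d)" by (subst power_add[symmetric]) (use dD in simp)
        have "(r / s) ^ d * s ^ D = r ^ d * s ^ (D - d)" using s by (simp add: 2 power_divide)
        moreover have "((16 * real d + 16) * (r / s)) ^ d * (vol_amb D K0 * (2 * s) ^ D) =
            (16 * real d + 16) ^ d * (vol_amb D K0 * 2 ^ D) * ((r / s) ^ d * s ^ D)"
          by (simp only: power_mult_distrib mult_ac)
        ultimately show ?thesis unfolding 1 vol_tube_def by (simp only:)
      qed
      finally show ?thesis .
    qed (simp only: emeasure_empty zero_le)
  qed (use nn in auto)
  then show ?thesis by simp
qed

lemma P_support: "measure P (- (euclid D \<inter> cball 0 K0)) = 0"
proof -
  let ?B = "- (euclid D \<inter> cball 0 K0)"
  have "?B \<in> sets borel" by (intro borel_comp borel_closed closed_Int closed_euclid closed_cball)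
  moreover have "M \<inter> ?B = {}" using ME M_cball by blast
  moreover have "emeasure (ball_uniform D K0) ?B = 0" using K0_pos dD by (intro ball_uniform(2)[of _ _ UNIV]) auto
  ultimately have "measure P ?B \<le> \<beta> * (f_max * 0) + 0" by (intro emeasure_P_le) (simp_all only: hausdorff_outer_empty order_refl zero_le)
  then show ?thesis by (simp add: measure_le_0_iff)
qed

end

section \<open>Local scatter and slabs\<close>

lemma linear_local_scatter: "linear (local_scatter Y h p)"
  unfolding local_scatter_def Let_def
  by (intro linearI) (simp_all add: inner_add_right scaleR_add_left sum.distrib scaleR_sum_right)

text \<open>Courant-Fischer: for a selected eigenvector \<open>e\<close>, take a unit vector of
  \<open>T\<close> orthogonal to the other selected ones. Its Rayleigh quotient involves only
  \<open>e\<close> and eigenvectors that were not selected, so it is at most the eigenvalue of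
  \<open>e\<close>.\<close>

lemma top_eigenspace_frame:
  assumes top: "top_eigenspace D d S V" and S: "linear S" and T: "dsub d T" "T \<subseteq> euclid D" and D: "1 \<le> D"
    and lower: "\<And>u. u \<in> T \<Longrightarrow> norm u = 1 \<Longrightarrow> b \<le> u \<bullet> S u"
  obtains E where "frame d E V" "V \<subseteq> euclid D" "\<And>e. e \<in> E \<Longrightarrow> \<exists>l\<ge>b. S e = l *\<^sub>R e"
proof -
  obtain B E l where B: "B \<subseteq> euclid D" "card B = D" "pairwise orthogonal B" "\<forall>b\<in>B. norm b = 1"
    "\<forall>b\<in>B. S b = l b *\<^sub>R b"
    and E: "E \<subseteq> B" "card E = d" "\<forall>e\<in>E. \<forall>b\<in>B - E. l b \<le> (l e :: real)" "V = span E"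
    using top unfolding top_eigenspace_def by blast
  have finB: "finite B" using B(2) D by (metis card.infinite not_one_le_zero)
  have ind: "independent B" using B(3,4) by (intro pairwise_orthogonal_independent) auto
  have FB: "frame D B (euclid D)"
    unfolding frame_def using finB B dsub_span_contained[OF dsub_euclid ind finB B(2,1)] by auto
  have FE: "frame d E V" unfolding frame_def
    using E B finB finite_subset pairwise_subset by (metis subsetD)
  have "b \<le> l e" if e: "e \<in> E" for e
  proof -
    have finE: "finite E" using E(1) finB finite_subset by blast
    have "card (E - {e}) < d" using e finE E(2) by (metis card_Diff1_less)
    then obtain u where u: "u \<in> T" "norm u = 1" "\<And>a. a \<in> E - {e} \<Longrightarrow> u \<bullet> a = 0"
      using dsub_orth_ex[OF T(1), of "E - {e}"] finE by auto
    have uD: "u \<in> euclid D" using u T by auto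
    have us: "u = (\<Sum>b\<in>B. (u \<bullet> b) *\<^sub>R b)" using proj_frame[OF FB, of u] proj_id[OF dsub_euclid uD] by simp
    have "S u = (\<Sum>b\<in>B. S ((u \<bullet> b) *\<^sub>R b))" by (subst us) (rule linear_sum[OF S])
    also have "\<dots> = (\<Sum>b\<in>B. (u \<bullet> b * l b) *\<^sub>R b)" using B(5) by (intro sum.cong) (auto simp: linear_cmul[OF S])
    finally have "u \<bullet> S u = (\<Sum>b\<in>B. l b * (u \<bullet> b)\<^sup>2)" by (simp add: inner_sum_right power2_eq_square mult_ac)
    also have "\<dots> \<le> (\<Sum>b\<in>B. l e * (u \<bullet> b)\<^sup>2)"
    proof (rule sum_mono)
      fix b assume b: "b \<in> B"
      show "l b * (u \<bullet> b)\<^sup>2 \<le> l e * (u \<bullet> b)\<^sup>2"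
      proof (cases "b \<in> E - {e}")
        case False
        then have "l b \<le> l e" using E(3) e b by (cases "b = e") auto
        then show ?thesis by (rule mult_right_mono) simp
      qed (simp add: u(3))
    qed
    also have "\<dots> = l e * (u \<bullet> (\<Sum>b\<in>B. (u \<bullet> b) *\<^sub>R b))"
      by (simp add: inner_sum_right power2_eq_square sum_distrib_left)
    also have "\<dots> = l e * (u \<bullet> u)" using us by simp
    also have "\<dots> = l e" using u(2) by (simp add: norm_eq_1)
    finally show ?thesis using lower[OF u(1,2)] by simp
  qed
  moreover have "S e = l e *\<^sub>R e" if "e \<in> E" for e using that B(5) E(1) by blast
  moreover have "V \<subseteq> euclid D" unfolding E(4) using E(1) B(1) by (intro span_minimal subspace_euclid) auto
  ultimately show ?thesis using FE by (intro that[of E]) blast+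
qed

lemma barycenter_sum:
  assumes "finite N" "N \<noteq> {}" shows "(\<Sum>q\<in>N. q - barycenter N) = (0 :: 'a :: real_vector)"
  using assms by (simp add: sum_subtractf barycenter_def sum_constant_scaleR)

lemma barycenter_dist:
  fixes p :: "'a :: real_normed_vector"
  assumes "finite N" "N \<noteq> {}" "\<And>q. q \<in> N \<Longrightarrow> norm (q - p) \<le> h"
  shows "norm (barycenter N - p) \<le> h"
proof -
  have c: "0 < real (card N)" using assms by (simp add: card_gt_0_iff)
  have "barycenter N - p = (\<Sum>q\<in>N. q - p) /\<^sub>R real (card N)"
    using c by (simp add: barycenter_def sum_subtractf sum_constant_scaleR scaleR_diff_right)
  then have "norm (barycenter N - p) = norm (\<Sum>q\<in>N. q - p) / real (card N)" by (simp add: divide_inverse)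
  also have "norm (\<Sum>q\<in>N. q - p) \<le> (\<Sum>q\<in>N. norm (q - p))" by (rule norm_sum)
  also have "\<dots> \<le> real (card N) * h" using assms(3) by (rule sum_bounded_above)
  finally show ?thesis using c by (simp add: divide_right_mono)
qed

lemma sum_gap_le:
  fixes f :: "'a \<Rightarrow> real"
  assumes "finite N" "G \<subseteq> N" "\<And>q. q \<in> G \<Longrightarrow> g \<le> \<bar>f q\<bar>" "0 \<le> g" "c \<le> real (card G)"
  shows "c * g\<^sup>2 \<le> (\<Sum>q\<in>N. (f q)\<^sup>2)"
proof -
  have "c * g\<^sup>2 \<le> real (card G) * g\<^sup>2" using assms(5) by (rule mult_right_mono) simp
  also have "\<dots> \<le> (\<Sum>q\<in>G. (f q)\<^sup>2)"
  proof (rule sum_bounded_below)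
    fix q assume "q \<in> G"
    then have "g\<^sup>2 \<le> \<bar>f q\<bar>\<^sup>2" using assms(3,4) by (intro power_mono) auto
    then show "g\<^sup>2 \<le> (f q)\<^sup>2" by simp
  qed
  also have "\<dots> \<le> (\<Sum>q\<in>N. (f q)\<^sup>2)" using assms(1,2) by (intro sum_mono2) auto
  finally show ?thesis .
qed

section \<open>Scatter matrices and slabs near a manifold\<close>

context reach_manifold
begin

text \<open>For an eigenvector \<open>e\<close> with eigenvalue \<open>l\<close> and a unit normal
  \<open>w\<close>, l (w . e) = w . S e. The right side sums products of a coordinate of size at
  most \<open>2 * h\<close> and a normal offset, of order h^2 / \<rho> for points of
  \<open>M\<close> and at most \<open>r\<close> for outliers. Points of \<open>M\<close> spread in
  every tangent direction bound \<open>l\<close> from below, and summing over \<open>d\<close>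
  eigenvectors gives the angle.\<close>

lemma TSE_angle:
  assumes Y: "finite Y" "Y \<subseteq> euclid D" and p: "p \<in> euclid D" and D: "1 \<le> D" and a: "foot M p a" "infdist p M \<le> h / 8"
    and h: "0 < h" "h < \<rho> / 28" and top: "top_eigenspace D d (local_scatter Y h p) T"
    and low: "\<And>y. y \<in> M \<Longrightarrow> nlow + 1 \<le> real (card (Y \<inter> (M \<inter> cball y (h / 32))))" "0 < nlow"
    and up: "real (card (Y \<inter> cball p (2 * h))) \<le> nup"
    and out: "real (card ((Y - M) \<inter> cball p (2 * h))) \<le> nout"
    and r: "0 \<le> r" "\<And>q w. q \<in> Y - M \<Longrightarrow> q \<in> cball p (2 * h) \<Longrightarrow> norm w = 1 \<Longrightarrow> w \<in> euclid D \<Longrightarrow>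
      (\<forall>v\<in>Tan a. w \<bullet> v = 0) \<Longrightarrow> \<bar>w \<bullet> (q - a)\<bar> \<le> r"
  shows "dsub d T" "T \<subseteq> euclid D"
    "dev T (Tan a) (real d * ((nup * (2 * h\<^sup>2 / \<rho>) + nout * r) * (2 * h) / (nlow * (h / 16)\<^sup>2)))"
proof -
  define N where "N = {q \<in> Y - {p}. q \<in> cball p h}"
  define m where "m = barycenter N"
  let ?S = "local_scatter Y h p"
  have finN: "finite N" using Y by (simp add: N_def)
  have aM: "a \<in> M" using a by (simp add: foot_def)
  have pa: "norm (p - a) \<le> h / 8" using a by (simp add: foot_def dist_norm)
  have S: "w \<bullet> ?S v = (\<Sum>q\<in>N. ((q - m) \<bullet> v) * ((q - m) \<bullet> w))" for v w
    unfolding local_scatter_def Let_def N_def[symmetric] m_def[symmetric]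
    by (simp add: inner_sum_right inner_commute[of w])
  \<comment> \<open>\<open>proj_surj\<close> gives a point \<open>y\<close> of \<open>M\<close> at
    offset \<open>h / 4\<close> in the direction \<open>u\<close>; sample points within
    \<open>h / 32\<close> of it keep an offset above \<open>h / 16\<close>.\<close>
  have group: "\<exists>G\<subseteq>N. nlow \<le> real (card G) \<and> (\<forall>q\<in>G. h / 16 \<le> (q - a) \<bullet> u)"
    if u: "u \<in> Tan a" "norm u = 1" for u
  proof -
    have uT: "(h / 4) *\<^sub>R u \<in> Tan a" by (intro subspace_scale dsub_subspace[OF dsub_Tan[OF aM]] u)
    have "norm ((h / 4) *\<^sub>R u) < \<rho> / 112" using h u by simp
    then obtain y where y: "y \<in> M" "proj (Tan a) (y - a) = (h / 4) *\<^sub>R u" "norm (y - a) \<le> 2 * norm ((h / 4) *\<^sub>R u)"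
      using proj_surj[OF aM uT] by blast
    have ya: "norm (y - a) \<le> h / 2" using y(3) u h by simp
    have "(y - a) \<bullet> u = h / 4"
      using proj_inner[OF dsub_Tan[OF aM] u(1), of "y - a"] y(2) u(2) by (simp add: norm_eq_1)
    let ?G = "Y \<inter> (M \<inter> cball y (h / 32)) - {p}"
    have close: "norm (q - y) \<le> h / 32" if "q \<in> ?G" for q using that by (simp add: dist_norm norm_minus_commute)
    have "?G \<subseteq> N"
    proof
      fix q assume q: "q \<in> ?G"
      have "norm (q - p) \<le> norm (q - y) + norm (y - a) + norm (p - a)"
        using norm_triangle_ineq[of "q - y" "y - a"] norm_triangle_ineq4[of "q - a" "p - a"] by simp
      also have "\<dots> \<le> h / 32 + h / 2 + h / 8" using close[OF q] ya pa by linarith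
      also have "\<dots> \<le> h" using h by simp
      finally show "q \<in> N" using q by (simp add: N_def dist_norm norm_minus_commute)
    qed
    \<comment> \<open>The scatter leaves out \<open>p\<close>, which may be one of the counted
      points; hence the \<open>nlow + 1\<close> in \<open>low\<close>.\<close>
    moreover have "nlow \<le> real (card ?G)"
    proof -
      have "card (Y \<inter> (M \<inter> cball y (h / 32))) \<le> card ?G + 1"
        using Y(1) by (metis Suc_eq_plus1 card.infinite card_Diff1_le card_Diff_singleton_if diff_le_self finite_Int le_diff_conv order_refl)
      then show ?thesis using low(1)[OF y(1)] by linarith
    qed
    moreover have "h / 16 \<le> (q - a) \<bullet> u" if q: "q \<in> ?G" for q
    proof -
      have "\<bar>(q - y) \<bullet> u\<bar> \<le> norm (q - y) * norm u" by (rule Cauchy_Schwarz_ineq2)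
      then have "- (h / 32) \<le> (q - y) \<bullet> u" using close[OF q] u(2) by simp
      moreover have "(q - a) \<bullet> u = (q - y) \<bullet> u + (y - a) \<bullet> u" by (simp add: inner_diff_left)
      ultimately show ?thesis using \<open>(y - a) \<bullet> u = h / 4\<close> h by simp
    qed
    ultimately show ?thesis by blast
  qed
  have lower: "nlow * (h / 16)\<^sup>2 \<le> u \<bullet> ?S u" if u: "u \<in> Tan a" "norm u = 1" for u
  proof -
    have Su: "u \<bullet> ?S u = (\<Sum>q\<in>N. ((q - m) \<bullet> u)\<^sup>2)" by (simp add: S power2_eq_square)
    have mu: "- u \<in> Tan a" "norm (- u) = 1" using u subspace_neg[OF dsub_subspace[OF dsub_Tan[OF aM]]] by auto
    show ?thesis
    \<comment> \<open>Whichever side of \<open>a\<close> the barycenter falls on, the group on the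
      other side is at least \<open>h / 16\<close> away from it.\<close>
    proof (cases "(m - a) \<bullet> u \<le> 0")
      case True
      obtain G where G: "G \<subseteq> N" "nlow \<le> real (card G)" "\<And>q. q \<in> G \<Longrightarrow> h / 16 \<le> (q - a) \<bullet> u" using group[OF u] by blast
      have "h / 16 \<le> \<bar>(q - m) \<bullet> u\<bar>" if "q \<in> G" for q
      proof -
        have "(q - m) \<bullet> u = (q - a) \<bullet> u - (m - a) \<bullet> u" by (simp add: inner_diff_left)
        then show ?thesis using G(3)[OF that] True by linarith
      qed
      then show ?thesis unfolding Su using finN G h by (intro sum_gap_le) auto
    next
      case False
      obtain G where G: "G \<subseteq> N" "nlow \<le> real (card G)" "\<And>q. q \<in> G \<Longrightarrow> h / 16 \<le> (q - a) \<bullet> (- u)" using group[OF mu] by blast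
      have "h / 16 \<le> \<bar>(q - m) \<bullet> u\<bar>" if "q \<in> G" for q
      proof -
        have "(q - m) \<bullet> u = (q - a) \<bullet> u - (m - a) \<bullet> u" by (simp add: inner_diff_left)
        moreover have "(q - a) \<bullet> (- u) = - ((q - a) \<bullet> u)" by simp
        ultimately show ?thesis using G(3)[OF that] False by linarith
      qed
      then show ?thesis unfolding Su using finN G h by (intro sum_gap_le) auto
    qed
  qed
  obtain E where E: "frame d E T" "T \<subseteq> euclid D" "\<And>e. e \<in> E \<Longrightarrow> \<exists>l\<ge>nlow * (h / 16)\<^sup>2. ?S e = l *\<^sub>R e"
    using top_eigenspace_frame[OF top linear_local_scatter dsub_Tan[OF aM] Tan_euclid[OF aM] D lower] by blast
  show "dsub d T" "T \<subseteq> euclid D" using E by (auto simp: dsub_def)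
  define \<Theta> where "\<Theta> = (nup * (2 * h\<^sup>2 / \<rho>) + nout * r) * (2 * h) / (nlow * (h / 16)\<^sup>2)"
  have nn: "0 \<le> nup" "0 \<le> nout" using up out of_nat_0_le_iff order_trans by blast+
  have den: "0 < nlow * (h / 16)\<^sup>2" using low h by simp
  have \<Theta>0: "0 \<le> \<Theta>" using nn r h \<rho> low by (simp add: \<Theta>_def)
  have we: "\<bar>w \<bullet> e\<bar> \<le> \<Theta>" if w: "norm w = 1" "w \<in> euclid D" "\<forall>v\<in>Tan a. w \<bullet> v = 0" and e: "e \<in> E" for w e
  proof -
    obtain l where l: "nlow * (h / 16)\<^sup>2 \<le> l" "?S e = l *\<^sub>R e" using E(3)[OF e] by blast
    have l0: "0 < l" using l(1) den by simp
    have ne: "norm e = 1" using E(1) e by (simp add: frame_def)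
    have "N \<noteq> {}"
    proof
      assume "N = {}"
      then have "e \<bullet> ?S e = 0" by (simp add: S)
      then show False using l ne l0 by (simp add: norm_eq_1)
    qed
    have Nh: "norm (q - p) \<le> h" if "q \<in> N" for q using that by (simp add: N_def dist_norm norm_minus_commute)
    have mp: "norm (m - p) \<le> h" unfolding m_def by (rule barycenter_dist[OF finN \<open>N \<noteq> {}\<close> Nh])
    have qe: "\<bar>(q - m) \<bullet> e\<bar> \<le> 2 * h" if "q \<in> N" for q
    proof -
      have "\<bar>(q - m) \<bullet> e\<bar> \<le> norm (q - m)" using Cauchy_Schwarz_ineq2[of "q - m" e] ne by simp
      also have "\<dots> \<le> norm (q - p) + norm (m - p)" using norm_triangle_ineq4[of "q - p" "m - p"] by simp
      finally show ?thesis using Nh[OF that] mp by simp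
    qed
    \<comment> \<open>Deviations from the barycenter sum to zero, so the barycenter may be replaced
      by \<open>a\<close> in the normal factor.\<close>
    have "(\<Sum>q\<in>N. ((q - m) \<bullet> e)) = 0"
      using barycenter_sum[OF finN \<open>N \<noteq> {}\<close>] by (simp add: inner_sum_left[symmetric] m_def)
    then have "(\<Sum>q\<in>N. ((q - m) \<bullet> e) * ((a - m) \<bullet> w)) = 0" by (simp add: sum_distrib_right[symmetric])
    then have "w \<bullet> ?S e = (\<Sum>q\<in>N. ((q - m) \<bullet> e) * ((q - m) \<bullet> w)) - (\<Sum>q\<in>N. ((q - m) \<bullet> e) * ((a - m) \<bullet> w))"
      by (simp add: S)
    also have "\<dots> = (\<Sum>q\<in>N. ((q - m) \<bullet> e) * (w \<bullet> (q - a)))"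
      unfolding sum_subtractf[symmetric]
      by (intro sum.cong) (auto simp: inner_diff_left inner_diff_right inner_commute algebra_simps)
    finally have "\<bar>w \<bullet> ?S e\<bar> \<le> (\<Sum>q\<in>N. \<bar>((q - m) \<bullet> e) * (w \<bullet> (q - a))\<bar>)" by (simp add: sum_abs)
    also have "\<dots> \<le> (\<Sum>q\<in>N. 2 * h * \<bar>w \<bullet> (q - a)\<bar>)"
      using qe by (intro sum_mono) (auto simp: abs_mult intro!: mult_right_mono)
    also have "\<dots> = 2 * h * (\<Sum>q\<in>N. \<bar>w \<bullet> (q - a)\<bar>)" by (simp add: sum_distrib_left)
    also have "(\<Sum>q\<in>N. \<bar>w \<bullet> (q - a)\<bar>) = (\<Sum>q\<in>N \<inter> M. \<bar>w \<bullet> (q - a)\<bar>) + (\<Sum>q\<in>N - M. \<bar>w \<bullet> (q - a)\<bar>)"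
      using sum.Int_Diff[OF finN] by blast
    also have "(\<Sum>q\<in>N \<inter> M. \<bar>w \<bullet> (q - a)\<bar>) \<le> real (card (N \<inter> M)) * (2 * h\<^sup>2 / \<rho>)"
    proof (rule sum_bounded_above)
      fix q assume q: "q \<in> N \<inter> M"
      have "norm (q - a) \<le> norm (q - p) + norm (p - a)" using norm_triangle_ineq[of "q - p" "p - a"] by simp
      also have "\<dots> \<le> 2 * h" using Nh[of q] q pa h by simp
      finally have "norm (q - a) \<le> 2 * h" .
      then have "(norm (q - a))\<^sup>2 / (2 * \<rho>) \<le> (2 * h)\<^sup>2 / (2 * \<rho>)" using \<rho> by (intro divide_right_mono power_mono) auto
      also have "\<dots> = 2 * h\<^sup>2 / \<rho>" by (simp add: power2_eq_square)
      finally have *: "(norm (q - a))\<^sup>2 / (2 * \<rho>) \<le> 2 * h\<^sup>2 / \<rho>" .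
      have mw: "- w \<in> euclid D" using w by (intro subspace_neg[OF subspace_euclid])
      show "\<bar>w \<bullet> (q - a)\<bar> \<le> 2 * h\<^sup>2 / \<rho>"
        using normal_ineq[OF aM w(2), of q] normal_ineq[OF aM mw, of q] w(1,3) q * by auto
    qed
    also have "(\<Sum>q\<in>N - M. \<bar>w \<bullet> (q - a)\<bar>) \<le> real (card (N - M)) * r"
      using r(2) w h by (intro sum_bounded_above) (auto simp: N_def)
    also have "real (card (N \<inter> M)) * (2 * h\<^sup>2 / \<rho>) + real (card (N - M)) * r \<le> nup * (2 * h\<^sup>2 / \<rho>) + nout * r"
    proof (intro add_mono mult_right_mono)
      have "card (N \<inter> M) \<le> card (Y \<inter> cball p (2 * h))" using Y h by (intro card_mono) (auto simp: N_def)
      then show "real (card (N \<inter> M)) \<le> nup" using up by linarith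
      have "card (N - M) \<le> card ((Y - M) \<inter> cball p (2 * h))" using Y h by (intro card_mono) (auto simp: N_def)
      then show "real (card (N - M)) \<le> nout" using out by linarith
    qed (use \<rho> r in auto)
    finally have "\<bar>w \<bullet> ?S e\<bar> \<le> 2 * h * (nup * (2 * h\<^sup>2 / \<rho>) + nout * r)" using h by simp
    then have "l * \<bar>w \<bullet> e\<bar> \<le> (nup * (2 * h\<^sup>2 / \<rho>) + nout * r) * (2 * h)"
      using l(2) l0 by (simp add: abs_mult mult_ac)
    moreover have "(nlow * (h / 16)\<^sup>2) * \<bar>w \<bullet> e\<bar> \<le> l * \<bar>w \<bullet> e\<bar>" using l(1) by (intro mult_right_mono) auto
    ultimately show ?thesis unfolding \<Theta>_def using den by (simp add: pos_le_divide_eq mult_ac)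
  qed
  have "dev T (Tan a) (real d * \<Theta>)"
  proof (rule devI[OF dsub_Tan[OF aM] E(2) Tan_euclid[OF aM]])
    show "0 \<le> real d * \<Theta>" using \<Theta>0 by simp
    fix u w assume u: "u \<in> T" and w: "w \<in> euclid D" "\<forall>v\<in>Tan a. w \<bullet> v = 0"
    show "w \<bullet> u \<le> real d * \<Theta> * norm w * norm u"
    proof (cases "w = 0")
      case False
      let ?w = "(1 / norm w) *\<^sub>R w"
      have nw: "norm ?w = 1" "?w \<in> euclid D" "\<forall>v\<in>Tan a. ?w \<bullet> v = 0"
        using False w by (auto intro: subspace_scale[OF subspace_euclid])
      have "u = (\<Sum>e\<in>E. (u \<bullet> e) *\<^sub>R e)"
        using proj_frame[OF E(1), of u] proj_id[OF \<open>dsub d T\<close> u] by simp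
      then have "?w \<bullet> u = (\<Sum>e\<in>E. (u \<bullet> e) * (?w \<bullet> e))" by (metis (no_types, lifting) inner_scaleR_right inner_sum_right sum.cong)
      also have "\<dots> \<le> (\<Sum>e\<in>E. \<bar>(u \<bullet> e) * (?w \<bullet> e)\<bar>)" by (intro sum_mono abs_ge_self)
      also have "\<dots> \<le> real (card E) * (norm u * \<Theta>)"
      proof (rule sum_bounded_above)
        fix e assume e: "e \<in> E"
        have "\<bar>u \<bullet> e\<bar> \<le> norm u" using Cauchy_Schwarz_ineq2[of u e] e E(1) by (simp add: frame_def)
        then show "\<bar>(u \<bullet> e) * (?w \<bullet> e)\<bar> \<le> norm u * \<Theta>"
          unfolding abs_mult using we[OF nw e] by (intro mult_mono) auto
      qed
      finally have "norm w * (?w \<bullet> u) \<le> norm w * (real (card E) * (norm u * \<Theta>))" by (rule mult_left_mono) simp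
      moreover have "norm w * (?w \<bullet> u) = w \<bullet> u" using False by simp
      moreover have "card E = d" using E(1) by (simp add: frame_def)
      ultimately show ?thesis by (simp add: mult_ac)
    qed simp
  qed
  then show "dev T (Tan a) (real d * ((nup * (2 * h\<^sup>2 / \<rho>) + nout * r) * (2 * h) / (nlow * (h / 16)\<^sup>2)))"
    by (simp only: \<Theta>_def)
qed

lemma normal_near_tube:
  assumes "a \<in> M" "w \<in> euclid D" "norm w = 1" "\<forall>v\<in>Tan a. w \<bullet> v = 0" "infdist q M \<le> \<tau>" "norm (q - a) \<le> R"
  shows "\<bar>w \<bullet> (q - a)\<bar> \<le> \<tau> + (R + \<tau>)\<^sup>2 / (2 * \<rho>)"
proof -
  obtain b where b: "foot M q b" using foot_exists by blast
  have qb: "norm (q - b) \<le> \<tau>" "b \<in> M" using b assms(5) by (auto simp: foot_def dist_norm)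
  have "norm (b - a) \<le> R + \<tau>"
    using norm_triangle_ineq[of "b - q" "q - a"] qb assms(6) by (simp add: norm_minus_commute)
  then have "(norm (b - a))\<^sup>2 / (2 * \<rho>) \<le> (R + \<tau>)\<^sup>2 / (2 * \<rho>)" using \<rho> by (intro divide_right_mono power_mono) auto
  moreover have "- w \<in> euclid D" using assms(2) by (rule subspace_neg[OF subspace_euclid])
  ultimately have "\<bar>w \<bullet> (b - a)\<bar> \<le> (R + \<tau>)\<^sup>2 / (2 * \<rho>)"
    using normal_ineq[OF assms(1,2) _ qb(2)] normal_ineq[OF assms(1) _ _ qb(2), of "- w"] assms(3,4) by auto
  moreover have "\<bar>w \<bullet> (q - b)\<bar> \<le> \<tau>" using Cauchy_Schwarz_ineq2[of w "q - b"] assms(3) qb by simp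
  moreover have "w \<bullet> (q - a) = w \<bullet> (q - b) + w \<bullet> (b - a)" by (simp add: inner_diff_right)
  ultimately show ?thesis by linarith
qed

text \<open>A chord of \<open>M\<close> from \<open>p\<close> leaves \<open>T\<close> by its
  deviation from \<open>Tan p\<close>, quadratic in its length, and by the angle of order
  \<open>h\<close> times its length. Both are of order h^2, like the thickness of the slab.\<close>

lemma slab_contains_manifold_ball:
  assumes p: "p \<in> M" and T: "dsub d T" "T \<subseteq> euclid D" "dev T (Tan p) (A * h)" "0 \<le> A" "A * h \<le> 1 / 2"
    and h: "0 < h" and \<kappa>: "0 < \<kappa>" "\<kappa> \<le> k\<^sub>1" "\<kappa>\<^sup>2 / (2 * \<rho>) + 2 * A * \<kappa> \<le> k\<^sub>2"
  shows "M \<inter> cball p (\<kappa> * h) \<subseteq> slab D k\<^sub>1 k\<^sub>2 p T h"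
proof
  fix y assume y: "y \<in> M \<inter> cball p (\<kappa> * h)"
  let ?v = "y - p"
  have nv: "norm ?v \<le> \<kappa> * h" using y by (simp add: dist_norm norm_minus_commute)
  have "dev (Tan p) T (2 * (A * h))"
    using T h by (intro dev_sym[OF T(1) dsub_Tan[OF p] T(2) Tan_euclid[OF p]]) auto
  let ?u = "proj (Tan p) ?v"
  have "norm (?v - proj T ?v) \<le> norm (?v - proj T ?u)" by (rule proj_best[OF T(1) proj_in[OF T(1)]])
  also have "\<dots> \<le> norm (?v - ?u) + norm (?u - proj T ?u)" using norm_triangle_ineq[of "?v - ?u" "?u - proj T ?u"] by simp
  also have "norm (?v - ?u) \<le> (norm ?v)\<^sup>2 / (2 * \<rho>)" using y by (intro normal_part p) auto
  also have "\<dots> \<le> (\<kappa> * h)\<^sup>2 / (2 * \<rho>)" using nv \<rho> by (intro divide_right_mono power_mono) auto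
  also have "norm (?u - proj T ?u) \<le> 2 * (A * h) * norm ?u"
    by (rule devD[OF \<open>dev (Tan p) T (2 * (A * h))\<close> proj_in[OF dsub_Tan[OF p]]])
  also have "\<dots> \<le> 2 * (A * h) * (\<kappa> * h)"
    using nv norm_proj_le[OF dsub_Tan[OF p], of ?v] T(4) h by (intro mult_left_mono) auto
  also have "(\<kappa> * h)\<^sup>2 / (2 * \<rho>) + 2 * (A * h) * (\<kappa> * h) = (\<kappa>\<^sup>2 / (2 * \<rho>) + 2 * A * \<kappa>) * h\<^sup>2"
    by (simp add: power2_eq_square algebra_simps)
  also have "\<dots> \<le> k\<^sub>2 * h\<^sup>2" using \<kappa>(3) by (rule mult_right_mono) simp
  finally have 1: "norm (?v - proj T ?v) \<le> k\<^sub>2 * h\<^sup>2" by simp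
  have "norm (proj T ?v) \<le> \<kappa> * h" using norm_proj_le[OF T(1), of ?v] nv by linarith
  also have "\<dots> \<le> k\<^sub>1 * h" using \<kappa> h by simp
  finally have 2: "norm (proj T ?v) \<le> k\<^sub>1 * h" .
  have "?v \<in> euclid D" using y p ME by (auto intro: subspace_diff[OF subspace_euclid])
  then have "?v - proj T ?v \<in> orth_compl D T"
    using proj_in[OF T(1), of ?v] T(2) proj_orth[OF T(1)]
    by (auto simp: orth_compl_def intro!: subspace_diff[OF subspace_euclid, of ?v])
  moreover have "y = p + proj T ?v + (?v - proj T ?v)" by simp
  ultimately show "y \<in> slab D k\<^sub>1 k\<^sub>2 p T h"
    unfolding slab_def using 1 2 proj_in[OF T(1), of ?v] by blast
qed

text \<open>Pairing \<open>y - a\<close> with the normal vector \<open>p - a\<close> yields the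
  square of the distance \<open>s\<close> plus terms that, like the bound on the pairing, carry a
  factor \<open>s\<close>. Dividing by \<open>s\<close> turns a mere hit into a distance of order
  h^2.\<close>

lemma slab_hits_manifold:
  assumes p: "p \<in> euclid D" and y: "y \<in> M" "y \<in> slab D k\<^sub>1 k\<^sub>2 p T h" and a: "foot M p a"
    and T: "dev T (Tan a) (A * h)" "0 \<le> A" and h: "0 < h" and k: "0 \<le> k\<^sub>1" "0 \<le> k\<^sub>2" "k\<^sub>2 * h \<le> k\<^sub>1"
    and inf: "infdist p M < \<rho>"
  shows "infdist p M \<le> (8 * k\<^sub>1\<^sup>2 / \<rho> + A * k\<^sub>1 + k\<^sub>2) * h\<^sup>2"
proof -
  obtain u w where uw: "y = p + u + w" "u \<in> T" "norm u \<le> k\<^sub>1 * h" "norm w \<le> k\<^sub>2 * h\<^sup>2"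
    using y(2) unfolding slab_def by blast
  have aM: "a \<in> M" using a by (simp add: foot_def)
  define s where "s = norm (p - a)"
  have s: "infdist p M = s" using a by (simp add: foot_def dist_norm s_def)
  have "k\<^sub>2 * h\<^sup>2 \<le> k\<^sub>1 * h" using mult_right_mono[OF k(3), of h] h by (simp add: power2_eq_square mult_ac)
  then have yp: "norm (y - p) \<le> 2 * (k\<^sub>1 * h)" using uw norm_triangle_ineq[of u w] by simp
  have "s \<le> norm (y - p)" using foot_le[OF a y(1)] by (simp add: s_def dist_norm norm_minus_commute)
  then have "norm (y - a) \<le> 4 * (k\<^sub>1 * h)"
    using norm_triangle_ineq[of "y - p" "p - a"] yp by (simp add: s_def)
  then have "(norm (y - a))\<^sup>2 / (2 * \<rho>) \<le> (4 * (k\<^sub>1 * h))\<^sup>2 / (2 * \<rho>)" using \<rho> by (intro divide_right_mono power_mono) auto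
  also have "\<dots> = 8 * k\<^sub>1\<^sup>2 / \<rho> * h\<^sup>2" by (simp add: power2_eq_square)
  finally have q: "(norm (y - a))\<^sup>2 / (2 * \<rho>) \<le> 8 * k\<^sub>1\<^sup>2 / \<rho> * h\<^sup>2" .
  have "(p - a) \<bullet> (y - a) \<le> s * ((norm (y - a))\<^sup>2 / (2 * \<rho>))"
    unfolding s_def by (rule foot_ineq[OF p inf a y(1)])
  also have "\<dots> \<le> s * (8 * k\<^sub>1\<^sup>2 / \<rho> * h\<^sup>2)" using q by (rule mult_left_mono) (simp add: s_def)
  finally have 1: "(p - a) \<bullet> (y - a) \<le> s * (8 * k\<^sub>1\<^sup>2 / \<rho> * h\<^sup>2)" .
  have "(p - a) \<bullet> (y - a) = s\<^sup>2 + (p - a) \<bullet> u + (p - a) \<bullet> w"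
    unfolding s_def power2_norm_eq_inner uw(1) by (simp add: inner_diff_right inner_add_right)
  moreover have "\<bar>(p - a) \<bullet> u\<bar> \<le> A * h * s * norm u"
    unfolding s_def by (rule dev_inner[OF dsub_Tan[OF aM] T(1) uw(2)]) (rule foot_normal[OF a])
  moreover have "A * h * s * norm u \<le> A * h * s * (k\<^sub>1 * h)" using uw(3) T(2) h by (intro mult_left_mono) (auto simp: s_def)
  moreover have "\<bar>(p - a) \<bullet> w\<bar> \<le> s * norm w" unfolding s_def by (rule Cauchy_Schwarz_ineq2)
  moreover have "s * norm w \<le> s * (k\<^sub>2 * h\<^sup>2)" using uw(4) by (intro mult_left_mono) (auto simp: s_def)
  ultimately have "s\<^sup>2 \<le> s * (8 * k\<^sub>1\<^sup>2 / \<rho> * h\<^sup>2) + A * h * s * (k\<^sub>1 * h) + s * (k\<^sub>2 * h\<^sup>2)" using 1 by linarith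
  also have "\<dots> = s * ((8 * k\<^sub>1\<^sup>2 / \<rho> + A * k\<^sub>1 + k\<^sub>2) * h\<^sup>2)" by (simp add: power2_eq_square algebra_simps)
  finally have main: "s * s \<le> s * ((8 * k\<^sub>1\<^sup>2 / \<rho> + A * k\<^sub>1 + k\<^sub>2) * h\<^sup>2)" by (simp add: power2_eq_square)
  show ?thesis
  proof (cases "s = 0")
    case True
    then show ?thesis using s k T \<rho> by simp
  next
    case False
    then have "0 < s" by (simp add: s_def)
    then show ?thesis using main s mult_left_le_imp_le by metis
  qed
qed

end

lemma slab_subset_cball:
  assumes "0 \<le> h" "k\<^sub>1 * h + k\<^sub>2 * h\<^sup>2 \<le> R" shows "slab D k\<^sub>1 k\<^sub>2 p T h \<subseteq> cball p R"
proof
  fix y assume "y \<in> slab D k\<^sub>1 k\<^sub>2 p T h"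
  then obtain u w where uw: "y = p + u + w" "norm u \<le> k\<^sub>1 * h" "norm w \<le> k\<^sub>2 * h\<^sup>2" unfolding slab_def by blast
  then have "norm (u + w) \<le> R" using norm_triangle_ineq[of u w] assms by linarith
  moreover have "dist p y = norm (u + w)" unfolding uw(1) dist_norm by (metis add.assoc add_diff_cancel_left' norm_minus_commute)
  ultimately show "y \<in> cball p R" by simp
qed

section \<open>Perturbations of the identity\<close>

text \<open>\<open>finseq\<close> itself is not complete, so fixed points are sought in
  \<open>euclid D\<close>.\<close>

lemma complete_euclid: "uniform_space_class.complete (euclid D)"
  unfolding metric_space_class.complete_def
proof (intro allI impI, elim conjE)
  fix X :: "nat \<Rightarrow> finseq" assume X: "\<forall>n. X n \<in> euclid D" "Cauchy X"
  obtain R where R: "\<And>n. norm (X n) \<le> R" using cauchy_imp_bounded[OF X(2)] by (auto simp: bounded_iff)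
  have "\<forall>n. X n \<in> euclid D \<inter> cball 0 R" using X(1) R by simp
  then show "\<exists>l\<in>euclid D. X \<longlonglongrightarrow> l"
    using compact_imp_complete[OF compact_euclid_cball0[of D R]] X(2) unfolding metric_space_class.complete_def by fastforce
qed

text \<open>Solving x + e x = y amounts to finding the fixed point of a contraction with factor
  1/2.\<close>

lemma perturbed_identity_bij:
  assumes e: "\<And>x. x \<in> euclid D \<Longrightarrow> e x \<in> euclid D"
    and lip: "\<And>x y. norm (e x - e y) \<le> 1 / 2 * norm (x - y :: finseq)"
  shows "inj_on (\<lambda>x. x + e x) (euclid D)" "(\<lambda>x. x + e x) ` euclid D = euclid D"
    "norm (x - y) \<le> 2 * norm (x + e x - (y + e y))"
proof -
  show *: "norm (x - y) \<le> 2 * norm (x + e x - (y + e y))" for x y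
  proof -
    have "norm (x - y) \<le> norm (x + e x - (y + e y)) + norm (e x - e y)"
      using norm_triangle_ineq4[of "x + e x - (y + e y)" "e x - e y"] by (simp add: algebra_simps)
    then show ?thesis using lip[of x y] by linarith
  qed
  show "inj_on (\<lambda>x. x + e x) (euclid D)"
  proof (rule inj_onI)
    fix x y assume "x + e x = y + e y"
    then show "x = y" using *[of x y] by simp
  qed
  show "(\<lambda>x. x + e x) ` euclid D = euclid D"
  proof
    show "(\<lambda>x. x + e x) ` euclid D \<subseteq> euclid D" using e by (auto intro: subspace_add[OF subspace_euclid])
    show "euclid D \<subseteq> (\<lambda>x. x + e x) ` euclid D"
    proof
      fix y assume y: "y \<in> euclid D"
      have "\<exists>!x\<in>euclid D. y - e x = x"
      proof (rule Banach_fix[OF complete_euclid])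
        show "(\<lambda>x. y - e x) ` euclid D \<subseteq> euclid D" using e y by (auto intro: subspace_diff[OF subspace_euclid])
        fix x z show "dist (y - e x) (y - e z) \<le> 1 / 2 * dist x z"
          using lip[of z x] by (simp add: dist_norm norm_minus_commute)
      qed (use y in auto)
      then obtain x where "x \<in> euclid D" "y - e x = x" by blast
      then have "y = x + e x" by (metis diff_add_cancel)
      then show "y \<in> (\<lambda>x. x + e x) ` euclid D" using \<open>x \<in> euclid D\<close> by blast
    qed
  qed
qed

lemma perturbed_identity_homeomorphism:
  assumes e: "\<And>x. x \<in> euclid D \<Longrightarrow> e x \<in> euclid D"
    and lip: "\<And>x y. norm (e x - e y) \<le> 1 / 2 * norm (x - y :: finseq)"
  shows "homeomorphism (euclid D) (euclid D) (\<lambda>x. x + e x) (inv_into (euclid D) (\<lambda>x. x + e x))"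
proof -
  let ?f = "\<lambda>x. x + e x"
  note b = perturbed_identity_bij[OF e lip]
  have "continuous_on (euclid D) e"
  proof (rule continuous_onI)
    fix x \<epsilon> :: real fix x :: finseq assume "0 < \<epsilon>"
    show "\<exists>d>0. \<forall>x'\<in>euclid D. dist x' x < d \<longrightarrow> dist (e x') (e x) \<le> \<epsilon>"
    proof (intro exI conjI ballI impI)
      fix x' assume "dist x' x < \<epsilon>"
      moreover have "norm (e x' - e x) \<le> 1 / 2 * norm (x' - x)" by (rule lip)
      ultimately show "dist (e x') (e x) \<le> \<epsilon>" using zero_le_dist[of x' x] unfolding dist_norm by linarith
    qed (rule \<open>0 < \<epsilon>\<close>)
  qed
  then have c1: "continuous_on (euclid D) ?f" by (intro continuous_intros)
  have c2: "continuous_on (euclid D) (inv_into (euclid D) ?f)"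
  proof (rule continuous_onI)
    fix y and \<epsilon> :: real assume y: "y \<in> euclid D" and \<epsilon>: "0 < \<epsilon>"
    show "\<exists>d>0. \<forall>y'\<in>euclid D. dist y' y < d \<longrightarrow> dist (inv_into (euclid D) ?f y') (inv_into (euclid D) ?f y) \<le> \<epsilon>"
    proof (intro exI conjI ballI impI)
      fix y' assume y': "y' \<in> euclid D" "dist y' y < \<epsilon> / 2"
      have "?f (inv_into (euclid D) ?f y') = y'" "?f (inv_into (euclid D) ?f y) = y"
        using y y'(1) b(2) by (auto intro: f_inv_into_f)
      then show "dist (inv_into (euclid D) ?f y') (inv_into (euclid D) ?f y) \<le> \<epsilon>"
        using b(3)[of "inv_into (euclid D) ?f y'" "inv_into (euclid D) ?f y"] y'(2) by (simp add: dist_norm)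
    qed (use \<epsilon> in simp)
  qed
  have inv: "inv_into (euclid D) ?f (?f x) = x" if "x \<in> euclid D" for x
    by (rule inv_into_f_f[OF b(1) that])
  have "inv_into (euclid D) ?f ` euclid D = inv_into (euclid D) ?f ` ?f ` euclid D" by (simp only: b(2))
  also have "\<dots> = euclid D" unfolding image_image using inv by simp
  finally show ?thesis
    unfolding homeomorphism_def using c1 c2 b(2) inv f_inv_into_f[of _ ?f "euclid D"] by simp
qed

text \<open>Concatenation at half time; the second isotopy starts from the identity, so the two
  halves agree there.\<close>

lemma ambient_isotopic_trans:
  assumes "ambient_isotopic D A B" "ambient_isotopic D B C" shows "ambient_isotopic D A C"
proof -
  obtain F where F: "continuous_on ({0..1} \<times> euclid D) (\<lambda>(s, x). F s x)"
    "\<And>s. s \<in> {0..1} \<Longrightarrow> \<exists>G. homeomorphism (euclid D) (euclid D) (F s) G"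
    "\<And>x. x \<in> euclid D \<Longrightarrow> F (0::real) x = x" "F 1 ` A = B"
    using assms(1) unfolding ambient_isotopic_def by blast
  obtain H where H: "continuous_on ({0..1} \<times> euclid D) (\<lambda>(s, x). H s x)"
    "\<And>s. s \<in> {0..1} \<Longrightarrow> \<exists>G. homeomorphism (euclid D) (euclid D) (H s) G"
    "\<And>x. x \<in> euclid D \<Longrightarrow> H (0::real) x = x" "H 1 ` B = C"
    using assms(2) unfolding ambient_isotopic_def by blast
  have Fim: "F s x \<in> euclid D" if "s \<in> {0..1}" "x \<in> euclid D" for s x
    using F(2)[OF that(1)] that(2) by (auto simp: homeomorphism_def)
  define J where "J s = (if s \<le> 1 / 2 then F (2 * s) else H (2 * s - 1) \<circ> F 1)" for s
  have "continuous_on ({0..1/2} \<times> euclid D) ((\<lambda>(s, x). F s x) \<circ> (\<lambda>(s, x). (2 * s, x)))"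
    by (intro continuous_on_compose continuous_on_subset[OF F(1)])
      (auto simp: case_prod_unfold intro!: continuous_intros)
  then have 1: "continuous_on ({0..1/2} \<times> euclid D) (\<lambda>(s, x). J s x)"
    by (rule continuous_on_cong[THEN iffD1, rotated 2]) (auto simp: J_def)
  have cF: "continuous_on ({1/2..1} \<times> euclid D) (\<lambda>z. F 1 (snd z))"
    using F(2)[of 1] by (auto simp: homeomorphism_def intro!: continuous_on_compose2[of "euclid D" "F 1"] continuous_intros)
  have "continuous_on ({1/2..1::real} \<times> euclid D) (\<lambda>z. (2 * fst z - 1, F 1 (snd z)))"
    by (intro continuous_intros cF)
  then have "continuous_on ({1/2..1} \<times> euclid D) (\<lambda>z. (\<lambda>(s, x). H s x) (2 * fst z - 1, F 1 (snd z)))"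
    by (rule continuous_on_compose2[OF H(1)]) (auto intro: Fim)
  then have 2: "continuous_on ({1/2..1} \<times> euclid D) (\<lambda>(s, x). J s x)"
  proof (rule continuous_on_cong[THEN iffD1, rotated 2])
    fix z assume "z \<in> {1/2..1::real} \<times> euclid D"
    then obtain s x where z: "z = (s, x)" "1/2 \<le> s" "s \<le> 1" "x \<in> euclid D" by auto
    then show "(\<lambda>(s, x). H s x) (2 * fst z - 1, F 1 (snd z)) = (\<lambda>(s, x). J s x) z"
      using H(3)[OF Fim[of 1 x]] by (cases "s = 1/2") (auto simp: J_def)
  qed simp
  have "continuous_on ({0..1/2} \<times> euclid D \<union> {1/2..1} \<times> euclid D) (\<lambda>(s, x). J s x)"
    by (intro continuous_on_closed_Un 1 2 closed_Times closed_euclid) auto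
  moreover have "{0..1/2} \<times> euclid D \<union> {1/2..1} \<times> euclid D = {0..1::real} \<times> euclid D" by auto
  ultimately have "continuous_on ({0..1} \<times> euclid D) (\<lambda>(s, x). J s x)" by simp
  moreover have "\<exists>G. homeomorphism (euclid D) (euclid D) (J s) G" if s: "s \<in> {0..1}" for s
  proof (cases "s \<le> 1 / 2")
    case True
    then show ?thesis using F(2)[of "2 * s"] s by (auto simp: J_def)
  next
    case False
    obtain G1 G2 where "homeomorphism (euclid D) (euclid D) (F 1) G1"
      "homeomorphism (euclid D) (euclid D) (H (2 * s - 1)) G2"
      using F(2)[of 1] H(2)[of "2 * s - 1"] s False by auto
    then have "homeomorphism (euclid D) (euclid D) (H (2 * s - 1) \<circ> F 1) (G1 \<circ> G2)" by (rule homeomorphism_compose)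
    then show ?thesis using False by (auto simp: J_def)
  qed
  moreover have "J 0 x = x" if "x \<in> euclid D" for x using F(3)[OF that] by (simp add: J_def)
  moreover have "J 1 ` A = C" unfolding F(4)[symmetric] H(4)[symmetric] by (simp add: J_def image_image)
  ultimately show ?thesis unfolding ambient_isotopic_def by blast
qed

text \<open>A displacement of class C^1,1; \<open>L\<close> takes the place of a bound on its second
  derivatives.\<close>

locale near_id =
  fixes D :: nat and e :: "finseq \<Rightarrow> finseq" and e' :: "finseq \<Rightarrow> finseq \<Rightarrow>\<^sub>L finseq" and L :: real
  assumes der: "\<And>x. (e has_derivative blinfun_apply (e' x)) (at x)" and eE: "\<And>x. e x \<in> euclid D"
    and norm_e': "\<And>x. norm (e' x) \<le> 1 / 2" and lip_e': "\<And>x y. norm (e' x - e' y) \<le> L * norm (x - y)"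
    and L: "0 \<le> L"
begin

definition "\<Phi> x = x + e x"
definition "\<Psi> = inv_into (euclid D) \<Phi>"

lemma lip_e: "norm (e x - e y) \<le> 1 / 2 * norm (x - y)"
  by (rule differentiable_bound[OF convex_UNIV, of e "\<lambda>x. blinfun_apply (e' x)"])
    (use der norm_e' in \<open>auto simp: norm_blinfun.rep_eq[symmetric]\<close>)

lemma homeo: "homeomorphism (euclid D) (euclid D) \<Phi> \<Psi>"
  using perturbed_identity_homeomorphism[of D e, OF eE lip_e] by (simp add: \<Phi>_def[abs_def] \<Psi>_def)

lemma \<Phi>_lower: "norm (x - y) \<le> 2 * norm (\<Phi> x - \<Phi> y)"
  unfolding \<Phi>_def by (rule perturbed_identity_bij(3)[of D e, OF eE lip_e])

lemma \<Phi>_in: "x \<in> euclid D \<Longrightarrow> \<Phi> x \<in> euclid D" and \<Psi>_in: "y \<in> euclid D \<Longrightarrow> \<Psi> y \<in> euclid D"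
  and \<Psi>\<Phi>: "x \<in> euclid D \<Longrightarrow> \<Psi> (\<Phi> x) = x" and \<Phi>\<Psi>: "y \<in> euclid D \<Longrightarrow> \<Phi> (\<Psi> y) = y"
  using homeo by (auto simp: homeomorphism_def)

lemma \<Psi>_lip: "y \<in> euclid D \<Longrightarrow> y' \<in> euclid D \<Longrightarrow> norm (\<Psi> y - \<Psi> y') \<le> 2 * norm (y - y')"
  using \<Phi>_lower[of "\<Psi> y" "\<Psi> y'"] \<Phi>\<Psi> by simp

text \<open>The straight-line homotopy: scaling \<open>e\<close> by \<open>s\<close> in [0, 1] keeps
  its Lipschitz constant at most 1/2, so every stage is a homeomorphism.\<close>

lemma isotopic: assumes "M \<subseteq> euclid D" shows "ambient_isotopic D M (\<Phi> ` M)"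
  unfolding ambient_isotopic_def
proof (intro exI[of _ "\<lambda>s x. x + s *\<^sub>R e x"] conjI ballI)
  have "continuous_on UNIV e"
    using der by (meson continuous_at_imp_continuous_on has_derivative_continuous)
  then have "continuous_on ({0..1::real} \<times> euclid D) (\<lambda>z. e (snd z))"
    by (rule continuous_on_compose2) (auto intro: continuous_intros)
  then have "continuous_on ({0..1} \<times> euclid D) (\<lambda>z. snd z + fst z *\<^sub>R e (snd z))"
    by (intro continuous_intros)
  then show "continuous_on ({0..1} \<times> euclid D) (\<lambda>(s, x). x + s *\<^sub>R e x)" by (simp add: case_prod_unfold)
  fix s :: real assume s: "s \<in> {0..1}"
  have "homeomorphism (euclid D) (euclid D) (\<lambda>x. x + s *\<^sub>R e x) (inv_into (euclid D) (\<lambda>x. x + s *\<^sub>R e x))"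
  proof (rule perturbed_identity_homeomorphism)
    fix x y
    have "norm (s *\<^sub>R e x - s *\<^sub>R e y) = s * norm (e x - e y)" using s by (simp flip: scaleR_diff_right)
    also have "\<dots> \<le> 1 * norm (e x - e y)" using s by (intro mult_right_mono) auto
    finally show "norm (s *\<^sub>R e x - s *\<^sub>R e y) \<le> 1 / 2 * norm (x - y)" using lip_e[of x y] by simp
  qed (use eE in \<open>auto intro: subspace_scale[OF subspace_euclid]\<close>)
  then show "\<exists>G. homeomorphism (euclid D) (euclid D) (\<lambda>x. x + s *\<^sub>R e x) G" by blast
qed (auto simp: \<Phi>_def)

lemma taylor: "norm (\<Phi> y - \<Phi> x - ((y - x) + e' x (y - x))) \<le> L * (norm (y - x))\<^sup>2"
proof -
  have "norm (e y - e x - e' x (y - x)) \<le> norm (y - x) * (L * norm (y - x))"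
  proof (rule differentiable_bound_linearization[where S = "closed_segment x y" and f' = "\<lambda>x. blinfun_apply (e' x)"])
    show "x + t *\<^sub>R (y - x) \<in> closed_segment x y" if "t \<in> {0..1}" for t
      unfolding closed_segment_def using that by (intro CollectI exI[of _ t]) (simp add: algebra_simps)
    show "\<And>z. z \<in> closed_segment x y \<Longrightarrow> (e has_derivative blinfun_apply (e' z)) (at z within closed_segment x y)"
      using der by (rule has_derivative_at_withinI)
    show "onorm (blinfun_apply (e' z) - blinfun_apply (e' x)) \<le> L * norm (y - x)" if z: "z \<in> closed_segment x y" for z
    proof -
    from z have "norm (z - x) \<le> norm (y - x)" using segment_bound1 by blast
    then have "L * norm (z - x) \<le> L * norm (y - x)" using L by (rule mult_left_mono)
    moreover have "onorm (blinfun_apply (e' z) - blinfun_apply (e' x)) = norm (e' z - e' x)"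
      by (simp add: norm_blinfun.rep_eq minus_blinfun.rep_eq fun_diff_def)
    ultimately show ?thesis using lip_e'[of z x] by simp
    qed
  qed simp
  then show ?thesis by (simp add: \<Phi>_def power2_eq_square algebra_simps)
qed

lemma e'_in: "v \<in> euclid D \<Longrightarrow> e' x v \<in> euclid D" 
proof -
  have "((\<lambda>s. e (x + s *\<^sub>R v)) has_vector_derivative e' x v) (at 0)"
  proof -
    have "((\<lambda>s. x + s *\<^sub>R v) has_vector_derivative v) (at 0)" by (auto intro!: derivative_eq_intros)
    then show ?thesis using curve_chain[of e "e' x" "\<lambda>s. x + s *\<^sub>R v" UNIV v 1] der[of x] by simp
  qed
  then show ?thesis by (rule vector_derivative_in_subspace[OF _ zero_less_one _ subspace_euclid closed_euclid]) (rule eE)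
qed

text \<open>The inverse of id + e' x on \<open>euclid D\<close>, precomposed with the projection so
  that it becomes a bounded operator on all of \<open>finseq\<close>.\<close>

definition J0 :: "finseq \<Rightarrow> finseq \<Rightarrow> finseq"
  where "J0 x v = inv_into (euclid D) (\<lambda>w. w + e' x w) (proj (euclid D) v)"

lemma lip_lin: "norm (e' x w - e' x w') \<le> 1 / 2 * norm (w - w')"
proof -
  have "norm (e' x (w - w')) \<le> norm (e' x) * norm (w - w')" by (rule norm_blinfun)
  also have "\<dots> \<le> 1 / 2 * norm (w - w')" using norm_e' by (rule mult_right_mono) simp
  finally show ?thesis by (simp add: blinfun.diff_right)
qed

lemma J0_in: "J0 x v \<in> euclid D" and J0_eq: "J0 x v + e' x (J0 x v) = proj (euclid D) v"
  and J0_unique: "w \<in> euclid D \<Longrightarrow> w + e' x w = proj (euclid D) v \<Longrightarrow> J0 x v = w"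
proof -
  note b = perturbed_identity_bij[of D "blinfun_apply (e' x)", OF e'_in lip_lin]
  have p: "proj (euclid D) v \<in> (\<lambda>w. w + e' x w) ` euclid D" using b(2) proj_in[OF dsub_euclid, of D v] by simp
  show "J0 x v \<in> euclid D" unfolding J0_def by (rule inv_into_into[OF p])
  show "J0 x v + e' x (J0 x v) = proj (euclid D) v"
    unfolding J0_def by (rule f_inv_into_f[OF p])
  show "J0 x v = w" if "w \<in> euclid D" "w + e' x w = proj (euclid D) v"
    unfolding J0_def using inv_into_f_f[OF b(1) that(1)] that(2) by simp
qed

lemma J0_norm: "norm (J0 x v) \<le> 2 * norm v"
proof -
  have "norm (J0 x v - 0) \<le> 2 * norm (J0 x v + e' x (J0 x v) - (0 + e' x 0))"
    by (rule perturbed_identity_bij(3)[of D "blinfun_apply (e' x)", OF e'_in lip_lin])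
  also have "\<dots> \<le> 2 * norm v" using norm_proj_le[OF dsub_euclid] by (simp add: J0_eq blinfun.zero_right)
  finally show ?thesis by simp
qed

lemma bounded_linear_J0: "bounded_linear (J0 x)"
proof (rule bounded_linear_intro)
  note lp = linear_proj[OF dsub_euclid[of D]]
  show "J0 x (v + w) = J0 x v + J0 x w" for v w
  proof (rule J0_unique)
    have "J0 x v + J0 x w + e' x (J0 x v + J0 x w) = (J0 x v + e' x (J0 x v)) + (J0 x w + e' x (J0 x w))"
      by (simp add: blinfun.add_right algebra_simps)
    then show "J0 x v + J0 x w + e' x (J0 x v + J0 x w) = proj (euclid D) (v + w)"
      by (simp only: J0_eq linear_add[OF lp])
  qed (intro subspace_add[OF subspace_euclid] J0_in)
  show "J0 x (r *\<^sub>R v) = r *\<^sub>R J0 x v" for r v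
  proof (rule J0_unique)
    have "r *\<^sub>R J0 x v + e' x (r *\<^sub>R J0 x v) = r *\<^sub>R (J0 x v + e' x (J0 x v))"
      by (simp add: blinfun.scaleR_right scaleR_add_right)
    then show "r *\<^sub>R J0 x v + e' x (r *\<^sub>R J0 x v) = proj (euclid D) (r *\<^sub>R v)"
      by (simp only: J0_eq linear_cmul[OF lp])
  qed (intro subspace_scale[OF subspace_euclid] J0_in)
  show "norm (J0 x v) \<le> norm v * 2" for v using J0_norm[of x v] by simp
qed

definition "J x = Blinfun (J0 x)"

lemma J_apply: "blinfun_apply (J x) = J0 x"
  unfolding J_def by (rule bounded_linear_Blinfun_apply[OF bounded_linear_J0])

lemma J_eq: "v \<in> euclid D \<Longrightarrow> J x v + e' x (J x v) = v"
  unfolding J_apply by (simp add: J0_eq proj_id[OF dsub_euclid])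

lemma J_inv: "w \<in> euclid D \<Longrightarrow> J x (w + e' x w) = w"
  unfolding J_apply
  by (rule J0_unique) (auto simp: proj_id[OF dsub_euclid] e'_in subspace_add[OF subspace_euclid])

text \<open>Resolvent identity: a difference of inverses is one inverse times the difference of the
  operators times the other inverse, and each inverse has norm at most 2.\<close>

lemma J_lip: "norm (J x - J y) \<le> 4 * L * norm (x - y)"
proof (rule norm_blinfun_bound)
  fix v
  let ?w = "J0 x v" and ?w' = "J0 y v"
  have "norm (?w - ?w') \<le> 2 * norm (?w + e' x ?w - (?w' + e' x ?w'))"
    by (rule perturbed_identity_bij(3)[of D "blinfun_apply (e' x)", OF e'_in lip_lin])
  also have "?w + e' x ?w - (?w' + e' x ?w') = (e' y - e' x) ?w'"
  proof -
    have "?w + e' x ?w = ?w' + e' y ?w'" by (simp only: J0_eq)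
    then show ?thesis by (simp add: blinfun.diff_left)
  qed
  also have "norm ((e' y - e' x) ?w') \<le> norm (e' y - e' x) * norm ?w'" by (rule norm_blinfun)
  also have "\<dots> \<le> (L * norm (x - y)) * (2 * norm v)"
    using lip_e'[of y x] J0_norm[of y v] L by (intro mult_mono) (auto simp: norm_minus_commute)
  finally show "norm ((J x - J y) v) \<le> 4 * L * norm (x - y) * norm v" by (simp add: blinfun.diff_left J_apply)
qed (use L in simp)

lemma \<Psi>_derivative:
  assumes y: "y \<in> euclid D" shows "(\<Psi> has_derivative blinfun_apply (J (\<Psi> y))) (at y within euclid D)"
  unfolding has_derivative_within_alt
proof (intro conjI allI impI)
  show "bounded_linear (blinfun_apply (J (\<Psi> y)))" by (rule blinfun.bounded_linear_right)
  fix \<epsilon> :: real assume \<epsilon>: "0 < \<epsilon>"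
  \<comment> \<open>With \<open>\<Psi>\<close> 2-Lipschitz and the inverse of norm at most 2, the
    Taylor remainder contributes at most \<open>8 * L\<close> times the squared increment.\<close>
  define \<delta> where "\<delta> = \<epsilon> / (8 * L + 1)"
  have \<delta>: "0 < \<delta>" using \<epsilon> L by (simp add: \<delta>_def add_nonneg_pos)
  show "\<exists>d>0. \<forall>z\<in>euclid D. norm (z - y) < d \<longrightarrow> norm (\<Psi> z - \<Psi> y - J (\<Psi> y) (z - y)) \<le> \<epsilon> * norm (z - y)"
  proof (intro exI conjI ballI impI)
    show "0 < \<delta>" by (rule \<delta>)
    fix z assume z: "z \<in> euclid D" "norm (z - y) < \<delta>"
    define x x' where "x = \<Psi> y" and "x' = \<Psi> z"
    have xx: "\<Phi> x = y" "\<Phi> x' = z" "x \<in> euclid D" "x' \<in> euclid D"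
      using y z \<Phi>\<Psi> \<Psi>_in by (auto simp: x_def x'_def)
    let ?w = "x' - x" and ?r = "\<Phi> x' - \<Phi> x - ((x' - x) + e' x (x' - x))"
    have wE: "?w \<in> euclid D" using xx by (intro subspace_diff[OF subspace_euclid])
    have "z - y = (?w + e' x ?w) + ?r" using xx by simp
    then have "J x (z - y) = ?w + J x ?r" using J_inv[OF wE] by (metis blinfun.add_right)
    then have "norm (?w - J x (z - y)) = norm (J x ?r)" by simp
    also have "\<dots> \<le> 2 * norm ?r" unfolding J_apply by (rule J0_norm)
    also have "\<dots> \<le> 2 * (L * (norm ?w)\<^sup>2)" using taylor by simp
    also have "\<dots> \<le> 2 * (L * (2 * norm (z - y))\<^sup>2)"
      using \<Psi>_lip[OF z(1) y] L by (intro mult_left_mono power_mono) (auto simp: x_def x'_def)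
    also have "\<dots> = 8 * L * norm (z - y) * norm (z - y)" by (simp add: power2_eq_square)
    also have "\<dots> \<le> \<epsilon> * norm (z - y)"
    proof (rule mult_right_mono)
      have "8 * L * norm (z - y) \<le> (8 * L + 1) * \<delta>" using z L \<delta> by (intro mult_mono) auto
      also have "\<dots> = \<epsilon>" using L by (simp add: \<delta>_def)
      finally show "8 * L * norm (z - y) \<le> \<epsilon>" .
    qed simp
    finally show "norm (\<Psi> z - \<Psi> y - J (\<Psi> y) (z - y)) \<le> \<epsilon> * norm (z - y)" by (simp add: x_def x'_def)
  qed
qed

lemma \<Phi>_derivative: "(\<Phi> has_derivative blinfun_apply (id_blinfun + e' x)) (at x within S)"
  unfolding \<Phi>_def[abs_def] by (auto intro!: derivative_eq_intros has_derivative_at_withinI[OF der] simp: blinfun.add_left)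

lemma continuous_lipschitz:
  assumes "0 \<le> c" "\<And>x y. x \<in> S \<Longrightarrow> y \<in> S \<Longrightarrow> norm (f x - f y) \<le> c * norm (x - y)"
  shows "continuous_on S (f :: 'a :: real_normed_vector \<Rightarrow> 'b :: real_normed_vector)"
  by (rule lipschitz_on_continuous_on[of c]) (use assms in \<open>auto intro: lipschitz_onI simp: dist_norm\<close>)

lemma C1_submanifold_image:
  assumes M: "C1_submanifold D d M" shows "C1_submanifold D d (\<Phi> ` M)"
proof -
  have ME: "d \<le> D" "M \<subseteq> euclid D" using M by (auto simp: C1_submanifold_def)
  have "\<exists>U W \<phi> \<psi>. q \<in> U \<and> openin (top_of_set (euclid D)) U \<and> openin (top_of_set (euclid D)) W \<and>
      homeomorphism U W \<phi> \<psi> \<and> C1_map_on D U \<phi> \<and> C1_map_on D W \<psi> \<and> \<phi> ` (U \<inter> \<Phi> ` M) = W \<inter> euclid d"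
    if q: "q \<in> \<Phi> ` M" for q
  proof -
    obtain p where p: "p \<in> M" "q = \<Phi> p" using q by blast
    obtain U W \<phi> \<psi> \<phi>' \<psi>' where "chart D d M U W \<phi> \<psi> \<phi>' \<psi>' p" using C1_submanifold_chart[OF M p(1)] by blast
    then interpret ch: chart D d M U W \<phi> \<psi> \<phi>' \<psi>' p .
    let ?U = "\<Phi> ` U"
    have UE: "?U \<subseteq> euclid D" using ch.UE \<Phi>_in by auto
    have U_eq: "?U = euclid D \<inter> \<Psi> -` U" using ch.UE \<Psi>\<Phi> \<Phi>\<Psi> \<Phi>_in by force
    have "openin (top_of_set (euclid D)) ?U"
      unfolding U_eq using homeo ch.openU by (intro continuous_openin_preimage[of _ _ "euclid D"]) (auto simp: homeomorphism_def)
    moreover have "homeomorphism ?U U \<Psi> \<Phi>"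
      using homeomorphism_symD[OF homeo] ch.UE UE \<Psi>\<Phi>
      by (rule_tac homeomorphism_of_subsets[of "euclid D" "euclid D"]) (auto simp: image_image subset_iff)
    then have "homeomorphism ?U W (\<phi> \<circ> \<Psi>) (\<Phi> \<circ> \<psi>)" using ch.hom by (rule homeomorphism_compose)
    moreover have "C1_map_on D ?U (\<phi> \<circ> \<Psi>)"
      unfolding C1_map_on_def
    proof (intro exI[of _ "\<lambda>y. \<phi>' (\<Psi> y) o\<^sub>L J (\<Psi> y)"] conjI ballI)
      fix y assume "y \<in> ?U"
      then have y: "y \<in> euclid D" "\<Psi> y \<in> U" using U_eq by auto
      have "(\<phi> has_derivative blinfun_apply (\<phi>' (\<Psi> y))) (at (\<Psi> y) within \<Psi> ` euclid D)"
        by (rule has_derivative_subset[OF ch.der\<phi>[OF y(2)]]) (auto intro: \<Psi>_in)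
      then show "((\<phi> \<circ> \<Psi>) has_derivative blinfun_apply (\<phi>' (\<Psi> y) o\<^sub>L J (\<Psi> y))) (at y within euclid D)"
        using diff_chain_within[OF \<Psi>_derivative[OF y(1)]] by (simp add: o_def blinfun_compose.rep_eq)
    next
      have c1: "continuous_on ?U \<Psi>" by (rule continuous_on_subset[of "euclid D"]) (use homeo UE in \<open>auto simp: homeomorphism_def\<close>)
      have "continuous_on ?U (\<lambda>y. \<phi>' (\<Psi> y))"
        by (rule continuous_on_compose2[OF ch.cont\<phi>' c1]) (use U_eq in auto)
      moreover have "continuous_on UNIV J" by (rule continuous_lipschitz[of "4 * L"]) (use L J_lip in auto)
      then have "continuous_on ?U (\<lambda>y. J (\<Psi> y))" by (rule continuous_on_compose2[OF _ c1]) auto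
      ultimately show "continuous_on ?U (\<lambda>y. \<phi>' (\<Psi> y) o\<^sub>L J (\<Psi> y))"
        by (rule bounded_bilinear.continuous_on[OF bounded_bilinear_blinfun_compose])
    qed
    moreover have "C1_map_on D W (\<Phi> \<circ> \<psi>)"
      unfolding C1_map_on_def
    proof (intro exI[of _ "\<lambda>y. (id_blinfun + e' (\<psi> y)) o\<^sub>L \<psi>' y"] conjI ballI)
      fix y assume y: "y \<in> W"
      show "((\<Phi> \<circ> \<psi>) has_derivative blinfun_apply ((id_blinfun + e' (\<psi> y)) o\<^sub>L \<psi>' y)) (at y within euclid D)"
        using diff_chain_within[OF ch.der\<psi>[OF y] \<Phi>_derivative] by (simp add: o_def blinfun_compose.rep_eq)
    next
      have c1: "continuous_on W \<psi>" using ch.hom by (simp add: homeomorphism_def)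
      have "continuous_on UNIV e'" by (rule continuous_lipschitz[OF L lip_e'])
      then have "continuous_on W (\<lambda>y. e' (\<psi> y))" by (rule continuous_on_compose2[OF _ c1]) auto
      then have "continuous_on W (\<lambda>y. id_blinfun + e' (\<psi> y))" by (intro continuous_intros)
      then show "continuous_on W (\<lambda>y. (id_blinfun + e' (\<psi> y)) o\<^sub>L \<psi>' y)"
        using ch.cont\<psi>' by (rule bounded_bilinear.continuous_on[OF bounded_bilinear_blinfun_compose])
    qed
    moreover have "(\<phi> \<circ> \<Psi>) ` (?U \<inter> \<Phi> ` M) = W \<inter> euclid d"
    proof -
      have "?U \<inter> \<Phi> ` M = \<Phi> ` (U \<inter> M)"
        using inj_on_image_Int[OF perturbed_identity_bij(1)[of D e, OF eE lip_e], of U M] ch.UE ME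
        by (simp add: \<Phi>_def[abs_def])
      moreover have "\<Psi> ` \<Phi> ` (U \<inter> M) = U \<inter> M" using ME \<Psi>\<Phi> by (force simp: image_image)
      ultimately show ?thesis using ch.img by (metis image_comp)
    qed
    moreover have "q \<in> ?U" using p ch.pU by blast
    moreover note ch.openW
    ultimately show ?thesis
      by (intro exI[of _ ?U] exI[of _ W] exI[of _ "\<phi> \<circ> \<Psi>"] exI[of _ "\<Phi> \<circ> \<psi>"] conjI) assumption+
  qed
  then show ?thesis unfolding C1_submanifold_def using ME \<Phi>_in by blast
qed

lemma tangent_space_image:
  assumes ME: "M \<subseteq> euclid D" and x: "x \<in> M"
  shows "tangent_space (\<Phi> ` M) (\<Phi> x) = (\<lambda>v. v + e' x v) ` tangent_space M x"
proof (intro equalityI subsetI)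
  fix w assume "w \<in> (\<lambda>v. v + e' x v) ` tangent_space M x"
  then obtain v \<gamma> \<epsilon> where v: "w = v + e' x v" "\<gamma> 0 = x" "\<epsilon> > 0" "\<And>s. \<bar>s\<bar> < \<epsilon> \<Longrightarrow> \<gamma> s \<in> M"
    "(\<gamma> has_vector_derivative v) (at 0)" unfolding tangent_space_def by blast
  have "((\<lambda>s. \<Phi> (\<gamma> s)) has_vector_derivative (id_blinfun + e' x) v) (at 0)"
    using curve_chain[of \<Phi> "id_blinfun + e' x" \<gamma> UNIV, OF _ v(5,3)] \<Phi>_derivative v(2) by simp
  then show "w \<in> tangent_space (\<Phi> ` M) (\<Phi> x)"
    unfolding tangent_space_def using v by (intro CollectI exI[of _ "\<lambda>s. \<Phi> (\<gamma> s)"]) (auto simp: blinfun.add_left)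
next
  fix w assume "w \<in> tangent_space (\<Phi> ` M) (\<Phi> x)"
  then obtain \<gamma> \<epsilon> where \<gamma>: "\<gamma> 0 = \<Phi> x" "\<epsilon> > 0" "\<And>s. \<bar>s\<bar> < \<epsilon> \<Longrightarrow> \<gamma> s \<in> \<Phi> ` M"
    "(\<gamma> has_vector_derivative w) (at 0)" unfolding tangent_space_def by blast
  have E: "\<gamma> s \<in> euclid D" if "\<bar>s\<bar> < \<epsilon>" for s using \<gamma>(3)[OF that] ME \<Phi>_in by auto
  have wE: "w \<in> euclid D" by (rule vector_derivative_in_subspace[OF \<gamma>(4,2) E subspace_euclid closed_euclid])
  have xE: "x \<in> euclid D" using ME x by auto
  have "((\<lambda>s. \<Psi> (\<gamma> s)) has_vector_derivative J x w) (at 0)"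
    using curve_chain[of \<Psi> "J x" \<gamma> "euclid D", OF _ \<gamma>(4,2) E] \<Psi>_derivative[OF \<Phi>_in[OF xE]] \<Psi>\<Phi>[OF xE] \<gamma>(1) by simp
  then have "J x w \<in> tangent_space M x"
    unfolding tangent_space_def using \<gamma>(1-3) \<Psi>\<Phi> ME x
    by (intro CollectI exI[of _ "\<lambda>s. \<Psi> (\<gamma> s)"]) (fastforce simp: subset_iff)
  then show "w \<in> (\<lambda>v. v + e' x v) ` tangent_space M x" using J_eq[OF wE, of x] by (metis imageI)
qed

text \<open>\<open>reach_ge\<close> is checked with the image of the tangential part of the old
  chord as competitor. The errors add up to (L + 3 / (4 \<rho>)) |y - x|^2, and |y - x| is at most
  twice the new chord.\<close>

lemma manifold_class_image:
  assumes "M \<in> manifold_class D d \<rho>" "0 < \<rho>"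
  shows "\<Phi> ` M \<in> manifold_class D d (1 / (6 / \<rho> + 8 * L))"
proof -
  interpret reach_manifold D d M \<rho> by standard (use assms in auto)
  have cont: "continuous_on M \<Phi>"
    by (rule continuous_on_subset[OF _ ME]) (use homeo in \<open>auto simp: homeomorphism_def\<close>)
  have tan: "tangent_space (\<Phi> ` M) (\<Phi> x) = (\<lambda>v. v + e' x v) ` Tan x" if "x \<in> M" for x
    by (rule tangent_space_image[OF ME that])
  have sub: "C1_submanifold D d (\<Phi> ` M)" by (rule C1_submanifold_image[OF M_sub])
  have pos: "0 < 6 / \<rho> + 8 * L" using \<rho> L by (intro add_pos_nonneg) auto
  have "ennreal (1 / (6 / \<rho> + 8 * L)) \<le> reach D (\<Phi> ` M)"
  proof (rule reach_ge)
    show "\<And>x. x \<in> \<Phi> ` M \<Longrightarrow> dsub d (tangent_space (\<Phi> ` M) x)" by (rule dsub_tangent_space[OF sub])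
    show "0 < 1 / (6 / \<rho> + 8 * L)" using pos by simp
    fix x' y' assume "x' \<in> \<Phi> ` M" "y' \<in> \<Phi> ` M"
    then obtain x y where xy: "x \<in> M" "y \<in> M" "x' = \<Phi> x" "y' = \<Phi> y" by blast
    let ?T = "tangent_space (\<Phi> ` M) x'"
    let ?v = "y - x" let ?u = "proj (Tan x) ?v"
    have T: "dsub d ?T" using xy by (intro dsub_tangent_space[OF sub]) auto
    have uT: "?u + e' x ?u \<in> ?T" using tan[OF xy(1)] proj_in[OF dsub_Tan[OF xy(1)]] xy(3) by auto
    have "norm (y' - x' - proj ?T (y' - x')) \<le> norm (y' - x' - (?u + e' x ?u))" by (rule proj_best[OF T uT])
    also have "y' - x' - (?u + e' x ?u) = (\<Phi> y - \<Phi> x - (?v + e' x ?v)) + (?v - ?u) + e' x (?v - ?u)"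
      by (simp add: xy blinfun.diff_right)
    also have "norm \<dots> \<le> norm (\<Phi> y - \<Phi> x - (?v + e' x ?v)) + norm (?v - ?u) + norm (e' x (?v - ?u))"
      using norm_triangle_ineq norm_triangle_le by (metis add_right_mono)
    also have "norm (e' x (?v - ?u)) \<le> norm (e' x) * norm (?v - ?u)" by (rule norm_blinfun)
    also have "\<dots> \<le> 1 / 2 * norm (?v - ?u)" using norm_e' by (rule mult_right_mono) simp
    also have "norm (\<Phi> y - \<Phi> x - (?v + e' x ?v)) \<le> L * (norm ?v)\<^sup>2" by (rule taylor)
    also have "norm (?v - ?u) \<le> (norm ?v)\<^sup>2 / (2 * \<rho>)" by (rule normal_part[OF xy(1,2)])
    finally have "norm (y' - x' - proj ?T (y' - x')) \<le> L * (norm ?v)\<^sup>2 + (norm ?v)\<^sup>2 / (2 * \<rho>) + 1 / 2 * ((norm ?v)\<^sup>2 / (2 * \<rho>))" by simp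
    also have "\<dots> = (L + 3 / (4 * \<rho>)) * (norm ?v)\<^sup>2" using \<rho> by (simp add: field_simps)
    also have "\<dots> \<le> (L + 3 / (4 * \<rho>)) * (2 * norm (y' - x'))\<^sup>2"
      using \<Phi>_lower[of y x] L \<rho> by (intro mult_left_mono power_mono) (auto simp: xy)
    also have "\<dots> = (6 / \<rho> + 8 * L) / 2 * (norm (y' - x'))\<^sup>2" using \<rho> by (simp add: power2_eq_square field_simps)
    also have "\<dots> = (norm (y' - x'))\<^sup>2 / (2 * (1 / (6 / \<rho> + 8 * L)))" using pos by (simp add: field_simps)
    finally show "norm (y' - x' - proj ?T (y' - x')) \<le> (norm (y' - x'))\<^sup>2 / (2 * (1 / (6 / \<rho> + 8 * L)))" .
  qed
  moreover have "connected (\<Phi> ` M)"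
    using mc cont by (intro connected_continuous_image) (auto simp: manifold_class_def)
  ultimately show ?thesis
    unfolding manifold_class_def using M_ne compact_continuous_image[OF cont M_compact] sub by simp
qed

end

section \<open>Interpolation of points and tangent spaces\<close>

text \<open>A squared positive part has a Lipschitz derivative across 0, which is the smoothness
  that \<open>near_id\<close> asks of a compactly supported bump.\<close>

lemma DERIV_pos_part_square: "DERIV (\<lambda>t::real. (max 0 t)\<^sup>2) t :> 2 * max 0 t"
proof -
  consider "0 < t" | "t < 0" | "t = 0" by linarith
  then show ?thesis
  proof cases
    case 1
    have "DERIV (\<lambda>t::real. t\<^sup>2) t :> 2 * t" by (auto intro!: derivative_eq_intros)
    then have "DERIV (\<lambda>t. (max 0 t)\<^sup>2) t :> 2 * t"
      by (rule has_field_derivative_transform_within_open[of _ _ _ "{0<..}"]) (use 1 in auto)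
    then show ?thesis using 1 by simp
  next
    case 2
    have "DERIV (\<lambda>t::real. 0) t :> 0" by simp
    then have "DERIV (\<lambda>t. (max 0 t)\<^sup>2) t :> 0"
      by (rule has_field_derivative_transform_within_open[of _ _ _ "{..<0}"]) (use 2 in auto)
    then show ?thesis using 2 by simp
  next
    case 3
    have "((\<lambda>t::real. (max 0 t)\<^sup>2) has_derivative (\<lambda>h. 0)) (at 0 within UNIV)"
      unfolding has_derivative_within_alt
    proof (intro conjI allI impI bounded_linear_zero)
      fix \<epsilon> :: real assume "0 < \<epsilon>"
      show "\<exists>d>0. \<forall>y\<in>UNIV. norm (y - 0) < d \<longrightarrow> norm ((max 0 y)\<^sup>2 - (max 0 0)\<^sup>2 - 0) \<le> \<epsilon> * norm (y - (0::real))"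
      proof (intro exI conjI ballI impI)
        fix y :: real assume y: "norm (y - 0) < \<epsilon>"
        have "(max 0 y)\<^sup>2 \<le> \<epsilon> * \<bar>y\<bar>"
          using y \<open>0 < \<epsilon>\<close> by (cases "y \<le> 0") (auto simp: power2_eq_square mult_nonneg_nonpos intro: mult_right_mono)
        then show "norm ((max 0 y)\<^sup>2 - (max 0 0)\<^sup>2 - 0) \<le> \<epsilon> * norm (y - 0)" by simp
      qed (rule \<open>0 < \<epsilon>\<close>)
    qed
    moreover have "(*) (0::real) = (\<lambda>h. 0)" by auto
    ultimately show ?thesis using 3 by (simp add: has_field_derivative_def)
  qed
qed

text \<open>A segment from inside to outside crosses the sphere, where \<open>f\<close> already
  vanishes, so the bound inside passes to the whole space.\<close>

lemma lipschitz_extend_by_zero: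
  fixes f :: "'a :: real_normed_vector \<Rightarrow> 'b :: real_normed_vector"
  assumes lip: "\<And>x y. norm x \<le> r \<Longrightarrow> norm y \<le> r \<Longrightarrow> norm (f x - f y) \<le> L * norm (x - y)"
    and zero: "\<And>x. r \<le> norm x \<Longrightarrow> f x = 0" and "0 \<le> L"
  shows "norm (f x - f y) \<le> L * norm (x - y)"
proof -
  have half: "norm (f x - f y) \<le> L * norm (x - y)" if x: "norm x \<le> r" and y: "r \<le> norm y" for x y
  proof -
    let ?g = "\<lambda>t. x + t *\<^sub>R (y - x)"
    have "\<exists>t\<ge>0. t \<le> 1 \<and> norm (?g t) = r"
      by (rule IVT') (use x y in \<open>auto intro!: continuous_intros\<close>)
    then obtain t where t: "0 \<le> t" "t \<le> 1" "norm (?g t) = r" by blast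
    have "norm (f x - f y) = norm (f x - f (?g t))" using zero y t by simp
    also have "\<dots> \<le> L * norm (x - ?g t)" using x t by (intro lip) auto
    also have "norm (x - ?g t) = t * norm (y - x)" using t by simp
    also have "L * (t * norm (y - x)) \<le> L * (1 * norm (y - x))"
      using t \<open>0 \<le> L\<close> by (intro mult_left_mono mult_right_mono) auto
    finally show ?thesis by (simp add: norm_minus_commute)
  qed
  consider "norm x \<le> r" "norm y \<le> r" | "norm x \<le> r" "r \<le> norm y" | "r \<le> norm x" "norm y \<le> r" | "r \<le> norm x" "r \<le> norm y"
    by linarith
  then show ?thesis
  proof cases
    case 3
    then show ?thesis using half[of y x] by (simp add: norm_minus_commute)
  next
    case 4
    then show ?thesis using zero \<open>0 \<le> L\<close> by simp
  qed (use lip half in auto)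
qed

text \<open>A cut-off affine map \<open>b + B z\<close>: the value \<open>b\<close> and the
  derivative \<open>B\<close> at the centre are prescribed together, and \<open>G\<close> bounds the
  affine map on the support of radius \<open>\<mu>\<close>.\<close>

locale bump =
  fixes \<mu> \<theta> G :: real and b :: finseq and B :: "finseq \<Rightarrow>\<^sub>L finseq"
  assumes \<mu>: "0 < \<mu>" and B: "norm B \<le> \<theta>" and G: "norm b + \<theta> * \<mu> \<le> G"
begin

definition "\<sigma> z = max 0 (1 - (norm z)\<^sup>2 / \<mu>\<^sup>2)" for z :: finseq
definition "\<eta> z = (\<sigma> z)\<^sup>2 *\<^sub>R (b + B z)"
definition "\<eta>0 z v = (2 * (z \<bullet> v) * (2 * \<sigma> z * (- 1 / \<mu>\<^sup>2))) *\<^sub>R (b + B z) + (\<sigma> z)\<^sup>2 *\<^sub>R B v"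
definition "\<eta>' z = Blinfun (\<eta>0 z)"

lemma der0: "(\<eta> has_derivative \<eta>0 z) (at z)"
proof -
  have "DERIV (\<lambda>t. (max 0 (1 - t / \<mu>\<^sup>2))\<^sup>2) t :> 2 * max 0 (1 - t / \<mu>\<^sup>2) * (- 1 / \<mu>\<^sup>2)" for t
  proof (rule DERIV_chain2[OF DERIV_pos_part_square])
    have "((\<lambda>t. 1 - t / \<mu>\<^sup>2) has_field_derivative (0 - 1 / \<mu>\<^sup>2)) (at t)"
      by (intro DERIV_diff DERIV_const DERIV_cdivide DERIV_ident)
    then show "((\<lambda>t. 1 - t / \<mu>\<^sup>2) has_field_derivative (- 1 / \<mu>\<^sup>2)) (at t)" by simp
  qed
  moreover have "((\<lambda>z. (norm z)\<^sup>2) has_derivative (\<lambda>v. 2 * (z \<bullet> v))) (at z)"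
    unfolding power2_norm_eq_inner by (auto intro!: derivative_eq_intros simp: inner_commute)
  ultimately have "((\<lambda>z. (\<sigma> z)\<^sup>2) has_derivative (\<lambda>v. 2 * (z \<bullet> v) * (2 * \<sigma> z * (- 1 / \<mu>\<^sup>2)))) (at z)"
    unfolding \<sigma>_def by (rule DERIV_compose_FDERIV)
  moreover have "((\<lambda>z. b + B z) has_derivative (\<lambda>v. B v)) (at z)"
    by (auto intro!: derivative_eq_intros)
  ultimately have "((\<lambda>z. (\<sigma> z)\<^sup>2 *\<^sub>R (b + B z)) has_derivative
      (\<lambda>v. (\<sigma> z)\<^sup>2 *\<^sub>R B v + (2 * (z \<bullet> v) * (2 * \<sigma> z * (- 1 / \<mu>\<^sup>2))) *\<^sub>R (b + B z))) (at z)"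
    by (rule has_derivative_scaleR)
  then show ?thesis by (simp add: \<eta>_def[abs_def] \<eta>0_def[abs_def] add.commute)
qed

lemma apply': "blinfun_apply (\<eta>' z) = \<eta>0 z"
  unfolding \<eta>'_def by (rule bounded_linear_Blinfun_apply[OF has_derivative_bounded_linear[OF der0]])

lemma der: "(\<eta> has_derivative blinfun_apply (\<eta>' z)) (at z)"
  unfolding apply' by (rule der0)

lemma \<theta>0: "0 \<le> \<theta>" using B norm_ge_zero[of B] by linarith

lemma G0: "0 \<le> G" and \<theta>G: "\<theta> * \<mu> \<le> G"
  using G \<theta>0 \<mu> norm_ge_zero[of b] mult_nonneg_nonneg[of \<theta> \<mu>] by linarith+

lemma \<sigma>_bounds: "0 \<le> \<sigma> z" "\<sigma> z \<le> 1" "\<mu> \<le> norm z \<Longrightarrow> \<sigma> z = 0"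
proof -
  show "0 \<le> \<sigma> z" "\<sigma> z \<le> 1" by (auto simp: \<sigma>_def)
  assume "\<mu> \<le> norm z"
  then have "\<mu>\<^sup>2 \<le> (norm z)\<^sup>2" using \<mu> by (intro power_mono) auto
  then show "\<sigma> z = 0" using \<mu> by (simp add: \<sigma>_def)
qed

lemma affine_le: assumes "norm z \<le> \<mu>" shows "norm (b + B z) \<le> G"
proof -
  have "norm (B z) \<le> norm B * norm z" by (rule norm_blinfun)
  also have "\<dots> \<le> \<theta> * \<mu>" using B assms \<theta>0 by (intro mult_mono) auto
  finally show ?thesis using norm_triangle_ineq[of b "B z"] G by linarith
qed

lemma zero: "\<mu> \<le> norm z \<Longrightarrow> \<eta> z = 0" and zero': "\<mu> \<le> norm z \<Longrightarrow> \<eta>' z = 0"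
  using \<sigma>_bounds(3) by (auto simp: \<eta>_def \<eta>0_def apply' intro!: blinfun_eqI)

lemma at_0: "\<eta> 0 = b" "\<eta>' 0 = B"
  by (auto simp: \<eta>_def \<eta>0_def apply' \<sigma>_def blinfun.zero_right intro!: blinfun_eqI)

lemma norm_le: "norm (\<eta> z) \<le> G"
proof (cases "norm z \<le> \<mu>")
  case True
  have "norm (\<eta> z) = (\<sigma> z)\<^sup>2 * norm (b + B z)" by (simp add: \<eta>_def)
  also have "\<dots> \<le> 1 * G" using \<sigma>_bounds[of z] affine_le[OF True] G0 by (intro mult_mono) (auto simp: power_le_one)
  finally show ?thesis by simp
qed (use zero[of z] G0 in simp)

lemma norm'_le: "norm (\<eta>' z) \<le> 5 * G / \<mu>"
proof (cases "norm z \<le> \<mu>")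
  case True
  show ?thesis
  proof (rule norm_blinfun_bound)
    fix v
    have zv: "\<bar>z \<bullet> v\<bar> \<le> \<mu> * norm v"
      using Cauchy_Schwarz_ineq2[of z v] mult_right_mono[OF True norm_ge_zero[of v]] by linarith
    have "norm (\<eta>' z v) \<le> norm ((2 * (z \<bullet> v) * (2 * \<sigma> z * (- 1 / \<mu>\<^sup>2))) *\<^sub>R (b + B z)) + norm ((\<sigma> z)\<^sup>2 *\<^sub>R B v)"
      unfolding apply' \<eta>0_def by (rule norm_triangle_ineq)
    also have "norm ((2 * (z \<bullet> v) * (2 * \<sigma> z * (- 1 / \<mu>\<^sup>2))) *\<^sub>R (b + B z)) = 4 / \<mu>\<^sup>2 * (\<sigma> z * \<bar>z \<bullet> v\<bar> * norm (b + B z))"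
      using \<sigma>_bounds(1)[of z] by (simp add: abs_mult)
    also have "\<dots> \<le> 4 / \<mu>\<^sup>2 * (1 * (\<mu> * norm v) * G)"
      using \<sigma>_bounds[of z] zv affine_le[OF True] \<mu> by (intro mult_left_mono mult_mono) auto
    also have "\<dots> = 4 * G / \<mu> * norm v" using \<mu> by (simp add: power2_eq_square)
    also have "norm ((\<sigma> z)\<^sup>2 *\<^sub>R B v) \<le> 1 * (\<theta> * norm v)"
      unfolding norm_scaleR using \<sigma>_bounds[of z] B
      by (intro mult_mono order_trans[OF norm_blinfun] mult_right_mono) (auto simp: power_le_one)
    also have "\<theta> \<le> G / \<mu>" using \<theta>G \<mu> by (simp add: pos_le_divide_eq)
    finally have "norm (\<eta>' z v) \<le> 4 * G / \<mu> * norm v + 1 * (G / \<mu> * norm v)" by (simp add: mult_right_mono)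
    also have "\<dots> = 5 * G / \<mu> * norm v" by (simp add: add_divide_distrib algebra_simps)
    finally show "norm (\<eta>' z v) \<le> 5 * G / \<mu> * norm v" .
  qed (use G0 \<mu> in simp)
qed (use zero'[of z] G0 \<mu> in simp)

lemma \<sigma>_lip: assumes "norm z \<le> \<mu>" "norm y \<le> \<mu>" shows "\<bar>\<sigma> z - \<sigma> y\<bar> \<le> 2 / \<mu> * norm (z - y)"
proof -
  have "\<bar>\<sigma> z - \<sigma> y\<bar> \<le> \<bar>(norm z)\<^sup>2 / \<mu>\<^sup>2 - (norm y)\<^sup>2 / \<mu>\<^sup>2\<bar>" unfolding \<sigma>_def by linarith
  also have "\<dots> = \<bar>norm z - norm y\<bar> * (norm z + norm y) / \<mu>\<^sup>2"
  proof -
    have "(norm z)\<^sup>2 - (norm y)\<^sup>2 = (norm z - norm y) * (norm z + norm y)" by (simp add: power2_eq_square algebra_simps)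
    then show ?thesis by (simp add: diff_divide_distrib[symmetric] abs_mult)
  qed
  also have "\<dots> \<le> norm (z - y) * (2 * \<mu>) / \<mu>\<^sup>2"
    using norm_triangle_ineq3[of z y] assms by (intro divide_right_mono mult_mono) auto
  also have "\<dots> = 2 / \<mu> * norm (z - y)" using \<mu> by (simp add: power2_eq_square)
  finally show ?thesis .
qed

text \<open>The difference is split so that each summand changes one factor. Three summands of total
  size 4 G carry the coefficient 4 / \<mu>^2, and the fourth, from the squared cut-off, adds 4 G /
  \<mu>^2.\<close>

lemma lip': "norm (\<eta>' z - \<eta>' y) \<le> 20 * G / \<mu>\<^sup>2 * norm (z - y)"
proof (rule lipschitz_extend_by_zero[of \<mu>])
  fix z y :: finseq assume zy: "norm z \<le> \<mu>" "norm y \<le> \<mu>"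
  show "norm (\<eta>' z - \<eta>' y) \<le> 20 * G / \<mu>\<^sup>2 * norm (z - y)"
  proof (rule norm_blinfun_bound)
    fix v
    let ?n = "norm (z - y)" and ?c = "4 / \<mu>\<^sup>2"
    have cs: "\<bar>x \<bullet> v\<bar> \<le> \<mu> * norm v" if "norm x \<le> \<mu>" for x :: finseq
      using Cauchy_Schwarz_ineq2[of x v] mult_right_mono[OF that norm_ge_zero[of v]] by linarith
    have nB: "norm (B w) \<le> \<theta> * norm w" for w
      using norm_blinfun[of B w] mult_right_mono[OF B norm_ge_zero[of w]] by linarith
    let ?t1 = "((\<sigma> z - \<sigma> y) * (z \<bullet> v)) *\<^sub>R (b + B z)"
    let ?t2 = "(\<sigma> y * ((z - y) \<bullet> v)) *\<^sub>R (b + B z)"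
    let ?t3 = "(\<sigma> y * (y \<bullet> v)) *\<^sub>R B (z - y)"
    let ?t4 = "((\<sigma> z - \<sigma> y) * (\<sigma> z + \<sigma> y)) *\<^sub>R B v"
    have s: "\<bar>\<sigma> z - \<sigma> y\<bar> \<le> 2 / \<mu> * ?n" by (rule \<sigma>_lip[OF zy])
    have "norm ?t1 \<le> (2 / \<mu> * ?n) * (\<mu> * norm v) * G"
      unfolding norm_scaleR abs_mult using s cs[OF zy(1)] affine_le[OF zy(1)] \<mu> by (intro mult_mono) auto
    then have 1: "norm ?t1 \<le> 2 * (G * ?n * norm v)" using \<mu> by (simp add: mult_ac)
    have "norm ?t2 \<le> 1 * (?n * norm v) * G"
      unfolding norm_scaleR abs_mult using \<sigma>_bounds[of y] Cauchy_Schwarz_ineq2[of "z - y" v] affine_le[OF zy(1)]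
      by (intro mult_mono) auto
    then have 2: "norm ?t2 \<le> G * ?n * norm v" by (simp add: mult_ac)
    have "norm ?t3 \<le> 1 * (\<mu> * norm v) * (\<theta> * ?n)"
      unfolding norm_scaleR abs_mult using \<sigma>_bounds[of y] cs[OF zy(2)] nB[of "z - y"] \<mu> by (intro mult_mono) auto
    also have "\<dots> = (\<theta> * \<mu>) * (?n * norm v)" by (simp add: mult_ac)
    also have "\<dots> \<le> G * (?n * norm v)" using \<theta>G by (intro mult_right_mono) auto
    finally have 3: "norm ?t3 \<le> G * ?n * norm v" by (simp add: mult_ac)
    have "norm ?t4 \<le> (2 / \<mu> * ?n) * 2 * (\<theta> * norm v)"
      unfolding norm_scaleR abs_mult using s \<sigma>_bounds[of z] \<sigma>_bounds[of y] nB[of v] \<mu> by (intro mult_mono) auto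
    also have "\<dots> = 4 / \<mu>\<^sup>2 * ((\<theta> * \<mu>) * (?n * norm v))" using \<mu> by (simp add: power2_eq_square)
    also have "\<dots> \<le> ?c * (G * (?n * norm v))" using \<theta>G \<mu> by (intro mult_left_mono mult_right_mono) auto
    finally have 4: "norm ?t4 \<le> ?c * (G * ?n * norm v)" by (simp add: mult_ac)
    have "\<eta>' z v - \<eta>' y v = ?t4 - ?c *\<^sub>R (?t1 + ?t2 + ?t3)"
    proof -
      have x1: "(\<sigma> z * (z \<bullet> v)) *\<^sub>R (b + B z) - (\<sigma> y * (y \<bullet> v)) *\<^sub>R (b + B y) = ?t1 + ?t2 + ?t3"
        by (simp add: blinfun.diff_right inner_diff_left algebra_simps)
      have x2: "\<eta>' z v = (\<sigma> z)\<^sup>2 *\<^sub>R B v - ?c *\<^sub>R ((\<sigma> z * (z \<bullet> v)) *\<^sub>R (b + B z))" for z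
        unfolding apply' \<eta>0_def by simp
      have x3: "(\<sigma> z)\<^sup>2 *\<^sub>R B v - (\<sigma> y)\<^sup>2 *\<^sub>R B v = ?t4"
        by (simp add: power2_eq_square algebra_simps)
      have "\<eta>' z v - \<eta>' y v = ((\<sigma> z)\<^sup>2 *\<^sub>R B v - (\<sigma> y)\<^sup>2 *\<^sub>R B v) -
          ?c *\<^sub>R ((\<sigma> z * (z \<bullet> v)) *\<^sub>R (b + B z) - (\<sigma> y * (y \<bullet> v)) *\<^sub>R (b + B y))"
        unfolding x2 scaleR_diff_right by simp
      then show ?thesis unfolding x1 x3 .
    qed
    then have "norm ((\<eta>' z - \<eta>' y) v) \<le> norm ?t4 + ?c * norm (?t1 + ?t2 + ?t3)"
      using norm_triangle_ineq4[of ?t4 "?c *\<^sub>R (?t1 + ?t2 + ?t3)"] \<mu> by (simp add: blinfun.diff_left)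
    also have "norm (?t1 + ?t2 + ?t3) \<le> norm ?t1 + norm ?t2 + norm ?t3"
      using norm_triangle_ineq[of "?t1 + ?t2" ?t3] norm_triangle_ineq[of ?t1 ?t2] by linarith
    also have "\<dots> \<le> 4 * (G * ?n * norm v)" using 1 2 3 by linarith
    finally have "norm ((\<eta>' z - \<eta>' y) v) \<le> norm ?t4 + ?c * (4 * (G * ?n * norm v))"
      using mult_left_mono[of _ _ ?c] \<mu> by fastforce
    also have "\<dots> \<le> ?c * (G * ?n * norm v) + ?c * (4 * (G * ?n * norm v))" using 4 by (rule add_right_mono)
    also have "\<dots> = 20 * G / \<mu>\<^sup>2 * ?n * norm v" by (simp add: algebra_simps)
    finally show "norm ((\<eta>' z - \<eta>' y) v) \<le> 20 * G / \<mu>\<^sup>2 * ?n * norm v" .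
  qed (use G0 in simp)
qed (use zero' G0 in auto)

end

text \<open>At most one summand is nonzero at a point, so at most two matter for a pair of points:
  no loss for values, a factor 2 for differences.\<close>

lemma disjoint_support_sum:
  fixes f :: "'p \<Rightarrow> 'a :: real_normed_vector \<Rightarrow> 'b :: real_normed_vector"
  assumes S: "finite S" and supp: "\<And>p x. p \<in> S \<Longrightarrow> \<mu> \<le> norm (x - a p) \<Longrightarrow> f p x = 0"
    and sep: "\<And>p q. p \<in> S \<Longrightarrow> q \<in> S \<Longrightarrow> p \<noteq> q \<Longrightarrow> 2 * \<mu> \<le> norm (a p - a q)" and c: "0 \<le> c"
  shows "(\<And>p. p \<in> S \<Longrightarrow> norm (f p x) \<le> c) \<Longrightarrow> norm (\<Sum>p\<in>S. f p x) \<le> c"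
    "(\<And>p. p \<in> S \<Longrightarrow> norm (f p x - f p y) \<le> c) \<Longrightarrow> norm ((\<Sum>p\<in>S. f p x) - (\<Sum>p\<in>S. f p y)) \<le> 2 * c"
proof -
  define N where "N x = {p \<in> S. norm (x - a p) < \<mu>}" for x
  have fin: "finite (N x)" for x using S by (simp add: N_def)
  have one: "card (N x) \<le> 1" for x
  proof -
    have "p = q" if "p \<in> N x" "q \<in> N x" for p q
    proof (rule ccontr)
      assume "p \<noteq> q"
      moreover have "norm (a p - a q) < 2 * \<mu>"
        using that norm_triangle_ineq4[of "x - a q" "x - a p"] by (simp add: N_def)
      ultimately show False using sep[of p q] that by (simp add: N_def)
    qed
    then show ?thesis using card_le_Suc0_iff_eq[OF fin] by simp
  qed
  have out: "f p x = 0" if "p \<in> S - N x" for p x using that supp by (auto simp: N_def)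
  show "norm (\<Sum>p\<in>S. f p x) \<le> c" if b: "\<And>p. p \<in> S \<Longrightarrow> norm (f p x) \<le> c"
  proof -
    have "(\<Sum>p\<in>S. f p x) = (\<Sum>p\<in>N x. f p x)" using S out by (intro sum.mono_neutral_right) (auto simp: N_def)
    then have "norm (\<Sum>p\<in>S. f p x) \<le> (\<Sum>p\<in>N x. norm (f p x))" by (simp add: norm_sum)
    also have "\<dots> \<le> real (card (N x)) * c" using b by (intro sum_bounded_above) (auto simp: N_def)
    also have "\<dots> \<le> 1 * c" using one[of x] c by (intro mult_right_mono) auto
    finally show ?thesis by simp
  qed
  show "norm ((\<Sum>p\<in>S. f p x) - (\<Sum>p\<in>S. f p y)) \<le> 2 * c" if b: "\<And>p. p \<in> S \<Longrightarrow> norm (f p x - f p y) \<le> c"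
  proof -
    have "(\<Sum>p\<in>S. f p x) - (\<Sum>p\<in>S. f p y) = (\<Sum>p\<in>S. f p x - f p y)" by (simp add: sum_subtractf)
    also have "\<dots> = (\<Sum>p\<in>N x \<union> N y. f p x - f p y)"
      using S out by (intro sum.mono_neutral_right) (auto simp: N_def)
    finally have "norm ((\<Sum>p\<in>S. f p x) - (\<Sum>p\<in>S. f p y)) \<le> (\<Sum>p\<in>N x \<union> N y. norm (f p x - f p y))" by (simp add: norm_sum)
    also have "\<dots> \<le> real (card (N x \<union> N y)) * c" using b by (intro sum_bounded_above) (auto simp: N_def)
    also have "\<dots> \<le> 2 * c"
      using card_Un_le[of "N x" "N y"] one[of x] one[of y] c by (intro mult_right_mono) auto
    finally show ?thesis .
  qed
qed

text \<open>
  Near its foot \<open>a p\<close>, the perturbation is \<open>p - a p\<close> plus the linear map \<open>B0 p\<close> that makes the projection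
  onto \<open>T p\<close> replace the identity on the tangent space at \<open>a p\<close>; the supports are disjoint.
\<close>

lemma (in reach_manifold) interpolation:
  assumes S: "finite S" "S \<subseteq> euclid D"
    and a: "\<And>p. p \<in> S \<Longrightarrow> foot M p (a p)" "\<And>p. p \<in> S \<Longrightarrow> norm (p - a p) \<le> \<eta>"
    and T: "\<And>p. p \<in> S \<Longrightarrow> dsub d (T p)" "\<And>p. p \<in> S \<Longrightarrow> T p \<subseteq> euclid D"
      "\<And>p. p \<in> S \<Longrightarrow> dev (T p) (Tan (a p)) \<theta>" and \<theta>: "0 \<le> \<theta>" "\<theta> \<le> 1 / 4"
    and sep: "\<And>p q. p \<in> S \<Longrightarrow> q \<in> S \<Longrightarrow> p \<noteq> q \<Longrightarrow> 2 * \<mu> \<le> norm (a p - a q)" and \<mu>: "0 < \<mu>"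
    and G: "\<eta> + 2 * \<theta> * \<mu> \<le> G" "10 * G \<le> \<mu>" "0 \<le> G"
  obtains M' where "M' \<in> manifold_class D d (1 / (6 / \<rho> + 320 * G / \<mu>\<^sup>2))" "S \<subseteq> M'"
    "\<And>p. p \<in> S \<Longrightarrow> tangent_space M' p = T p" "ambient_isotopic D M M'"
    "\<And>x. x \<in> M \<Longrightarrow> \<exists>x'\<in>M'. norm (x - x') \<le> G" "\<And>x'. x' \<in> M' \<Longrightarrow> \<exists>x\<in>M. norm (x - x') \<le> G"
proof -
  have aM: "a p \<in> M" if "p \<in> S" for p using a(1)[OF that] by (simp add: foot_def)
  define B0 where "B0 p v = proj (T p) (proj (Tan (a p)) v) - proj (Tan (a p)) v" for p v
  \<comment> \<open>The estimated planes are known to be close to the true ones; reversing the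
    relation produces the factor 2 that accompanies \<open>\<theta>\<close>.\<close>
  have dev2: "dev (Tan (a p)) (T p) (2 * \<theta>)" if "p \<in> S" for p
    using T[OF that] \<theta> aM[OF that] by (intro dev_sym[OF _ dsub_Tan _ Tan_euclid]) auto
  have B0n: "norm (B0 p v) \<le> 2 * \<theta> * norm v" if "p \<in> S" for p v
  proof -
    have "norm (B0 p v) \<le> 2 * \<theta> * norm (proj (Tan (a p)) v)"
      unfolding B0_def norm_minus_commute[of "proj (T p) _"]
      by (rule devD[OF dev2[OF that] proj_in[OF dsub_Tan[OF aM[OF that]]]])
    also have "\<dots> \<le> 2 * \<theta> * norm v"
      using norm_proj_le[OF dsub_Tan[OF aM[OF that]]] \<theta> by (intro mult_left_mono) auto
    finally show ?thesis .
  qed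
  have blB0: "bounded_linear (B0 p)" if "p \<in> S" for p
    unfolding B0_def[abs_def]
    by (intro bounded_linear_sub bounded_linear_compose[OF bounded_linear_proj[OF T(1)[OF that]]]
        bounded_linear_proj[OF dsub_Tan[OF aM[OF that]]])
  define B where "B p = Blinfun (B0 p)" for p
  have Bapp: "blinfun_apply (B p) = B0 p" if "p \<in> S" for p
    unfolding B_def by (rule bounded_linear_Blinfun_apply[OF blB0[OF that]])
  have bump: "bump \<mu> (2 * \<theta>) G (p - a p) (B p)" if p: "p \<in> S" for p
  proof
    show "norm (B p) \<le> 2 * \<theta>" using B0n[OF p] \<theta> by (intro norm_blinfun_bound) (auto simp: Bapp[OF p])
    show "norm (p - a p) + 2 * \<theta> * \<mu> \<le> G" using a(2)[OF p] G(1) by linarith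
  qed (rule \<mu>)
  define f where "f p x = bump.\<eta> \<mu> (p - a p) (B p) (x - a p)" for p x
  define f' where "f' p x = bump.\<eta>' \<mu> (p - a p) (B p) (x - a p)" for p x
  define e where "e x = (\<Sum>p\<in>S. f p x)" for x
  define e' where "e' x = (\<Sum>p\<in>S. f' p x)" for x
  have z: "f p x = 0" "f' p x = 0" if "p \<in> S" "\<mu> \<le> norm (x - a p)" for p x
    using bump.zero[OF bump] bump.zero'[OF bump] that by (auto simp: f_def f'_def)
  \<comment> \<open>The assumption \<open>10 * G \<le> \<mu>\<close> is what keeps the derivative of
    the displacement at most 1/2.\<close>
  have Gmu: "0 \<le> 5 * G / \<mu>" "0 \<le> 20 * G / \<mu>\<^sup>2" "5 * G / \<mu> \<le> 1 / 2" using G \<mu> by (auto simp: pos_divide_le_eq)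
  have pE: "p \<in> euclid D" "a p \<in> euclid D" if "p \<in> S" for p using that S(2) aM ME by auto
  interpret near_id D e e' "40 * G / \<mu>\<^sup>2"
  proof
    fix x y
    show "(e has_derivative blinfun_apply (e' x)) (at x)"
    proof -
      have "(f p has_derivative blinfun_apply (f' p x)) (at x)" if "p \<in> S" for p
      proof -
        have "((\<lambda>x. x - a p) has_derivative (\<lambda>v. v)) (at x)" by (auto intro!: derivative_eq_intros)
        from has_derivative_compose[OF this bump.der[OF bump[OF that]]]
        show ?thesis by (simp add: f_def[abs_def] f'_def)
      qed
      then have "((\<lambda>x. \<Sum>p\<in>S. f p x) has_derivative (\<lambda>v. \<Sum>p\<in>S. f' p x v)) (at x)"
        by (intro has_derivative_sum) auto
      moreover have "blinfun_apply (\<Sum>p\<in>S. f' p x) = (\<lambda>v. \<Sum>p\<in>S. f' p x v)"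
        by (rule ext) (simp add: blinfun.sum_left)
      ultimately show ?thesis by (simp add: e_def[abs_def] e'_def)
    qed
    show "e x \<in> euclid D"
      unfolding e_def
    proof (rule subspace_sum[OF subspace_euclid])
      fix p assume p: "p \<in> S"
      have "B0 p (x - a p) \<in> euclid D" unfolding B0_def
        using proj_in[OF T(1)[OF p]] T(2)[OF p] proj_in[OF dsub_Tan[OF aM[OF p]]] Tan_euclid[OF aM[OF p]]
        by (intro subspace_diff[OF subspace_euclid]) auto
      then show "f p x \<in> euclid D"
        unfolding f_def bump.\<eta>_def[OF bump[OF p]] Bapp[OF p]
        using pE[OF p] by (intro subspace_scale[OF subspace_euclid] subspace_add[OF subspace_euclid] subspace_diff[OF subspace_euclid])
    qed
    have "norm (e' x) \<le> 5 * G / \<mu>"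
      unfolding e'_def using bump.norm'_le[OF bump]
      by (intro disjoint_support_sum(1)[OF S(1) z(2) sep Gmu(1)]) (auto simp: f'_def)
    then show "norm (e' x) \<le> 1 / 2" using Gmu(3) by linarith
    have "norm (e' x - e' y) \<le> 2 * (20 * G / \<mu>\<^sup>2 * norm (x - y))"
      unfolding e'_def
    proof (rule disjoint_support_sum(2)[where a = a and \<mu> = \<mu> and f = f', OF S(1) z(2) sep])
      fix p assume p: "p \<in> S"
      show "norm (f' p x - f' p y) \<le> 20 * G / \<mu>\<^sup>2 * norm (x - y)"
        using bump.lip'[OF bump[OF p], of "x - a p" "y - a p"] by (simp add: f'_def)
    qed (assumption | rule mult_nonneg_nonneg[OF Gmu(2) norm_ge_zero])+
    then show "norm (e' x - e' y) \<le> 40 * G / \<mu>\<^sup>2 * norm (x - y)" by simp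
    show "0 \<le> 40 * G / \<mu>\<^sup>2" using G by simp
  qed
  have eG: "norm (e x) \<le> G" for x
    unfolding e_def using bump.norm_le[OF bump]
    by (intro disjoint_support_sum(1)[OF S(1) z(1) sep G(3)]) (auto simp: f_def)
  have at: "e (a p) = p - a p" "e' (a p) = B p" if p: "p \<in> S" for p
  proof -
    have zq: "f q (a p) = 0 \<and> f' q (a p) = 0" if q: "q \<in> S - {p}" for q
    proof -
      have "\<mu> \<le> norm (a p - a q)" using sep[of p q] p q \<mu> by auto
      then show ?thesis using z[of q "a p"] q by blast
    qed
    have "e (a p) = f p (a p)" unfolding e_def using S(1) p zq by (subst sum.remove[of _ p]) auto
    then show "e (a p) = p - a p" using bump.at_0[OF bump[OF p]] by (simp add: f_def)
    have "e' (a p) = f' p (a p)" unfolding e'_def using S(1) p zq by (subst sum.remove[of _ p]) auto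
    then show "e' (a p) = B p" using bump.at_0[OF bump[OF p]] by (simp add: f'_def)
  qed
  have \<Phi>a: "\<Phi> (a p) = p" if "p \<in> S" for p using at(1)[OF that] by (simp add: \<Phi>_def)
  show ?thesis
  proof (rule that[of "\<Phi> ` M"])
    \<comment> \<open>320 = 8 * 40, and 40 is twice the Lipschitz factor 20 of a single
      bump.\<close>
    show "\<Phi> ` M \<in> manifold_class D d (1 / (6 / \<rho> + 320 * G / \<mu>\<^sup>2))"
      using manifold_class_image[OF mc \<rho>] by simp
    show "S \<subseteq> \<Phi> ` M" using \<Phi>a aM by force
    show "ambient_isotopic D M (\<Phi> ` M)" by (rule isotopic[OF ME])
    show "\<exists>x'\<in>\<Phi> ` M. norm (x - x') \<le> G" if "x \<in> M" for x
      using that eG[of x] by (intro bexI[of _ "\<Phi> x"]) (auto simp: \<Phi>_def)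
    show "\<exists>x\<in>M. norm (x - x') \<le> G" if "x' \<in> \<Phi> ` M" for x'
    proof -
      obtain x where "x \<in> M" "x' = \<Phi> x" using \<open>x' \<in> \<Phi> ` M\<close> by blast
      then show ?thesis using eG[of x] by (intro bexI[of _ x]) (auto simp: \<Phi>_def)
    qed
    fix p assume p: "p \<in> S"
    have "tangent_space (\<Phi> ` M) p = (\<lambda>v. v + e' (a p) v) ` Tan (a p)"
      using tangent_space_image[OF ME aM[OF p]] \<Phi>a[OF p] by simp
    also have "\<dots> = proj (T p) ` Tan (a p)"
      using proj_id[OF dsub_Tan[OF aM[OF p]]] by (intro image_cong) (auto simp: at(2)[OF p] Bapp[OF p] B0_def)
    also have "\<dots> = T p" using \<theta> by (intro proj_onto[OF dsub_Tan[OF aM[OF p]] T(1)[OF p] dev2[OF p]]) auto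
    finally show "tangent_space (\<Phi> ` M) p = T p" .
  qed
qed

section \<open>Concentration of counts\<close>

text \<open>Counting indices makes this a sum of independent indicators; it becomes the cardinality
  of a set of sample points once these are distinct.\<close>

definition hits :: "nat \<Rightarrow> (nat \<Rightarrow> 'a) \<Rightarrow> 'a set \<Rightarrow> real"
  where "hits n x A = real (card {i. i < n \<and> x i \<in> A})"

lemma hits_mono: "A \<subseteq> B \<Longrightarrow> hits n x A \<le> hits n x B"
  unfolding hits_def by (auto intro!: card_mono)

text \<open>Witnessed by a measurable subevent, hence compatible with \<open>inner_prob\<close> for
  predicates of unknown measurability.\<close>

definition whp :: "finseq measure \<Rightarrow> nat \<Rightarrow> real \<Rightarrow> ((nat \<Rightarrow> finseq) \<Rightarrow> bool) \<Rightarrow> bool"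
  where "whp P n \<epsilon> Q \<longleftrightarrow> (\<exists>G\<in>sets (sample P n). 1 - \<epsilon> \<le> measure (sample P n) G \<and> (\<forall>x\<in>G. Q x))"

lemma whp_mono: "whp P n \<epsilon> Q \<Longrightarrow> \<epsilon> \<le> \<epsilon>' \<Longrightarrow> (\<And>x. Q x \<Longrightarrow> Q' x) \<Longrightarrow> whp P n \<epsilon>' Q'"
  unfolding whp_def by (elim bexE conjE, rule bexI) auto

locale prob_borel =
  fixes P :: "finseq measure" assumes prob: "prob_space P" and sets_eq: "sets P = sets borel"
begin

lemma space_eq: "space P = UNIV" using sets_eq_imp_space_eq[OF sets_eq] by simp

sublocale PP: prob_space P by (rule prob)

lemma product: "product_prob_space (\<lambda>_::nat. P)" using prob by (simp add: product_prob_spaceI)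

lemma prob_sample: "prob_space (sample P n)"
  unfolding sample_def by (intro prob_space_PiM prob)

lemma whp_conj:
  assumes "whp P n \<epsilon> Q" "whp P n \<epsilon>' Q'" shows "whp P n (\<epsilon> + \<epsilon>') (\<lambda>x. Q x \<and> Q' x)"
proof -
  interpret S: prob_space "sample P n" by (rule prob_sample)
  obtain G G' where G: "G \<in> sets (sample P n)" "1 - \<epsilon> \<le> measure (sample P n) G" "\<forall>x\<in>G. Q x"
    "G' \<in> sets (sample P n)" "1 - \<epsilon>' \<le> measure (sample P n) G'" "\<forall>x\<in>G'. Q' x"
    using assms unfolding whp_def by blast
  have "measure (sample P n) G \<le> measure (sample P n) ((G \<inter> G') \<union> (space (sample P n) - G'))"
    using G(1,4) sets.sets_into_space[OF G(1)] by (intro S.finite_measure_mono) auto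
  also have "\<dots> \<le> measure (sample P n) (G \<inter> G') + measure (sample P n) (space (sample P n) - G')"
    using G(1,4) by (intro measure_Un_le) auto
  also have "measure (sample P n) (space (sample P n) - G') = 1 - measure (sample P n) G'"
    by (rule S.prob_compl[OF G(4)])
  finally have "1 - (\<epsilon> + \<epsilon>') \<le> measure (sample P n) (G \<inter> G')" using G(2,5) by linarith
  then show ?thesis unfolding whp_def using G by (intro bexI[of _ "G \<inter> G'"]) auto
qed

lemma whp_ball:
  assumes "finite F" "\<And>z. z \<in> F \<Longrightarrow> whp P n \<epsilon> (Q z)"
  shows "whp P n (real (card F) * \<epsilon>) (\<lambda>x. \<forall>z\<in>F. Q z x)"
  using assms
proof (induction F rule: finite_induct)
  case empty
  show ?case unfolding whp_def using prob_space.prob_space[OF prob_sample[of n]]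
    by (intro bexI[of _ "space (sample P n)"]) auto
next
  case (insert z F)
  then have "whp P n (\<epsilon> + real (card F) * \<epsilon>) (\<lambda>x. Q z x \<and> (\<forall>z\<in>F. Q z x))" by (intro whp_conj) auto
  then show ?case using insert by (elim whp_mono) (auto simp: algebra_simps)
qed

lemma whpI:
  assumes "B \<in> sets (sample P n)" "measure (sample P n) B \<le> \<epsilon>" "\<And>x. x \<in> space (sample P n) - B \<Longrightarrow> Q x"
  shows "whp P n \<epsilon> Q"
  unfolding whp_def
proof (intro bexI[of _ "space (sample P n) - B"] conjI ballI)
  show "1 - \<epsilon> \<le> measure (sample P n) (space (sample P n) - B)"
    using prob_space.prob_compl[OF prob_sample assms(1)] assms(2) by simp
qed (use assms in auto)

lemma hits_measurable:
  assumes "A \<in> sets borel" shows "(\<lambda>x. hits n x A) \<in> borel_measurable (sample P n)"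
proof -
  have "hits n x A = (\<Sum>i<n. indicator A (x i))" for x :: "nat \<Rightarrow> finseq"
  proof -
    have "(\<Sum>i<n. indicator A (x i)) = real (card ({..<n} \<inter> {i. x i \<in> A}))"
      by (simp add: indicator_def sum.If_cases)
    moreover have "{..<n} \<inter> {i. x i \<in> A} = {i. i < n \<and> x i \<in> A}" by auto
    ultimately show ?thesis by (simp add: hits_def)
  qed
  moreover have "(\<lambda>x. indicator A (x i) :: real) \<in> borel_measurable (sample P n)" if "i < n" for i
    unfolding sample_def using assms that
    by (intro measurable_compose[OF measurable_component_singleton] borel_measurable_indicator) (auto simp: sets_eq)
  ultimately show ?thesis by (simp add: borel_measurable_sum)
qed

text \<open>The sign of \<open>z\<close> selects the tail: positive for too many hits, negative for
  too few. The moment of one indicator is 1 + p (exp z - 1), at most exp (p (exp z - 1)).\<close>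

lemma chernoff:
  assumes A: "A \<in> sets borel"
  shows "measure (sample P n) {x \<in> space (sample P n). z * s \<le> z * hits n x A}
    \<le> exp (real n * measure P A * (exp z - 1) - z * s)"
proof -
  interpret S: prob_space "sample P n" by (rule prob_sample)
  let ?p = "measure P A"
  define \<phi> where "\<phi> y = (if y \<in> A then ennreal (exp z) else 1)" for y
  have [measurable]: "A \<in> sets P" using A by (simp add: sets_eq)
  have \<phi>_meas: "\<phi> \<in> borel_measurable P" unfolding \<phi>_def by measurable
  have prod: "(\<Prod>i<n. \<phi> (x i)) = ennreal (exp (z * hits n x A))" for x
  proof -
    have "(\<Prod>i<n. \<phi> (x i)) = (\<Prod>i\<in>{..<n} \<inter> {i. x i \<in> A}. ennreal (exp z))"
      unfolding \<phi>_def by (subst prod.If_cases) auto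
    also have "{..<n} \<inter> {i. x i \<in> A} = {i. i < n \<and> x i \<in> A}" by auto
    finally show ?thesis
      by (simp add: hits_def ennreal_power exp_of_nat_mult[symmetric] mult.commute)
  qed
  have "(\<integral>\<^sup>+y. \<phi> y \<partial>P) = (\<integral>\<^sup>+y. ennreal (exp z) * indicator A y + indicator (space P - A) y \<partial>P)"
    by (intro nn_integral_cong) (auto simp: \<phi>_def indicator_def)
  also have "\<dots> = ennreal (exp z) * emeasure P A + emeasure P (space P - A)"
    by (subst nn_integral_add) (auto simp: nn_integral_cmult_indicator)
  also have "\<dots> = ennreal (exp z * ?p + (1 - ?p))"
    by (simp add: PP.emeasure_eq_measure PP.prob_compl ennreal_mult')
  also have "\<dots> \<le> ennreal (exp (?p * (exp z - 1)))"
    using exp_ge_add_one_self[of "?p * (exp z - 1)"] by (intro ennreal_leI) (simp add: algebra_simps)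
  finally have \<phi>_int: "(\<integral>\<^sup>+y. \<phi> y \<partial>P) \<le> ennreal (exp (?p * (exp z - 1)))" .
  have "(\<integral>\<^sup>+x. (\<Prod>i<n. \<phi> (x i)) \<partial>sample P n) = (\<Prod>i<n. \<integral>\<^sup>+y. \<phi> y \<partial>P)"
    unfolding sample_def using \<phi>_meas by (intro product_sigma_finite.product_nn_integral_prod) (auto simp: product_sigma_finite_def PP.sigma_finite_measure_axioms)
  also have "\<dots> = (\<integral>\<^sup>+y. \<phi> y \<partial>P) ^ n" by simp
  also have "\<dots> \<le> ennreal (exp (?p * (exp z - 1))) ^ n" by (intro power_mono \<phi>_int) auto
  also have "\<dots> = ennreal (exp (real n * ?p * (exp z - 1)))"
    by (simp add: ennreal_power exp_of_nat_mult[symmetric] mult.assoc)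
  finally have int: "(\<integral>\<^sup>+x. ennreal (exp (z * hits n x A)) \<partial>sample P n) \<le> ennreal (exp (real n * ?p * (exp z - 1)))"
    by (simp add: prod)
  let ?B = "{x \<in> space (sample P n). 1 \<le> ennreal (exp (- (z * s))) * ennreal (exp (z * hits n x A))}"
  have "emeasure (sample P n) ?B \<le> ennreal (exp (- (z * s))) * (\<integral>\<^sup>+x. ennreal (exp (z * hits n x A)) * indicator (space (sample P n)) x \<partial>sample P n)"
    using hits_measurable[OF A] by (intro nn_integral_Markov_inequality) auto
  also have "(\<integral>\<^sup>+x. ennreal (exp (z * hits n x A)) * indicator (space (sample P n)) x \<partial>sample P n) = (\<integral>\<^sup>+x. ennreal (exp (z * hits n x A)) \<partial>sample P n)"
    by (intro nn_integral_cong) auto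
  also have "ennreal (exp (- (z * s))) * \<dots> \<le> ennreal (exp (- (z * s))) * ennreal (exp (real n * ?p * (exp z - 1)))"
    by (intro mult_left_mono int) auto
  also have "\<dots> = ennreal (exp (real n * ?p * (exp z - 1) - z * s))"
    by (simp add: ennreal_mult'[symmetric] exp_add[symmetric])
  also have "?B = {x \<in> space (sample P n). z * s \<le> z * hits n x A}"
    by (auto simp: ennreal_mult'[symmetric] exp_add[symmetric] simp flip: ennreal_1)
  finally show ?thesis by (simp add: S.emeasure_eq_measure)
qed

text \<open>The parameter stays free: 1 suits counts with a large mean, while
  \<open>tube_hits\<close> takes it of order ln n to bound counts of vanishing mean by a
  constant.\<close>

lemma whp_hits_less:
  assumes A: "A \<in> sets borel" and p: "measure P A \<le> p" and z: "0 < z"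
  shows "whp P n (exp (real n * p * (exp z - 1) - z * s)) (\<lambda>x. hits n x A < s)"
proof (rule whpI)
  show "{x \<in> space (sample P n). z * s \<le> z * hits n x A} \<in> sets (sample P n)"
    using hits_measurable[OF A, of n] by measurable
  have "real n * measure P A * (exp z - 1) \<le> real n * p * (exp z - 1)"
    using p z by (intro mult_right_mono mult_left_mono) auto
  then show "measure (sample P n) {x \<in> space (sample P n). z * s \<le> z * hits n x A} \<le> exp (real n * p * (exp z - 1) - z * s)"
    by (intro order_trans[OF chernoff[OF A]]) auto
qed (use z in auto)

text \<open>Parameter -1, with exp (-1) at most 1/2: the exponent is at most - n p / 2 + n p /
  4.\<close>

lemma whp_hits_greater:
  assumes A: "A \<in> sets borel" and p: "p \<le> measure P A"
  shows "whp P n (exp (- (real n * p / 4))) (\<lambda>x. real n * p / 4 < hits n x A)"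
proof (rule whpI)
  show "{x \<in> space (sample P n). (- 1) * (real n * p / 4) \<le> (- 1) * hits n x A} \<in> sets (sample P n)"
    using hits_measurable[OF A, of n] by measurable
  have "exp (- 1) \<le> (1 / 2 :: real)"
    using exp_ge_add_one_self[of 1] by (simp add: exp_minus field_simps)
  then have "real n * measure P A * (exp (- 1) - 1) \<le> real n * measure P A * (- 1 / 2)" by (intro mult_left_mono) auto
  also have "\<dots> = - (real n * measure P A / 2)" by simp
  also have "\<dots> \<le> - (real n * p / 2)" using p by (simp add: mult_left_mono)
  finally have "real n * measure P A * (exp (- 1) - 1) - (- 1) * (real n * p / 4) \<le> - (real n * p / 4)" by linarith
  then show "measure (sample P n) {x \<in> space (sample P n). (- 1) * (real n * p / 4) \<le> (- 1) * hits n x A} \<le> exp (- (real n * p / 4))"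
    by (intro order_trans[OF chernoff[OF A]]) simp
qed auto

lemma whp_all_in:
  assumes "A \<in> sets borel" "measure P (- A) = 0"
  shows "whp P n 0 (\<lambda>x. \<forall>i<n. x i \<in> A)"
proof -
  have "whp P n (real (card {..<n}) * 0) (\<lambda>x. \<forall>i\<in>{..<n}. x i \<in> A)"
  proof (rule whp_ball)
    fix i assume i: "i \<in> {..<n}"
    have A: "- A \<in> sets P" using assms by (simp add: sets_eq)
    show "whp P n 0 (\<lambda>x. x i \<in> A)"
    proof (rule whpI)
      show "{x \<in> space (sample P n). x i \<in> - A} \<in> sets (sample P n)"
        unfolding sample_def using i A by measurable
      show "measure (sample P n) {x \<in> space (sample P n). x i \<in> - A} \<le> 0"
        unfolding sample_def measure_def using product_prob_space.emeasure_PiM_Collect_single[OF product i A] assms(2) by (simp add: measure_def)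
    qed auto
  qed simp
  then show ?thesis by (simp add: Ball_def)
qed

lemma pair_in_measure:
  assumes "i < n" "j < n" "i \<noteq> j" "A \<in> sets borel"
  shows "{x \<in> space (sample P n). x i \<in> A \<and> x j \<in> A} \<in> sets (sample P n)"
    "measure (sample P n) {x \<in> space (sample P n). x i \<in> A \<and> x j \<in> A} = (measure P A)\<^sup>2"
proof -
  have [measurable]: "A \<in> sets P" using assms by (simp add: sets_eq)
  have *: "{x \<in> space (sample P n). x i \<in> A \<and> x j \<in> A} = {x \<in> space (sample P n). \<forall>k\<in>{i, j}. x k \<in> A}" by auto
  have [measurable]: "i \<in> {..<n}" "j \<in> {..<n}" using assms by auto
  show "{x \<in> space (sample P n). x i \<in> A \<and> x j \<in> A} \<in> sets (sample P n)"
    unfolding sample_def by measurable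
  have "emeasure (sample P n) {x \<in> space (sample P n). \<forall>k\<in>{i, j}. x k \<in> A} = (\<Prod>k\<in>{i, j}. emeasure P A)"
    unfolding sample_def using assms by (intro product_prob_space.emeasure_PiM_Collect[OF product]) (auto simp: sets_eq)
  then show "measure (sample P n) {x \<in> space (sample P n). x i \<in> A \<and> x j \<in> A} = (measure P A)\<^sup>2"
    unfolding * using assms(3) by (simp add: measure_def power2_eq_square enn2real_mult)
qed

text \<open>The estimator sees the sample as a set, so repeated points would spoil the counts. With
  the support cut into disjoint pieces of mass at most \<open>\<epsilon>\<close>, two given points
  share a piece with probability at most the sum of the squared masses, hence at most
  \<open>\<epsilon>\<close>.\<close>

lemma whp_inj:
  assumes C: "finite C" "S \<subseteq> \<Union>C" "C \<subseteq> sets borel" "\<And>B. B \<in> C \<Longrightarrow> measure P B \<le> \<epsilon>"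
    and S: "S \<in> sets borel" "measure P (- S) = 0"
  shows "whp P n ((real n)\<^sup>2 * \<epsilon>) (\<lambda>x. inj_on x {..<n})"
proof -
  obtain c :: "nat \<Rightarrow> finseq set" where c: "bij_betw c {..<card C} C"
    using ex_bij_betw_nat_finite[OF C(1)] by (auto simp: atLeast0LessThan)
  define c' where "c' k = (if k < card C then c k else {})" for k
  define B where "B = disjointed c'"
  have c'b: "c' k \<in> sets borel" for k using c C(3) by (auto simp: c'_def bij_betw_def)
  then have Bb: "B k \<in> sets borel" for k unfolding B_def using sets.range_disjointed_sets[of c' borel] by auto
  have UB: "S \<subseteq> (\<Union>k. B k)"
  proof -
    have "\<Union>C \<subseteq> (\<Union>k. c' k)" using c by (force simp: c'_def bij_betw_def)
    from subset_trans[OF C(2) this] show ?thesis unfolding B_def UN_disjointed_eq .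
  qed
  have BC: "B k \<subseteq> c' k" for k unfolding B_def by (rule disjointed_subset)
  have "S \<noteq> {}"
  proof
    assume "S = {}"
    then have "measure P UNIV = 0" using S by simp
    then show False using PP.prob_space space_eq by simp
  qed
  then have "C \<noteq> {}" using C(2) by auto
  then obtain B0 where "B0 \<in> C" by blast
  then have \<epsilon>: "0 \<le> \<epsilon>" using C(4) measure_nonneg order_trans by blast
  have Bsmall: "measure P (B k) \<le> \<epsilon>" for k
  proof (cases "k < card C")
    case True
    then have ck: "c k \<in> C" using c by (auto simp: bij_betw_def)
    have "measure P (B k) \<le> measure P (c k)"
      using BC[of k] True ck C(3) by (intro PP.finite_measure_mono) (auto simp: c'_def sets_eq)
    then show ?thesis using C(4)[OF ck] by linarith
  next
    case False
    then have "B k = {}" using BC[of k] by (simp add: c'_def)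
    then show ?thesis using \<epsilon> by simp
  qed
  have pair: "whp P n \<epsilon> (\<lambda>x. \<forall>k<card C. \<not> (x i \<in> B k \<and> x j \<in> B k))" if ij: "i < n" "j < n" "i \<noteq> j" for i j
  proof (rule whpI)
    let ?E = "\<lambda>k. {x \<in> space (sample P n). x i \<in> B k \<and> x j \<in> B k}"
    note E = pair_in_measure[OF ij Bb]
    show "(\<Union>k<card C. ?E k) \<in> sets (sample P n)" using E(1) by (intro sets.finite_UN) auto
    interpret S: prob_space "sample P n" by (rule prob_sample)
    have "measure (sample P n) (\<Union>k<card C. ?E k) \<le> (\<Sum>k<card C. measure (sample P n) (?E k))"
      using E(1) by (intro S.finite_measure_subadditive_finite) auto
    also have "\<dots> = (\<Sum>k<card C. (measure P (B k))\<^sup>2)" by (simp only: E(2))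
    also have "\<dots> \<le> (\<Sum>k<card C. \<epsilon> * measure P (B k))"
      using Bsmall by (intro sum_mono) (auto simp: power2_eq_square intro: mult_right_mono)
    also have "\<dots> = \<epsilon> * (\<Sum>k<card C. measure P (B k))" by (simp add: sum_distrib_left)
    also have "(\<Sum>k<card C. measure P (B k)) = measure P (\<Union>k<card C. B k)"
      using Bb disjoint_family_disjointed[of c']
      by (intro PP.finite_measure_finite_Union[symmetric]) (auto simp: sets_eq B_def disjoint_family_on_def)
    also have "\<epsilon> * \<dots> \<le> \<epsilon> * 1" using \<epsilon> by (intro mult_left_mono) auto
    finally show "measure (sample P n) (\<Union>k<card C. ?E k) \<le> \<epsilon>" by simp
  qed auto
  let ?I = "{(i, j). i < n \<and> j < n \<and> i \<noteq> j}"
  have finI: "finite ?I" by (rule finite_subset[of _ "{..<n} \<times> {..<n}"]) auto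
  have "card ?I \<le> card ({..<n} \<times> {..<n})" by (intro card_mono) auto
  then have "real (card ?I) \<le> real (n * n)" unfolding card_cartesian_product card_lessThan of_nat_le_iff .
  then have cI: "real (card ?I) \<le> (real n)\<^sup>2" by (simp add: power2_eq_square)
  have "whp P n (real (card ?I) * \<epsilon>) (\<lambda>x. \<forall>ij\<in>?I. \<forall>k<card C. \<not> (x (fst ij) \<in> B k \<and> x (snd ij) \<in> B k))"
    using pair by (intro whp_ball finI) auto
  from whp_conj[OF this whp_all_in[OF S]] show ?thesis
  proof (rule whp_mono)
    show "real (card ?I) * \<epsilon> + 0 \<le> (real n)\<^sup>2 * \<epsilon>" using cI \<epsilon> by (simp add: mult_right_mono)
    fix x assume x: "(\<forall>ij\<in>?I. \<forall>k<card C. \<not> (x (fst ij) \<in> B k \<and> x (snd ij) \<in> B k)) \<and> (\<forall>i<n. x i \<in> S)"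
    show "inj_on x {..<n}"
    proof (rule inj_onI, rule ccontr)
      fix i j assume ij: "i \<in> {..<n}" "j \<in> {..<n}" "x i = x j" "i \<noteq> j"
      obtain k where k: "x i \<in> B k" using x ij UB by blast
      have "k < card C"
      proof (rule ccontr)
        assume "\<not> ?thesis"
        then show False using k BC[of k] by (auto simp: c'_def)
      qed
      moreover have "(i, j) \<in> ?I" using ij by simp
      ultimately show False using x k ij(3) by fastforce
    qed
  qed
qed

end

sublocale outlier_dist \<subseteq> prob_borel P by (rule prob_borel.intro[OF prob_P sets_P])

section \<open>Counts in all balls simultaneously\<close>

context outlier_dist
begin

lemma support_borel: "euclid D \<inter> cball 0 K0 \<in> sets borel"
  by (intro borel_closed closed_Int closed_euclid closed_cball)

lemma whp_support: "whp P n 0 (\<lambda>x. \<forall>i<n. x i \<in> euclid D \<inter> cball 0 K0)"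
  by (rule whp_all_in[OF support_borel P_support])

lemma zero_in_euclid: "0 \<in> euclid D" by (rule subspace_0[OF subspace_euclid])

text \<open>Union bound over a net of mesh \<open>h\<close>: each ball of radius
  \<open>2 * h\<close> lies in one of radius \<open>3 * h\<close> about a net point.\<close>

lemma whp_ball_hits_less:
  assumes h: "0 < h" "h \<le> K0" and B: "B \<in> sets borel" and z: "0 < z"
    and p: "\<And>y. measure P (cball y (3 * h) \<inter> B) \<le> p"
  shows "whp P n (((2 * real D + 2) * (K0 / h)) ^ D * exp (real n * p * (exp z - 1) - z * s))
    (\<lambda>x. \<forall>y\<in>euclid D \<inter> cball 0 K0. hits n x (cball y (2 * h) \<inter> B) < s)"
proof -
  obtain F where F: "finite F" "real (card F) \<le> ((2 * real D + 2) * (K0 / h)) ^ D"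
    "\<And>x. x \<in> euclid D \<inter> cball 0 K0 \<Longrightarrow> \<exists>z\<in>F. dist x z \<le> h"
    by (rule euclid_cover[of D h K0 "euclid D \<inter> cball 0 K0" 0]) (use dD h zero_in_euclid in auto)
  have "whp P n (real (card F) * exp (real n * p * (exp z - 1) - z * s)) (\<lambda>x. \<forall>y\<in>F. hits n x (cball y (3 * h) \<inter> B) < s)"
    using B z p by (intro whp_ball F(1) whp_hits_less) auto
  then show ?thesis
  proof (rule whp_mono)
    show "real (card F) * exp (real n * p * (exp z - 1) - z * s) \<le> ((2 * real D + 2) * (K0 / h)) ^ D * exp (real n * p * (exp z - 1) - z * s)"
      using F(2) by (rule mult_right_mono) simp
    fix x assume x: "\<forall>y\<in>F. hits n x (cball y (3 * h) \<inter> B) < s"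
    show "\<forall>y\<in>euclid D \<inter> cball 0 K0. hits n x (cball y (2 * h) \<inter> B) < s"
    proof
      fix y assume "y \<in> euclid D \<inter> cball 0 K0"
      then obtain w where w: "w \<in> F" "dist y w \<le> h" using F(3) by blast
      have "cball y (2 * h) \<inter> B \<subseteq> cball w (3 * h) \<inter> B"
      proof
        fix q assume q: "q \<in> cball y (2 * h) \<inter> B"
        have "dist w q \<le> dist y w + dist y q" by (metis dist_triangle dist_commute)
        then show "q \<in> cball w (3 * h) \<inter> B" using q w by simp
      qed
      then have "hits n x (cball y (2 * h) \<inter> B) \<le> hits n x (cball w (3 * h) \<inter> B)" by (rule hits_mono)
      then show "hits n x (cball y (2 * h) \<inter> B) < s" using x w(1) by fastforce
    qed
  qed
qed

lemma whp_manifold_hits_greater: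
  assumes r: "0 < r" "r \<le> \<rho> / 112"
  shows "whp P n (((2 * real D + 2) * (K0 / (r / 2))) ^ D * exp (- (real n * (\<beta> * f_min * vol_low d * (r / 2) ^ d) / 4)))
    (\<lambda>x. \<forall>y\<in>M. real n * (\<beta> * f_min * vol_low d * (r / 2) ^ d) / 4 < hits n x (M \<inter> cball y r))"
proof -
  let ?p = "\<beta> * f_min * vol_low d * (r / 2) ^ d"
  have "\<rho> \<le> K0" using A f \<rho> by (simp add: ball_radius_def diam_constant_def)
  then have rK: "r / 2 \<le> K0" using r \<rho> by simp
  obtain F where F: "F \<subseteq> M" "finite F" "real (card F) \<le> ((2 * real D + 2) * (K0 / (r / 2))) ^ D"
    "\<And>x. x \<in> M \<Longrightarrow> \<exists>z\<in>F. dist x z \<le> r / 2"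
    by (rule euclid_cover[of D "r / 2" K0 M 0]) (use dD r rK zero_in_euclid M_cball ME in auto)
  have "whp P n (real (card F) * exp (- (real n * ?p / 4))) (\<lambda>x. \<forall>y\<in>F. real n * ?p / 4 < hits n x (M \<inter> cball y (r / 2)))"
    using F(1) r by (intro whp_ball F(2) whp_hits_greater manifold_ball_ge) auto
  then show ?thesis
  proof (rule whp_mono)
    show "real (card F) * exp (- (real n * ?p / 4)) \<le> ((2 * real D + 2) * (K0 / (r / 2))) ^ D * exp (- (real n * ?p / 4))"
      using F(3) by (rule mult_right_mono) simp
    fix x assume x: "\<forall>y\<in>F. real n * ?p / 4 < hits n x (M \<inter> cball y (r / 2))"
    show "\<forall>y\<in>M. real n * ?p / 4 < hits n x (M \<inter> cball y r)"
    proof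
      fix y assume "y \<in> M"
      then obtain w where w: "w \<in> F" "dist y w \<le> r / 2" using F(4) by blast
      have "M \<inter> cball w (r / 2) \<subseteq> M \<inter> cball y r"
      proof
        fix q assume q: "q \<in> M \<inter> cball w (r / 2)"
        have "dist y q \<le> dist y w + dist w q" by (rule dist_triangle)
        then show "q \<in> M \<inter> cball y r" using q w by simp
      qed
      then have "hits n x (M \<inter> cball w (r / 2)) \<le> hits n x (M \<inter> cball y r)" by (rule hits_mono)
      then show "real n * ?p / 4 < hits n x (M \<inter> cball y r)" using x w(1) by fastforce
    qed
  qed
qed

text \<open>Balls of radius \<open>r\<close> have mass of order at most \<open>r\<close>, and
  \<open>r\<close> is free; it is taken so small that the n^2 pairs cost at most
  \<open>\<epsilon>\<close>.\<close>

lemma whp_inj_sample: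
  assumes "0 < \<epsilon>" shows "whp P n \<epsilon> (\<lambda>x. inj_on x {..<n})"
proof -
  define C where "C = \<beta> * (f_max * vol_up d) + vol_amb D K0"
  have C: "0 < C" unfolding C_def using \<beta> f vol_pos(2)[of d] vol_pos(3)[OF K0_pos, of D] dD by (intro add_pos_pos mult_pos_pos) auto
  define r where "r = min (min 1 (\<rho> / 224)) (min K0 (\<epsilon> / (((real n)\<^sup>2 + 1) * C)))"
  have pos: "0 < ((real n)\<^sup>2 + 1) * C" using C by (intro mult_pos_pos) (auto simp: add_nonneg_pos)
  have r: "0 < r" using \<rho> K0_pos assms pos by (auto simp: r_def)
  have r': "r \<le> 1" "r \<le> \<rho> / 224" "r \<le> K0" "r \<le> \<epsilon> / (((real n)\<^sup>2 + 1) * C)"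
    by (simp_all only: r_def min.coboundedI1 min.coboundedI2 min.cobounded1 min.cobounded2 order_refl)
  note r = r r'
  obtain F where F: "finite F" "\<And>x. x \<in> euclid D \<inter> cball 0 K0 \<Longrightarrow> \<exists>z\<in>F. dist x z \<le> r"
    by (rule euclid_cover[of D r K0 "euclid D \<inter> cball 0 K0" 0]) (use dD r zero_in_euclid in auto)
  have "whp P n ((real n)\<^sup>2 * (C * r)) (\<lambda>x. inj_on x {..<n})"
  proof (rule whp_inj[OF _ _ _ _ support_borel P_support])
    show "finite ((\<lambda>z. cball z r) ` F)" using F(1) by simp
    show "euclid D \<inter> cball 0 K0 \<subseteq> \<Union>((\<lambda>z. cball z r) ` F)"
    proof
      fix x assume "x \<in> euclid D \<inter> cball 0 K0"
      then obtain z where "z \<in> F" "dist x z \<le> r" using F(2) by blast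
      then show "x \<in> \<Union>((\<lambda>z. cball z r) ` F)" by (auto simp: dist_commute)
    qed
    fix B assume "B \<in> (\<lambda>z. cball z r) ` F"
    then obtain z where B: "B = cball z r" by blast
    have "r ^ d \<le> r ^ 1" "r ^ D \<le> r ^ 1" using r dD by (intro power_decreasing; simp)+
    then have rr: "r ^ d \<le> r" "r ^ D \<le> r" by simp_all
    have "measure P B \<le> \<beta> * (f_max * (vol_up d * r ^ d)) + vol_amb D K0 * r ^ D" unfolding B by (rule ball_le[OF r(1,3)])
    also have "\<dots> \<le> \<beta> * (f_max * (vol_up d * r)) + vol_amb D K0 * r"
      using rr \<beta> f vol_pos(2)[of d] vol_pos(3)[OF K0_pos, of D] dD by (intro add_mono mult_left_mono) auto
    also have "\<dots> = C * r" by (simp add: C_def algebra_simps)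
    finally show "measure P B \<le> C * r" .
  qed auto
  then show ?thesis
  proof (rule whp_mono)
    have "(real n)\<^sup>2 * (C * r) \<le> ((real n)\<^sup>2 + 1) * (C * r)" using C r by (intro mult_right_mono) auto
    also have "\<dots> = ((real n)\<^sup>2 + 1) * C * r" by simp
    also have "\<dots> \<le> ((real n)\<^sup>2 + 1) * C * (\<epsilon> / (((real n)\<^sup>2 + 1) * C))" using pos r(5) by (intro mult_left_mono) auto
    also have "\<dots> = \<epsilon>" using less_imp_neq[OF pos, symmetric] by (simp only: times_divide_eq_right nonzero_mult_div_cancel_left not_False_eq_True)
    finally show "(real n)\<^sup>2 * (C * r) \<le> \<epsilon>" .
  qed
qed

end

section \<open>The sequence of scales\<close>

lemma gam_less: "1 \<le> d \<Longrightarrow> gam d k < 1 / real d"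
proof (induction k)
  case (Suc k)
  then have "2 * gam d k + 1 < 2 / real d + 1" by simp
  also have "\<dots> = (real d + 2) / real d" using Suc by (simp add: field_simps)
  finally show ?case by (simp add: pos_divide_less_eq)
qed (simp add: field_simps)

lemma gam_rec: "gam d (Suc k) * (real d + 2) = 2 * gam d k + 1"
proof -
  have "real d + 2 \<noteq> 0" by linarith
  then show ?thesis by simp
qed

lemma gam_step: "1 \<le> d \<Longrightarrow> gam d k < gam d (Suc k)"
  using gam_less[of d k] by (simp add: field_simps)

lemma gam_mono: "1 \<le> d \<Longrightarrow> j \<le> k \<Longrightarrow> gam d j \<le> gam d k"
  by (rule lift_Suc_mono_le) (use gam_step less_imp_le in auto)

lemma gam_ge: "1 \<le> d \<Longrightarrow> 1 / (real d + 1) \<le> gam d k"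
  using gam_mono[of d 0 k] by simp

lemma gam_gap: "1 \<le> d \<Longrightarrow> 1 / real d - gam d k = (1 / real d - 1 / (real d + 1)) * (2 / (real d + 2)) ^ k"
proof (induction k)
  case (Suc k)
  have "1 / real d - gam d (Suc k) = (1 / real d - gam d k) * (2 / (real d + 2))"
    using Suc.prems by (simp add: field_simps)
  then show ?case using Suc by simp
qed simp

lemma k_delta_ge: assumes "1 \<le> d" "0 < \<delta>" shows "1 / real d - \<delta> \<le> gam d (k_delta d \<delta>)"
proof -
  have "(\<lambda>k. (1 / real d - 1 / (real d + 1)) * (2 / (real d + 2)) ^ k) \<longlonglongrightarrow> (1 / real d - 1 / (real d + 1)) * 0"
    using assms by (intro tendsto_mult_left LIMSEQ_power_zero) simp
  then have "\<forall>\<^sub>F k in sequentially. (1 / real d - 1 / (real d + 1)) * (2 / (real d + 2)) ^ k < \<delta>"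
    using assms(2) by (intro order_tendstoD(2)) auto
  then obtain k where "1 / real d - gam d k < \<delta>"
    using gam_gap[OF assms(1)] by (metis (mono_tags, lifting) eventually_sequentially order_refl)
  then have "1 / real d - \<delta> \<le> gam d k" by simp
  then show ?thesis unfolding k_delta_def by (rule LeastI)
qed

text \<open>The bound on \<open>\<delta>\<close> says that \<open>gam d 0\<close> misses the target
  \<open>1 / d - \<delta>\<close>. So at least one scale beyond the first is run, and there the
  angle constant is free of \<open>D\<close> and \<open>\<beta>\<close>.\<close>

lemma k_delta_pos:
  assumes "1 \<le> d" "0 < \<delta>" "\<delta> < 1 / (real d * (real d + 1))" shows "0 < k_delta d \<delta>"
proof (rule ccontr)
  assume "\<not> ?thesis"
  then have "1 / real d - \<delta> \<le> 1 / (real d + 1)" using k_delta_ge[OF assms(1,2)] by simp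
  moreover have "1 / real d - 1 / (real d + 1) = 1 / (real d * (real d + 1))" using assms(1) by (simp add: field_simps)
  ultimately show False using assms(3) by linarith
qed

locale params =
  fixes d D :: nat and \<beta> \<rho> A f_min f_max :: real
  assumes dD: "1 \<le> d" "d < D" and \<beta>: "0 < \<beta>" "\<beta> \<le> 1" and \<rho>: "0 < \<rho>"
    and f: "0 < f_min" "f_min \<le> f_max" and A: "diam_constant d A"
begin

definition "q n = ln (real n) / (\<beta> * (real n - 1))"
text \<open>The tuning constant \<open>c\<close> is 1. As \<open>gam\<close> stays below
  \<open>1 / d\<close>, n h^d grows at least like a power of \<open>n\<close>, which dominates every
  constant in the concentration bounds.\<close>

definition "h n j = scale d 1 \<beta> n j"
abbreviation "KK \<equiv> ball_radius A d f_min \<rho>"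
abbreviation "model M P \<equiv> outlier_dist D d M \<rho> A f_min f_max \<beta> P"

lemma modelI: "(P, M) \<in> outlier_model A D d f_min f_max \<rho> \<beta> \<Longrightarrow> model M P"
proof -
  assume PM: "(P, M) \<in> outlier_model A D d f_min f_max \<rho> \<beta>"
  then have "M \<in> manifold_class D d \<rho>" by (auto simp: outlier_model_def)
  then show ?thesis by unfold_locales (use PM dD \<beta> \<rho> f A in simp_all)
qed

lemma h_def': "h n j = q n powr gam d j" by (simp add: h_def scale_def q_def)

lemma KK_ge: "\<rho> \<le> KK" and KK_pos: "0 < KK"
proof -
  show "\<rho> \<le> KK" using A f \<rho> by (simp add: ball_radius_def diam_constant_def)
  then show "0 < KK" using \<rho> by simp
qed

lemma q_pos: "\<forall>\<^sub>F n in sequentially. 0 < q n" and q_lt1: "\<forall>\<^sub>F n in sequentially. q n < 1"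
  using \<beta> unfolding q_def by real_asymp+

lemma gam_pos: "0 < gam d k"
proof -
  have "0 < 1 / (real d + 1)" by simp
  then show ?thesis using gam_ge[OF dD(1), of k] by linarith
qed

lemma h_pos: "\<forall>\<^sub>F n in sequentially. 0 < h n j"
  using q_pos by eventually_elim (simp add: h_def')

lemma h_tendsto: "(\<lambda>n. h n j) \<longlonglongrightarrow> 0"
proof -
  define a where "a = gam d j"
  have a: "0 < a" using gam_pos by (simp add: a_def)
  have "(\<lambda>n. (ln (real n) / (\<beta> * (real n - 1))) powr a) \<longlonglongrightarrow> 0" using \<beta> a by real_asymp
  then show ?thesis by (simp add: h_def' q_def a_def)
qed

lemma h_less: "0 < c \<Longrightarrow> \<forall>\<^sub>F n in sequentially. h n j < c"
  using order_tendstoD(2)[OF h_tendsto] by blast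

lemma h_ge_inverse: "\<forall>\<^sub>F n in sequentially. 1 / real n \<le> h n j"
proof -
  define b where "b = 1 - gam d j"
  have "gam d j < 1" using gam_less[OF dD(1), of j] dD(1) order_less_le_trans[of _ "1 / real d" 1] by simp
  then have b: "0 < b" by (simp add: b_def)
  have "\<forall>\<^sub>F n in sequentially. 1 / real n \<le> (ln (real n) / (\<beta> * (real n - 1))) powr (1 - b)"
    using \<beta> b by real_asymp
  then show ?thesis by (simp add: h_def' q_def b_def)
qed

lemma h_power: "\<forall>\<^sub>F n in sequentially. (h n j) ^ m = q n powr (gam d j * real m)"
  using q_pos by eventually_elim (simp add: h_def' powr_power mult.commute)

lemma n_h_power:
  obtains a where "0 < a" "\<forall>\<^sub>F n in sequentially. real n powr a \<le> real n * (h n j) ^ d"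
proof -
  define a where "a = 1 - gam d j * real d"
  have "gam d j * real d < 1 / real d * real d" using gam_less[OF dD(1), of j] dD(1) by (intro mult_strict_right_mono) auto
  then have a: "0 < a" using dD(1) by (simp add: a_def)
  have a1: "a < 1" using gam_pos dD(1) by (simp add: a_def)
  have "\<forall>\<^sub>F n in sequentially. real n powr a \<le> real n * (ln (real n) / (\<beta> * (real n - 1))) powr (1 - a)"
    using \<beta> a a1 by real_asymp
  then have "\<forall>\<^sub>F n in sequentially. real n powr a \<le> real n * (h n j) ^ d"
    using h_power[of j d] by eventually_elim (simp add: a_def q_def)
  then show ?thesis using that a by blast
qed

text \<open>Up to constants, a bound on the mean number of outliers in a ball of the new scale and
  the tube of the old one, in the worst case of codimension one. By the recursion its exponent in
  \<open>q\<close> is 1 + 2 b. Here b > 0 because all exponents are at least 1 / (d + 1) and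
  strictly below 1 / d, which is at most twice that.\<close>

lemma n_h_tube:
  obtains b where "0 < b" "\<forall>\<^sub>F n in sequentially. real n * ((h n (Suc j)) ^ d * (h n j)\<^sup>2) \<le> real n powr (- b)"
proof -
  define b where "b = 2 * gam d j - gam d (Suc j)"
  have "1 / real d \<le> 2 * (1 / (real d + 1))" using dD(1) by (simp add: field_simps)
  then have b: "0 < b" using gam_less[OF dD(1), of "Suc j"] gam_ge[OF dD(1), of j] by (simp add: b_def)
  have E: "gam d (Suc j) * real d + gam d j * real 2 = 1 + 2 * b"
    using gam_rec[of d j] by (simp add: b_def algebra_simps del: gam.simps)
  have "\<forall>\<^sub>F n in sequentially. real n * (ln (real n) / (\<beta> * (real n - 1))) powr (1 + 2 * b) \<le> real n powr (- b)"
    using \<beta> b by real_asymp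
  then have "\<forall>\<^sub>F n in sequentially. real n * ((h n (Suc j)) ^ d * (h n j)\<^sup>2) \<le> real n powr (- b)"
    using h_power[of "Suc j" d] h_power[of j 2]
  proof eventually_elim
    case (elim n)
    show ?case unfolding elim(2,3) powr_add[symmetric] E using elim(1) by (simp add: q_def)
  qed
  then show ?thesis using that b by blast
qed

text \<open>The balance that \<open>gam\<close> encodes: the new scale to the power d + 2 is
  \<open>q\<close> times the squared old scale, and n \<beta> q is at least ln n.\<close>

lemma n_h_step: "\<forall>\<^sub>F n in sequentially. ln (real n) * (h n j)\<^sup>2 \<le> real n * \<beta> * (h n (Suc j)) ^ (d + 2)"
proof -
  have E: "gam d (Suc j) * real (d + 2) = gam d j * real 2 + 1"
    using gam_rec[of d j] by (simp add: algebra_simps del: gam.simps)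
  have "\<forall>\<^sub>F n in sequentially. ln (real n) \<le> real n * \<beta> * (ln (real n) / (\<beta> * (real n - 1)))"
    using \<beta> by real_asymp
  then show ?thesis using h_power[of "Suc j" "d + 2"] h_power[of j 2] q_pos
  proof eventually_elim
    case (elim n)
    have "ln (real n) * (h n j)\<^sup>2 \<le> real n * \<beta> * q n * (h n j)\<^sup>2"
      using elim(1) by (intro mult_right_mono) (auto simp: q_def)
    also have "\<dots> = real n * \<beta> * (h n (Suc j)) ^ (d + 2)"
      unfolding elim(2,3) E powr_add using elim(4) by simp
    finally show ?case .
  qed
qed

text \<open>The initial balance: outliers near a point are then only known to have offset O(h), and
  this inequality makes the logarithmic part of their number cost an angle O(h).\<close>

lemma n_h_first: "\<forall>\<^sub>F n in sequentially. ln (real n) \<le> real n * \<beta> * (h n 0) ^ (d + 1)"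
proof -
  have "\<forall>\<^sub>F n in sequentially. ln (real n) \<le> real n * \<beta> * (ln (real n) / (\<beta> * (real n - 1)))"
    using \<beta> by real_asymp
  then show ?thesis using h_power[of 0 "d + 1"] q_pos
  proof eventually_elim
    case (elim n)
    have "gam d 0 * real (d + 1) = 1" using dD(1) by simp
    then have "(h n 0) ^ (d + 1) = q n powr 1" using elim(2) by (simp only:)
    also have "\<dots> = q n" using elim(3) by simp
    finally show ?case using elim(1) by (simp only: q_def)
  qed
qed

lemma h_decreasing: "\<forall>\<^sub>F n in sequentially. h n (Suc j) \<le> h n j"
  using q_pos q_lt1
  by eventually_elim (use gam_step[OF dD(1), of j] in \<open>auto simp: h_def' intro: powr_mono'\<close>)

lemma h_square_less: "0 < c \<Longrightarrow> \<forall>\<^sub>F n in sequentially. (h n j)\<^sup>2 \<le> c * h n (Suc j)"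
proof -
  assume c: "0 < c"
  define b where "b = 2 * gam d j - gam d (Suc j)"
  have "1 / real d \<le> 2 * (1 / (real d + 1))" using dD(1) by (simp add: field_simps)
  then have b: "0 < b" using gam_less[OF dD(1), of "Suc j"] gam_ge[OF dD(1), of j] by (simp add: b_def)
  have "\<forall>\<^sub>F n in sequentially. (ln (real n) / (\<beta> * (real n - 1))) powr b \<le> c"
    using \<beta> b c by real_asymp
  then show ?thesis using h_power[of j 2] q_pos
  proof eventually_elim
    case (elim n)
    have "(h n j)\<^sup>2 = q n powr b * h n (Suc j)"
      unfolding h_def'[of n "Suc j"] powr_add[symmetric] elim(2) by (simp add: b_def mult.commute del: gam.simps)
    also have "\<dots> \<le> c * h n (Suc j)" using elim(1) by (intro mult_right_mono) (auto simp: q_def h_def')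
    finally show ?case .
  qed
qed

lemma net_size:
  assumes "0 < c"
  shows "\<forall>\<^sub>F n in sequentially. ((2 * real D + 2) * (KK / (c * h n j))) ^ D \<le> ((2 * real D + 2) * KK / c * real n) ^ D"
  using h_ge_inverse[of j] h_pos[of j] eventually_gt_at_top[of 0]
proof eventually_elim
  case (elim n)
  have "1 / h n j \<le> real n" using elim by (simp add: field_simps)
  then have "(2 * real D + 2) * KK / c * (1 / h n j) \<le> (2 * real D + 2) * KK / c * real n"
    using assms KK_pos by (intro mult_left_mono) auto
  then have "(2 * real D + 2) * (KK / (c * h n j)) \<le> (2 * real D + 2) * KK / c * real n" by simp
  moreover have "0 \<le> (2 * real D + 2) * (KK / (c * h n j))" using assms KK_pos elim by simp
  ultimately show ?case by (rule power_mono)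
qed

lemma net_c_pos: "0 < c \<Longrightarrow> 0 < (2 * real D + 2) * KK / c"
  using KK_pos by (simp add: add_nonneg_pos)

text \<open>The net has polynomially many points, while each failure probability is exponentially
  small in a power of \<open>n\<close>.\<close>

lemma manifold_hits:
  assumes \<kappa>: "0 < \<kappa>"
  shows "\<forall>\<^sub>F n in sequentially. \<forall>M P. model M P \<longrightarrow> whp P n (real n powr -4)
    (\<lambda>x. \<forall>y\<in>M. real n * (\<beta> * f_min * vol_low d * (\<kappa> * h n j / 2) ^ d) / 4 < hits n x (M \<inter> cball y (\<kappa> * h n j)))"
proof -
  obtain a where a: "0 < a" "\<forall>\<^sub>F n in sequentially. real n powr a \<le> real n * (h n j) ^ d" using n_h_power by blast
  define c where "c = (2 * real D + 2) * KK / (\<kappa> / 2)"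
  have c: "0 < c" unfolding c_def by (rule net_c_pos) (use \<kappa> in simp)
  define e where "e = \<beta> * f_min * vol_low d * (\<kappa> / 2) ^ d / 4"
  have e: "0 < e" using \<beta> f \<kappa> vol_pos(1)[OF dD(1)] by (simp add: e_def)
  have "\<forall>\<^sub>F n::nat in sequentially. (c * real n) ^ D * exp (- (e * real n powr a)) \<le> real n powr -4"
    using c a(1) e by real_asymp
  moreover have "\<forall>\<^sub>F n in sequentially. h n j < \<rho> / (112 * \<kappa>)" using \<rho> \<kappa> by (intro h_less) auto
  moreover have "\<forall>\<^sub>F n in sequentially. ((2 * real D + 2) * (KK / (\<kappa> / 2 * h n j))) ^ D \<le> (c * real n) ^ D"
    unfolding c_def by (rule net_size) (use \<kappa> in simp)
  ultimately show ?thesis using a(2) h_pos[of j]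
  proof eventually_elim
    case (elim n)
    show ?case
    proof (intro allI impI)
      fix M P assume "model M P"
      then interpret outlier_dist D d M \<rho> A f_min f_max \<beta> P .
      have r: "0 < \<kappa> * h n j" "\<kappa> * h n j \<le> \<rho> / 112" using elim(2,5) \<kappa> by (auto simp: field_simps)
      have "((2 * real D + 2) * (KK / (\<kappa> * h n j / 2))) ^ D * exp (- (real n * (\<beta> * f_min * vol_low d * (\<kappa> * h n j / 2) ^ d) / 4))
          \<le> (c * real n) ^ D * exp (- (e * real n powr a))"
      proof (rule mult_mono)
        show "((2 * real D + 2) * (KK / (\<kappa> * h n j / 2))) ^ D \<le> (c * real n) ^ D" using elim(3) by simp
        have "e * real n powr a \<le> e * (real n * h n j ^ d)" using elim(4) e by (intro mult_left_mono) auto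
        also have "\<dots> = real n * (\<beta> * f_min * vol_low d * (\<kappa> * h n j / 2) ^ d) / 4"
          by (simp add: e_def power_mult_distrib power_divide)
        finally show "exp (- (real n * (\<beta> * f_min * vol_low d * (\<kappa> * h n j / 2) ^ d) / 4)) \<le> exp (- (e * real n powr a))" by simp
      qed (use c in auto)
      also have "\<dots> \<le> real n powr -4" by (rule elim(1))
      finally show "whp P n (real n powr -4) (\<lambda>x. \<forall>y\<in>M. real n * (\<beta> * f_min * vol_low d * (\<kappa> * h n j / 2) ^ d) / 4 < hits n x (M \<inter> cball y (\<kappa> * h n j)))"
        by (intro whp_mono[OF whp_manifold_hits_greater[OF r]])
    qed
  qed
qed

text \<open>Three times a bound on the mean, which is itself twice the manifold part for a ball of
  radius \<open>3 * h\<close>: at small scales the outlier part is no larger than the manifold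
  part.\<close>

definition "cnt_all n j = 6 * (\<beta> * (f_max * (vol_up d * (3 * h n j) ^ d))) * real n"
text \<open>Twice a bound on the mean, plus a logarithm whose factor \<open>D + 5\<close> pays for a
  net of order n^D and leaves n^-5.\<close>

definition "cnt_out n j = 2 * (vol_amb D KK * (3 * h n j) ^ D) * real n + (real D + 5) * ln (real n)"

lemma all_hits:
  "\<forall>\<^sub>F n in sequentially. \<forall>M P. model M P \<longrightarrow> whp P n (real n powr -4)
    (\<lambda>x. \<forall>y\<in>euclid D \<inter> cball 0 KK. hits n x (cball y (2 * h n j)) < cnt_all n j)"
proof -
  obtain a where a: "0 < a" "\<forall>\<^sub>F n in sequentially. real n powr a \<le> real n * (h n j) ^ d" using n_h_power by blast
  define c where "c = (2 * real D + 2) * KK / 1"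
  have c: "0 < c" unfolding c_def by (rule net_c_pos) simp
  define e where "e = 2 * (\<beta> * (f_max * (vol_up d * 3 ^ d)))"
  have e: "0 < e" using \<beta> f vol_pos(2)[of d] by (simp add: e_def)
  define g where "g = \<beta> * (f_max * vol_up d) / (vol_amb D KK * 3)"
  have va: "0 < vol_amb D KK" using vol_pos(3)[OF KK_pos, of D] dD by simp
  have g: "0 < g" using \<beta> f vol_pos(2)[of d] va by (simp add: g_def)
  have "\<forall>\<^sub>F n::nat in sequentially. (c * real n) ^ D * exp (- (e * real n powr a)) \<le> real n powr -4"
    using c a(1) e by real_asymp
  moreover have "\<forall>\<^sub>F n in sequentially. h n j < min (min (\<rho> / 672) KK) (min (1 / 3) g)" using \<rho> KK_pos g by (intro h_less) auto
  moreover have "\<forall>\<^sub>F n in sequentially. ((2 * real D + 2) * (KK / (1 * h n j))) ^ D \<le> (c * real n) ^ D"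
    unfolding c_def by (rule net_size) simp
  ultimately show ?thesis using a(2) h_pos[of j]
  proof eventually_elim
    case (elim n)
    let ?h = "h n j"
    define p where "p = 2 * (\<beta> * (f_max * (vol_up d * (3 * ?h) ^ d)))"
    have p0: "0 \<le> p" using \<beta> f vol_pos(2)[of d] elim(5) by (simp add: p_def)
    have pe: "p = e * ?h ^ d" by (simp add: p_def e_def power_mult_distrib)
    show ?case
    proof (intro allI impI)
      fix M P assume "model M P"
      then interpret outlier_dist D d M \<rho> A f_min f_max \<beta> P .
      have pb: "measure P (cball y (3 * ?h) \<inter> UNIV) \<le> p" for y
      proof -
        have "measure P (cball y (3 * ?h)) \<le> \<beta> * (f_max * (vol_up d * (3 * ?h) ^ d)) + vol_amb D KK * (3 * ?h) ^ D"
          using elim(2,5) by (intro ball_le) auto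
        also have "vol_amb D KK * (3 * ?h) ^ D \<le> \<beta> * (f_max * (vol_up d * (3 * ?h) ^ d))"
        proof -
          have "(3 * ?h) ^ D \<le> (3 * ?h) ^ (d + 1)" using elim(2,5) dD by (intro power_decreasing) auto
          also have "\<dots> = 3 * ?h * (3 * ?h) ^ d" by simp
          finally have "vol_amb D KK * (3 * ?h) ^ D \<le> vol_amb D KK * (3 * ?h * (3 * ?h) ^ d)" using va by (intro mult_left_mono) auto
          also have "\<dots> = vol_amb D KK * 3 * ?h * (3 * ?h) ^ d" by simp
          also have "\<dots> \<le> vol_amb D KK * 3 * g * (3 * ?h) ^ d" using va elim(2,5) by (intro mult_right_mono mult_left_mono) auto
          also have "\<dots> = \<beta> * (f_max * (vol_up d * (3 * ?h) ^ d))" using va by (simp add: g_def)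
          finally show ?thesis .
        qed
        finally show ?thesis by (simp add: p_def)
      qed
      have "exp 1 - 1 \<le> (2 :: real)" using exp_le by simp
      then have "real n * p * (exp 1 - 1) \<le> real n * p * 2" using p0 by (intro mult_left_mono) auto
      then have "real n * p * (exp 1 - 1) - 1 * (3 * (real n * p)) \<le> - (real n * p)" by linarith
      also have "\<dots> \<le> - (e * real n powr a)"
        using mult_left_mono[OF elim(4), of e] e by (simp add: pe mult_ac)
      finally have "((2 * real D + 2) * (KK / ?h)) ^ D * exp (real n * p * (exp 1 - 1) - 1 * (3 * (real n * p)))
          \<le> (c * real n) ^ D * exp (- (e * real n powr a))"
        using elim(3) c by (intro mult_mono) auto
      also have "\<dots> \<le> real n powr -4" by (rule elim(1))
      finally have err: "((2 * real D + 2) * (KK / ?h)) ^ D * exp (real n * p * (exp 1 - 1) - 1 * (3 * (real n * p))) \<le> real n powr -4" .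
      have "whp P n (((2 * real D + 2) * (KK / ?h)) ^ D * exp (real n * p * (exp 1 - 1) - 1 * (3 * (real n * p))))
        (\<lambda>x. \<forall>y\<in>euclid D \<inter> cball 0 KK. hits n x (cball y (2 * ?h) \<inter> UNIV) < 3 * (real n * p))"
        using elim(2,5) pb by (intro whp_ball_hits_less) auto
      then show "whp P n (real n powr -4) (\<lambda>x. \<forall>y\<in>euclid D \<inter> cball 0 KK. hits n x (cball y (2 * ?h)) < cnt_all n j)"
        by (rule whp_mono[OF _ err]) (simp add: cnt_all_def p_def mult_ac)
    qed
  qed
qed

lemma outlier_hits:
  "\<forall>\<^sub>F n in sequentially. \<forall>M P. model M P \<longrightarrow> whp P n (real n powr -4)
    (\<lambda>x. \<forall>y\<in>euclid D \<inter> cball 0 KK. hits n x (cball y (2 * h n j) \<inter> (- M)) < cnt_out n j)"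
proof -
  define c where "c = (2 * real D + 2) * KK / 1"
  have c: "0 < c" unfolding c_def by (rule net_c_pos) simp
  have va: "0 < vol_amb D KK" using vol_pos(3)[OF KK_pos, of D] dD by simp
  have "\<forall>\<^sub>F n::nat in sequentially. (c * real n) ^ D * real n powr (- (real D + 5)) \<le> real n powr -4"
    using c by real_asymp
  moreover have "\<forall>\<^sub>F n in sequentially. h n j < KK" using KK_pos by (intro h_less) auto
  moreover have "\<forall>\<^sub>F n in sequentially. ((2 * real D + 2) * (KK / (1 * h n j))) ^ D \<le> (c * real n) ^ D"
    unfolding c_def by (rule net_size) simp
  ultimately show ?thesis using h_pos[of j] eventually_gt_at_top[of 0]
  proof eventually_elim
    case (elim n)
    let ?h = "h n j"
    define p where "p = vol_amb D KK * (3 * ?h) ^ D"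
    have p0: "0 \<le> p" using va elim(4) by (simp add: p_def)
    show ?case
    proof (intro allI impI)
      fix M P assume "model M P"
      then interpret outlier_dist D d M \<rho> A f_min f_max \<beta> P .
      have pb: "measure P (cball y (3 * ?h) \<inter> - M) \<le> p" for y
        using outlier_ball_le[of "3 * ?h" y] elim(4) by (simp add: p_def Diff_eq)
      have cnt: "cnt_out n j = 2 * (real n * p) + (real D + 5) * ln (real n)" by (simp add: cnt_out_def p_def mult_ac)
      have "exp 1 - 1 \<le> (2 :: real)" using exp_le by simp
      then have "real n * p * (exp 1 - 1) \<le> real n * p * 2" using p0 by (intro mult_left_mono) auto
      then have "real n * p * (exp 1 - 1) - 1 * cnt_out n j \<le> (- (real D + 5)) * ln (real n)"
        unfolding cnt by (simp add: algebra_simps)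
      then have "exp (real n * p * (exp 1 - 1) - 1 * cnt_out n j) \<le> real n powr (- (real D + 5))"
        using elim(5) by (simp add: powr_def)
      then have "((2 * real D + 2) * (KK / ?h)) ^ D * exp (real n * p * (exp 1 - 1) - 1 * cnt_out n j)
          \<le> (c * real n) ^ D * real n powr (- (real D + 5))"
        using elim(3) c by (intro mult_mono) auto
      also have "\<dots> \<le> real n powr -4" by (rule elim(1))
      finally have err: "((2 * real D + 2) * (KK / ?h)) ^ D * exp (real n * p * (exp 1 - 1) - 1 * cnt_out n j) \<le> real n powr -4" .
      have "whp P n (((2 * real D + 2) * (KK / ?h)) ^ D * exp (real n * p * (exp 1 - 1) - 1 * cnt_out n j))
        (\<lambda>x. \<forall>y\<in>euclid D \<inter> cball 0 KK. hits n x (cball y (2 * ?h) \<inter> (- M)) < cnt_out n j)"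
        using elim(2,4) pb M_borel by (intro whp_ball_hits_less) auto
      then show "whp P n (real n powr -4) (\<lambda>x. \<forall>y\<in>euclid D \<inter> cball 0 KK. hits n x (cball y (2 * ?h) \<inter> (- M)) < cnt_out n j)"
        by (rule whp_mono[OF _ err])
    qed
  qed
qed

text \<open>The mean is of order at most n^-b. With the parameter \<open>b * ln n\<close> its
  exponential cancels this factor, and a constant threshold \<open>m\<close> already makes the tail
  of order n^-(D + 5).\<close>

lemma tube_hits:
  obtains m where "0 < m" "\<forall>\<^sub>F n in sequentially. \<forall>M P. model M P \<longrightarrow> whp P n (real n powr -4)
    (\<lambda>x. \<forall>y\<in>euclid D \<inter> cball 0 KK.
      hits n x (cball y (2 * h n (Suc j)) \<inter> ({x. infdist x M \<le> (h n j)\<^sup>2 / \<rho>} - M)) < m)"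
proof -
  obtain b where b: "0 < b" "\<forall>\<^sub>F n in sequentially. real n * ((h n (Suc j)) ^ d * (h n j)\<^sup>2) \<le> real n powr (- b)"
    using n_h_tube by blast
  define m where "m = (real D + 5) / b"
  have m: "0 < m" using b by (simp add: m_def add_nonneg_pos)
  define c where "c = (2 * real D + 2) * KK / 1"
  have c: "0 < c" unfolding c_def by (rule net_c_pos) simp
  define w where "w = vol_tube d D KK * 3 ^ d / \<rho>"
  have w: "0 < w" using vol_pos(4)[OF KK_pos, of D d] dD \<rho> by (simp add: w_def)
  have "\<forall>\<^sub>F n::nat in sequentially. (c * real n) ^ D * (exp w * real n powr (- (real D + 5))) \<le> real n powr -4"
    using c w by real_asymp
  moreover have "\<forall>\<^sub>F n in sequentially. h n (Suc j) < min KK (\<rho> / 1344)" using KK_pos \<rho> by (intro h_less) auto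
  moreover have "\<forall>\<^sub>F n in sequentially. h n j < min 1 \<rho>" using \<rho> by (intro h_less) auto
  moreover have "\<forall>\<^sub>F n in sequentially. (h n j)\<^sup>2 \<le> \<rho> * h n (Suc j)" using \<rho> by (rule h_square_less)
  moreover have "\<forall>\<^sub>F n in sequentially. ((2 * real D + 2) * (KK / (1 * h n (Suc j)))) ^ D \<le> (c * real n) ^ D"
    unfolding c_def by (rule net_size) simp
  ultimately have "\<forall>\<^sub>F n in sequentially. \<forall>M P. model M P \<longrightarrow> whp P n (real n powr -4)
    (\<lambda>x. \<forall>y\<in>euclid D \<inter> cball 0 KK.
      hits n x (cball y (2 * h n (Suc j)) \<inter> ({x. infdist x M \<le> (h n j)\<^sup>2 / \<rho>} - M)) < m)"
    using h_pos[of j] h_pos[of "Suc j"] eventually_gt_at_top[of 1] b(2)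
  proof eventually_elim
    case (elim n)
    let ?h = "h n (Suc j)" and ?s = "(h n j)\<^sup>2 / \<rho>"
    have s: "0 < ?s" "?s \<le> ?h" "?s \<le> 1"
    proof -
      show "0 < ?s" using elim(6) \<rho> by simp
      show "?s \<le> ?h" using elim(4) \<rho> by (simp add: pos_divide_le_eq mult.commute)
      have "(h n j)\<^sup>2 \<le> 1 * \<rho>" unfolding power2_eq_square using elim(3,6) by (intro mult_mono) auto
      then show "?s \<le> 1" using \<rho> by (simp add: pos_divide_le_eq)
    qed
    define p where "p = vol_tube d D KK * ((3 * ?h) ^ d * ?s)"
    have p: "real n * p \<le> w * real n powr (- b)"
    proof -
      have "real n * p = w * (real n * (?h ^ d * (h n j)\<^sup>2))" by (simp add: p_def w_def power_mult_distrib mult_ac)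
      also have "\<dots> \<le> w * real n powr (- b)" using elim(9) w by (intro mult_left_mono) auto
      finally show ?thesis .
    qed
    have p0: "0 \<le> p" using vol_pos(4)[OF KK_pos, of D d] dD elim(7) \<rho> by (simp add: p_def)
    define z where "z = b * ln (real n)"
    have z: "0 < z" using b elim(8) by (simp add: z_def)
    have ez: "exp z = real n powr b" using elim(8) by (simp add: z_def powr_def)
    show ?case
    proof (intro allI impI)
      fix M P assume "model M P"
      then interpret outlier_dist D d M \<rho> A f_min f_max \<beta> P .
      let ?B = "{x. infdist x M \<le> ?s} - M"
      have pb: "measure P (cball y (3 * ?h) \<inter> ?B) \<le> p" for y
      proof -
        have "cball y (3 * ?h) \<inter> ?B = cball y (3 * ?h) \<inter> {x. infdist x M \<le> ?s} - M" by auto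
        then have "measure P (cball y (3 * ?h) \<inter> ?B) \<le> vol_tube d D KK * ((3 * ?h) ^ d * ?s ^ (D - d))"
          using outlier_tube_le[of ?s "3 * ?h" y] s elim(2,7) by auto
        also have "?s ^ (D - d) \<le> ?s ^ 1" using s dD by (intro power_decreasing) auto
        then have "vol_tube d D KK * ((3 * ?h) ^ d * ?s ^ (D - d)) \<le> p"
          unfolding p_def using vol_pos(4)[OF KK_pos, of D d] dD elim(7) by (intro mult_left_mono) auto
        finally show ?thesis .
      qed
      have "real n * p * (exp z - 1) \<le> real n * p * exp z" using p0 by (intro mult_left_mono) auto
      also have "\<dots> \<le> w * real n powr (- b) * exp z" using p by (intro mult_right_mono) auto
      also have "\<dots> = w" unfolding ez using elim(8) by (simp add: powr_add[symmetric])
      finally have "real n * p * (exp z - 1) \<le> w" .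
      moreover have "z * m = (real D + 5) * ln (real n)" using b(1) by (simp add: z_def m_def)
      ultimately have "real n * p * (exp z - 1) - z * m \<le> w + (- (real D + 5)) * ln (real n)"
        unfolding mult_minus_left by linarith
      then have "exp (real n * p * (exp z - 1) - z * m) \<le> exp (w + (- (real D + 5)) * ln (real n))" by simp
      also have "\<dots> = exp w * real n powr (- (real D + 5))" using elim(8) by (simp only: exp_add powr_def) simp
      finally have "((2 * real D + 2) * (KK / ?h)) ^ D * exp (real n * p * (exp z - 1) - z * m)
          \<le> (c * real n) ^ D * (exp w * real n powr (- (real D + 5)))"
        using elim(5) c by (intro mult_mono) auto
      also have "\<dots> \<le> real n powr -4" by (rule elim(1))
      finally have err: "((2 * real D + 2) * (KK / ?h)) ^ D * exp (real n * p * (exp z - 1) - z * m) \<le> real n powr -4" .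
      have "?B \<in> sets borel" using tube_borel M_borel by auto
      then have "whp P n (((2 * real D + 2) * (KK / ?h)) ^ D * exp (real n * p * (exp z - 1) - z * m))
        (\<lambda>x. \<forall>y\<in>euclid D \<inter> cball 0 KK. hits n x (cball y (2 * ?h) \<inter> ?B) < m)"
        using elim(2,7) pb z by (intro whp_ball_hits_less) auto
      then show "whp P n (real n powr -4) (\<lambda>x. \<forall>y\<in>euclid D \<inter> cball 0 KK. hits n x (cball y (2 * ?h) \<inter> ?B) < m)"
        by (rule whp_mono[OF _ err])
    qed
  qed
  then show ?thesis using that m by blast
qed

end

section \<open>Decluttering\<close>

lemma card_image_Int_eq_hits:
  assumes "inj_on x {..<n}" shows "real (card (x ` {..<n} \<inter> A)) = hits n x A"
proof -
  have "x ` {..<n} \<inter> A = x ` {i. i < n \<and> x i \<in> A}" by auto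
  moreover have "inj_on x {i. i < n \<and> x i \<in> A}" by (rule inj_on_subset[OF assms]) auto
  ultimately show ?thesis by (simp add: hits_def card_image)
qed

section \<open>Tuning constants, regular samples and one decluttering step\<close>

context params
begin

text \<open>Angles in units of the scale. \<open>A_in\<close> comes from points of \<open>M\<close>
  and \<open>A_out\<close> from outliers at the first scale; at later scales the boundedly many
  outliers cost only \<open>1 / \<rho>\<close>, which gives \<open>A_lim\<close>, free of
  \<open>D\<close> and \<open>\<beta>\<close>. The large numbers contain 2048 * 64^d from the lower
  eigenvalue bound.\<close>

definition "A_in = 49152 * 192 ^ d * f_max * vol_up d / (\<rho> * f_min * vol_low d)"
definition "A_out = 12288 * 64 ^ d * (2 * vol_amb D KK * 3 ^ D + (real D + 5) * \<beta>) / (\<beta> * f_min * vol_low d)"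
definition "A_lim = real d * (A_in + 1 / \<rho>)"
definition "A_max = max (real d * (A_in + A_out)) A_lim"
text \<open>The bound 1/16 keeps slabs at fine scales inside balls of radius \<open>h / 8\<close>;
  the other one makes \<open>A_max * slab1\<close> at most \<open>1 / (4 * \<rho>)\<close>, as
  \<open>slab_bounds\<close> requires.\<close>

definition "slab1 = min (1 / 16) (1 / (4 * A_max * \<rho> + 1))"
definition "slab2 = 1 / (4 * \<rho>)"
definition "\<kappa> = slab1 / 2"
text \<open>Chosen so that \<open>thr * n * h ^ d\<close> is the number of sample points guaranteed
  in a ball of radius \<open>\<kappa> * h\<close> about a point of \<open>M\<close>.\<close>

definition "thr = \<beta> * f_min * vol_low d * (\<kappa> / 2) ^ d / 4"

lemma A_pos: "0 < A_in" "0 < A_out" "0 < A_lim" "0 < A_max" "A_lim \<le> A_max"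
proof -
  show 1: "0 < A_in" using f \<rho> vol_pos(1)[OF dD(1)] vol_pos(2)[of d] by (simp add: A_in_def)
  show "0 < A_out" using f \<beta> vol_pos(1)[OF dD(1)] vol_pos(3)[OF KK_pos, of D] dD
    by (simp add: A_out_def add_pos_pos)
  show "0 < A_lim" using 1 \<rho> dD by (simp add: A_lim_def add_pos_pos)
  then show "0 < A_max" "A_lim \<le> A_max" by (auto simp: A_max_def)
qed

lemma slab_pos: "0 < slab1" "slab1 \<le> 1 / 16" "0 < slab2" "0 < \<kappa>" "0 < thr"
  and slab_bounds: "8 * slab1\<^sup>2 / \<rho> + A_max * slab1 + slab2 \<le> 1 / \<rho>"
    "\<kappa>\<^sup>2 / (2 * \<rho>) + 2 * A_max * \<kappa> \<le> slab2"
proof -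
  have p: "0 < 4 * A_max * \<rho> + 1" using A_pos \<rho> by (simp add: add_pos_pos)
  show 1: "0 < slab1" "slab1 \<le> 1 / 16" "0 < slab2" using p \<rho> by (auto simp: slab1_def slab2_def)
  then show 2: "0 < \<kappa>" by (simp add: \<kappa>_def)
  then show "0 < thr" using f \<beta> vol_pos(1)[OF dD(1)] by (simp add: thr_def)
  have s: "slab1 * (4 * A_max * \<rho> + 1) \<le> 1"
  proof -
    have "slab1 \<le> 1 / (4 * A_max * \<rho> + 1)" by (simp add: slab1_def)
    then show ?thesis using p by (simp add: pos_le_divide_eq)
  qed
  then have As: "A_max * slab1 \<le> 1 / (4 * \<rho>)" using 1 \<rho> by (simp add: field_simps)
  have "slab1\<^sup>2 \<le> (1 / 16)\<^sup>2" using 1 by (intro power_mono) auto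
  then have "8 * slab1\<^sup>2 / \<rho> \<le> 8 * (1 / 16)\<^sup>2 / \<rho>" using \<rho> by (intro divide_right_mono mult_left_mono) auto
  moreover have "8 * (1 / 16)\<^sup>2 / \<rho> = 1 / (32 * \<rho>)" by (simp add: power2_eq_square)
  moreover have "1 / (32 * \<rho>) + 1 / (4 * \<rho>) + 1 / (4 * \<rho>) \<le> 1 / \<rho>" using \<rho> by (simp add: field_simps)
  ultimately show "8 * slab1\<^sup>2 / \<rho> + A_max * slab1 + slab2 \<le> 1 / \<rho>" using As by (simp add: slab2_def)
  have "\<kappa>\<^sup>2 \<le> 1 * \<kappa>" unfolding power2_eq_square using 1 2 by (intro mult_right_mono) (auto simp: \<kappa>_def)
  then have "\<kappa>\<^sup>2 / (2 * \<rho>) \<le> \<kappa> / (2 * \<rho>)" using \<rho> by (simp add: divide_right_mono)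
  moreover have "\<kappa> / (2 * \<rho>) + 2 * A_max * \<kappa> = slab1 * (4 * A_max * \<rho> + 1) / (4 * \<rho>)"
    using \<rho> by (simp add: \<kappa>_def field_simps)
  moreover have "slab1 * (4 * A_max * \<rho> + 1) / (4 * \<rho>) \<le> 1 / (4 * \<rho>)" using s \<rho> by (intro divide_right_mono) auto
  ultimately show "\<kappa>\<^sup>2 / (2 * \<rho>) + 2 * A_max * \<kappa> \<le> slab2" by (simp add: slab2_def)
qed

text \<open>
  The balls of radius \<open>\<kappa> h\<close> fit into the slabs; those of radius \<open>h / 32\<close> spread the sample enough
  to bound the tangential eigenvalues from below.
\<close>

definition regular_sample :: "nat \<Rightarrow> finseq set \<Rightarrow> nat \<Rightarrow> real \<Rightarrow> finseq set \<Rightarrow> bool"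
  where "regular_sample n M k m X \<longleftrightarrow> finite X \<and> X \<subseteq> euclid D \<inter> cball 0 KK \<and>
    (\<forall>j\<le>k. (\<forall>y\<in>M. real n * (\<beta> * f_min * vol_low d * (1 / 32 * h n j / 2) ^ d) / 4 < card (X \<inter> (M \<inter> cball y (1 / 32 * h n j)))) \<and>
      (\<forall>y\<in>M. real n * (\<beta> * f_min * vol_low d * (\<kappa> * h n j / 2) ^ d) / 4 < card (X \<inter> (M \<inter> cball y (\<kappa> * h n j)))) \<and>
      (\<forall>y\<in>euclid D \<inter> cball 0 KK. card (X \<inter> cball y (2 * h n j)) < cnt_all n j) \<and>
      (\<forall>y\<in>euclid D \<inter> cball 0 KK. card (X \<inter> (cball y (2 * h n j) \<inter> - M)) < cnt_out n j)) \<and>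
    (\<forall>j<k. \<forall>y\<in>euclid D \<inter> cball 0 KK.
      real (card (X \<inter> (cball y (2 * h n (Suc j)) \<inter> ({x. infdist x M \<le> (h n j)\<^sup>2 / \<rho>} - M)))) < m)"

lemma regular_sample_whp:
  obtains m where "0 < m" "\<forall>\<^sub>F n in sequentially. \<forall>M P. model M P \<longrightarrow>
    whp P n (real n powr -3) (\<lambda>x. regular_sample n M k m (x ` {..<n}))"
proof -
  let ?T = "\<lambda>m n M P j. whp P n (real n powr -4)
    (\<lambda>x. \<forall>y\<in>euclid D \<inter> cball 0 KK. hits n x (cball y (2 * h n (Suc j)) \<inter> ({x. infdist x M \<le> (h n j)\<^sup>2 / \<rho>} - M)) < m)"
  let ?R = "\<lambda>j m. 0 < m \<and> (\<forall>\<^sub>F n in sequentially. \<forall>M P. model M P \<longrightarrow> ?T m n M P j)"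
  have ex: "\<exists>m. ?R j m" for j
  proof (rule tube_hits[of j])
    fix m assume "0 < m" "\<forall>\<^sub>F n in sequentially. \<forall>M P. model M P \<longrightarrow> ?T m n M P j"
    then show ?thesis by (intro exI[of _ m] conjI)
  qed
  define mf where "mf j = (SOME m. ?R j m)" for j
  have R: "?R j (mf j)" for j unfolding mf_def by (rule someI_ex[OF ex])
  note mf = R[THEN conjunct1] R[THEN conjunct2]
  define m where "m = Max (mf ` {..k})"
  have m: "mf j \<le> m" if "j \<le> k" for j using that by (simp add: m_def)
  have m0: "0 < m" using mf(1)[of 0] m[of 0] by simp
  let ?L = "\<lambda>\<kappa> n M j x. \<forall>y\<in>M. real n * (\<beta> * f_min * vol_low d * (\<kappa> * h n j / 2) ^ d) / 4 < hits n x (M \<inter> cball y (\<kappa> * h n j))"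
  let ?U = "\<lambda>n j x. \<forall>y\<in>euclid D \<inter> cball 0 KK. hits n x (cball y (2 * h n j)) < cnt_all n j"
  let ?O = "\<lambda>n M j x. \<forall>y\<in>euclid D \<inter> cball 0 KK. hits n x (cball y (2 * h n j) \<inter> - M) < cnt_out n j"
  have 1: "\<forall>\<^sub>F n in sequentially. \<forall>j\<in>{..k}. \<forall>M P. model M P \<longrightarrow> whp P n (real n powr -4) (?L (1 / 32) n M j)"
    by (intro eventually_ball_finite ballI manifold_hits) auto
  have 2: "\<forall>\<^sub>F n in sequentially. \<forall>j\<in>{..k}. \<forall>M P. model M P \<longrightarrow> whp P n (real n powr -4) (?L \<kappa> n M j)"
    by (intro eventually_ball_finite ballI manifold_hits slab_pos) auto
  have 3: "\<forall>\<^sub>F n in sequentially. \<forall>j\<in>{..k}. \<forall>M P. model M P \<longrightarrow> whp P n (real n powr -4) (?U n j)"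
    by (intro eventually_ball_finite ballI all_hits) auto
  have 4: "\<forall>\<^sub>F n in sequentially. \<forall>j\<in>{..k}. \<forall>M P. model M P \<longrightarrow> whp P n (real n powr -4) (?O n M j)"
    by (intro eventually_ball_finite ballI outlier_hits) auto
  have 5: "\<forall>\<^sub>F n in sequentially. \<forall>j\<in>{..<k}. \<forall>M P. model M P \<longrightarrow> ?T (mf j) n M P j"
    by (intro eventually_ball_finite ballI mf(2)) auto
  \<comment> \<open>Four events at each of k + 1 levels, one at each of k transitions, and
    injectivity: 5 k + 5 possible failures.\<close>
  have 6: "\<forall>\<^sub>F n::nat in sequentially. (5 * real k + 5) * real n powr -4 \<le> real n powr -3" by real_asymp
  have "\<forall>\<^sub>F n in sequentially. \<forall>M P. model M P \<longrightarrow> whp P n (real n powr -3) (\<lambda>x. regular_sample n M k m (x ` {..<n}))"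
    using 1 2 3 4 5 6 eventually_gt_at_top[of 0]
  proof eventually_elim
    case (elim n)
    show ?case
    proof (intro allI impI)
      fix M P assume mod: "model M P"
      then interpret outlier_dist D d M \<rho> A f_min f_max \<beta> P .
      let ?e = "real n powr -4"
      have "whp P n (?e + (?e + (?e + ?e))) (\<lambda>x. ?L (1 / 32) n M j x \<and> ?L \<kappa> n M j x \<and> ?U n j x \<and> ?O n M j x)" if "j \<in> {..k}" for j
        using elim(1-4) mod that by (intro whp_conj) blast+
      then have a: "whp P n (real (card {..k}) * (?e + (?e + (?e + ?e)))) (\<lambda>x. \<forall>j\<in>{..k}. ?L (1 / 32) n M j x \<and> ?L \<kappa> n M j x \<and> ?U n j x \<and> ?O n M j x)"
        by (intro whp_ball) auto
      have b: "whp P n (real (card {..<k}) * ?e) (\<lambda>x. \<forall>j\<in>{..<k}. \<forall>y\<in>euclid D \<inter> cball 0 KK.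
          hits n x (cball y (2 * h n (Suc j)) \<inter> ({x. infdist x M \<le> (h n j)\<^sup>2 / \<rho>} - M)) < mf j)"
        using elim(5) mod by (intro whp_ball) auto
      have c: "whp P n ?e (\<lambda>x. inj_on x {..<n})" using elim(7) by (intro whp_inj_sample) simp
      show "whp P n (real n powr -3) (\<lambda>x. regular_sample n M k m (x ` {..<n}))"
      proof (rule whp_mono[OF whp_conj[OF a whp_conj[OF b whp_conj[OF c whp_support]]]])
        show "real (card {..k}) * (?e + (?e + (?e + ?e))) + (real (card {..<k}) * ?e + (?e + 0)) \<le> real n powr -3"
          using elim(6) by (simp add: algebra_simps)
        fix x assume x: "(\<forall>j\<in>{..k}. ?L (1 / 32) n M j x \<and> ?L \<kappa> n M j x \<and> ?U n j x \<and> ?O n M j x) \<and>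
          (\<forall>j\<in>{..<k}. \<forall>y\<in>euclid D \<inter> cball 0 KK.
            hits n x (cball y (2 * h n (Suc j)) \<inter> ({x. infdist x M \<le> (h n j)\<^sup>2 / \<rho>} - M)) < mf j) \<and>
          inj_on x {..<n} \<and> (\<forall>i<n. x i \<in> euclid D \<inter> cball 0 KK)"
        then have inj: "inj_on x {..<n}" by blast
        show "regular_sample n M k m (x ` {..<n})"
          unfolding regular_sample_def card_image_Int_eq_hits[OF inj]
        proof (intro conjI allI impI ballI)
          show "finite (x ` {..<n})" by simp
          show "x ` {..<n} \<subseteq> euclid D \<inter> cball 0 KK" using x by blast
          fix j y assume "j < k" "y \<in> euclid D \<inter> cball 0 KK"
          then have "hits n x (cball y (2 * h n (Suc j)) \<inter> ({x. infdist x M \<le> (h n j)\<^sup>2 / \<rho>} - M)) < mf j"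
            using x by blast
          then show "hits n x (cball y (2 * h n (Suc j)) \<inter> ({x. infdist x M \<le> (h n j)\<^sup>2 / \<rho>} - M)) < m"
            using m[of j] \<open>j < k\<close> by simp
        qed (use x in blast)+
      qed
    qed
  qed
  then show ?thesis using that m0 by blast
qed

text \<open>Conditions that hold for large \<open>n\<close> whatever the sample. The one on
  \<open>m\<close> lets ln n absorb the number of outliers in the tube, so that \<open>m\<close>
  leaves no trace in the angle constant.\<close>

definition fine_scales :: "nat \<Rightarrow> nat \<Rightarrow> real \<Rightarrow> bool"
  where "fine_scales n k m \<longleftrightarrow> 1 < n \<and> ln (real n) \<le> real n * \<beta> * (h n 0) ^ (d + 1) \<and>
    m * (36864 * 64 ^ d / (f_min * vol_low d)) \<le> ln (real n) \<and>
    (\<forall>j\<le>k. 0 < h n j \<and> h n j < 1 \<and> h n j < \<rho> / 56 \<and> h n j < 4 * \<rho> * slab1 \<and> A_max * h n j < 1 / 4 \<and>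
      8 \<le> real n * (\<beta> * f_min * vol_low d * (h n j / 64) ^ d) \<and> cnt_out n j < thr * (real n - 1) * h n j ^ d) \<and>
    (\<forall>j<k. h n (Suc j) \<le> h n j \<and> (h n j)\<^sup>2 \<le> \<rho> * h n (Suc j) \<and>
      ln (real n) * (h n j)\<^sup>2 \<le> real n * \<beta> * h n (Suc j) ^ (d + 2))"

text \<open>A bound of order n h^D + ln n is negligible against n h^d, since \<open>d < D\<close>;
  this is why a slab that misses \<open>M\<close> stays below the threshold.\<close>

lemma cnt_out_small: "\<forall>\<^sub>F n in sequentially. cnt_out n j < thr * (real n - 1) * h n j ^ d"
proof -
  obtain a where a: "0 < a" "\<forall>\<^sub>F n in sequentially. real n powr a \<le> real n * (h n j) ^ d" using n_h_power by blast
  have va: "0 < vol_amb D KK" using vol_pos(3)[OF KK_pos, of D] dD by simp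
  define g where "g = thr / 8 / (2 * vol_amb D KK * 3 ^ D)"
  have g: "0 < g" using slab_pos va by (simp add: g_def)
  define t where "t = thr"
  have t: "0 < t" using slab_pos by (simp add: t_def)
  have "\<forall>\<^sub>F n::nat in sequentially. (real D + 5) * ln (real n) \<le> t / 8 * real n powr a" using a(1) t by real_asymp
  moreover have "\<forall>\<^sub>F n in sequentially. h n j < min 1 g" using g by (intro h_less) auto
  ultimately show ?thesis using a(2) h_pos[of j] eventually_gt_at_top[of 1]
  proof eventually_elim
    case (elim n)
    let ?h = "h n j"
    have n: "0 < real n * ?h ^ d" using elim by simp
    have "?h ^ D \<le> ?h ^ (d + 1)" using elim dD by (intro power_decreasing) auto
    then have "2 * (vol_amb D KK * (3 * ?h) ^ D) * real n \<le> 2 * (vol_amb D KK * (3 ^ D * (?h ^ d * ?h))) * real n"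
      unfolding power_mult_distrib using va by (intro mult_right_mono mult_left_mono) (auto simp: mult.commute)
    also have "\<dots> = (2 * vol_amb D KK * 3 ^ D) * ?h * (real n * ?h ^ d)" by (simp add: mult_ac)
    also have "\<dots> \<le> (2 * vol_amb D KK * 3 ^ D) * g * (real n * ?h ^ d)"
      using elim va by (intro mult_right_mono mult_left_mono) auto
    also have "(2 * vol_amb D KK * 3 ^ D) * g = thr / 8" using va by (simp add: g_def)
    finally have 1: "2 * (vol_amb D KK * (3 * ?h) ^ D) * real n \<le> thr / 8 * (real n * ?h ^ d)" .
    have "t / 8 * real n powr a \<le> t / 8 * (real n * ?h ^ d)" using elim(3) t by (intro mult_left_mono) auto
    then have 2: "(real D + 5) * ln (real n) \<le> thr / 8 * (real n * ?h ^ d)" using elim(1) by (simp add: t_def)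
    have "cnt_out n j \<le> thr / 4 * (real n * ?h ^ d)" unfolding cnt_out_def using 1 2 by linarith
    also have "\<dots> < thr / 2 * (real n * ?h ^ d)" using n slab_pos(5) by (intro mult_strict_right_mono) auto
    also have "\<dots> = thr * (real n / 2) * ?h ^ d" by simp
    also have "\<dots> \<le> thr * (real n - 1) * ?h ^ d"
      using elim slab_pos(5) by (intro mult_right_mono mult_left_mono) auto
    finally show ?case .
  qed
qed

lemma fine_scales_eventually: "\<forall>\<^sub>F n in sequentially. fine_scales n k m"
proof -
  have 1: "\<forall>\<^sub>F n in sequentially. \<forall>j\<in>{..k}. 0 < h n j" by (intro eventually_ball_finite ballI h_pos) auto
  define c where "c = min (min 1 (\<rho> / 56)) (min (4 * \<rho> * slab1) (1 / 4 / A_max))"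
  have c: "0 < c" using \<rho> slab_pos A_pos by (simp add: c_def)
  have 2: "\<forall>\<^sub>F n in sequentially. \<forall>j\<in>{..k}. h n j < c"
    using c by (intro eventually_ball_finite ballI h_less) auto
  have 3: "\<forall>\<^sub>F n in sequentially. \<forall>j\<in>{..k}. cnt_out n j < thr * (real n - 1) * h n j ^ d"
    by (intro eventually_ball_finite ballI cnt_out_small) auto
  have "\<forall>\<^sub>F n in sequentially. 8 \<le> real n * (\<beta> * f_min * vol_low d * (h n j / 64) ^ d)" for j
  proof -
    obtain a where a: "0 < a" "\<forall>\<^sub>F n in sequentially. real n powr a \<le> real n * (h n j) ^ d" using n_h_power by blast
    define e where "e = \<beta> * f_min * vol_low d / 64 ^ d"
    have e: "0 < e" using \<beta> f vol_pos(1)[OF dD(1)] by (simp add: e_def)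
    have "\<forall>\<^sub>F n::nat in sequentially. 8 \<le> e * real n powr a" using a(1) e by real_asymp
    then show ?thesis using a(2)
    proof eventually_elim
      case (elim n)
      have "e * real n powr a \<le> e * (real n * (h n j) ^ d)" using elim(2) e by (intro mult_left_mono) auto
      also have "\<dots> = real n * (\<beta> * f_min * vol_low d * (h n j / 64) ^ d)" by (simp add: e_def power_divide)
      finally show ?case using elim(1) by simp
    qed
  qed
  then have 4: "\<forall>\<^sub>F n in sequentially. \<forall>j\<in>{..k}. 8 \<le> real n * (\<beta> * f_min * vol_low d * (h n j / 64) ^ d)"
    by (intro eventually_ball_finite ballI) auto
  have 5: "\<forall>\<^sub>F n in sequentially. \<forall>j\<in>{..<k}. h n (Suc j) \<le> h n j"
    by (intro eventually_ball_finite ballI h_decreasing) auto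
  have 6: "\<forall>\<^sub>F n in sequentially. \<forall>j\<in>{..<k}. (h n j)\<^sup>2 \<le> \<rho> * h n (Suc j)"
    by (intro eventually_ball_finite ballI h_square_less \<rho>) auto
  have 7: "\<forall>\<^sub>F n in sequentially. \<forall>j\<in>{..<k}. ln (real n) * (h n j)\<^sup>2 \<le> real n * \<beta> * h n (Suc j) ^ (d + 2)"
    by (intro eventually_ball_finite ballI n_h_step) auto
  define w where "w = m * (36864 * 64 ^ d / (f_min * vol_low d))"
  have 8: "\<forall>\<^sub>F n::nat in sequentially. w \<le> ln (real n)" by real_asymp
  show ?thesis using 1 2 3 4 5 6 7 8 n_h_first eventually_gt_at_top[of 1]
  proof eventually_elim
    case (elim n)
    have "h n j < 1 \<and> h n j < \<rho> / 56 \<and> h n j < 4 * \<rho> * slab1 \<and> A_max * h n j < 1 / 4" if "j \<le> k" for j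
    proof -
      have "h n j < 1 / 4 / A_max" using elim(2) that by (simp add: c_def)
      then have "h n j * A_max < 1 / 4" using A_pos by (subst (asm) pos_less_divide_eq) auto
      then show ?thesis using elim(2) that by (simp add: c_def mult.commute)
    qed
    then show ?case unfolding fine_scales_def using elim by (simp add: w_def)
  qed
qed

text \<open>At level 0 outliers may be anywhere in the ball, at offset up to \<open>3 * h\<close>;
  from level 1 on there are at most \<open>m\<close> of them, in the tube left by the previous
  level. The two cases feed different counts and offsets into \<open>TSE_angle\<close>.\<close>

lemma TSE_angle_level:
  assumes mod: "model M P" and X: "regular_sample n M k m X" and fine: "fine_scales n k m" and j: "j \<le> k"
    and Y: "X \<inter> M \<subseteq> Y" "Y \<subseteq> X" and tube: "\<And>i q. j = Suc i \<Longrightarrow> q \<in> Y \<Longrightarrow> infdist q M \<le> (h n i)\<^sup>2 / \<rho>"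
    and p: "p \<in> X" "foot M p a" "infdist p M \<le> h n j / 8"
    and top: "top_eigenspace D d (local_scatter Y (h n j) p) T"
  shows "dsub d T" "T \<subseteq> euclid D" "dev T (tangent_space M a) (A_max * h n j)"
    "0 < j \<Longrightarrow> dev T (tangent_space M a) (A_lim * h n j)"
proof -
  interpret outlier_dist D d M \<rho> A f_min f_max \<beta> P by (rule mod)
  let ?h = "h n j"
  \<comment> \<open>Half of the guaranteed count. It is at least 1, so the other half pays for the
    excluded point.\<close>
  define nlow where "nlow = real n * (\<beta> * f_min * vol_low d * (?h / 64) ^ d) / 8"
  have XE: "X \<subseteq> euclid D \<inter> cball 0 KK" "finite X" using X by (auto simp: regular_sample_def)
  have finY: "finite Y" using Y XE finite_subset by blast
  have hh: "0 < ?h" "?h < 1" "?h < \<rho> / 56" "8 \<le> real n * (\<beta> * f_min * vol_low d * (?h / 64) ^ d)" "1 < n"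
    using fine j by (auto simp: fine_scales_def)
  have vl: "0 < vol_low d" "0 < vol_up d" "0 < vol_amb D KK"
    using vol_pos(1)[OF dD(1)] vol_pos(2)[of d] vol_pos(3)[OF KK_pos, of D] dD by auto
  have low: "nlow + 1 \<le> real (card (Y \<inter> (M \<inter> cball y (?h / 32))))" if y: "y \<in> M" for y
  proof -
    have "real n * (\<beta> * f_min * vol_low d * (1 / 32 * ?h / 2) ^ d) / 4 < card (X \<inter> (M \<inter> cball y (1 / 32 * ?h)))"
      using X j y by (auto simp: regular_sample_def)
    moreover have "X \<inter> (M \<inter> cball y (1 / 32 * ?h)) = Y \<inter> (M \<inter> cball y (?h / 32))" using Y by auto
    moreover have "1 / 32 * ?h / 2 = ?h / 64" by simp
    ultimately have "real n * (\<beta> * f_min * vol_low d * (?h / 64) ^ d) / 4 < card (Y \<inter> (M \<inter> cball y (?h / 32)))"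
      by (simp only:)
    then have "2 * nlow < card (Y \<inter> (M \<inter> cball y (?h / 32)))" unfolding nlow_def by linarith
    moreover have "1 \<le> nlow" using hh(4) by (simp add: nlow_def)
    ultimately show ?thesis by linarith
  qed
  have nlow: "0 < nlow" using hh(4) by (simp add: nlow_def)
  have pX: "p \<in> euclid D \<inter> cball 0 KK" using p(1) XE by auto
  have "card (Y \<inter> cball p (2 * ?h)) \<le> card (X \<inter> cball p (2 * ?h))" using Y XE by (intro card_mono) auto
  moreover have "card (X \<inter> cball p (2 * ?h)) < cnt_all n j" using X j pX by (auto simp: regular_sample_def)
  ultimately have up: "real (card (Y \<inter> cball p (2 * ?h))) \<le> cnt_all n j" by linarith
  have aM: "a \<in> M" using p(2) by (simp add: foot_def)
  have pa: "norm (p - a) \<le> ?h / 8" using p by (simp add: foot_def dist_norm)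
  have qa: "norm (q - a) \<le> 3 * ?h" if "q \<in> cball p (2 * ?h)" for q
    using that pa hh norm_triangle_ineq[of "q - p" "p - a"] by (simp add: dist_norm norm_minus_commute)
  have vol: "nlow * (?h / 16)\<^sup>2 = real n * \<beta> * (f_min * vol_low d / (2048 * 64 ^ d)) * ?h ^ (d + 2)"
    by (simp add: nlow_def power_divide power_add power2_eq_square)
  define c where "c = f_min * vol_low d / (2048 * 64 ^ d)"
  have c: "0 < c" using f vl by (simp add: c_def)
  have vol_eq: "nlow * (?h / 16)\<^sup>2 = real n * \<beta> * ?h ^ (d + 2) * c" unfolding vol c_def by (simp only: mult_ac)
  have n\<beta>: "0 < real n * \<beta>" "0 < real n * \<beta> * ?h ^ (d + 2)" using hh \<beta> by auto
  have den: "0 < nlow * (?h / 16)\<^sup>2" using nlow hh by simp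
  have inner: "cnt_all n j * (2 * ?h\<^sup>2 / \<rho>) * (2 * ?h) / (nlow * (?h / 16)\<^sup>2) = A_in * ?h"
  proof -
    have "cnt_all n j * (2 * ?h\<^sup>2 / \<rho>) * (2 * ?h) = real n * \<beta> * ?h ^ (d + 2) * (24 * f_max * vol_up d * 3 ^ d / \<rho> * ?h)"
      by (simp add: cnt_all_def power_mult_distrib power_add power2_eq_square mult_ac)
    then have "cnt_all n j * (2 * ?h\<^sup>2 / \<rho>) * (2 * ?h) / (nlow * (?h / 16)\<^sup>2) =
        real n * \<beta> * ?h ^ (d + 2) * (24 * f_max * vol_up d * 3 ^ d / \<rho> * ?h) / (real n * \<beta> * ?h ^ (d + 2) * c)"
      by (simp only: vol_eq)
    also have "\<dots> = 24 * f_max * vol_up d * 3 ^ d / \<rho> * ?h / c" by (rule mult_divide_mult_cancel_left[OF less_imp_neq[OF n\<beta>(2), symmetric]])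
    also have "\<dots> = A_in * ?h"
    proof -
      have "(192::real) ^ d = 64 ^ d * 3 ^ d" by (simp flip: power_mult_distrib)
      then show ?thesis unfolding A_in_def c_def using f vl \<rho> by (simp add: field_simps)
    qed
    finally show ?thesis .
  qed
  have split: "(cnt_all n j * (2 * ?h\<^sup>2 / \<rho>) + nout * r) * (2 * ?h) / (nlow * (?h / 16)\<^sup>2) = A_in * ?h + nout * r * (2 * ?h) / (nlow * (?h / 16)\<^sup>2)" for nout r
    unfolding inner[symmetric] by (simp add: distrib_right add_divide_distrib)
  have YE: "Y \<subseteq> euclid D" using Y XE by blast
  have D1: "1 \<le> D" using dD by simp
  have h28: "?h < \<rho> / 28" using hh by simp
  have pE: "p \<in> euclid D" using pX by simp
  have "dsub d T \<and> T \<subseteq> euclid D \<and> dev T (Tan a) (A_max * ?h) \<and> (0 < j \<longrightarrow> dev T (Tan a) (A_lim * ?h))"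
  proof (cases j)
    case 0
    have "card ((Y - M) \<inter> cball p (2 * ?h)) \<le> card (X \<inter> (cball p (2 * ?h) \<inter> - M))" using Y XE by (intro card_mono) auto
    moreover have "card (X \<inter> (cball p (2 * ?h) \<inter> - M)) < cnt_out n j" using X j pX by (auto simp: regular_sample_def)
    ultimately have out: "real (card ((Y - M) \<inter> cball p (2 * ?h))) \<le> cnt_out n j" by linarith
    have r: "\<bar>w \<bullet> (q - a)\<bar> \<le> 3 * ?h"
      if "q \<in> Y - M" "q \<in> cball p (2 * ?h)" "norm w = 1" "w \<in> euclid D" "\<forall>v\<in>Tan a. w \<bullet> v = 0" for q w
      using Cauchy_Schwarz_ineq2[of w "q - a"] that qa[of q] by simp
    have r0: "0 \<le> 3 * ?h" using hh by simp
    note main = TSE_angle[OF finY YE pE D1 p(2,3) hh(1) h28 top low nlow up out r0 r]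
    have "cnt_out n j * (3 * ?h) * (2 * ?h) / (nlow * (?h / 16)\<^sup>2) \<le> A_out * ?h"
    proof -
      have "?h ^ D \<le> ?h ^ (d + 1)" using hh dD by (intro power_decreasing) auto
      then have "2 * (vol_amb D KK * (3 * ?h) ^ D) * real n \<le> 2 * (vol_amb D KK * (3 ^ D * ?h ^ (d + 1))) * real n"
        unfolding power_mult_distrib using vl by (intro mult_right_mono mult_left_mono) auto
      moreover have "(real D + 5) * ln (real n) \<le> (real D + 5) * (real n * \<beta> * ?h ^ (d + 1))"
        using fine 0 by (intro mult_left_mono) (auto simp: fine_scales_def)
      ultimately have "cnt_out n j \<le> 2 * (vol_amb D KK * (3 ^ D * ?h ^ (d + 1))) * real n + (real D + 5) * (real n * \<beta> * ?h ^ (d + 1))"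
        unfolding cnt_out_def by linarith
      also have "\<dots> = (2 * vol_amb D KK * 3 ^ D + (real D + 5) * \<beta>) * (real n * ?h ^ (d + 1))" by (simp add: algebra_simps)
      finally have "cnt_out n j * (6 * ?h\<^sup>2) \<le> (2 * vol_amb D KK * 3 ^ D + (real D + 5) * \<beta>) * (real n * ?h ^ (d + 1)) * (6 * ?h\<^sup>2)"
        by (rule mult_right_mono) simp
      also have "\<dots> = (real n * \<beta> * ?h ^ (d + 2)) * (6 * (2 * vol_amb D KK * 3 ^ D + (real D + 5) * \<beta>) / \<beta> * ?h)"
        using \<beta> by (simp add: power_add power2_eq_square)
      finally have "cnt_out n j * (3 * ?h) * (2 * ?h) \<le> (real n * \<beta> * ?h ^ (d + 2)) * (6 * (2 * vol_amb D KK * 3 ^ D + (real D + 5) * \<beta>) / \<beta> * ?h)"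
        by (simp add: power2_eq_square mult_ac)
      then have "cnt_out n j * (3 * ?h) * (2 * ?h) / (nlow * (?h / 16)\<^sup>2) \<le>
        (real n * \<beta> * ?h ^ (d + 2)) * (6 * (2 * vol_amb D KK * 3 ^ D + (real D + 5) * \<beta>) / \<beta> * ?h) / (nlow * (?h / 16)\<^sup>2)"
        using den by (intro divide_right_mono) auto
      also have "\<dots> = (real n * \<beta> * ?h ^ (d + 2)) * (6 * (2 * vol_amb D KK * 3 ^ D + (real D + 5) * \<beta>) / \<beta> * ?h) / (real n * \<beta> * ?h ^ (d + 2) * c)"
        by (simp only: vol_eq)
      also have "\<dots> = 6 * (2 * vol_amb D KK * 3 ^ D + (real D + 5) * \<beta>) / \<beta> * ?h / c"
        by (rule mult_divide_mult_cancel_left[OF less_imp_neq[OF n\<beta>(2), symmetric]])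
      also have "\<dots> = A_out * ?h" unfolding A_out_def c_def using f vl \<beta> by (simp add: field_simps)
      finally show ?thesis .
    qed
    then have "real d * (A_in * ?h + cnt_out n j * (3 * ?h) * (2 * ?h) / (nlow * (?h / 16)\<^sup>2)) \<le> real d * (A_in * ?h + A_out * ?h)"
      by (intro mult_left_mono add_left_mono) auto
    also have "\<dots> = real d * (A_in + A_out) * ?h" by (simp add: algebra_simps)
    also have "\<dots> \<le> A_max * ?h" unfolding A_max_def using hh by (intro mult_right_mono) auto
    finally have le: "real d * (A_in * ?h + cnt_out n j * (3 * ?h) * (2 * ?h) / (nlow * (?h / 16)\<^sup>2)) \<le> A_max * ?h" .
    have "dev T (Tan a) (A_max * ?h)" using main(3) le unfolding split by (rule dev_mono)
    then show ?thesis using main(1,2) 0 by blast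
  next
    case (Suc i)
    define \<tau> where "\<tau> = (h n i)\<^sup>2 / \<rho>"
    have ik: "i < k" using j Suc by simp
    have hi: "?h \<le> h n i" "(h n i)\<^sup>2 \<le> \<rho> * ?h" "ln (real n) * (h n i)\<^sup>2 \<le> real n * \<beta> * ?h ^ (d + 2)" "0 < h n i"
      using fine ik Suc by (auto simp: fine_scales_def)
    have \<tau>: "0 \<le> \<tau>" "\<tau> \<le> ?h" using hi \<rho> by (auto simp: \<tau>_def pos_divide_le_eq mult.commute)
    have "(Y - M) \<inter> cball p (2 * ?h) \<subseteq> X \<inter> (cball p (2 * h n (Suc i)) \<inter> ({x. infdist x M \<le> (h n i)\<^sup>2 / \<rho>} - M))"
      using Y tube[OF Suc] Suc by auto
    then have "card ((Y - M) \<inter> cball p (2 * ?h)) \<le> card (X \<inter> (cball p (2 * h n (Suc i)) \<inter> ({x. infdist x M \<le> (h n i)\<^sup>2 / \<rho>} - M)))"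
      using XE by (intro card_mono) auto
    moreover have "card (X \<inter> (cball p (2 * h n (Suc i)) \<inter> ({x. infdist x M \<le> (h n i)\<^sup>2 / \<rho>} - M))) < m"
      using X ik pX by (auto simp: regular_sample_def)
    ultimately have out: "real (card ((Y - M) \<inter> cball p (2 * ?h))) \<le> m" by linarith
    then have m0: "0 \<le> m" using of_nat_0_le_iff order_trans by blast
    \<comment> \<open>One tube radius plus (4 h_old)^2 / (2 \<rho>), that is 1 + 8 units of h_old^2
      / \<rho>.\<close>
    define r where "r = 9 * (h n i)\<^sup>2 / \<rho>"
    have r0: "0 \<le> r" using \<rho> by (simp add: r_def)
    have r: "\<bar>w \<bullet> (q - a)\<bar> \<le> r" if "q \<in> Y - M" "q \<in> cball p (2 * ?h)" "norm w = 1" "w \<in> euclid D" "\<forall>v\<in>Tan a. w \<bullet> v = 0" for q w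
    proof -
      have "\<bar>w \<bullet> (q - a)\<bar> \<le> \<tau> + (3 * ?h + \<tau>)\<^sup>2 / (2 * \<rho>)"
        using that tube[OF Suc] qa by (intro normal_near_tube[OF aM]) (auto simp: \<tau>_def)
      also have "(3 * ?h + \<tau>)\<^sup>2 / (2 * \<rho>) \<le> (4 * h n i)\<^sup>2 / (2 * \<rho>)"
        using \<tau> hi hh \<rho> by (intro divide_right_mono power_mono) auto
      also have "\<tau> + (4 * h n i)\<^sup>2 / (2 * \<rho>) = r" using \<rho> by (simp add: \<tau>_def r_def power2_eq_square field_simps)
      finally show ?thesis by simp
    qed
    note main = TSE_angle[OF finY YE pE D1 p(2,3) hh(1) h28 top low nlow up out r0 r]
    have "m * r * (2 * ?h) / (nlow * (?h / 16)\<^sup>2) \<le> 1 / \<rho> * ?h"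
    proof -
      \<comment> \<open>18 = 9 * 2, from \<open>r\<close> and the factor
        \<open>2 * h\<close>.\<close>
      have "m * 18 / c = m * (36864 * 64 ^ d / (f_min * vol_low d))" by (simp add: c_def)
      moreover have "m * (36864 * 64 ^ d / (f_min * vol_low d)) \<le> ln (real n)"
        using fine unfolding fine_scales_def by (elim conjE)
      ultimately have "m * 18 / c * (h n i)\<^sup>2 \<le> ln (real n) * (h n i)\<^sup>2" by (intro mult_right_mono) auto
      also have "\<dots> \<le> real n * \<beta> * ?h ^ (d + 2)" by (rule hi)
      finally have "m * 18 * (h n i)\<^sup>2 \<le> real n * \<beta> * ?h ^ (d + 2) * c" using c by (simp add: pos_divide_le_eq)
      then have "m * 18 * (h n i)\<^sup>2 * (?h / \<rho>) \<le> real n * \<beta> * ?h ^ (d + 2) * c * (?h / \<rho>)"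
        using hh \<rho> by (intro mult_right_mono) auto
      then have "m * r * (2 * ?h) \<le> 1 / \<rho> * ?h * (nlow * (?h / 16)\<^sup>2)"
        unfolding vol_eq r_def by (simp add: mult_ac)
      then show ?thesis using den by (simp add: pos_divide_le_eq)
    qed
    then have "real d * (A_in * ?h + m * r * (2 * ?h) / (nlow * (?h / 16)\<^sup>2)) \<le> real d * (A_in * ?h + 1 / \<rho> * ?h)"
      by (intro mult_left_mono add_left_mono) auto
    also have "\<dots> = A_lim * ?h" by (simp add: A_lim_def algebra_simps)
    finally have le: "real d * (A_in * ?h + m * r * (2 * ?h) / (nlow * (?h / 16)\<^sup>2)) \<le> A_lim * ?h" .
    have le2: "A_lim * ?h \<le> A_max * ?h" using A_pos hh by (intro mult_right_mono) auto
    have dv: "dev T (Tan a) (A_lim * ?h)" using main(3) le unfolding split by (rule dev_mono)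
    then show ?thesis using main(1,2) dev_mono[OF dv le2] by blast
  qed
  then show "dsub d T" "T \<subseteq> euclid D" "dev T (tangent_space M a) (A_max * h n j)"
    "0 < j \<Longrightarrow> dev T (tangent_space M a) (A_lim * h n j)" by auto
qed

text \<open>Survivors are handled in two stages. Outliers alone do not reach the threshold, so a
  surviving slab meets \<open>M\<close>; this puts its centre within \<open>h / 8\<close> of
  \<open>M\<close>, close enough for the angle bound, which then improves the distance to h^2 /
  \<rho>.\<close>

lemma declutter_level:
  assumes mod: "model M P" and X: "regular_sample n M k m X" and fine: "fine_scales n k m" and j: "j \<le> k"
    and Y: "X \<inter> M \<subseteq> Y" "Y \<subseteq> X" and tube: "\<And>i q. j = Suc i \<Longrightarrow> q \<in> Y \<Longrightarrow> infdist q M \<le> (h n i)\<^sup>2 / \<rho>"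
    and T: "is_TSE D d Y (h n j) T"
  defines "Z \<equiv> slab_declutter D d slab1 slab2 thr n Y T (h n j)"
  shows "X \<inter> M \<subseteq> Z" "Z \<subseteq> X" "\<And>q. q \<in> Z \<Longrightarrow> infdist q M \<le> (h n j)\<^sup>2 / \<rho>"
proof -
  interpret outlier_dist D d M \<rho> A f_min f_max \<beta> P by (rule mod)
  let ?h = "h n j"
  have XE: "X \<subseteq> euclid D \<inter> cball 0 KK" "finite X" using X by (auto simp: regular_sample_def)
  have finY: "finite Y" using Y XE finite_subset by blast
  have hh: "0 < ?h" "?h < 1" "?h < \<rho> / 56" "?h < 4 * \<rho> * slab1" "A_max * ?h < 1 / 4"
    "cnt_out n j < thr * (real n - 1) * ?h ^ d" "1 < n"
    using fine j by (auto simp: fine_scales_def)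
  have angle: "dsub d (T p)" "T p \<subseteq> euclid D" "dev (T p) (Tan a) (A_max * ?h)"
    if "p \<in> Y" "foot M p a" "infdist p M \<le> ?h / 8" for p a
  proof -
    have "p \<in> X" and top: "top_eigenspace D d (local_scatter Y ?h p) (T p)"
      using that(1) Y(2) T by (auto simp: is_TSE_def)
    note angle = TSE_angle_level[OF mod X fine j Y tube \<open>p \<in> X\<close> that(2,3) top]
    show "dsub d (T p)" "T p \<subseteq> euclid D" "dev (T p) (Tan a) (A_max * ?h)" by (rule angle(1-3); assumption)+
  qed
  have k2: "slab2 * ?h \<le> slab1" using hh(4) \<rho> by (simp add: slab2_def field_simps)
  have k2h: "slab2 * ?h\<^sup>2 \<le> slab1 * ?h" using mult_right_mono[OF k2, of ?h] hh by (simp add: power2_eq_square mult_ac)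
  have s1: "slab1 * ?h \<le> 1 / 16 * ?h" using slab_pos hh by (intro mult_right_mono) auto
  show "Z \<subseteq> X" using Y by (auto simp: Z_def slab_declutter_def)
  show "X \<inter> M \<subseteq> Z"
  proof
    fix p assume p: "p \<in> X \<inter> M"
    then have pY: "p \<in> Y" and ft: "foot M p p" and inf: "infdist p M \<le> ?h / 8" using Y hh by (auto simp: foot_def)
    have "A_max * ?h \<le> 1 / 2" using hh by simp
    then have "M \<inter> cball p (\<kappa> * ?h) \<subseteq> slab D slab1 slab2 p (T p) ?h"
      using p angle[OF pY ft inf] A_pos hh slab_pos slab_bounds(2)
      by (intro slab_contains_manifold_ball[of p "T p" A_max]) (auto simp: \<kappa>_def)
    then have "X \<inter> (M \<inter> cball p (\<kappa> * ?h)) \<subseteq> slab D slab1 slab2 p (T p) ?h \<inter> Y" using Y by blast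
    then have "card (X \<inter> (M \<inter> cball p (\<kappa> * ?h))) \<le> card (slab D slab1 slab2 p (T p) ?h \<inter> Y)"
      using finY by (intro card_mono) auto
    moreover have "real n * (\<beta> * f_min * vol_low d * (\<kappa> * ?h / 2) ^ d) / 4 < card (X \<inter> (M \<inter> cball p (\<kappa> * ?h)))"
      using X j p by (auto simp: regular_sample_def)
    moreover have "real n * (\<beta> * f_min * vol_low d * (\<kappa> * ?h / 2) ^ d) / 4 = thr * real n * ?h ^ d"
      by (simp add: thr_def power_mult_distrib power_divide)
    moreover have "thr * (real n - 1) * ?h ^ d \<le> thr * real n * ?h ^ d"
      using slab_pos(5) hh by (intro mult_right_mono mult_left_mono) auto
    ultimately have "thr * (real n - 1) * ?h ^ d \<le> real (card (slab D slab1 slab2 p (T p) ?h \<inter> Y))" by linarith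
    then show "p \<in> Z" using pY by (simp add: Z_def slab_declutter_def)
  qed
  fix p assume "p \<in> Z"
  then have p: "p \<in> Y" "thr * (real n - 1) * ?h ^ d \<le> real (card (slab D slab1 slab2 p (T p) ?h \<inter> Y))"
    by (auto simp: Z_def slab_declutter_def)
  have pX: "p \<in> euclid D \<inter> cball 0 KK" using p Y XE by blast
  have sub: "slab D slab1 slab2 p (T p) ?h \<subseteq> cball p (1 / 8 * ?h)"
  proof (rule slab_subset_cball)
    show "slab1 * ?h + slab2 * ?h\<^sup>2 \<le> 1 / 8 * ?h" using k2h s1 by linarith
  qed (use hh in simp)
  have "slab D slab1 slab2 p (T p) ?h \<inter> M \<noteq> {}"
  proof
    assume e: "slab D slab1 slab2 p (T p) ?h \<inter> M = {}"
    have "cball p (1 / 8 * ?h) \<subseteq> cball p (2 * ?h)" using hh by auto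
    then have "slab D slab1 slab2 p (T p) ?h \<inter> Y \<subseteq> X \<inter> (cball p (2 * ?h) \<inter> - M)" using e sub Y by blast
    then have "card (slab D slab1 slab2 p (T p) ?h \<inter> Y) \<le> card (X \<inter> (cball p (2 * ?h) \<inter> - M))" using XE by (intro card_mono) auto
    moreover have "card (X \<inter> (cball p (2 * ?h) \<inter> - M)) < cnt_out n j" using X j pX by (auto simp: regular_sample_def)
    ultimately show False using p(2) hh(6) by linarith
  qed
  then obtain y where y: "y \<in> M" "y \<in> slab D slab1 slab2 p (T p) ?h" by blast
  obtain a where a: "foot M p a" using foot_exists by blast
  have inf: "infdist p M \<le> ?h / 8" using infdist_le[OF y(1), of p] sub y(2) by auto
  have "infdist p M \<le> (8 * slab1\<^sup>2 / \<rho> + A_max * slab1 + slab2) * ?h\<^sup>2"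
    using pX angle(3)[OF p(1) a inf] A_pos hh slab_pos k2 inf \<rho> by (intro slab_hits_manifold[OF _ y a]) auto
  also have "\<dots> \<le> 1 / \<rho> * ?h\<^sup>2" using slab_bounds(1) by (rule mult_right_mono) simp
  finally show "infdist p M \<le> ?h\<^sup>2 / \<rho>" by simp
qed

lemma decluttered_level:
  assumes mod: "model M P" and X: "regular_sample n M k m X" and fine: "fine_scales n k m"
    and decl: "decluttered D d slab1 slab2 1 thr \<beta> n X j Y" and j: "j \<le> Suc k"
  shows "X \<inter> M \<subseteq> Y \<and> Y \<subseteq> X \<and> (\<forall>i q. j = Suc i \<longrightarrow> q \<in> Y \<longrightarrow> infdist q M \<le> (h n i)\<^sup>2 / \<rho>)"
  using decl j
proof (induction rule: decluttered.induct)
  case (step j Y T)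
  then have IH: "X \<inter> M \<subseteq> Y" "Y \<subseteq> X" "\<And>i q. j = Suc i \<Longrightarrow> q \<in> Y \<Longrightarrow> infdist q M \<le> (h n i)\<^sup>2 / \<rho>" and jk: "j \<le> k" by auto
  have T: "is_TSE D d Y (h n j) T" using step(2) by (simp add: h_def)
  show ?case using declutter_level[OF mod X fine jk IH T] unfolding h_def by blast
qed auto

end

section \<open>The tangential Delaunay complex\<close>

lemma decluttered_subset: "decluttered D d k\<^sub>1 k\<^sub>2 c t \<beta> n X j Y \<Longrightarrow> Y \<subseteq> X"
  by (induction rule: decluttered.induct) (auto simp: slab_declutter_def)

text \<open>A point is added only while the maximal distance exceeds \<open>\<epsilon>\<close>, and
  it realises that maximum.\<close>

lemma fps_state_props:
  assumes "fps_state Y \<epsilon> S"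
  shows "finite S \<and> S \<noteq> {} \<and> S \<subseteq> Y \<and> (\<forall>p\<in>S. \<forall>q\<in>S. p \<noteq> q \<longrightarrow> \<epsilon> < dist p q)"
  using assms
proof (induction rule: fps_state.induct)
  case (step S q)
  obtain p where "p \<in> Y" "\<epsilon> < infdist p S" using step(2) by blast
  then have "\<epsilon> < infdist q S" using step(4) by fastforce
  then have "\<epsilon> < dist q s" if "s \<in> S" for s using infdist_le[OF that, of q] by linarith
  then show ?case using step by (auto simp: dist_commute)
qed auto

lemma tangential_delaunay_complex:
  assumes "finite S"
  shows "abstract_simplicial_complex (tangential_delaunay D \<omega> S T)" "\<Union>(tangential_delaunay D \<omega> S T) \<subseteq> S"
proof -
  have sub: "\<sigma> \<subseteq> S" if "\<sigma> \<in> tangential_delaunay D \<omega> S T" for \<sigma>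
    using that unfolding tangential_delaunay_def weighted_delaunay_def by blast
  then show "\<Union>(tangential_delaunay D \<omega> S T) \<subseteq> S" by blast
  show "abstract_simplicial_complex (tangential_delaunay D \<omega> S T)"
    unfolding abstract_simplicial_complex_def
  proof (intro conjI ballI allI impI)
    fix \<sigma> assume \<sigma>: "\<sigma> \<in> tangential_delaunay D \<omega> S T"
    show "finite \<sigma>" using sub[OF \<sigma>] assms finite_subset by blast
    show "\<sigma> \<noteq> {}" using \<sigma> by (simp add: tangential_delaunay_def)
    fix \<tau> assume "\<tau> \<subseteq> \<sigma> \<and> \<tau> \<noteq> {}"
    then show "\<tau> \<in> tangential_delaunay D \<omega> S T" using \<sigma> unfolding tangential_delaunay_def by blast
  qed
qed

text \<open>A point of maximal weight lies in its own Voronoi cell.\<close>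

lemma tangential_delaunay_nonempty:
  assumes S: "finite S" "S \<noteq> {}" "S \<subseteq> euclid D" and \<omega>: "\<And>p. p \<in> S \<Longrightarrow> 0 \<le> \<omega> p" and T: "\<And>p. p \<in> S \<Longrightarrow> 0 \<in> T p"
  shows "tangential_delaunay D \<omega> S T \<noteq> {}"
proof -
  have "Max (\<omega> ` S) \<in> \<omega> ` S" using S(1,2) by (intro Max_in) auto
  then obtain p where p: "p \<in> S" "Max (\<omega> ` S) = \<omega> p" by (rule imageE)
  have max: "\<omega> q \<le> \<omega> p" if "q \<in> S" for q
    unfolding p(2)[symmetric] by (rule Max_ge) (use S(1) that in auto)
  have "p \<in> weighted_voronoi D \<omega> S {p}"
    unfolding weighted_voronoi_def
  proof (intro CollectI conjI ballI)
    fix p' q assume "p' \<in> {p}" "q \<in> S"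
    then have "(\<omega> q)\<^sup>2 \<le> (\<omega> p')\<^sup>2" "(norm (p - p'))\<^sup>2 = 0" using max \<omega> by (auto intro: power_mono)
    moreover have "0 \<le> (norm (p - q))\<^sup>2" by simp
    ultimately show "(norm (p - p'))\<^sup>2 - (\<omega> p')\<^sup>2 \<le> (norm (p - q))\<^sup>2 - (\<omega> q)\<^sup>2" by linarith
  qed (use p S in auto)
  moreover have "p \<in> (\<Union>p\<in>{p}. (+) p ` T p)" using T[OF p(1)] by (auto intro!: image_eqI[of _ _ 0])
  ultimately have "{p} \<in> tangential_delaunay D \<omega> S T"
    unfolding tangential_delaunay_def weighted_delaunay_def using p(1) by blast
  then show ?thesis by blast
qed

lemma TSE_zero: "is_TSE D d Y h T \<Longrightarrow> p \<in> Y \<Longrightarrow> 0 \<in> T p"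
  unfolding is_TSE_def top_eigenspace_def by (auto dest!: bspec simp: span_zero)

text \<open>Nonemptiness matters: the Hausdorff distance to an empty set is infinite and would ruin
  the expectation on the exceptional event.\<close>

lemma is_TDC_delta_complex:
  assumes tdc: "is_TDC_delta \<omega>\<^sub>s D d k\<^sub>1 k\<^sub>2 c t c' \<beta> \<delta> n X K" and X: "finite X" "X \<subseteq> euclid D"
    and \<omega>: "\<forall>D P T. finite P \<longrightarrow> (\<forall>p\<in>P. 0 \<le> \<omega>\<^sub>s D P T p)"
  shows "abstract_simplicial_complex K \<and> \<Union>K \<subseteq> X \<and> K \<noteq> {}"
proof -
  obtain Y where Y: "decluttered D d k\<^sub>1 k\<^sub>2 c t \<beta> n X (Suc (k_delta d \<delta>)) Y"
    "if Y = {} then \<exists>p\<in>X. K = {{p}}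
       else \<exists>T S. is_TSE D d Y (scale d c \<beta> n (k_delta d \<delta>)) T \<and>
              is_fps Y (c' * scale d c \<beta> n (k_delta d \<delta>)) S \<and>
              K = tangential_delaunay D (\<omega>\<^sub>s D S (restrict T S)) S (restrict T S)"
    using tdc unfolding is_TDC_delta_def by blast
  show ?thesis
  proof (cases "Y = {}")
    case True
    then obtain p where "p \<in> X" "K = {{p}}" using Y(2) by auto
    then show ?thesis by (auto simp: abstract_simplicial_complex_def subset_singleton_iff)
  next
    case False
    then obtain T S where TS: "is_TSE D d Y (scale d c \<beta> n (k_delta d \<delta>)) T"
      "is_fps Y (c' * scale d c \<beta> n (k_delta d \<delta>)) S"
      "K = tangential_delaunay D (\<omega>\<^sub>s D S (restrict T S)) S (restrict T S)" using Y(2) by auto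
    have S: "finite S" "S \<noteq> {}" "S \<subseteq> Y" using fps_state_props TS(2) by (auto simp: is_fps_def)
    have SX: "S \<subseteq> X" using S(3) decluttered_subset[OF Y(1)] by blast
    have "tangential_delaunay D (\<omega>\<^sub>s D S (restrict T S)) S (restrict T S) \<noteq> {}"
      using S SX X TSE_zero[OF TS(1)] \<omega> by (intro tangential_delaunay_nonempty) auto
    then show ?thesis using tangential_delaunay_complex[OF S(1)] SX unfolding TS(3) by blast
  qed
qed

lemma hausdorff_dist_le:
  assumes "\<And>x. x \<in> A \<Longrightarrow> \<exists>y\<in>B. dist x y \<le> r" "\<And>y. y \<in> B \<Longrightarrow> \<exists>x\<in>A. dist x y \<le> r"
  shows "hausdorff_dist A B \<le> ennreal r"
  unfolding hausdorff_dist_def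
proof (intro max.boundedI SUP_least)
  fix x assume "x \<in> A"
  then obtain y where "y \<in> B" "dist x y \<le> r" using assms(1) by blast
  then show "(INF y\<in>B. ennreal (dist x y)) \<le> ennreal r" by (intro INF_lower2[of y] ennreal_leI)
next
  fix y assume "y \<in> B"
  then obtain x where "x \<in> A" "dist x y \<le> r" using assms(2) by blast
  then show "(INF x\<in>A. ennreal (dist x y)) \<le> ennreal r" by (intro INF_lower2[of x] ennreal_leI)
qed

text \<open>The infima need not be attained on general sets, hence the arbitrary positive
  slack.\<close>

lemma hausdorff_dist_triangle:
  assumes AB: "\<And>x. x \<in> A \<Longrightarrow> \<exists>y\<in>B. dist x y \<le> r" "\<And>y. y \<in> B \<Longrightarrow> \<exists>x\<in>A. dist x y \<le> r"
    and BC: "hausdorff_dist B C \<le> ennreal s" and "0 \<le> r" "0 \<le> s"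
  shows "hausdorff_dist A C \<le> ennreal (r + s)"
  unfolding hausdorff_dist_def
proof (intro max.boundedI SUP_least)
  fix x assume "x \<in> A"
  then obtain y where y: "y \<in> B" "dist x y \<le> r" using AB(1) by blast
  have s: "(INF z\<in>C. ennreal (dist y z)) \<le> ennreal s"
    by (rule order_trans[OF SUP_upper[OF y(1)] order_trans[OF max.cobounded1 BC[unfolded hausdorff_dist_def]]])
  show "(INF z\<in>C. ennreal (dist x z)) \<le> ennreal (r + s)"
  proof (rule ennreal_le_epsilon)
    fix \<epsilon> :: real assume \<epsilon>: "0 < \<epsilon>"
    have "ennreal s < ennreal (s + \<epsilon>)" using assms(5) \<epsilon> by (simp add: ennreal_less_iff)
    then have "(INF z\<in>C. ennreal (dist y z)) < ennreal (s + \<epsilon>)" by (rule le_less_trans[OF s])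
    then obtain z where z: "z \<in> C" "ennreal (dist y z) < ennreal (s + \<epsilon>)" unfolding INF_less_iff by blast
    have "dist y z < s + \<epsilon>" using z(2) by (simp add: ennreal_less_iff)
    then have "dist x z \<le> r + s + \<epsilon>" using y(2) dist_triangle[of x z y] by linarith
    then have "(INF z\<in>C. ennreal (dist x z)) \<le> ennreal (r + s + \<epsilon>)" using z(1) by (intro INF_lower2[of z] ennreal_leI)
    then show "(INF z\<in>C. ennreal (dist x z)) \<le> ennreal (r + s) + ennreal \<epsilon>"
      using assms(4,5) \<epsilon> by (simp add: ennreal_plus[symmetric] del: ennreal_plus)
  qed
next
  fix z assume z: "z \<in> C"
  have s: "(INF y\<in>B. ennreal (dist y z)) \<le> ennreal s"
    by (rule order_trans[OF SUP_upper[OF z] order_trans[OF max.cobounded2 BC[unfolded hausdorff_dist_def]]])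
  show "(INF x\<in>A. ennreal (dist x z)) \<le> ennreal (r + s)"
  proof (rule ennreal_le_epsilon)
    fix \<epsilon> :: real assume \<epsilon>: "0 < \<epsilon>"
    have "ennreal s < ennreal (s + \<epsilon>)" using assms(5) \<epsilon> by (simp add: ennreal_less_iff)
    then have "(INF y\<in>B. ennreal (dist y z)) < ennreal (s + \<epsilon>)" by (rule le_less_trans[OF s])
    then obtain y where y: "y \<in> B" "ennreal (dist y z) < ennreal (s + \<epsilon>)" unfolding INF_less_iff by blast
    obtain x where x: "x \<in> A" "dist x y \<le> r" using AB(2)[OF y(1)] by blast
    have "dist y z < s + \<epsilon>" using y(2) by (simp add: ennreal_less_iff)
    then have "dist x z \<le> r + s + \<epsilon>" using x(2) dist_triangle[of x z y] by linarith
    then have "(INF x\<in>A. ennreal (dist x z)) \<le> ennreal (r + s + \<epsilon>)" using x(1) by (intro INF_lower2[of x] ennreal_leI)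
    then show "(INF x\<in>A. ennreal (dist x z)) \<le> ennreal (r + s) + ennreal \<epsilon>"
      using assms(4,5) \<epsilon> by (simp add: ennreal_plus[symmetric] del: ennreal_plus)
  qed
qed

text \<open>The crude bound for the exceptional event: the complex lies in any ball that holds its
  vertices, by convexity.\<close>

lemma hausdorff_dist_bounded:
  assumes K: "K \<noteq> {}" "abstract_simplicial_complex K" "\<Union>K \<subseteq> cball 0 R" and M: "M \<noteq> {}" "M \<subseteq> cball (0 :: 'a :: real_normed_vector) R"
  shows "hausdorff_dist M (underlying K) \<le> ennreal (2 * R)"
proof -
  have sub: "underlying K \<subseteq> cball 0 R" unfolding underlying_def
    using K(3) by (intro UN_least hull_minimal convex_cball) auto
  obtain \<sigma> p where "\<sigma> \<in> K" "p \<in> \<sigma>" using K(1,2) unfolding abstract_simplicial_complex_def by blast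
  then have "p \<in> underlying K" unfolding underlying_def using hull_inc by fastforce
  then have ne: "underlying K \<noteq> {}" by blast
  have d: "dist x y \<le> 2 * R" if "x \<in> cball 0 R" "y \<in> cball 0 R" for x y :: 'a
    using that dist_triangle[of x y 0] by (simp add: dist_norm)
  show ?thesis
  proof (rule hausdorff_dist_le)
    show "\<exists>y\<in>underlying K. dist x y \<le> 2 * R" if "x \<in> M" for x using that M(2) sub ne d by blast
    show "\<exists>x\<in>M. dist x y \<le> 2 * R" if "y \<in> underlying K" for y using that M sub d by blast
  qed
qed

section \<open>From events to inner probability and outer expectation\<close>

context prob_borel
begin

lemma inner_prob_ge:
  assumes "whp P n \<epsilon> Q" shows "1 - \<epsilon> \<le> inner_prob (sample P n) {x \<in> space (sample P n). Q x}"
    "inner_prob (sample P n) {x \<in> space (sample P n). Q x} \<le> 1"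
proof -
  interpret S: prob_space "sample P n" by (rule prob_sample)
  let ?E = "{x \<in> space (sample P n). Q x}"
  obtain G where G: "G \<in> sets (sample P n)" "1 - \<epsilon> \<le> measure (sample P n) G" "\<forall>x\<in>G. Q x"
    using assms unfolding whp_def by blast
  have GE: "G \<in> {B \<in> sets (sample P n). B \<subseteq> ?E}" using G sets.sets_into_space[OF G(1)] by auto
  have bdd: "bdd_above (measure (sample P n) ` {B \<in> sets (sample P n). B \<subseteq> ?E})"
    by (rule bdd_aboveI[of _ 1]) auto
  show "1 - \<epsilon> \<le> inner_prob (sample P n) ?E"
    unfolding inner_prob_def by (rule order_trans[OF G(2) cSUP_upper[OF GE bdd]])
  show "inner_prob (sample P n) ?E \<le> 1"
    unfolding inner_prob_def using GE by (intro cSUP_least) auto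
qed

text \<open>The measurable majorant is \<open>a\<close> on the good event, \<open>b\<close> off it,
  with infinity added on the null set where \<open>R\<close> is not guaranteed.\<close>

lemma outer_expectation_le:
  assumes Q: "whp P n \<epsilon> Q" "\<And>x. Q x \<Longrightarrow> f x \<le> ennreal a" and R: "whp P n 0 R" "\<And>x. R x \<Longrightarrow> f x \<le> ennreal b"
    and ab: "0 \<le> a" "0 \<le> b" "0 \<le> \<epsilon>"
  shows "outer_expectation (sample P n) f \<le> ennreal (a + b * \<epsilon>)"
proof -
  interpret S: prob_space "sample P n" by (rule prob_sample)
  let ?S = "sample P n"
  obtain G where G: "G \<in> sets ?S" "1 - \<epsilon> \<le> measure ?S G" "\<forall>x\<in>G. Q x" using Q(1) unfolding whp_def by blast
  obtain H where H: "H \<in> sets ?S" "1 - 0 \<le> measure ?S H" "\<forall>x\<in>H. R x" using R(1) unfolding whp_def by blast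
  define g where "g x = ennreal a * indicator G x + (ennreal b * indicator (space ?S - G) x + \<infinity> * indicator (space ?S - H) x)" for x
  have sets: "space ?S - G \<in> sets ?S" "space ?S - H \<in> sets ?S" using G H by auto
  have gm: "g \<in> borel_measurable ?S" unfolding g_def using G H by measurable
  have "f x \<le> g x" if x: "x \<in> space ?S" for x
  proof (cases "x \<in> H")
    case True
    then show ?thesis using x G(3) H(3) Q(2) R(2) by (cases "x \<in> G") (auto simp: g_def)
  qed (use x in \<open>simp add: g_def\<close>)
  then have "outer_expectation ?S f \<le> (\<integral>\<^sup>+x. g x \<partial>?S)"
    unfolding outer_expectation_def using gm by (intro INF_lower) auto
  also have "\<dots> = ennreal a * emeasure ?S G + (ennreal b * emeasure ?S (space ?S - G) + \<infinity> * emeasure ?S (space ?S - H))"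
    unfolding g_def using G H sets
    by (subst nn_integral_add, simp_all, subst nn_integral_add, simp_all add: nn_integral_cmult_indicator)
  also have "emeasure ?S (space ?S - H) = 0"
    using H(1,2) S.prob_compl[OF H(1)] S.prob_le_1[of H] by (simp add: S.emeasure_eq_measure)
  also have "emeasure ?S (space ?S - G) \<le> ennreal \<epsilon>"
    using G(2) S.prob_compl[OF G(1)] by (simp add: S.emeasure_eq_measure ennreal_leI)
  also have "emeasure ?S G \<le> 1" by (rule S.emeasure_le_1)
  finally have "outer_expectation ?S f \<le> ennreal a * 1 + (ennreal b * ennreal \<epsilon> + \<infinity> * 0)"
    by (simp add: add_mono mult_left_mono)
  also have "\<dots> = ennreal (a + b * \<epsilon>)" using ab by (simp add: ennreal_mult')
  finally show ?thesis .
qed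

end

text \<open>A copy of \<open>A_lim\<close> outside the locale, which shows that neither
  \<open>D\<close> nor \<open>\<beta>\<close> occurs; the final constants must be chosen before
  both.\<close>

definition angle_const :: "nat \<Rightarrow> real \<Rightarrow> real \<Rightarrow> real \<Rightarrow> real"
  where "angle_const d f_min f_max \<rho> = real d * (49152 * 192 ^ d * f_max * vol_up d / (\<rho> * f_min * vol_low d) + 1 / \<rho>)"

text \<open>In units of h^2: the displacement 1 / \<rho> of a point plus the rotation term 2
  \<theta> \<mu>, with \<theta> = \<open>A_lim\<close> h and \<mu> = h / 4.\<close>

definition shift_const :: "nat \<Rightarrow> real \<Rightarrow> real \<Rightarrow> real \<Rightarrow> real"
  where "shift_const d f_min f_max \<rho> = 1 / \<rho> + angle_const d f_min f_max \<rho> / 2"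

text \<open>The reach after interpolation with bumps of radius h / 4, where 320 * 16 = 5120 and the
  powers of h cancel.\<close>

definition reach_const :: "nat \<Rightarrow> real \<Rightarrow> real \<Rightarrow> real \<Rightarrow> real"
  where "reach_const d f_min f_max \<rho> = 1 / (6 / \<rho> + 5120 * shift_const d f_min f_max \<rho>)"

section \<open>The complex on the good event, and the rates\<close>

context params
begin

abbreviation "C_shift \<equiv> shift_const d f_min f_max \<rho>"
abbreviation "\<rho>' \<equiv> reach_const d f_min f_max \<rho>"

lemma A_lim_eq: "A_lim = angle_const d f_min f_max \<rho>"
  by (simp add: A_lim_def A_in_def angle_const_def)

lemma C_shift_pos: "0 < C_shift" and \<rho>'_pos: "0 < \<rho>'"
proof -
  show 1: "0 < C_shift" using A_pos(3) \<rho> unfolding shift_const_def A_lim_eq[symmetric] by (simp add: add_pos_pos)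
  show "0 < \<rho>'" using 1 \<rho> unfolding reach_const_def by (simp add: add_pos_pos)
qed

lemma TDC_close:
  assumes mod: "model M P" and X: "regular_sample n M k m X" and fine: "fine_scales n k m"
    and k: "k = k_delta d \<delta>" "0 < k"
    and small: "40 * C_shift * h n k \<le> 1" "h n k \<le> \<epsilon> * \<rho>'"
    and BG: "\<forall>D \<rho> \<epsilon>' M P. 0 < \<rho> \<longrightarrow> 0 < \<epsilon>' \<longrightarrow> \<epsilon>' \<le> \<epsilon> * \<rho> \<longrightarrow> M \<in> manifold_class D d \<rho> \<longrightarrow> is_net \<epsilon>' M P \<longrightarrow>
        (let T = restrict (tangent_space M) P; N = underlying (tangential_delaunay D (\<omega>\<^sub>s D P T) P T)
         in hausdorff_dist M N \<le> ennreal (B * \<epsilon>'\<^sup>2 / \<rho>) \<and> ambient_isotopic D M N)" and B: "0 < B"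
    and tdc: "is_TDC_delta \<omega>\<^sub>s D d slab1 slab2 1 thr 1 \<beta> \<delta> n X K"
  shows "hausdorff_dist M (underlying K) \<le> ennreal ((C_shift + B / \<rho>') * (h n k)\<^sup>2)"
    "ambient_isotopic D M (underlying K)"
proof -
  interpret outlier_dist D d M \<rho> A f_min f_max \<beta> P by (rule mod)
  let ?h = "h n k"
  obtain Y where Y: "decluttered D d slab1 slab2 1 thr \<beta> n X (Suc k) Y"
    "if Y = {} then \<exists>p\<in>X. K = {{p}}
       else \<exists>T S. is_TSE D d Y ?h T \<and> is_fps Y (1 * ?h) S \<and>
              K = tangential_delaunay D (\<omega>\<^sub>s D S (restrict T S)) S (restrict T S)"
    using tdc unfolding is_TDC_delta_def k(1)[symmetric] h_def[symmetric] by blast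
  have Yp: "X \<inter> M \<subseteq> Y" "Y \<subseteq> X" "\<And>q. q \<in> Y \<Longrightarrow> infdist q M \<le> ?h\<^sup>2 / \<rho>"
    using decluttered_level[OF mod X fine Y(1)] by auto
  have XE: "X \<subseteq> euclid D \<inter> cball 0 KK" "finite X" using X by (auto simp: regular_sample_def)
  have hh: "0 < ?h" "?h < 1" "?h < \<rho> / 56" "A_max * ?h < 1 / 4" using fine by (auto simp: fine_scales_def)
  have near: "\<exists>q\<in>X \<inter> M. dist y q \<le> ?h / 32" if y: "y \<in> M" for y
  proof -
    have "real n * (\<beta> * f_min * vol_low d * (1 / 32 * ?h / 2) ^ d) / 4 < card (X \<inter> (M \<inter> cball y (1 / 32 * ?h)))"
      using X y by (auto simp: regular_sample_def)
    moreover have "0 \<le> real n * (\<beta> * f_min * vol_low d * (1 / 32 * ?h / 2) ^ d) / 4"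
      using \<beta> f vol_pos(1)[OF dD(1)] hh by simp
    ultimately have "0 < card (X \<inter> (M \<inter> cball y (1 / 32 * ?h)))" by linarith
    then have "X \<inter> (M \<inter> cball y (1 / 32 * ?h)) \<noteq> {}" by (metis card.empty less_numeral_extra(3))
    then show ?thesis by auto
  qed
  obtain y0 where "y0 \<in> M" using M_ne by blast
  then have "Y \<noteq> {}" using near[of y0] Yp(1) by blast
  then obtain T S where T: "is_TSE D d Y ?h T" and S: "is_fps Y ?h S"
    and K: "K = tangential_delaunay D (\<omega>\<^sub>s D S (restrict T S)) S (restrict T S)" using Y(2) by auto
  have Sp: "finite S" "S \<noteq> {}" "S \<subseteq> Y" "\<And>p q. p \<in> S \<Longrightarrow> q \<in> S \<Longrightarrow> p \<noteq> q \<Longrightarrow> ?h < dist p q"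
    "\<And>p. p \<in> Y \<Longrightarrow> infdist p S \<le> ?h"
    using fps_state_props[of Y ?h S] S by (auto simp: is_fps_def)
  have SE: "S \<subseteq> euclid D" using Sp(3) Yp(2) XE by blast
  define a where "a p = (SOME a. foot M p a)" for p
  have a: "foot M p (a p)" for p unfolding a_def by (rule someI_ex[OF foot_exists])
  have h\<rho>: "?h\<^sup>2 / \<rho> \<le> ?h / 8"
  proof -
    have "?h * ?h \<le> ?h * (\<rho> / 8)" using hh by (intro mult_left_mono) auto
    then show ?thesis using \<rho> by (simp add: power2_eq_square pos_divide_le_eq)
  qed
  have pa: "norm (p - a p) \<le> ?h\<^sup>2 / \<rho>" if "p \<in> S" for p
    using a[of p] Yp(3)[of p] Sp(3) that by (auto simp: foot_def dist_norm)
  obtain i where i: "k = Suc i" using k(2) gr0_conv_Suc by blast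
  \<comment> \<open>The final tangent spaces are estimated at the same scale at which the set was
    last decluttered. \<open>TSE_angle_level\<close> asks only for the tube of the preceding, larger
    scale.\<close>
  have "?h \<le> h n i" using fine i by (auto simp: fine_scales_def)
  then have "?h\<^sup>2 / \<rho> \<le> (h n i)\<^sup>2 / \<rho>" using hh \<rho> by (intro divide_right_mono power_mono) auto
  then have tube: "infdist q M \<le> (h n i')\<^sup>2 / \<rho>" if "k = Suc i'" "q \<in> Y" for i' q
    using Yp(3)[OF that(2)] that(1) i by simp
  have angle: "dsub d (T p)" "T p \<subseteq> euclid D" "dev (T p) (Tan (a p)) (A_lim * ?h)" if p: "p \<in> S" for p
  proof -
    have pX: "p \<in> X" and inf: "infdist p M \<le> ?h / 8" and top: "top_eigenspace D d (local_scatter Y ?h p) (T p)"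
      using p Sp(3) Yp(2) order_trans[OF Yp(3) h\<rho>] T by (auto simp: is_TSE_def)
    note angle = TSE_angle_level[OF mod X fine order_refl Yp(1,2) tube pX a inf top]
    show "dsub d (T p)" "T p \<subseteq> euclid D" by (rule angle(1,2); assumption)+
    show "dev (T p) (Tan (a p)) (A_lim * ?h)" using angle(4)[OF _ _ k(2)] by simp
  qed
  have th: "0 \<le> A_lim * ?h" "A_lim * ?h \<le> 1 / 4"
    using A_pos hh order_trans[OF mult_right_mono[OF A_pos(5), of ?h] less_imp_le[OF hh(4)]] by auto
  define G where "G = C_shift * ?h\<^sup>2"
  have G0: "0 \<le> G" using C_shift_pos by (simp add: G_def)
  have Gh: "40 * G \<le> ?h"
  proof -
    have "40 * C_shift * ?h * ?h \<le> 1 * ?h" using small(1) hh by (intro mult_right_mono) auto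
    then show ?thesis by (simp add: G_def power2_eq_square)
  qed
  \<comment> \<open>Sample points are more than \<open>h\<close> apart and lie within
    \<open>h / 8\<close> of their feet, so the feet stay \<open>h / 2\<close> apart.\<close>
  have sep: "2 * (?h / 4) \<le> norm (a p - a q)" if pq: "p \<in> S" "q \<in> S" "p \<noteq> q" for p q
  proof -
    have "?h < norm (p - q)" using Sp(4)[OF pq] by (simp add: dist_norm)
    also have "\<dots> \<le> norm (p - a p) + norm (a p - a q) + norm (q - a q)"
      using norm_triangle_ineq[of "p - a p" "a p - q"] norm_triangle_ineq4[of "a p - a q" "q - a q"] by simp
    finally show ?thesis using pa[OF pq(1)] pa[OF pq(2)] h\<rho> hh(1) by linarith
  qed
  have G1: "?h\<^sup>2 / \<rho> + 2 * (A_lim * ?h) * (?h / 4) \<le> G"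
    by (simp add: G_def shift_const_def A_lim_eq power2_eq_square algebra_simps)
  have G2: "10 * G \<le> ?h / 4" using Gh by simp
  have h4: "0 < ?h / 4" using hh by simp
  obtain M' where M': "M' \<in> manifold_class D d (1 / (6 / \<rho> + 320 * G / (?h / 4)\<^sup>2))" "S \<subseteq> M'"
    "\<And>p. p \<in> S \<Longrightarrow> tangent_space M' p = T p" "ambient_isotopic D M M'"
    "\<And>x. x \<in> M \<Longrightarrow> \<exists>x'\<in>M'. norm (x - x') \<le> G" "\<And>x'. x' \<in> M' \<Longrightarrow> \<exists>x\<in>M. norm (x - x') \<le> G"
    by (rule interpolation[OF Sp(1) SE a pa angle th sep h4 G1 G2 G0]) blast+
  have "320 * G / (?h / 4)\<^sup>2 = 5120 * C_shift" using hh by (simp add: G_def power2_eq_square)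
  then have M'c: "M' \<in> manifold_class D d \<rho>'" using M'(1) by (simp add: reach_const_def)
  \<comment> \<open>Farthest point sampling covers the decluttered set up to \<open>h\<close>; going
    from \<open>M'\<close> to \<open>M\<close> and on to a sample point of \<open>M\<close> adds at
    most \<open>h / 40 + h / 32\<close>.\<close>
  have net: "is_net ?h M' S"
    unfolding is_net_def
  proof (intro conjI ballI)
    show "?h \<le> dist p q" if "p \<in> S" "q \<in> S - {p}" for p q using Sp(4)[of p q] that by fastforce
    fix x' assume "x' \<in> M'"
    then obtain x where x: "x \<in> M" "norm (x - x') \<le> G" using M'(6) by blast
    obtain q where q: "q \<in> X \<inter> M" "dist x q \<le> ?h / 32" using near[OF x(1)] by blast
    have "infdist x' S \<le> infdist q S + dist x' q" by (rule infdist_triangle)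
    also have "infdist q S \<le> ?h" using q Yp(1) by (intro Sp(5)) auto
    also have "dist x' q \<le> dist x' x + dist x q" by (rule dist_triangle)
    also have "dist x' x \<le> G" using x(2) by (simp add: dist_norm norm_minus_commute)
    finally show "infdist x' S \<le> 2 * ?h" using q(2) Gh hh by simp
  qed (use Sp(1,2) M'(2) in auto)
  have "restrict (tangent_space M') S = restrict T S" by (rule restrict_ext) (rule M'(3))
  then have BG': "hausdorff_dist M' (underlying K) \<le> ennreal (B * ?h\<^sup>2 / \<rho>')" "ambient_isotopic D M' (underlying K)"
    using BG[rule_format, OF \<rho>'_pos hh(1) small(2) M'c net] unfolding K by (auto simp: Let_def)
  show "ambient_isotopic D M (underlying K)" by (rule ambient_isotopic_trans[OF M'(4) BG'(2)])
  have "hausdorff_dist M (underlying K) \<le> ennreal (G + B * ?h\<^sup>2 / \<rho>')"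
    using M'(5,6) BG'(1) G0 B \<rho>'_pos by (intro hausdorff_dist_triangle[of M M']) (auto simp: dist_norm)
  also have "G + B * ?h\<^sup>2 / \<rho>' = (C_shift + B / \<rho>') * ?h\<^sup>2" by (simp add: G_def algebra_simps)
  finally show "hausdorff_dist M (underlying K) \<le> ennreal ((C_shift + B / \<rho>') * ?h\<^sup>2)" .
qed

definition "rate \<delta> n = (ln (real n) / (\<beta> * real n)) powr (2 / real d - 2 * \<delta>)"

lemma rate_exponent:
  assumes "0 < \<delta>" "\<delta> < 1 / (real d * (real d + 1))"
  shows "0 < 2 / real d - 2 * \<delta>" "2 / real d - 2 * \<delta> < 2"
proof -
  have "1 * real d \<le> (real d + 1) * real d" using dD(1) by (intro mult_right_mono) auto
  then have "1 / (real d * (real d + 1)) \<le> 1 / real d" using dD(1) by (intro divide_left_mono) (auto simp: mult_ac)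
  then show "0 < 2 / real d - 2 * \<delta>" using assms by (simp add: field_simps)
  have "2 / real d \<le> 2" using dD(1) by (simp add: field_simps)
  then show "2 / real d - 2 * \<delta> < 2" using assms by linarith
qed

text \<open>By the choice of \<open>k_delta\<close> and \<open>q < 1\<close>, h^2 is at most
  \<open>q\<close> raised to the exponent of the rate. Replacing n - 1 by n costs a factor 2 in the
  base, and the exponent is below 2; hence 4.\<close>

lemma h_square_rate:
  assumes \<delta>: "0 < \<delta>" "\<delta> < 1 / (real d * (real d + 1))"
  shows "\<forall>\<^sub>F n in sequentially. (h n (k_delta d \<delta>))\<^sup>2 \<le> 4 * rate \<delta> n"
proof -
  let ?k = "k_delta d \<delta>" and ?e = "2 / real d - 2 * \<delta>"
  note e = rate_exponent[OF \<delta>]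
  have "\<forall>\<^sub>F n in sequentially. ln (real n) / (\<beta> * (real n - 1)) \<le> 2 * (ln (real n) / (\<beta> * real n))"
    using \<beta> by real_asymp
  moreover have "\<forall>\<^sub>F n in sequentially. 0 < ln (real n) / (\<beta> * real n)" using \<beta> by real_asymp
  ultimately show ?thesis using q_pos q_lt1 h_power[of ?k 2]
  proof eventually_elim
    case (elim n)
    have "(h n ?k)\<^sup>2 = q n powr (gam d ?k * real 2)" by (rule elim(5))
    also have "\<dots> \<le> q n powr ?e"
      using elim(3,4) k_delta_ge[OF dD(1) \<delta>(1)] by (intro powr_mono') auto
    also have "\<dots> \<le> (2 * (ln (real n) / (\<beta> * real n))) powr ?e"
      using elim e by (intro powr_mono2) (auto simp: q_def)
    also have "\<dots> = 2 powr ?e * rate \<delta> n" using elim(2) by (simp only: rate_def powr_mult)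
    also have "\<dots> \<le> 2 powr 2 * rate \<delta> n" using e by (intro mult_right_mono powr_mono) (auto simp: rate_def)
    finally show ?case by simp
  qed
qed

text \<open>The exponent of the rate is below 2, so the failure probability n^-3 times the crude
  bound \<open>2 * KK\<close> is negligible.\<close>

lemma failure_rate:
  assumes \<delta>: "0 < \<delta>" "\<delta> < 1 / (real d * (real d + 1))"
  shows "\<forall>\<^sub>F n in sequentially. 2 * KK * real n powr -3 \<le> rate \<delta> n"
proof -
  define e where "e = 3 - (2 / real d - 2 * \<delta>)"
  have e: "1 < e" "e < 3" using rate_exponent[OF \<delta>] by (auto simp: e_def)
  define c where "c = 2 * KK"
  have c: "0 < c" using KK_pos by (simp add: c_def)
  have "\<forall>\<^sub>F n::nat in sequentially. c * real n powr -3 \<le> (ln (real n) / (\<beta> * real n)) powr (3 - e)"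
    using \<beta> e c by real_asymp
  then show ?thesis by (simp add: rate_def e_def c_def)
qed

theorem TDC_rates:
  assumes \<delta>: "0 < \<delta>" "\<delta> < 1 / (real d * (real d + 1))" and B: "0 < B" "0 < \<epsilon>"
    and BG: "\<forall>D \<rho> \<epsilon>' M P. 0 < \<rho> \<longrightarrow> 0 < \<epsilon>' \<longrightarrow> \<epsilon>' \<le> \<epsilon> * \<rho> \<longrightarrow> M \<in> manifold_class D d \<rho> \<longrightarrow> is_net \<epsilon>' M P \<longrightarrow>
        (let T = restrict (tangent_space M) P; N = underlying (tangential_delaunay D (\<omega>\<^sub>s D P T) P T)
         in hausdorff_dist M N \<le> ennreal (B * \<epsilon>'\<^sup>2 / \<rho>) \<and> ambient_isotopic D M N)"
    and \<omega>: "\<forall>D P T. finite P \<longrightarrow> (\<forall>p\<in>P. 0 \<le> \<omega>\<^sub>s D P T p)"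
    and est: "tdc_estimator \<omega>\<^sub>s D d slab1 slab2 1 thr 1 \<beta> \<delta> est"
  defines "C \<equiv> 4 * (C_shift + B / \<rho>')"
  shows "\<forall>\<^sub>F n in sequentially. \<forall>M P. model M P \<longrightarrow>
      whp P n (real n powr -3) (\<lambda>x. hausdorff_dist M (underlying (est n (x ` {..<n}))) \<le> ennreal (C * rate \<delta> n) \<and>
        ambient_isotopic D M (underlying (est n (x ` {..<n}))))"
    and "\<forall>\<^sub>F n in sequentially. \<forall>M P. model M P \<longrightarrow>
      outer_expectation (sample P n) (\<lambda>x. hausdorff_dist M (underlying (est n (x ` {..<n})))) \<le> ennreal ((C + 1) * rate \<delta> n)"
proof -
  let ?k = "k_delta d \<delta>"
  have C: "0 < C" using C_shift_pos \<rho>'_pos B unfolding C_def by (intro mult_pos_pos add_pos_pos divide_pos_pos) auto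
  obtain m where m: "\<forall>\<^sub>F n in sequentially. \<forall>M P. model M P \<longrightarrow>
    whp P n (real n powr -3) (\<lambda>x. regular_sample n M ?k m (x ` {..<n}))"
    by (rule regular_sample_whp)
  have "\<forall>\<^sub>F n in sequentially. h n ?k < min (1 / (40 * C_shift)) (\<epsilon> * \<rho>')"
    using C_shift_pos \<rho>'_pos B by (intro h_less) auto
  with m h_square_rate[OF \<delta>] fine_scales_eventually[of ?k m] eventually_gt_at_top[of 0]
  show whp: "\<forall>\<^sub>F n in sequentially. \<forall>M P. model M P \<longrightarrow>
      whp P n (real n powr -3) (\<lambda>x. hausdorff_dist M (underlying (est n (x ` {..<n}))) \<le> ennreal (C * rate \<delta> n) \<and>
        ambient_isotopic D M (underlying (est n (x ` {..<n}))))"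
  proof eventually_elim
    case (elim n)
    show ?case
    proof (intro allI impI)
      fix M P assume mod: "model M P"
      show "whp P n (real n powr -3) (\<lambda>x. hausdorff_dist M (underlying (est n (x ` {..<n}))) \<le> ennreal (C * rate \<delta> n) \<and>
        ambient_isotopic D M (underlying (est n (x ` {..<n}))))"
      proof (rule whp_mono[OF elim(1)[rule_format, OF mod] order_refl])
        fix x assume X: "regular_sample n M ?k m (x ` {..<n})"
        have "finite (x ` {..<n})" "x ` {..<n} \<noteq> {}" "x ` {..<n} \<subseteq> euclid D"
          using elim(4) X by (auto simp: regular_sample_def)
        then have tdc: "is_TDC_delta \<omega>\<^sub>s D d slab1 slab2 1 thr 1 \<beta> \<delta> n (x ` {..<n}) (est n (x ` {..<n}))"
          by (rule est[unfolded tdc_estimator_def, rule_format])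
        have "h n ?k < 1 / (40 * C_shift)" "h n ?k \<le> \<epsilon> * \<rho>'" using elim(5) by auto
        then have small: "40 * C_shift * h n ?k \<le> 1" "h n ?k \<le> \<epsilon> * \<rho>'"
          using C_shift_pos by (auto simp: pos_less_divide_eq mult_ac)
        note close = TDC_close[OF mod X elim(3) refl k_delta_pos[OF dD(1) \<delta>] small BG B(1) tdc]
        have "(C_shift + B / \<rho>') * (h n ?k)\<^sup>2 \<le> (C_shift + B / \<rho>') * (4 * rate \<delta> n)"
          using elim(2) C_shift_pos \<rho>'_pos B by (intro mult_left_mono add_nonneg_nonneg) auto
        also have "\<dots> = C * rate \<delta> n" by (simp add: C_def)
        finally have le: "ennreal ((C_shift + B / \<rho>') * (h n ?k)\<^sup>2) \<le> ennreal (C * rate \<delta> n)" by (rule ennreal_leI)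
        show "hausdorff_dist M (underlying (est n (x ` {..<n}))) \<le> ennreal (C * rate \<delta> n) \<and>
          ambient_isotopic D M (underlying (est n (x ` {..<n})))"
          using order_trans[OF close(1) le] close(2) by blast
      qed
    qed
  qed
  show "\<forall>\<^sub>F n in sequentially. \<forall>M P. model M P \<longrightarrow>
      outer_expectation (sample P n) (\<lambda>x. hausdorff_dist M (underlying (est n (x ` {..<n})))) \<le> ennreal ((C + 1) * rate \<delta> n)"
    using whp failure_rate[OF \<delta>] eventually_gt_at_top[of 0]
  proof eventually_elim
    case (elim n)
    show ?case
    proof (intro allI impI)
      fix M P assume mod: "model M P"
      then interpret outlier_dist D d M \<rho> A f_min f_max \<beta> P .
      have "outer_expectation (sample P n) (\<lambda>x. hausdorff_dist M (underlying (est n (x ` {..<n})))) \<le>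
          ennreal (C * rate \<delta> n + 2 * KK * real n powr -3)"
      proof (rule outer_expectation_le[OF elim(1)[rule_format, OF mod] _ whp_support])
        fix x assume x: "\<forall>i<n. x i \<in> euclid D \<inter> cball 0 KK"
        let ?X = "x ` {..<n}"
        have X: "finite ?X" "?X \<noteq> {}" "?X \<subseteq> euclid D" "?X \<subseteq> cball 0 KK" using x elim(3) by auto
        have "is_TDC_delta \<omega>\<^sub>s D d slab1 slab2 1 thr 1 \<beta> \<delta> n ?X (est n ?X)"
          by (rule est[unfolded tdc_estimator_def, rule_format, OF X(1-3)])
        then have "abstract_simplicial_complex (est n ?X) \<and> \<Union>(est n ?X) \<subseteq> ?X \<and> est n ?X \<noteq> {}"
          by (rule is_TDC_delta_complex[OF _ X(1,3) \<omega>])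
        then have K: "abstract_simplicial_complex (est n ?X)" "\<Union>(est n ?X) \<subseteq> ?X" "est n ?X \<noteq> {}" by auto
        show "hausdorff_dist M (underlying (est n ?X)) \<le> ennreal (2 * KK)"
          by (rule hausdorff_dist_bounded[OF K(3,1) order_trans[OF K(2) X(4)] M_ne M_cball])
      qed (use C KK_pos in \<open>auto simp: rate_def\<close>)
      also have "\<dots> \<le> ennreal ((C + 1) * rate \<delta> n)" using elim(2) by (intro ennreal_leI) (simp add: algebra_simps)
      finally show "outer_expectation (sample P n) (\<lambda>x. hausdorff_dist M (underlying (est n (x ` {..<n})))) \<le> ennreal ((C + 1) * rate \<delta> n)" .
    qed
  qed
qed

end

text \<open>The witnesses for \<open>c\<close> and \<open>c'\<close> are 1. These and the bounds
  \<open>C\<close>, \<open>C'\<close> precede \<open>D\<close> and \<open>\<beta>\<close>, whereas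
  the slab sizes and the threshold come after, because \<open>A_max\<close> contains the outlier
  constant of the first scale.\<close>

theorem theorem8:
  fixes d :: nat and f_min f_max diam_const :: real
    and \<omega>\<^sub>s :: "nat \<Rightarrow> finseq set \<Rightarrow> (finseq \<Rightarrow> finseq set) \<Rightarrow> finseq \<Rightarrow> real"
  assumes "1 \<le> d"
    and "0 < f_min" and "f_min \<le> f_max"
    and "diam_constant d diam_const"
    and "weights_of_Boissonnat_Ghosh d \<omega>\<^sub>s"
  shows
    "\<exists>c'>0. \<forall>\<rho>>0. \<exists>C>0. \<exists>C'>0. \<exists>c>0.
      \<forall>(D :: nat) (\<beta> :: real) (\<delta> :: real).
        d < D \<longrightarrow> 0 < \<beta> \<longrightarrow> \<beta> \<le> 1 \<longrightarrow> 0 < \<delta> \<longrightarrow> \<delta> < 1 / (real d * (real d + 1)) \<longrightarrow>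
        (\<exists>k\<^sub>1>0. \<exists>k\<^sub>2>0. \<exists>t>0. \<forall>est.
          tdc_estimator \<omega>\<^sub>s D d k\<^sub>1 k\<^sub>2 c t c' \<beta> \<delta> est \<longrightarrow>
          (\<forall>n X. finite X \<longrightarrow> X \<noteq> {} \<longrightarrow> X \<subseteq> euclid D \<longrightarrow>
             abstract_simplicial_complex (est n X) \<and> \<Union>(est n X) \<subseteq> X) \<and>
          (\<forall>(P, M)\<in>outlier_model diam_const D d f_min f_max \<rho> \<beta>.
             (\<lambda>n. inner_prob (sample P n)
                {x \<in> space (sample P n).
                   hausdorff_dist M (underlying (est n (x ` {..<n})))
                     \<le> ennreal (C * (ln (real n) / (\<beta> * real n)) powr (2 / real d - 2 * \<delta>)) \<and>
                   ambient_isotopic D M (underlying (est n (x ` {..<n})))})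
             \<longlonglongrightarrow> 1) \<and>
          (\<forall>\<^sub>F n in sequentially.
             (SUP (P, M)\<in>outlier_model diam_const D d f_min f_max \<rho> \<beta>.
                outer_expectation (sample P n)
                  (\<lambda>x. hausdorff_dist M (underlying (est n (x ` {..<n})))))
             \<le> ennreal (C' * (ln (real n) / (\<beta> * real n)) powr (2 / real d - 2 * \<delta>))))"
proof -
  note BGw = assms(5)[unfolded weights_of_Boissonnat_Ghosh_def]
  note \<omega> = BGw[THEN conjunct1]
  obtain \<epsilon> B where BG0: "0 < \<epsilon>" "0 < B" and BG: "\<forall>D \<rho> \<epsilon>' M P. 0 < \<rho> \<longrightarrow> 0 < \<epsilon>' \<longrightarrow> \<epsilon>' \<le> \<epsilon> * \<rho> \<longrightarrow>
      M \<in> manifold_class D d \<rho> \<longrightarrow> is_net \<epsilon>' M P \<longrightarrow>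
      (let T = restrict (tangent_space M) P; N = underlying (tangential_delaunay D (\<omega>\<^sub>s D P T) P T)
       in hausdorff_dist M N \<le> ennreal (B * \<epsilon>'\<^sup>2 / \<rho>) \<and> ambient_isotopic D M N)"
    using BGw[THEN conjunct2] by (elim exE conjE)
  define C where "C \<rho> = 4 * (shift_const d f_min f_max \<rho> + B / reach_const d f_min f_max \<rho>)" for \<rho>
  have C_pos: "0 < C \<rho>" if "0 < \<rho>" for \<rho>
  proof -
    \<comment> \<open>Positivity of \<open>C\<close> concerns neither \<open>D\<close> nor
      \<open>\<beta>\<close>, so any admissible pair serves to enter the locale.\<close>
    interpret params d "Suc d" 1 \<rho> diam_const f_min f_max
      using assms(1-4) that by unfold_locales auto
    show ?thesis unfolding C_def using C_shift_pos \<rho>'_pos BG0 by (simp add: add_pos_pos)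
  qed
  have main: "\<exists>k\<^sub>1>0. \<exists>k\<^sub>2>0. \<exists>t>0. \<forall>est.
      tdc_estimator \<omega>\<^sub>s D d k\<^sub>1 k\<^sub>2 1 t 1 \<beta> \<delta> est \<longrightarrow>
      (\<forall>n X. finite X \<longrightarrow> X \<noteq> {} \<longrightarrow> X \<subseteq> euclid D \<longrightarrow>
         abstract_simplicial_complex (est n X) \<and> \<Union>(est n X) \<subseteq> X) \<and>
      (\<forall>(P, M)\<in>outlier_model diam_const D d f_min f_max \<rho> \<beta>.
         (\<lambda>n. inner_prob (sample P n)
            {x \<in> space (sample P n).
               hausdorff_dist M (underlying (est n (x ` {..<n})))
                 \<le> ennreal (C \<rho> * (ln (real n) / (\<beta> * real n)) powr (2 / real d - 2 * \<delta>)) \<and>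
               ambient_isotopic D M (underlying (est n (x ` {..<n})))})
         \<longlonglongrightarrow> 1) \<and>
      (\<forall>\<^sub>F n in sequentially.
         (SUP (P, M)\<in>outlier_model diam_const D d f_min f_max \<rho> \<beta>.
            outer_expectation (sample P n)
              (\<lambda>x. hausdorff_dist M (underlying (est n (x ` {..<n})))))
         \<le> ennreal ((C \<rho> + 1) * (ln (real n) / (\<beta> * real n)) powr (2 / real d - 2 * \<delta>)))"
    (is "\<exists>k\<^sub>1>0. \<exists>k\<^sub>2>0. \<exists>t>0. \<forall>est. ?E k\<^sub>1 k\<^sub>2 t est \<longrightarrow> ?Q est")
    if \<rho>: "0 < \<rho>" and dD: "d < D" and \<beta>: "0 < \<beta>" "\<beta> \<le> 1" and \<delta>: "0 < \<delta>" "\<delta> < 1 / (real d * (real d + 1))"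
    for \<rho> D \<beta> \<delta>
  proof -
    interpret params d D \<beta> \<rho> diam_const f_min f_max
      using assms(1-4) that by unfold_locales auto
    show ?thesis
    proof (rule exI[of _ slab1], rule conjI[OF slab_pos(1)], rule exI[of _ slab2], rule conjI[OF slab_pos(3)],
        rule exI[of _ thr], rule conjI[OF slab_pos(5)], intro allI impI)
      fix est assume est: "tdc_estimator \<omega>\<^sub>s D d slab1 slab2 1 thr 1 \<beta> \<delta> est"
      note rates = TDC_rates[OF \<delta> BG0(2,1) BG \<omega> est, folded C_def, unfolded rate_def]
      have complex: "abstract_simplicial_complex (est n X) \<and> \<Union>(est n X) \<subseteq> X"
        if X: "finite X" "X \<noteq> {}" "X \<subseteq> euclid D" for n X
        using is_TDC_delta_complex[OF est[unfolded tdc_estimator_def, rule_format, OF X] X(1,3) \<omega>] by blast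
      have prob: "(\<lambda>n. inner_prob (sample P n)
            {x \<in> space (sample P n).
               hausdorff_dist M (underlying (est n (x ` {..<n})))
                 \<le> ennreal (C \<rho> * (ln (real n) / (\<beta> * real n)) powr (2 / real d - 2 * \<delta>)) \<and>
               ambient_isotopic D M (underlying (est n (x ` {..<n})))}) \<longlonglongrightarrow> 1"
        if PM: "(P, M) \<in> outlier_model diam_const D d f_min f_max \<rho> \<beta>" for P M
      proof -
        have mod: "model M P" by (rule modelI[OF PM])
        then interpret outlier_dist D d M \<rho> diam_const f_min f_max \<beta> P .
        show ?thesis
        proof (rule tendsto_sandwich[of "\<lambda>n. 1 - real n powr -3" _ _ "\<lambda>_. 1"])
          show "(\<lambda>n. 1 - real n powr -3) \<longlonglongrightarrow> 1" by real_asymp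
        qed (use rates(1) in \<open>auto elim!: eventually_mono intro!: inner_prob_ge mod\<close>)
      qed
      have expect: "\<forall>\<^sub>F n in sequentially.
         (SUP (P, M)\<in>outlier_model diam_const D d f_min f_max \<rho> \<beta>.
            outer_expectation (sample P n)
              (\<lambda>x. hausdorff_dist M (underlying (est n (x ` {..<n})))))
         \<le> ennreal ((C \<rho> + 1) * (ln (real n) / (\<beta> * real n)) powr (2 / real d - 2 * \<delta>))"
        using rates(2)
      proof eventually_elim
        case (elim n)
        show ?case by (rule SUP_least) (use elim modelI in auto)
      qed
      show "?Q est"
        using complex prob expect by auto
    qed
  qed
  show ?thesis (is "\<exists>c'>0. \<forall>\<rho>>0. ?R c' \<rho>")
  proof (rule exI[of _ 1], rule conjI[OF zero_less_one], intro allI impI)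
    fix \<rho> :: real assume \<rho>: "0 < \<rho>"
    have C1: "0 < C \<rho> + 1" using C_pos[OF \<rho>] by simp
    show "?R 1 \<rho>"
      by (rule exI[of _ "C \<rho>"], rule conjI[OF C_pos[OF \<rho>]], rule exI[of _ "C \<rho> + 1"], rule conjI[OF C1],
          rule exI[of _ 1], rule conjI[OF zero_less_one], intro allI impI main[OF \<rho>])
  qed
qed

end
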